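(* Let $\alpha,\beta>0$, $0<p\le\infty$, $0<q<\infty$, and $\gamma=\sqrt{\alpha\beta}$. Then the continuous dual of $\mathcal F_\alpha^{p,q}$ can be identified with $\mathcal F_{\beta;\sigma(p,q)}^{p^*,q^*}$ under the transported pairing $\langle\cdot,\cdot\rangle_{\alpha\to\gamma}^{\mathrm{tr}}$. That is: each $g\in\mathcal F_{\beta;\sigma(p,q)}^{p^*,q^*}$ defines a continuous linear functional on $\mathcal F_\alpha^{p,q}$ by $F_g(f)=\langle f,g\rangle_{\alpha\to\gamma}^{\mathrm{tr}}$, $f\in\mathcal F_\alpha^{p,q}$; conversely, every $F\in(\mathcal F_\alpha^{p,q})^*$ is of the form $F=F_{g_F}$ for a unique $g_F\in\mathcal F_{\beta;\sigma(p,q)}^{p^*,q^*}$; and $\|F\|_{(\mathcal F_\alpha^{p,q})^*}\asymp\|g_F\|_{\mathcal F_{\beta;\sigma(p,q)}^{p^*,q^*}}$ with constants depending only on $\alpha,\beta,p,q$.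
   Context: Convention: $\frac1\infty=0$, $(x)_+:=\max\{x,0\}$; $X\asymp Y$ means $C^{-1}Y\le X\le CY$. For an entire function $f$ and $r\ge0$, $M_p(f,r):=\left(\frac1{2\pi}\int_0^{2\pi}|f(re^{i\theta})|^p\,d\theta\right)^{1/p}$ for $0<p<\infty$, and $M_\infty(f,r):=\sup_{\theta}|f(re^{i\theta})|$. For $\alpha>0$, $\sigma\in\mathbb R$, $0<p,q\le\infty$, $\mathcal F_{\alpha;\sigma}^{p,q}$ is the space of entire functions $f$ with finite $$\|f\|_{\mathcal F_{\alpha;\sigma}^{p,q}}:=\left(\int_0^\infty[M_p(f,r)(1+r)^\sigma]^q\,\alpha q\,e^{-\frac{\alpha q}2r^2}r\,dr\right)^{1/q}\ (q<\infty),\qquad \|f\|_{\mathcal F_{\alpha;\sigma}^{p,\infty}}:=\sup_{r\ge0}M_p(f,r)e^{-\frac\alpha2r^2}(1+r)^\sigma .$$ $\mathcal F_\alpha^{p,q}:=\mathcal F_{\alpha;0}^{p,q}$. $p^*:=\infty$ if $0<p\le1$, $p^*:=\frac p{p-1}$ if $1<p<\infty$, $p^*:=1$ if $p=\infty$; $q^*$ likewise. $\sigma(p,q):=\left(\frac1p-1\right)_+-\left(\frac1q-1\right)_+$. Gaussian pairing: $\langle f,g\rangle_\alpha:=\frac\alpha\pi\int_{\mathbb C}f(z)\overline{g(z)}e^{-\alpha|z|^2}dA(z)$ ($dA$ Lebesgue area measure) whenever absolutely convergent. Dilation: $(D_\tau g)(z):=g(\tau z)$ for $\tau>0$. Transported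 pairing: $\langle f,g\rangle_{\alpha\to\gamma}^{\mathrm{tr}}:=\langle f,D_{\alpha/\gamma}g\rangle_\alpha$. The dual norm is $\|F\|_{X^*}:=\sup_{\|f\|_X\le1}|F(f)|$. *)

theory Defs
  imports "HOL-Analysis.Analysis"
begin

text \<open>
  Exponents \<open>p, q \<in> (0, \<infinity>]\<close> have type \<^typ>\<open>ennreal\<close>, and \<open>\<infinity>\<close> is \<^term>\<open>top\<close>.
  Since \<^term>\<open>enn2real top = 0\<close>, the reciprocal \<open>recip\<close> satisfies \<open>1 / \<infinity> = 0\<close>.
\<close>

definition recip :: "ennreal \<Rightarrow> real" where
  "recip p = 1 / enn2real p"

definition conj_exponent :: "ennreal \<Rightarrow> ennreal" where
  "conj_exponent p = (if p \<le> 1 then top else if p = top then 1 else p / (p - 1))"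

definition pos_part :: "real \<Rightarrow> real" where
  "pos_part x = max x 0"

definition sigma_exponent :: "ennreal \<Rightarrow> ennreal \<Rightarrow> real" where
  "sigma_exponent p q = pos_part (recip p - 1) - pos_part (recip q - 1)"

definition integral_mean :: "ennreal \<Rightarrow> (complex \<Rightarrow> complex) \<Rightarrow> real \<Rightarrow> real" where
  "integral_mean p f r =
     (if p = top then (SUP \<theta>. cmod (f (complex_of_real r * cis \<theta>)))
      else (1 / (2 * pi) *
             (LBINT \<theta>:{0..2 * pi}. cmod (f (complex_of_real r * cis \<theta>)) powr enn2real p))
           powr (1 / enn2real p))"

definition ennreal_powr :: "ennreal \<Rightarrow> real \<Rightarrow> ennreal" where
  "ennreal_powr x a = (if x = top then top else ennreal (enn2real x powr a))"
  \<comment> \<open>only meant for \<open>a > 0\<close>\<close>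

text \<open>
  The mixed (quasi-)norm of an entire function, with value \<^term>\<open>top\<close> if the integral or the
  supremum is infinite.
\<close>

definition fock_norm :: "real \<Rightarrow> real \<Rightarrow> ennreal \<Rightarrow> ennreal \<Rightarrow> (complex \<Rightarrow> complex) \<Rightarrow> ennreal" where
  "fock_norm \<alpha> \<sigma> p q f =
     (if q = top
      then (SUP r\<in>{0..}. ennreal (integral_mean p f r * exp (- (\<alpha> / 2) * r\<^sup>2) * (1 + r) powr \<sigma>))
      else ennreal_powr
             (\<integral>\<^sup>+ r\<in>{0..}. ennreal
                ((integral_mean p f r * (1 + r) powr \<sigma>) powr enn2real q
                   * (\<alpha> * enn2real q * exp (- (\<alpha> * enn2real q / 2) * r\<^sup>2) * r)) \<partial>lborel)
             (1 / enn2real q))"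

definition fock_space :: "real \<Rightarrow> real \<Rightarrow> ennreal \<Rightarrow> ennreal \<Rightarrow> (complex \<Rightarrow> complex) set" where
  "fock_space \<alpha> \<sigma> p q = {f. f holomorphic_on UNIV \<and> fock_norm \<alpha> \<sigma> p q f < top}"

definition gauss_integrand ::
    "real \<Rightarrow> (complex \<Rightarrow> complex) \<Rightarrow> (complex \<Rightarrow> complex) \<Rightarrow> complex \<Rightarrow> complex" where
  "gauss_integrand \<alpha> f g z = f z * cnj (g z) * complex_of_real (exp (- \<alpha> * (cmod z)\<^sup>2))"

definition gauss_convergent ::
    "real \<Rightarrow> (complex \<Rightarrow> complex) \<Rightarrow> (complex \<Rightarrow> complex) \<Rightarrow> bool" where
  "gauss_convergent \<alpha> f g \<longleftrightarrow> integrable lborel (gauss_integrand \<alpha> f g)"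

definition gauss_pairing ::
    "real \<Rightarrow> (complex \<Rightarrow> complex) \<Rightarrow> (complex \<Rightarrow> complex) \<Rightarrow> complex" where
  "gauss_pairing \<alpha> f g = complex_of_real (\<alpha> / pi) * (LINT z|lborel. gauss_integrand \<alpha> f g z)"

definition dilation :: "real \<Rightarrow> (complex \<Rightarrow> complex) \<Rightarrow> complex \<Rightarrow> complex" where
  "dilation \<tau> g z = g (complex_of_real \<tau> * z)"

definition tr_convergent ::
    "real \<Rightarrow> real \<Rightarrow> (complex \<Rightarrow> complex) \<Rightarrow> (complex \<Rightarrow> complex) \<Rightarrow> bool" where
  "tr_convergent \<alpha> \<gamma> f g \<longleftrightarrow> gauss_convergent \<alpha> f (dilation (\<alpha> / \<gamma>) g)"

definition tr_pairing ::
    "real \<Rightarrow> real \<Rightarrow> (complex \<Rightarrow> complex) \<Rightarrow> (complex \<Rightarrow> complex) \<Rightarrow> complex" where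
  "tr_pairing \<alpha> \<gamma> f g = gauss_pairing \<alpha> f (dilation (\<alpha> / \<gamma>) g)"

text \<open>
  The following notions are for a space \<open>X\<close> of functions on the plane with a (quasi-)norm \<open>N\<close>.
  Functionals on \<open>X\<close> are normalised to be \<^term>\<open>undefined\<close> outside \<open>X\<close>, so that equality of
  functionals is equality on \<open>X\<close>.
\<close>

definition linear_functional_on ::
    "(complex \<Rightarrow> complex) set \<Rightarrow> ((complex \<Rightarrow> complex) \<Rightarrow> complex) \<Rightarrow> bool" where
  "linear_functional_on X F \<longleftrightarrow>
     (\<forall>f\<in>X. \<forall>h\<in>X. F (\<lambda>z. f z + h z) = F f + F h) \<and>
     (\<forall>c. \<forall>f\<in>X. F (\<lambda>z. c * f z) = c * F f)"

definition continuous_functional_on ::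
    "(complex \<Rightarrow> complex) set \<Rightarrow> ((complex \<Rightarrow> complex) \<Rightarrow> ennreal)
       \<Rightarrow> ((complex \<Rightarrow> complex) \<Rightarrow> complex) \<Rightarrow> bool" where
  "continuous_functional_on X N F \<longleftrightarrow>
     (\<forall>f\<in>X. \<forall>\<epsilon>>0. \<exists>\<delta>>0. \<forall>h\<in>X.
        N (\<lambda>z. h z - f z) < ennreal \<delta> \<longrightarrow> cmod (F h - F f) < \<epsilon>)"

definition continuous_dual ::
    "(complex \<Rightarrow> complex) set \<Rightarrow> ((complex \<Rightarrow> complex) \<Rightarrow> ennreal)
       \<Rightarrow> ((complex \<Rightarrow> complex) \<Rightarrow> complex) set" where
  "continuous_dual X N =
     {F. F \<in> extensional X \<and> linear_functional_on X F \<and> continuous_functional_on X N F}"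

definition dual_norm ::
    "(complex \<Rightarrow> complex) set \<Rightarrow> ((complex \<Rightarrow> complex) \<Rightarrow> ennreal)
       \<Rightarrow> ((complex \<Rightarrow> complex) \<Rightarrow> complex) \<Rightarrow> ennreal" where
  "dual_norm X N F = (SUP f\<in>{f \<in> X. N f \<le> 1}. ennreal (cmod (F f)))"

definition tr_functional ::
    "(complex \<Rightarrow> complex) set \<Rightarrow> real \<Rightarrow> real \<Rightarrow> (complex \<Rightarrow> complex)
       \<Rightarrow> (complex \<Rightarrow> complex) \<Rightarrow> complex" where
  "tr_functional X \<alpha> \<gamma> g = restrict (\<lambda>f. tr_pairing \<alpha> \<gamma> f g) X"

end

theory Submission
  imports Defs "HOL-Complex_Analysis.Complex_Analysis"
begin

text \<open>
  Write \<open>u f z = |f z| exp (- \<alpha> |z|\<^sup>2 / 2)\<close>. A Hardy-Littlewood sub-mean-value estimate, valid for all exponents,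
  shows that the mixed norm of \<open>f\<close> is equivalent to a mixed sequence norm of the suprema of \<open>u f\<close> over the unit
  discs around the Gaussian integers, grouped into the rings \<open>j \<le> |k| < j + 1\<close>. The same sequence norm of the
  coefficients bounds the norm of a finite sum of kernels centred near lattice points, because the normalised
  kernels decay like Gaussians.

  Hence the pairing is bounded by Hoelder's inequality for sequences. Conversely a functional \<open>F\<close> is represented
  by \<open>g w = cnj (F (K w))\<close>, where \<open>K w\<close> is the reproducing kernel: testing \<open>F\<close> on sums of kernels with extremal
  coefficients bounds the sequence norm of \<open>g\<close>, and \<open>F\<close> is determined by its values on monomials since the
  dilates \<open>f (\<rho> z)\<close> converge to \<open>f\<close> as \<open>\<rho>\<close> tends to \<open>1\<close> (here \<open>q < \<infinity>\<close> is needed). A dilation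
  reduces \<open>\<beta>\<close> to \<open>\<alpha>\<close>.
\<close>

section \<open>Inequalities for sums and sequence norms\<close>

text \<open>For p < 1 or q < 1 the spaces are only quasi-normed, so neither the triangle inequality
  nor Minkowski's inequality is at hand. Finite sequences put all exponents on the same footing: for
  p \<le> 1 the p-norm dominates the sum, so such a sequence pairs with a bounded one, and Hoelder
  extremals exist for every exponent. If P' denotes the conjugate exponent, then (1/P - 1)_+ - 1/P'
  = 1/P - 1 throughout; hence \<sigma>(p,q) is exactly the weight for which the sequence norm of the
  dual space carries the opposite power of 1 + j to that of the original space. Estimates from
  functions to sequences work with powers t = min(1, P, Q): the sub-mean inequality holds for t
  \<le> 1, and P/t, Q/t \<ge> 1 restore convexity. As to \<gamma>: with \<tau> = \<alpha>/\<gamma>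
  one has \<alpha> = \<beta> \<tau>^2, so dilation by \<tau> exchanges the two Gaussian weights, and
  the transported pairing is the ordinary pairing with the dilated g.\<close>

lemma powr_sum_subadd:
  fixes x :: "'i \<Rightarrow> real"
  assumes "finite S" and "\<And>i. i \<in> S \<Longrightarrow> 0 \<le> x i" and t: "0 < t" "t \<le> 1"
  shows "(\<Sum>i\<in>S. x i) powr t \<le> (\<Sum>i\<in>S. x i powr t)"
  using assms(1,2)
proof (induction S rule: finite_induct)
  case (insert i S)
  have binary: "(a + b) powr t \<le> a powr t + b powr t" if "0 \<le> a" "0 \<le> b" for a b :: real
  proof (cases "a + b = 0")
    case False
    then have pos: "a + b > 0" using that by linarith
    have frac: "c / (a + b) \<le> (c / (a + b)) powr t" if "0 \<le> c" "c \<le> a + b" for c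
      using that t pos powr_mono'[of t 1 "c / (a + b)"] by (auto simp: field_simps)
    have "1 = a / (a + b) + b / (a + b)" using pos by (simp add: add_divide_distrib[symmetric])
    also have "\<dots> \<le> (a / (a + b)) powr t + (b / (a + b)) powr t"
      by (intro add_mono frac) (use that in auto)
    also have "\<dots> = (a powr t + b powr t) / (a + b) powr t"
      using that by (simp add: powr_divide add_divide_distrib)
    finally show ?thesis using pos by (simp add: field_simps)
  qed (use that in auto)
  have "(\<Sum>i\<in>insert i S. x i) powr t \<le> x i powr t + (\<Sum>i\<in>S. x i) powr t"
    using insert by (auto intro!: binary sum_nonneg)
  also have "\<dots> \<le> (\<Sum>i\<in>insert i S. x i powr t)" using insert by simp
  finally show ?case .
qed simp

text \<open>The tangent of x^T at s, solved for x. The right side is affine in x^T, so it can be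
  summed or integrated term by term, and s is chosen afterwards.\<close>

lemma powr_tangent:
  fixes x s T :: real
  assumes "0 \<le> x" "0 < s" "1 \<le> T"
  shows "x \<le> x powr T * s powr (1 - T) / T + (1 - 1 / T) * s"
proof (cases "x = 0 \<or> T = 1")
  case False
  then have x: "x > 0" and T: "T > 1" using assms by auto
  have "(x powr T * s powr (1 - T)) powr (1 / T) * s powr (1 - 1 / T)
      \<le> 1 / T * (x powr T * s powr (1 - T)) + (1 - 1 / T) * s"
    by (rule Youngs_inequality_0) (use x T assms in auto)
  moreover have "(x powr T * s powr (1 - T)) powr (1 / T) * s powr (1 - 1 / T)
      = x * s powr ((1 - T) / T + (1 - 1 / T))"
    using x T assms by (simp add: powr_mult powr_powr powr_add)
  moreover have "(1 - T) / T + (1 - 1 / T) = 0" using T by (simp add: field_simps)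
  ultimately show ?thesis using assms by simp
qed (use assms in auto)

text \<open>\<open>le\<close> is what the tangent inequality yields after summation or integration
  against weights of total mass at most K, with J bounding the weighted T-th powers. Optimising over
  s gives Jensen's inequality without normalising the weights.\<close>

lemma tangent_to_power:
  fixes m J K T :: real
  assumes m: "0 \<le> m" and K: "0 < K" and T: "1 \<le> T"
    and le: "\<And>s. 0 < s \<Longrightarrow> m \<le> J * s powr (1 - T) / T + (1 - 1 / T) * (s * K)"
    and J: "0 \<le> J"
  shows "m powr T \<le> K powr (T - 1) * J"
proof (cases "m = 0")
  case False
  then have m: "m > 0" using m by simp
  \<comment> \<open>The optimal tangent point: the second term becomes (1 - 1/T) m and is absorbed
    on the left.\<close>
  define s where "s = m / K"
  have s: "s > 0" using m K by (simp add: s_def)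
  have "m \<le> J * s powr (1 - T) / T + (1 - 1 / T) * m"
    using le[OF s] K by (simp add: s_def)
  then have "m / T \<le> J * s powr (1 - T) / T" by (simp add: algebra_simps)
  then have "m \<le> J * s powr (1 - T)" using T by (simp add: field_simps)
  then have "m * s powr (T - 1) \<le> J"
    using s by (simp add: powr_diff field_simps)
  moreover have "m * s powr (T - 1) = m powr T / K powr (T - 1)"
    using m K by (simp add: s_def powr_divide powr_diff)
  ultimately show ?thesis using K by (simp add: field_simps)
qed (use assms in auto)

lemma sum_jensen:
  fixes x w :: "'i \<Rightarrow> real"
  assumes nn: "\<And>i. i \<in> S \<Longrightarrow> 0 \<le> x i" "\<And>i. i \<in> S \<Longrightarrow> 0 \<le> w i"
    and K: "(\<Sum>i\<in>S. w i) \<le> K" "0 < K" and T: "1 \<le> T"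
  shows "(\<Sum>i\<in>S. w i * x i) powr T \<le> K powr (T - 1) * (\<Sum>i\<in>S. w i * x i powr T)"
proof (rule tangent_to_power)
  fix s :: real assume s: "0 < s"
  have "(\<Sum>i\<in>S. w i * x i) \<le> (\<Sum>i\<in>S. w i * (x i powr T * s powr (1 - T) / T + (1 - 1 / T) * s))"
    by (intro sum_mono mult_left_mono powr_tangent nn s T)
  also have "\<dots> = (\<Sum>i\<in>S. w i * x i powr T) * s powr (1 - T) / T + (1 - 1 / T) * (s * (\<Sum>i\<in>S. w i))"
    by (simp add: distrib_left sum.distrib sum_distrib_left sum_distrib_right sum_divide_distrib mult_ac)
  also have "\<dots> \<le> (\<Sum>i\<in>S. w i * x i powr T) * s powr (1 - T) / T + (1 - 1 / T) * (s * K)"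
    using s T K by (intro add_mono mult_left_mono) auto
  finally show "(\<Sum>i\<in>S. w i * x i) \<le> \<dots>" .
qed (use assms in \<open>auto intro!: sum_nonneg\<close>)

lemma nn_integral_jensen:
  fixes f g :: "'a \<Rightarrow> real"
  assumes meas: "f \<in> borel_measurable M" "g \<in> borel_measurable M"
    and nn: "\<And>x. 0 \<le> f x" "\<And>x. 0 \<le> g x"
    and K: "(\<integral>\<^sup>+x. ennreal (g x) \<partial>M) \<le> ennreal K" "0 < K" and T: "1 \<le> T"
    and J: "(\<integral>\<^sup>+x. ennreal (f x powr T * g x) \<partial>M) \<le> ennreal J" "0 \<le> J"
  shows "(\<integral>\<^sup>+x. ennreal (f x * g x) \<partial>M) \<le> ennreal ((K powr (T - 1) * J) powr (1 / T))"
proof -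
  note [measurable] = meas
  have bound: "(\<integral>\<^sup>+x. ennreal (f x * g x) \<partial>M) \<le> ennreal (J * s powr (1 - T) / T + (1 - 1 / T) * (s * K))"
    if s: "0 < s" for s
  proof -
    have "(\<integral>\<^sup>+x. ennreal (f x * g x) \<partial>M)
        \<le> (\<integral>\<^sup>+x. ennreal (s powr (1 - T) / T) * ennreal (f x powr T * g x)
              + ennreal ((1 - 1 / T) * s) * ennreal (g x) \<partial>M)"
    proof (intro nn_integral_mono)
      fix x
      have "f x * g x \<le> (f x powr T * s powr (1 - T) / T + (1 - 1 / T) * s) * g x"
        by (intro mult_right_mono powr_tangent nn s T)
      also have "\<dots> = s powr (1 - T) / T * (f x powr T * g x) + (1 - 1 / T) * s * g x"
        by (simp add: algebra_simps)
      finally show "ennreal (f x * g x) \<le> ennreal (s powr (1 - T) / T) * ennreal (f x powr T * g x)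
              + ennreal ((1 - 1 / T) * s) * ennreal (g x)"
        using T s nn[of x] by (simp add: ennreal_mult[symmetric] ennreal_plus[symmetric] ennreal_leI del: ennreal_plus)
    qed
    also have "\<dots> = ennreal (s powr (1 - T) / T) * (\<integral>\<^sup>+x. ennreal (f x powr T * g x) \<partial>M)
              + ennreal ((1 - 1 / T) * s) * (\<integral>\<^sup>+x. ennreal (g x) \<partial>M)"
      by (simp add: nn_integral_add nn_integral_cmult)
    also have "\<dots> \<le> ennreal (s powr (1 - T) / T) * ennreal J + ennreal ((1 - 1 / T) * s) * ennreal K"
      by (intro add_mono mult_left_mono K J) auto
    also have "\<dots> = ennreal (J * s powr (1 - T) / T + (1 - 1 / T) * (s * K))"
      using T s K J by (subst (1 2) ennreal_mult[symmetric]; (subst ennreal_plus[symmetric])?) (auto simp: mult_ac)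
    finally show ?thesis .
  qed
  \<comment> \<open>The value s = 1 already gives finiteness, so that the integral is a real number
    m and the optimisation over s takes place in the reals.\<close>
  then have "(\<integral>\<^sup>+x. ennreal (f x * g x) \<partial>M) < top"
    using bound[of 1] by (auto intro: le_less_trans)
  then obtain m where m: "(\<integral>\<^sup>+x. ennreal (f x * g x) \<partial>M) = ennreal m" "0 \<le> m"
    by (cases "\<integral>\<^sup>+x. ennreal (f x * g x) \<partial>M") auto
  have "m powr T \<le> K powr (T - 1) * J"
  proof (rule tangent_to_power)
    fix s :: real assume "0 < s"
    moreover have "0 \<le> J * s powr (1 - T) / T + (1 - 1 / T) * (s * K)"
      using \<open>0 < s\<close> T K J by (intro add_nonneg_nonneg mult_nonneg_nonneg divide_nonneg_nonneg) auto
    ultimately show "m \<le> J * s powr (1 - T) / T + (1 - 1 / T) * (s * K)"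
      using bound[of s] m by simp
  qed (use assms m in auto)
  then have "(m powr T) powr (1 / T) \<le> (K powr (T - 1) * J) powr (1 / T)"
    using T by (intro powr_mono2) auto
  then show ?thesis using m T by (simp add: powr_powr ennreal_leI)
qed

text \<open>One bound for every t > 0. For t \<le> 1 the power enters each term and scales the rate
  of decay by t; for t > 1 Jensen's inequality with the weights exp(-e d) keeps the rate. Since 1
  \<le> K, the factor K^t covers both cases.\<close>

lemma sum_powr_le:
  fixes x d :: "'i \<Rightarrow> real"
  assumes fin: "finite S" and nn: "\<And>i. i \<in> S \<Longrightarrow> 0 \<le> x i" "\<And>i. i \<in> S \<Longrightarrow> 0 \<le> d i"
    and K: "(\<Sum>i\<in>S. exp (- e * d i)) \<le> K" "1 \<le> K" and t: "0 < t" and e: "0 < e"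
  shows "(\<Sum>i\<in>S. exp (- e * d i) * x i) powr t
      \<le> K powr t * (\<Sum>i\<in>S. exp (- (min 1 t * e) * d i) * x i powr t)"
proof (cases "t \<le> 1")
  case True
  have "(\<Sum>i\<in>S. exp (- e * d i) * x i) powr t \<le> (\<Sum>i\<in>S. (exp (- e * d i) * x i) powr t)"
    by (intro powr_sum_subadd) (use assms True in auto)
  also have "\<dots> = (\<Sum>i\<in>S. exp (- (min 1 t * e) * d i) * x i powr t)"
    using True nn by (intro sum.cong) (auto simp: powr_mult exp_powr_real min_def mult_ac)
  also have "\<dots> \<le> K powr t * \<dots>"
  proof -
    have "1 \<le> K powr t" using K t by (simp add: ge_one_powr_ge_zero)
    moreover have "0 \<le> (\<Sum>i\<in>S. exp (- (min 1 t * e) * d i) * x i powr t)" by (intro sum_nonneg) auto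
    ultimately show ?thesis using mult_right_mono by fastforce
  qed
  finally show ?thesis .
next
  case False
  have "(\<Sum>i\<in>S. exp (- e * d i) * x i) powr t \<le> K powr (t - 1) * (\<Sum>i\<in>S. exp (- e * d i) * x i powr t)"
    by (intro sum_jensen) (use assms False in auto)
  also have "\<dots> \<le> K powr t * (\<Sum>i\<in>S. exp (- e * d i) * x i powr t)"
    using K by (intro mult_right_mono powr_mono sum_nonneg) auto
  finally show ?thesis using False by simp
qed

section \<open>Exponential sums over integers and Gaussian integers, and slowly varying
  weights\<close>

lemma sum_exp_int:
  assumes e: "(0::real) < e"
  obtains K where "1 \<le> K" "\<And>S x. finite S \<Longrightarrow> (\<Sum>m\<in>S. exp (- e * \<bar>x - real_of_int m\<bar>)) \<le> K"
proof -
  define K0 where "K0 = (\<Sum>n. exp (- e) ^ n)"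
  have summ: "summable (\<lambda>n. exp (- e) ^ n)"
    using e by (intro summable_geometric) auto
  have nat: "(\<Sum>n\<in>A. exp (- e * real n)) \<le> K0" if "finite A" for A :: "nat set"
  proof -
    have "(\<Sum>n\<in>A. exp (- e) ^ n) \<le> K0"
      unfolding K0_def by (intro sum_le_suminf summ that) auto
    then show ?thesis by (simp add: exp_of_nat_mult[symmetric] mult_ac)
  qed
  have centred: "(\<Sum>m\<in>S. exp (- e * \<bar>real_of_int m\<bar>)) \<le> 2 * K0" if S: "finite S" for S :: "int set"
  proof -
    have "(\<Sum>m\<in>S. exp (- e * \<bar>real_of_int m\<bar>))
        = (\<Sum>m\<in>{m\<in>S. 0 \<le> m}. exp (- e * \<bar>real_of_int m\<bar>)) + (\<Sum>m\<in>{m\<in>S. m < 0}. exp (- e * \<bar>real_of_int m\<bar>))"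
      by (subst sum.union_disjoint[symmetric]) (use S in \<open>auto intro!: sum.cong\<close>)
    also have "(\<Sum>m\<in>{m\<in>S. 0 \<le> m}. exp (- e * \<bar>real_of_int m\<bar>)) = (\<Sum>n\<in>nat ` {m\<in>S. 0 \<le> m}. exp (- e * real n))"
      by (subst sum.reindex) (auto simp: inj_on_def)
    also have "(\<Sum>m\<in>{m\<in>S. m < 0}. exp (- e * \<bar>real_of_int m\<bar>)) = (\<Sum>n\<in>(\<lambda>m. nat (-m)) ` {m\<in>S. m < 0}. exp (- e * real n))"
      by (subst sum.reindex) (auto simp: inj_on_def)
    also have "(\<Sum>n\<in>nat ` {m\<in>S. 0 \<le> m}. exp (- e * real n)) + \<dots> \<le> K0 + K0"
      by (intro add_mono nat) (use S in auto)
    finally show ?thesis by simp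
  qed
  \<comment> \<open>The bound must not depend on x: shifting by the floor of x costs at most a
    factor exp e and leaves two geometric series.\<close>
  have "(\<Sum>m\<in>S. exp (- e * \<bar>x - real_of_int m\<bar>)) \<le> exp e * (2 * K0)" if S: "finite S" for S :: "int set" and x
  proof -
    have "(\<Sum>m\<in>S. exp (- e * \<bar>x - real_of_int m\<bar>)) \<le> (\<Sum>m\<in>S. exp e * exp (- e * \<bar>real_of_int (m - \<lfloor>x\<rfloor>)\<bar>))"
    proof (intro sum_mono)
      fix m
      have "\<bar>real_of_int (m - \<lfloor>x\<rfloor>)\<bar> - 1 \<le> \<bar>x - real_of_int m\<bar>" by linarith
      then have "e * (\<bar>real_of_int (m - \<lfloor>x\<rfloor>)\<bar> - 1) \<le> e * \<bar>x - real_of_int m\<bar>" using e by simp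
      then show "exp (- e * \<bar>x - real_of_int m\<bar>) \<le> exp e * exp (- e * \<bar>real_of_int (m - \<lfloor>x\<rfloor>)\<bar>)"
        by (simp add: exp_add[symmetric] algebra_simps)
    qed
    also have "\<dots> = exp e * (\<Sum>m\<in>(\<lambda>m. m - \<lfloor>x\<rfloor>) ` S. exp (- e * \<bar>real_of_int m\<bar>))"
      by (subst sum.reindex) (auto simp: inj_on_def sum_distrib_left)
    also have "\<dots> \<le> exp e * (2 * K0)" by (intro mult_left_mono centred) (use S in auto)
    finally show ?thesis .
  qed
  then show ?thesis by (intro that[of "max 1 (exp e * (2 * K0))"]) (auto intro: max.coboundedI2)
qed

lemma sum_exp_nat:
  assumes e: "(0::real) < e"
  obtains K where "1 \<le> K" "\<And>S x. finite S \<Longrightarrow> (\<Sum>m\<in>S. exp (- e * \<bar>x - real m\<bar>)) \<le> K"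
proof -
  obtain K where K: "1 \<le> K" "\<And>S x. finite S \<Longrightarrow> (\<Sum>m\<in>S. exp (- e * \<bar>x - real_of_int m\<bar>)) \<le> K"
    using sum_exp_int[OF e] by metis
  have "(\<Sum>m\<in>S. exp (- e * \<bar>x - real m\<bar>)) \<le> K" if "finite S" for S x
    using K(2)[of "int ` S" x] that by (simp add: sum.reindex)
  then show ?thesis using K(1) that by blast
qed

definition lattice_point :: "int \<times> int \<Rightarrow> complex" where
  "lattice_point k = Complex (of_int (fst k)) (of_int (snd k))"

text \<open>The modulus dominates half the sum of the absolute values of the two coordinates, so the
  sum factorises into two sums over the integers at rate e/2.\<close>

lemma sum_exp_lattice:
  assumes e: "(0::real) < e"
  obtains K where "1 \<le> K" "\<And>S z. finite S \<Longrightarrow> (\<Sum>k\<in>S. exp (- e * cmod (z - lattice_point k))) \<le> K"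
proof -
  have "e / 2 > 0" using e by simp
  then obtain K where K: "1 \<le> K" "\<And>S x. finite S \<Longrightarrow> (\<Sum>m\<in>S. exp (- (e / 2) * \<bar>x - real_of_int m\<bar>)) \<le> K"
    using sum_exp_int by metis
  have "(\<Sum>k\<in>S. exp (- e * cmod (z - lattice_point k))) \<le> K * K" if S: "finite S" for S z
  proof -
    have "(\<Sum>k\<in>S. exp (- e * cmod (z - lattice_point k)))
        \<le> (\<Sum>k\<in>S. exp (- (e / 2) * \<bar>Re z - real_of_int (fst k)\<bar>) * exp (- (e / 2) * \<bar>Im z - real_of_int (snd k)\<bar>))"
    proof (intro sum_mono)
      fix k
      have "\<bar>Re z - of_int (fst k)\<bar> \<le> cmod (z - lattice_point k)" "\<bar>Im z - of_int (snd k)\<bar> \<le> cmod (z - lattice_point k)"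
        using abs_Re_le_cmod[of "z - lattice_point k"] abs_Im_le_cmod[of "z - lattice_point k"]
        by (simp_all add: lattice_point_def)
      then have "e / 2 * (\<bar>Re z - of_int (fst k)\<bar> + \<bar>Im z - of_int (snd k)\<bar>) \<le> e / 2 * (2 * cmod (z - lattice_point k))"
        using e by (intro mult_left_mono) auto
      then show "exp (- e * cmod (z - lattice_point k))
          \<le> exp (- (e / 2) * \<bar>Re z - real_of_int (fst k)\<bar>) * exp (- (e / 2) * \<bar>Im z - real_of_int (snd k)\<bar>)"
        by (simp add: exp_add[symmetric] algebra_simps)
    qed
    also have "\<dots> \<le> (\<Sum>k\<in>fst ` S \<times> snd ` S. exp (- (e / 2) * \<bar>Re z - real_of_int (fst k)\<bar>) * exp (- (e / 2) * \<bar>Im z - real_of_int (snd k)\<bar>))"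
      using S by (intro sum_mono2) (auto simp: image_iff, force+)
    also have "\<dots> = (\<Sum>m\<in>fst ` S. exp (- (e / 2) * \<bar>Re z - real_of_int m\<bar>)) * (\<Sum>m\<in>snd ` S. exp (- (e / 2) * \<bar>Im z - real_of_int m\<bar>))"
      by (simp add: sum_product sum.cartesian_product case_prod_beta)
    also have "\<dots> \<le> K * K"
      using S K by (intro mult_mono K) (auto intro: sum_nonneg)
    finally show ?thesis .
  qed
  moreover have "1 \<le> K * K" using K(1) mult_mono[of 1 K 1 K] by simp
  ultimately show ?thesis using that by blast
qed

text \<open>Peetre's inequality 1 + a \<le> (1 + b)(1 + |a - b|) handles both signs of w, and an
  exponential of any rate e > 0 dominates the remaining power of 1 + |a - b|. In this way a
  polynomial weight moves between a radius and a ring index at the price of part of the exponential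
  decay.\<close>

lemma weight_exp_le:
  assumes e: "(0::real) < e"
  obtains C where "1 \<le> C"
    "\<And>a b. 0 \<le> a \<Longrightarrow> 0 \<le> b \<Longrightarrow> (1 + a) powr w \<le> C * (1 + b) powr w * exp (e * \<bar>a - b\<bar>)"
proof -
  define n where "n = \<bar>w\<bar>"
  \<comment> \<open>Chosen so that c \<le> 1 and n c \<le> e; then 1 + x \<le> exp(c x) / c can be
    raised to the power n. For n = 0 the quotient \<open>e / n\<close> would be 0, and c has to be
    positive.\<close>
  define c where "c = (if n = 0 then 1 else min 1 (e / n))"
  have c: "0 < c" "c \<le> 1" "n * c \<le> e" using e by (auto simp: c_def n_def min_def field_simps)
  define C where "C = (1 / c) powr n"
  have C1: "1 \<le> C" unfolding C_def using c by (intro ge_one_powr_ge_zero) (auto simp: n_def)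
  have grow: "(1 + x) powr n \<le> C * exp (e * x)" if "0 \<le> x" for x
  proof -
    have "1 + x \<le> (1 / c) * (1 + c * x)" using c that by (simp add: field_simps)
    also have "\<dots> \<le> (1 / c) * exp (c * x)" using c by (intro mult_left_mono exp_ge_add_one_self) auto
    finally have "(1 + x) powr n \<le> ((1 / c) * exp (c * x)) powr n"
      using that by (intro powr_mono2) (auto simp: n_def)
    also have "\<dots> = C * exp (n * c * x)"
      unfolding C_def using c by (subst powr_mult) (auto simp: powr_def mult_ac)
    also have "\<dots> \<le> C * exp (e * x)"
      using c C1 that by (intro mult_left_mono) (auto intro!: mult_right_mono)
    finally show ?thesis .
  qed
  have "(1 + a) powr w \<le> C * (1 + b) powr w * exp (e * \<bar>a - b\<bar>)" if ab: "0 \<le> a" "0 \<le> b" for a b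
  proof -
    have *: "1 + c \<le> (1 + d) * (1 + \<bar>c - d\<bar>)" if "0 \<le> c" "0 \<le> d" for c d :: real
    proof -
      have "1 + c \<le> 1 + d + \<bar>c - d\<bar>" by linarith
      also have "\<dots> \<le> (1 + d) * (1 + \<bar>c - d\<bar>)" using that by (simp add: algebra_simps)
      finally show ?thesis .
    qed
    have "(1 + a) powr w \<le> (1 + b) powr w * (1 + \<bar>a - b\<bar>) powr n"
    proof (cases "0 \<le> w")
      case True
      have "(1 + a) powr w \<le> ((1 + b) * (1 + \<bar>a - b\<bar>)) powr w"
        using ab True by (intro powr_mono2 *) auto
      then show ?thesis using ab True by (simp add: powr_mult n_def)
    next
      case False
      have "(1 + b) powr n \<le> ((1 + a) * (1 + \<bar>b - a\<bar>)) powr n"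
        using ab by (intro powr_mono2 *) (auto simp: n_def)
      then have "(1 + b) powr n \<le> (1 + a) powr n * (1 + \<bar>a - b\<bar>) powr n"
        using ab by (simp add: powr_mult abs_minus_commute)
      moreover have "w = - n" using False by (simp add: n_def)
      ultimately show ?thesis using ab by (simp add: powr_minus field_simps)
    qed
    also have "\<dots> \<le> (1 + b) powr w * (C * exp (e * \<bar>a - b\<bar>))"
      by (intro mult_left_mono grow) auto
    finally show ?thesis by (simp add: mult_ac)
  qed
  then show ?thesis using C1 that by blast
qed

section \<open>Exponents, finite sequence norms and Hoelder duality\<close>

lemma exponent_cases:
  assumes "0 < (p :: ennreal)"
  obtains "p = top" | r where "0 < r" "p = ennreal r"
  using assms by (cases p) (auto simp: ennreal_eq_0_iff)

lemma recip_ennreal [simp]: "0 < r \<Longrightarrow> recip (ennreal r) = 1 / r"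
  by (simp add: recip_def)

lemma recip_top [simp]: "recip top = 0"
  by (simp add: recip_def)

lemma conj_exponent_ennreal: "1 < r \<Longrightarrow> conj_exponent (ennreal r) = ennreal (r / (r - 1))"
  unfolding conj_exponent_def
  by (auto simp: ennreal_le_1 divide_ennreal ennreal_minus simp flip: ennreal_1)

lemma conj_exponent_top [simp]: "conj_exponent top = 1"
  by (simp add: conj_exponent_def top_unique)

lemma conj_exponent_pos: "0 < p \<Longrightarrow> 0 < conj_exponent p"
proof (erule exponent_cases, goal_cases)
  case (2 r)
  then show ?thesis
    by (cases "r \<le> 1") (simp_all add: conj_exponent_ennreal, simp add: conj_exponent_def ennreal_le_1)
qed (auto simp: conj_exponent_def)

text \<open>Only meant for nonnegative families; the \<open>0\<close> in the maximum covers the empty index set.\<close>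

definition lnorm :: "ennreal \<Rightarrow> 'i set \<Rightarrow> ('i \<Rightarrow> real) \<Rightarrow> real" where
  "lnorm P S a = (if P = top then Max (insert 0 (a ` S))
     else (\<Sum>i\<in>S. a i powr enn2real P) powr (1 / enn2real P))"

lemma lnorm_ennreal: "0 < p \<Longrightarrow> lnorm (ennreal p) S a = (\<Sum>i\<in>S. a i powr p) powr (1 / p)"
  by (simp add: lnorm_def)

lemma lnorm_nonneg: "finite S \<Longrightarrow> 0 \<le> lnorm P S a"
  by (auto simp: lnorm_def)

lemma lnorm_top_le: "finite S \<Longrightarrow> 0 \<le> B \<Longrightarrow> (\<And>i. i \<in> S \<Longrightarrow> a i \<le> B) \<Longrightarrow> lnorm top S a \<le> B"
  by (auto simp: lnorm_def)

lemma le_lnorm_top: "finite S \<Longrightarrow> i \<in> S \<Longrightarrow> a i \<le> lnorm top S a"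
  by (auto simp: lnorm_def)

lemma lnorm_mono:
  assumes "finite S" "0 < P" "\<And>i. i \<in> S \<Longrightarrow> 0 \<le> a i" "\<And>i. i \<in> S \<Longrightarrow> a i \<le> b i"
  shows "lnorm P S a \<le> lnorm P S b"
  using assms(2)
proof (cases P rule: exponent_cases)
  case 1
  then show ?thesis using assms
    by (auto intro!: lnorm_top_le intro: order_trans[OF _ le_lnorm_top] lnorm_nonneg)
next
  case (2 r)
  then show ?thesis using assms
    by (auto simp: lnorm_ennreal intro!: powr_mono2 sum_mono sum_nonneg)
qed

lemma lnorm_cmult:
  assumes "finite S" "0 < P" "0 \<le> c" "\<And>i. i \<in> S \<Longrightarrow> 0 \<le> a i"
  shows "lnorm P S (\<lambda>i. c * a i) = c * lnorm P S a"
  using assms(2)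
proof (cases P rule: exponent_cases)
  case 1
  have "Max ((*) c ` insert 0 (a ` S)) = c * Max (insert 0 (a ` S))"
    using assms by (intro mono_Max_commute[symmetric]) (auto simp: mono_def mult_left_mono)
  then show ?thesis using 1 unfolding lnorm_def by (simp add: image_image)
next
  case (2 r)
  then show ?thesis using assms
    by (simp add: lnorm_ennreal powr_mult sum_distrib_left[symmetric] powr_powr sum_nonneg)
qed

text \<open>For p \<le> 1 the p-norm dominates the sum, so the conjugate exponent is infinite and
  only the largest b matters. For p > 1 it is Young's inequality for the normalised sequences, which
  is why vanishing norms are treated apart.\<close>

lemma lnorm_holder:
  assumes fin: "finite S" and P: "0 < P" and nn: "\<And>i. i \<in> S \<Longrightarrow> 0 \<le> a i" "\<And>i. i \<in> S \<Longrightarrow> 0 \<le> b i"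
  shows "(\<Sum>i\<in>S. a i * b i) \<le> lnorm P S a * lnorm (conj_exponent P) S b"
proof -
  have top1: "(\<Sum>i\<in>S. a i * b i) \<le> lnorm top S b * (\<Sum>i\<in>S. a i)" if "\<And>i. i \<in> S \<Longrightarrow> 0 \<le> a i" for a b
    unfolding sum_distrib_left
    by (intro sum_mono) (subst mult.commute, intro mult_right_mono le_lnorm_top, use that fin in auto)
  show ?thesis
  using P proof (cases P rule: exponent_cases)
    case 1
    then show ?thesis using top1[of b a] nn by (simp add: lnorm_def mult_ac sum_nonneg)
  next
    case (2 p)
    show ?thesis
    proof (cases "p \<le> 1")
      case True
      have "(\<Sum>i\<in>S. a i) powr p \<le> (\<Sum>i\<in>S. a i powr p)"
        by (intro powr_sum_subadd) (use fin nn 2 True in auto)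
      then have "((\<Sum>i\<in>S. a i) powr p) powr (1 / p) \<le> (\<Sum>i\<in>S. a i powr p) powr (1 / p)"
        using 2 by (intro powr_mono2) auto
      then have "(\<Sum>i\<in>S. a i) \<le> lnorm P S a"
        using 2 nn by (simp add: lnorm_ennreal powr_powr sum_nonneg)
      then have "lnorm top S b * (\<Sum>i\<in>S. a i) \<le> lnorm top S b * lnorm P S a"
        by (intro mult_left_mono lnorm_nonneg fin)
      moreover have "conj_exponent P = top" using 2 True by (simp add: conj_exponent_def ennreal_le_1)
      ultimately show ?thesis using top1[of a b] nn by (simp add: mult_ac)
    next
      case False
      then have p: "1 < p" by simp
      define q where "q = p / (p - 1)"
      have q: "1 < q" "1 / p + 1 / q = 1" using p by (auto simp: q_def field_simps)
      define A where "A = lnorm P S a"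
      define B where "B = lnorm (conj_exponent P) S b"
      have A: "A = (\<Sum>i\<in>S. a i powr p) powr (1 / p)" using 2 by (simp add: A_def lnorm_ennreal)
      have B: "B = (\<Sum>i\<in>S. b i powr q) powr (1 / q)"
        using 2 p q by (simp add: B_def conj_exponent_ennreal q_def[symmetric] lnorm_ennreal)
      show ?thesis
      proof (cases "A = 0 \<or> B = 0")
        case True
        have "(\<Sum>i\<in>S. a i powr p) = 0 \<or> (\<Sum>i\<in>S. b i powr q) = 0" using True A B by auto
        then have "(\<forall>i\<in>S. a i = 0) \<or> (\<forall>i\<in>S. b i = 0)"
          using fin by (auto simp: sum_nonneg_eq_0_iff)
        then have "(\<Sum>i\<in>S. a i * b i) = 0" by (auto intro!: sum.neutral)
        then show ?thesis by (simp add: lnorm_nonneg fin)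
      next
        case False
        then have pos: "A > 0" "B > 0" by (auto simp: A_def B_def less_le lnorm_nonneg fin)
        have Ap: "A powr p = (\<Sum>i\<in>S. a i powr p)" using A p by (simp add: powr_powr sum_nonneg)
        have Bq: "B powr q = (\<Sum>i\<in>S. b i powr q)" using B q by (simp add: powr_powr sum_nonneg)
        have "(\<Sum>i\<in>S. (a i / A) * (b i / B)) \<le> (\<Sum>i\<in>S. (a i / A) powr p / p + (b i / B) powr q / q)"
          by (intro sum_mono Youngs_inequality) (use p q pos nn in auto)
        also have "\<dots> = (\<Sum>i\<in>S. a i powr p) / A powr p / p + (\<Sum>i\<in>S. b i powr q) / B powr q / q"
          using pos nn by (simp add: sum.distrib powr_divide sum_divide_distrib)
        also have "\<dots> = 1" using pos q unfolding Ap[symmetric] Bq[symmetric] by simp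
        finally have "(\<Sum>i\<in>S. a i * b i) / (A * B) \<le> 1"
          by (simp add: sum_divide_distrib)
        then show ?thesis using pos unfolding A_def[symmetric] B_def[symmetric] by (simp add: field_simps)
      qed
    qed
  qed
qed

text \<open>Sharpness of Hoelder's inequality, attained because S is finite: the constant 1 for
  infinite P, a unit mass at a maximum of b for p \<le> 1, a normalised power of b
  otherwise.\<close>

lemma lnorm_extremal:
  assumes fin: "finite S" and P: "0 < P" and nn: "\<And>i. i \<in> S \<Longrightarrow> 0 \<le> b i"
  obtains c where "\<And>i. 0 \<le> c i" "lnorm P S c \<le> 1" "(\<Sum>i\<in>S. c i * b i) = lnorm (conj_exponent P) S b"
  using P
proof (cases P rule: exponent_cases)
  case 1
  have "lnorm P S (\<lambda>_. 1) \<le> 1" using 1 fin by (auto intro: lnorm_top_le)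
  moreover have "(\<Sum>i\<in>S. 1 * b i) = lnorm (conj_exponent P) S b"
    using 1 nn by (simp add: lnorm_def sum_nonneg)
  ultimately show ?thesis using that[of "\<lambda>_. 1"] by simp
next
  case (2 p)
  show ?thesis
  proof (cases "p \<le> 1")
    case True
    have top: "conj_exponent P = top" using 2 True by (simp add: conj_exponent_def ennreal_le_1)
    show ?thesis
    proof (cases "S = {}")
      case True
      then show ?thesis using top 2 by (intro that[of "\<lambda>_. 0"]) (auto simp: lnorm_def)
    next
      case False
      have "Max (b ` S) \<in> b ` S" using False fin by simp
      then obtain k where k: "k \<in> S" "b k = Max (b ` S)" by auto
      have M: "lnorm top S b = b k"
        using k nn[OF k(1)] fin by (intro antisym lnorm_top_le le_lnorm_top) auto
      define c where "c i = (if i = k then 1 else 0 :: real)" for i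
      have "(\<Sum>i\<in>S. c i powr p) = (\<Sum>i\<in>S. if i = k then 1 else 0)"
        using 2 by (intro sum.cong) (auto simp: c_def)
      then have "lnorm P S c = 1" using 2 fin k by (simp add: lnorm_ennreal)
      moreover have "(\<Sum>i\<in>S. c i * b i) = (\<Sum>i\<in>S. if i = k then b i else 0)"
        by (intro sum.cong) (auto simp: c_def)
      ultimately show ?thesis using fin k M top by (intro that[of c]) (auto simp: c_def)
    qed
  next
    case False
    then have p: "1 < p" by simp
    define q where "q = p / (p - 1)"
    have q: "1 < q" "1 / p + 1 / q = 1" "(q - 1) * p = q" using p by (auto simp: q_def field_simps)
    define B where "B = (\<Sum>i\<in>S. b i powr q)"
    have L: "lnorm (conj_exponent P) S b = B powr (1 / q)"
      using 2 p q by (simp add: conj_exponent_ennreal q_def[symmetric] lnorm_ennreal B_def)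
    show ?thesis
    proof (cases "B = 0")
      case True
      then show ?thesis using L 2 by (intro that[of "\<lambda>_. 0"]) (auto simp: lnorm_ennreal)
    next
      case False
      then have B: "B > 0" by (simp add: B_def less_le sum_nonneg)
      \<comment> \<open>Since (q - 1) p = q, the p-th power of c is b^q / B, of sum 1, while c b is
        proportional to b^q.\<close>
      define c where "c i = \<bar>b i\<bar> powr (q - 1) / B powr (1 / p)" for i
      have "(\<Sum>i\<in>S. c i powr p) = (\<Sum>i\<in>S. b i powr q / B)"
        using nn B p q by (intro sum.cong) (auto simp: c_def powr_divide powr_powr)
      also have "\<dots> = 1" using B by (simp add: sum_divide_distrib[symmetric] B_def[symmetric])
      finally have 1: "lnorm P S c = 1" using 2 by (simp add: lnorm_ennreal)
      have "(\<Sum>i\<in>S. c i * b i) = (\<Sum>i\<in>S. b i powr q / B powr (1 / p))"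
      proof (intro sum.cong refl)
        fix i assume "i \<in> S"
        then show "c i * b i = b i powr q / B powr (1 / p)"
          using nn[of i] q by (cases "b i = 0") (auto simp: c_def powr_diff)
      qed
      also have "\<dots> = B powr 1 / B powr (1 / p)" using B by (simp add: sum_divide_distrib[symmetric] B_def[symmetric])
      also have "\<dots> = B powr (1 - 1 / p)" by (rule powr_diff[symmetric])
      also have "1 - 1 / p = 1 / q" using q by simp
      finally show ?thesis using 1 L by (intro that[of c]) (auto simp: c_def)
    qed
  qed
qed

section \<open>Polar coordinates\<close>

lemma measurable_Complex [measurable]:
  assumes [measurable]: "g \<in> borel_measurable M" "h \<in> borel_measurable M"
  shows "(\<lambda>z. Complex (g z) (h z)) \<in> borel_measurable M"
  unfolding Complex_eq by measurable

text \<open>Lebesgue measure on the plane is determined by its values on boxes, and these are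
  products of intervals for the real and the imaginary part.\<close>

lemma lborel_complex: "(lborel :: complex measure) = distr (lborel \<Otimes>\<^sub>M lborel) borel (\<lambda>(x, y). Complex x y)"
proof (rule lborel_eqI)
  fix l u :: complex assume le: "\<And>b. b \<in> Basis \<Longrightarrow> l \<bullet> b \<le> u \<bullet> b"
  have le': "Re l \<le> Re u" "Im l \<le> Im u" using le[of 1] le[of \<i>] by (auto simp: Basis_complex_def inner_complex_def)
  have "(\<lambda>(x, y). Complex x y) -` box l u \<inter> space (lborel \<Otimes>\<^sub>M lborel) = {Re l<..<Re u} \<times> {Im l<..<Im u}"
    by (auto simp: in_box_complex_iff space_pair_measure)
  then have "emeasure (distr (lborel \<Otimes>\<^sub>M lborel) borel (\<lambda>(x, y). Complex x y)) (box l u)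
      = emeasure (lborel \<Otimes>\<^sub>M lborel) ({Re l<..<Re u} \<times> {Im l<..<Im u})"
    by (subst emeasure_distr) auto
  also have "\<dots> = ennreal (Re u - Re l) * ennreal (Im u - Im l)"
    using le' by (subst lborel.emeasure_pair_measure_Times) auto
  also have "\<dots> = ennreal (\<Prod>b\<in>Basis. (u - l) \<bullet> b)"
    using le' by (simp add: Basis_complex_def inner_complex_def ennreal_mult)
  finally show "emeasure (distr (lborel \<Otimes>\<^sub>M lborel) borel (\<lambda>(x, y). Complex x y)) (box l u)
      = (\<Prod>b\<in>Basis. (u - l) \<bullet> b)" .
qed auto

lemma nn_integral_complex:
  assumes f [measurable]: "f \<in> borel_measurable borel"
  shows "(\<integral>\<^sup>+z. f z \<partial>lborel) = (\<integral>\<^sup>+x. \<integral>\<^sup>+y. f (Complex x y) \<partial>lborel \<partial>lborel)"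
proof -
  show ?thesis
    by (subst lborel_complex, subst nn_integral_distr)
      (auto simp: lborel.nn_integral_fst[symmetric] case_prod_beta)
qed

text \<open>The substitution is carried out on the compact intervals [-n, n]. Their images increase
  to the open interval (-pi/2, pi/2), and both measures pass to the limit along increasing
  sets.\<close>

lemma distr_arctan:
  "distr (density lborel (\<lambda>t. ennreal (1 / (1 + t\<^sup>2)))) borel arctan
     = density lborel (indicator {- (pi / 2)<..<pi / 2})"
proof (rule measure_eqI)
  note [measurable] = borel_measurable_continuous_onI[OF continuous_on_arctan[OF continuous_on_id]]
  fix A assume "A \<in> sets (distr (density lborel (\<lambda>t. ennreal (1 / (1 + t\<^sup>2)))) borel arctan)"
  then have [measurable]: "A \<in> sets borel" by simp
  define I where "I n = {arctan (- real n)..arctan (real n)}" for n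
  have I_mono: "incseq I" by (auto simp: I_def incseq_def arctan_le_iff)
  have I_Un: "(\<Union>n. I n) = {- (pi / 2)<..<pi / 2}"
  proof (intro equalityI subsetI)
    fix x assume "x \<in> {- (pi / 2)<..<pi / 2}"
    then have x: "arctan (tan x) = x" by (intro arctan_tan) auto
    obtain n :: nat where "\<bar>tan x\<bar> \<le> real n" using real_arch_simple by blast
    then have "arctan (- real n) \<le> arctan (tan x)" "arctan (tan x) \<le> arctan (real n)"
      by (auto intro!: arctan_monotone')
    then show "x \<in> (\<Union>n. I n)" using x by (auto simp: I_def)
  next
    fix x assume "x \<in> (\<Union>n. I n)"
    then show "x \<in> {- (pi / 2)<..<pi / 2}"
    proof -
      from \<open>x \<in> (\<Union>n. I n)\<close> obtain n where "arctan (- real n) \<le> x" "x \<le> arctan (real n)"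
        by (auto simp: I_def)
      then show ?thesis using arctan_lbound[of "- real n"] arctan_ubound[of "real n"] by auto
    qed
  qed
  have n_Un: "(\<Union>n. {- real n..real n}) = UNIV"
  proof (intro equalityI subsetI)
    fix x obtain n :: nat where "\<bar>x\<bar> \<le> real n" using real_arch_simple by blast
    then show "x \<in> (\<Union>n. {- real n..real n})" by (intro UN_I[of n]) auto
  qed auto
  have eq: "emeasure (density lborel (\<lambda>t. ennreal (1 / (1 + t\<^sup>2)))) (arctan -` A \<inter> {- real n..real n})
      = emeasure lborel (A \<inter> I n)" for n
  proof -
    have "(\<integral>\<^sup>+x. ennreal (indicator A x * indicator {arctan (- real n)..arctan (real n)} x) \<partial>lborel)
        = (\<integral>\<^sup>+x. ennreal (indicator A (arctan x) * inverse (1 + x\<^sup>2) * indicator {- real n..real n} x) \<partial>lborel)"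
    proof (rule nn_integral_substitution)
      have "1 + x\<^sup>2 \<noteq> 0" for x :: real using zero_le_power2[of x] by linarith
      then show "continuous_on {- real n..real n} (\<lambda>x. inverse (1 + x\<^sup>2))" by (intro continuous_intros) auto
    qed (auto intro!: DERIV_arctan simp: set_borel_measurable_def)
    moreover have "emeasure lborel (A \<inter> I n) = (\<integral>\<^sup>+x. ennreal (indicator A x * indicator {arctan (- real n)..arctan (real n)} x) \<partial>lborel)"
    proof -
      have "(\<integral>\<^sup>+x. ennreal (indicator A x * indicator {arctan (- real n)..arctan (real n)} x) \<partial>lborel)
          = (\<integral>\<^sup>+x. indicator (A \<inter> I n) x \<partial>lborel)"
        by (intro nn_integral_cong) (auto simp: I_def indicator_def)
      then show ?thesis by (simp add: I_def)
    qed
    moreover have "emeasure (density lborel (\<lambda>t. ennreal (1 / (1 + t\<^sup>2)))) (arctan -` A \<inter> {- real n..real n})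
        = (\<integral>\<^sup>+x. ennreal (indicator A (arctan x) * inverse (1 + x\<^sup>2) * indicator {- real n..real n} x) \<partial>lborel)"
      by (subst emeasure_density) (auto simp: indicator_def inverse_eq_divide intro!: nn_integral_cong borel_measurable_vimage)
    ultimately show ?thesis by simp
  qed
  have "emeasure (distr (density lborel (\<lambda>t. ennreal (1 / (1 + t\<^sup>2)))) borel arctan) A
      = emeasure (density lborel (\<lambda>t. ennreal (1 / (1 + t\<^sup>2)))) (\<Union>n. arctan -` A \<inter> {- real n..real n})"
    unfolding Int_UN_distrib[symmetric] n_Un by (subst emeasure_distr) auto
  also have "\<dots> = (SUP n. emeasure (density lborel (\<lambda>t. ennreal (1 / (1 + t\<^sup>2)))) (arctan -` A \<inter> {- real n..real n}))"
    by (subst SUP_emeasure_incseq) (auto simp: incseq_def intro!: sets.Int measurable_sets_borel[OF _ \<open>A \<in> sets borel\<close>])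
  also have "\<dots> = (SUP n. emeasure lborel (A \<inter> I n))" by (simp only: eq)
  also have "\<dots> = emeasure lborel (\<Union>n. A \<inter> I n)"
  proof (subst SUP_emeasure_incseq)
    show "incseq (\<lambda>n. A \<inter> I n)" using I_mono unfolding incseq_def by blast
  qed (auto simp: I_def)
  also have "\<dots> = emeasure lborel (A \<inter> {- (pi / 2)<..<pi / 2})"
    unfolding Int_UN_distrib[symmetric] I_Un ..
  also have "\<dots> = emeasure (density lborel (indicator {- (pi / 2)<..<pi / 2})) A"
    by (subst emeasure_density) (auto simp: indicator_inter_arith[symmetric] Int_commute mult.commute)
  finally show "emeasure (distr (density lborel (\<lambda>t. ennreal (1 / (1 + t\<^sup>2)))) borel arctan) A
      = emeasure (density lborel (indicator {- (pi / 2)<..<pi / 2})) A" .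
qed simp

lemma measurable_cis [measurable]: "cis \<in> borel_measurable borel"
  by (intro borel_measurable_continuous_onI continuous_intros)

lemma nn_integral_lborel_shift:
  fixes f :: "real \<Rightarrow> ennreal"
  assumes "f \<in> borel_measurable borel"
  shows "(\<integral>\<^sup>+x. f (x + c) \<partial>lborel) = (\<integral>\<^sup>+x. f x \<partial>lborel)"
  using nn_integral_real_affine[OF assms, of 1 c] by (simp add: add.commute)

text \<open>The substitutions \<open>y = x t\<close> and \<open>t = tan \<theta>\<close> describe the plane by the lines through the origin.\<close>

lemma nn_integral_polar_lines:
  assumes f [measurable]: "f \<in> borel_measurable borel"
  shows "(\<integral>\<^sup>+z. f z \<partial>lborel) =
    (\<integral>\<^sup>+\<theta>. (\<integral>\<^sup>+r. f (of_real r * cis \<theta>) * ennreal \<bar>r\<bar> \<partial>lborel) * indicator {- (pi / 2)<..<pi / 2} \<theta> \<partial>lborel)"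
proof -
  note [measurable] = borel_measurable_continuous_onI[OF continuous_on_arctan[OF continuous_on_id]]
  define \<Phi> where "\<Phi> \<theta> = (\<integral>\<^sup>+r. f (of_real r * cis \<theta>) * ennreal \<bar>r\<bar> \<partial>lborel)" for \<theta>
  have \<Phi>_meas [measurable]: "\<Phi> \<in> borel_measurable borel" unfolding \<Phi>_def by measurable
  have "(\<integral>\<^sup>+z. f z \<partial>lborel) = (\<integral>\<^sup>+x. \<integral>\<^sup>+y. f (Complex x y) \<partial>lborel \<partial>lborel)"
    by (rule nn_integral_complex) measurable
  also have "\<dots> = (\<integral>\<^sup>+x. \<integral>\<^sup>+t. ennreal \<bar>x\<bar> * f (Complex x (x * t)) \<partial>lborel \<partial>lborel)"
  proof (rule nn_integral_cong_AE)
    show "AE x in lborel. (\<integral>\<^sup>+y. f (Complex x y) \<partial>lborel) = (\<integral>\<^sup>+t. ennreal \<bar>x\<bar> * f (Complex x (x * t)) \<partial>lborel)"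
      using AE_lborel_singleton[of 0]
    proof eventually_elim
      case (elim x)
      then show ?case
        by (subst nn_integral_real_affine[where c = x and t = 0]) (auto simp: nn_integral_cmult)
    qed
  qed
  also have "\<dots> = (\<integral>\<^sup>+t. \<integral>\<^sup>+x. ennreal \<bar>x\<bar> * f (Complex x (x * t)) \<partial>lborel \<partial>lborel)"
    by (rule lborel_pair.Fubini'[symmetric]) measurable
  also have "\<dots> = (\<integral>\<^sup>+t. ennreal (1 / (1 + t\<^sup>2)) * \<Phi> (arctan t) \<partial>lborel)"
  proof (intro nn_integral_cong)
    fix t :: real
    \<comment> \<open>On the line of slope t the signed polar radius is x / c. The substitution x =
      c r turns |x| dx into c^2 |r| dr, and c^2 = 1/(1 + t^2) is the density that t = tan \<theta>
      removes.\<close>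
    define c where "c = cos (arctan t)"
    have pos: "1 + t\<^sup>2 > 0" using zero_le_power2[of t] by linarith
    have c: "c > 0" "c * t = sin (arctan t)" "c * c = 1 / (1 + t\<^sup>2)"
      using pos by (auto simp: c_def cos_arctan sin_arctan simp flip: real_sqrt_mult)
    have "(\<integral>\<^sup>+x. ennreal \<bar>x\<bar> * f (Complex x (x * t)) \<partial>lborel)
        = ennreal c * (\<integral>\<^sup>+r. ennreal \<bar>c * r\<bar> * f (Complex (c * r) (c * r * t)) \<partial>lborel)"
      using c by (subst nn_integral_real_affine[where c = c and t = 0]) auto
    also have "\<dots> = (\<integral>\<^sup>+r. ennreal (1 / (1 + t\<^sup>2)) * (f (of_real r * cis (arctan t)) * ennreal \<bar>r\<bar>) \<partial>lborel)"
    proof (subst nn_integral_cmult[symmetric], measurable, intro nn_integral_cong)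
      fix r
      have "Complex (c * r) (c * r * t) = of_real r * cis (arctan t)"
        using c by (simp add: complex_eq_iff c_def mult_ac)
      moreover have "ennreal c * ennreal \<bar>c * r\<bar> = ennreal (1 / (1 + t\<^sup>2)) * ennreal \<bar>r\<bar>"
        using c by (simp add: ennreal_mult[symmetric] abs_mult c(3)[symmetric] mult_ac)
      ultimately show "ennreal c * (ennreal \<bar>c * r\<bar> * f (Complex (c * r) (c * r * t)))
          = ennreal (1 / (1 + t\<^sup>2)) * (f (of_real r * cis (arctan t)) * ennreal \<bar>r\<bar>)"
        by (metis (no_types, lifting) mult.assoc mult.commute)
    qed
    also have "\<dots> = ennreal (1 / (1 + t\<^sup>2)) * \<Phi> (arctan t)"
      unfolding \<Phi>_def by (rule nn_integral_cmult) measurable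
    finally show "(\<integral>\<^sup>+x. ennreal \<bar>x\<bar> * f (Complex x (x * t)) \<partial>lborel) = ennreal (1 / (1 + t\<^sup>2)) * \<Phi> (arctan t)" .
  qed
  also have "\<dots> = (\<integral>\<^sup>+\<theta>. \<Phi> \<theta> \<partial>distr (density lborel (\<lambda>t. ennreal (1 / (1 + t\<^sup>2)))) borel arctan)"
    by (subst nn_integral_distr) (auto simp: nn_integral_density)
  also have "\<dots> = (\<integral>\<^sup>+\<theta>. \<Phi> \<theta> * indicator {- (pi / 2)<..<pi / 2} \<theta> \<partial>lborel)"
    unfolding distr_arctan by (subst nn_integral_density) (auto simp: mult.commute)
  finally show ?thesis unfolding \<Phi>_def .
qed

text \<open>A line through the origin consists of two opposite rays, so integration over all real r
  in direction \<theta> splits into the rays at \<theta> and \<theta> + pi. The half-turn of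
  directions and its translate by pi are then cut and shifted to [0, 2 pi] by periodicity, up to
  three directions of measure zero.\<close>

lemma nn_integral_polar:
  assumes f [measurable]: "f \<in> borel_measurable borel"
  shows "(\<integral>\<^sup>+z. f z \<partial>lborel) =
    (\<integral>\<^sup>+r\<in>{0..}. (\<integral>\<^sup>+\<theta>\<in>{0..2 * pi}. f (of_real r * cis \<theta>) \<partial>lborel) * ennreal r \<partial>lborel)"
proof -
  \<comment> \<open>\<open>ennreal r\<close> vanishes for negative r, so this is the integral over
    the ray in direction \<theta> only.\<close>
  define \<Psi> where "\<Psi> \<theta> = (\<integral>\<^sup>+r. f (of_real r * cis \<theta>) * ennreal r \<partial>lborel)" for \<theta>
  have \<Psi>_meas [measurable]: "\<Psi> \<in> borel_measurable borel" unfolding \<Psi>_def by measurable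
  have line: "(\<integral>\<^sup>+r. f (of_real r * cis \<theta>) * ennreal \<bar>r\<bar> \<partial>lborel) = \<Psi> \<theta> + \<Psi> (\<theta> + pi)" for \<theta>
  proof -
    have "\<Psi> (\<theta> + pi) = (\<integral>\<^sup>+r. f (of_real r * cis \<theta>) * ennreal (- r) \<partial>lborel)"
      unfolding \<Psi>_def by (subst nn_integral_real_affine[where c = "-1" and t = 0]) (auto simp: cis_mult[symmetric])
    moreover have "f (of_real r * cis \<theta>) * ennreal \<bar>r\<bar>
        = f (of_real r * cis \<theta>) * ennreal r + f (of_real r * cis \<theta>) * ennreal (- r)" for r
      by (cases "0 \<le> r") (auto simp: ennreal_neg)
    ultimately show ?thesis unfolding \<Psi>_def by (simp add: nn_integral_add)
  qed
  have periodic: "\<Psi> (\<theta> + 2 * pi) = \<Psi> \<theta>" for \<theta>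
    unfolding \<Psi>_def by (simp add: cis_mult[symmetric])
  have "(\<integral>\<^sup>+z. f z \<partial>lborel) = (\<integral>\<^sup>+\<theta>. \<Psi> \<theta> * indicator {- (pi / 2)<..<pi / 2} \<theta> + \<Psi> (\<theta> + pi) * indicator {- (pi / 2)<..<pi / 2} \<theta> \<partial>lborel)"
    by (subst nn_integral_polar_lines) (auto simp: line distrib_right)
  also have "\<dots> = (\<integral>\<^sup>+\<theta>. \<Psi> \<theta> * indicator {- (pi / 2)<..<pi / 2} \<theta> \<partial>lborel)
      + (\<integral>\<^sup>+\<theta>. \<Psi> (\<theta> + pi) * indicator {- (pi / 2)<..<pi / 2} \<theta> \<partial>lborel)"
    by (rule nn_integral_add) measurable
  also have "(\<integral>\<^sup>+\<theta>. \<Psi> (\<theta> + pi) * indicator {- (pi / 2)<..<pi / 2} \<theta> \<partial>lborel)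
      = (\<integral>\<^sup>+\<theta>. \<Psi> \<theta> * indicator {pi / 2<..<3 * pi / 2} \<theta> \<partial>lborel)"
    by (subst nn_integral_lborel_shift[of _ pi, symmetric]) (auto intro!: nn_integral_cong simp: indicator_def)
  also have "(\<integral>\<^sup>+\<theta>. \<Psi> \<theta> * indicator {- (pi / 2)<..<pi / 2} \<theta> \<partial>lborel)
     = (\<integral>\<^sup>+\<theta>. \<Psi> \<theta> * indicator {0..<pi / 2} \<theta> + \<Psi> \<theta> * indicator {- (pi / 2)<..<0} \<theta> \<partial>lborel)"
    using pi_gt_zero by (intro nn_integral_cong) (auto simp: indicator_def)
  also have "\<dots> = (\<integral>\<^sup>+\<theta>. \<Psi> \<theta> * indicator {0..<pi / 2} \<theta> \<partial>lborel) + (\<integral>\<^sup>+\<theta>. \<Psi> \<theta> * indicator {- (pi / 2)<..<0} \<theta> \<partial>lborel)"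
    by (rule nn_integral_add) measurable
  also have "(\<integral>\<^sup>+\<theta>. \<Psi> \<theta> * indicator {- (pi / 2)<..<0} \<theta> \<partial>lborel)
      = (\<integral>\<^sup>+\<theta>. \<Psi> (\<theta> + 2 * pi) * indicator {3 * pi / 2<..<2 * pi} (\<theta> + 2 * pi) \<partial>lborel)"
    unfolding periodic by (intro nn_integral_cong) (auto simp: indicator_def)
  also have "\<dots> = (\<integral>\<^sup>+\<theta>. \<Psi> \<theta> * indicator {3 * pi / 2<..<2 * pi} \<theta> \<partial>lborel)"
    by (rule nn_integral_lborel_shift) measurable
  also have "(\<integral>\<^sup>+\<theta>. \<Psi> \<theta> * indicator {0..<pi / 2} \<theta> \<partial>lborel) + (\<integral>\<^sup>+\<theta>. \<Psi> \<theta> * indicator {3 * pi / 2<..<2 * pi} \<theta> \<partial>lborel)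
        + (\<integral>\<^sup>+\<theta>. \<Psi> \<theta> * indicator {pi / 2<..<3 * pi / 2} \<theta> \<partial>lborel)
     = (\<integral>\<^sup>+\<theta>. \<Psi> \<theta> * indicator {0..<pi / 2} \<theta> + \<Psi> \<theta> * indicator {3 * pi / 2<..<2 * pi} \<theta>
        + \<Psi> \<theta> * indicator {pi / 2<..<3 * pi / 2} \<theta> \<partial>lborel)"
    by (simp add: nn_integral_add)
  also have "\<dots> = (\<integral>\<^sup>+\<theta>. \<Psi> \<theta> * indicator {0..2 * pi} \<theta> \<partial>lborel)"
  proof (rule nn_integral_cong_AE)
    show "AE \<theta> in lborel. \<Psi> \<theta> * indicator {0..<pi / 2} \<theta> + \<Psi> \<theta> * indicator {3 * pi / 2<..<2 * pi} \<theta>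
        + \<Psi> \<theta> * indicator {pi / 2<..<3 * pi / 2} \<theta> = \<Psi> \<theta> * indicator {0..2 * pi} \<theta>"
      using AE_lborel_singleton[of "pi / 2"] AE_lborel_singleton[of "3 * pi / 2"] AE_lborel_singleton[of "2 * pi"]
      by eventually_elim (auto simp: indicator_def not_le not_less)
  qed
  also have "\<dots> = (\<integral>\<^sup>+\<theta>. \<integral>\<^sup>+r. f (of_real r * cis \<theta>) * ennreal r * indicator {0..2 * pi} \<theta> \<partial>lborel \<partial>lborel)"
    unfolding \<Psi>_def by (intro nn_integral_cong) (simp add: nn_integral_multc)
  also have "\<dots> = (\<integral>\<^sup>+r. \<integral>\<^sup>+\<theta>. f (of_real r * cis \<theta>) * ennreal r * indicator {0..2 * pi} \<theta> \<partial>lborel \<partial>lborel)"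
    by (rule lborel_pair.Fubini'[symmetric]) measurable
  also have "\<dots> = (\<integral>\<^sup>+r\<in>{0..}. (\<integral>\<^sup>+\<theta>\<in>{0..2 * pi}. f (of_real r * cis \<theta>) \<partial>lborel) * ennreal r \<partial>lborel)"
  proof (intro nn_integral_cong)
    fix r :: real
    have "(\<integral>\<^sup>+\<theta>. f (of_real r * cis \<theta>) * ennreal r * indicator {0..2 * pi} \<theta> \<partial>lborel)
        = (\<integral>\<^sup>+\<theta>\<in>{0..2 * pi}. f (of_real r * cis \<theta>) \<partial>lborel) * ennreal r"
      by (subst nn_integral_multc[symmetric]) (auto simp: mult_ac)
    then show "(\<integral>\<^sup>+\<theta>. f (of_real r * cis \<theta>) * ennreal r * indicator {0..2 * pi} \<theta> \<partial>lborel)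
        = (\<integral>\<^sup>+\<theta>\<in>{0..2 * pi}. f (of_real r * cis \<theta>) \<partial>lborel) * ennreal r * indicator {0..} r"
      by (auto simp: indicator_def ennreal_neg)
  qed
  finally show ?thesis .
qed

text \<open>The form of polar coordinates that applies to integrals of complex-valued functions,
  where the formula for nonnegative functions does not suffice.\<close>

lemma lborel_polar:
  "(lborel :: complex measure) = distr (density (lborel \<Otimes>\<^sub>M lborel)
     (\<lambda>(r, \<theta>). ennreal (r * indicator {0..} r * indicator {0..2 * pi} \<theta>))) borel (\<lambda>(r, \<theta>). of_real r * cis \<theta>)"
    (is "_ = ?M")
proof (rule measure_eqI)
  fix A :: "complex set" assume "A \<in> sets lborel"
  then have [measurable]: "A \<in> sets borel" by simp
  have "emeasure ?M A = (\<integral>\<^sup>+z. indicator A z \<partial>?M)" by (subst nn_integral_indicator) auto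
  also have "\<dots> = (\<integral>\<^sup>+r. \<integral>\<^sup>+\<theta>. ennreal (r * indicator {0..} r * indicator {0..2 * pi} \<theta>) * indicator A (of_real r * cis \<theta>) \<partial>lborel \<partial>lborel)"
    by (subst nn_integral_distr, measurable, subst nn_integral_density, measurable,
      subst lborel.nn_integral_fst[symmetric], measurable)
  also have "\<dots> = (\<integral>\<^sup>+r\<in>{0..}. (\<integral>\<^sup>+\<theta>\<in>{0..2 * pi}. indicator A (of_real r * cis \<theta>) \<partial>lborel) * ennreal r \<partial>lborel)"
  proof (intro nn_integral_cong)
    fix r :: real
    have "(\<integral>\<^sup>+\<theta>. ennreal (r * indicator {0..} r * indicator {0..2 * pi} \<theta>) * indicator A (of_real r * cis \<theta>) \<partial>lborel)
      = (\<integral>\<^sup>+\<theta>. ennreal r * indicator {0..} r * (indicator A (of_real r * cis \<theta>) * indicator {0..2 * pi} \<theta>) \<partial>lborel)"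
      by (intro nn_integral_cong) (auto simp: indicator_def)
    also have "\<dots> = ennreal r * indicator {0..} r * (\<integral>\<^sup>+\<theta>\<in>{0..2 * pi}. indicator A (of_real r * cis \<theta>) \<partial>lborel)"
      by (rule nn_integral_cmult) measurable
    finally show "(\<integral>\<^sup>+\<theta>. ennreal (r * indicator {0..} r * indicator {0..2 * pi} \<theta>) * indicator A (of_real r * cis \<theta>) \<partial>lborel)
      = (\<integral>\<^sup>+\<theta>\<in>{0..2 * pi}. indicator A (of_real r * cis \<theta>) \<partial>lborel) * ennreal r * indicator {0..} r"
      by (simp add: mult_ac)
  qed
  also have "\<dots> = (\<integral>\<^sup>+z. indicator A z \<partial>lborel)" by (rule nn_integral_polar[symmetric]) measurable
  also have "\<dots> = emeasure lborel A" by (subst nn_integral_indicator) auto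
  finally show "emeasure lborel A = emeasure ?M A" ..
qed simp

section \<open>Local estimates for entire functions\<close>

text \<open>Cauchy's formula for the n-th derivative, parametrised by the angle. For n = 0 it is the
  mean value property; in general it extracts a Taylor coefficient from each circle.\<close>

lemma cauchy_circle_coefficient:
  assumes h: "h holomorphic_on UNIV" and r: "0 < r"
  shows "((\<lambda>\<theta>. h (of_real r * cis \<theta>) * cis (- real n * \<theta>)) has_integral
      of_real (2 * pi * r ^ n) * ((deriv ^^ n) h 0 / fact n)) {0..2 * pi}"
proof -
  have "((\<lambda>u. h u / (u - 0) ^ (Suc n)) has_contour_integral ((of_real (2 * pi) * \<i>) / (fact n) * (deriv ^^ n) h 0)) (circlepath 0 r)"
    by (rule Cauchy_has_contour_integral_higher_derivative_circlepath)
      (use h r in \<open>auto intro: holomorphic_on_subset holomorphic_on_imp_continuous_on\<close>)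
  then have "((\<lambda>\<theta>. h (0 + of_real r * cis \<theta>) / (0 + of_real r * cis \<theta> - 0) ^ Suc n * r * \<i> * cis \<theta>) has_integral
      (of_real (2 * pi) * \<i>) / (fact n) * (deriv ^^ n) h 0) {0..2 * pi}"
    unfolding circlepath_def by (subst (asm) has_contour_integral_part_circlepath_iff) auto
  then have "((\<lambda>\<theta>. h (0 + of_real r * cis \<theta>) / (0 + of_real r * cis \<theta> - 0) ^ Suc n * r * \<i> * cis \<theta> * (of_real (r ^ n) / \<i>)) has_integral
      (of_real (2 * pi) * \<i>) / (fact n) * (deriv ^^ n) h 0 * (of_real (r ^ n) / \<i>)) {0..2 * pi}"
    by (rule has_integral_mult_left)
  moreover have "h (0 + of_real r * cis \<theta>) / (0 + of_real r * cis \<theta> - 0) ^ Suc n * r * \<i> * cis \<theta> * (of_real (r ^ n) / \<i>)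
      = h (of_real r * cis \<theta>) * cis (- real n * \<theta>)" for \<theta>
  proof -
    have "cis (- real n * \<theta>) = inverse (cis \<theta> ^ n)"
      by (simp add: Complex.DeMoivre cis_inverse)
    then show ?thesis using r by (simp add: field_simps power_mult_distrib)
  qed
  moreover have "(of_real (2 * pi) * \<i>) / (fact n) * (deriv ^^ n) h 0 * (of_real (r ^ n) / \<i>)
      = of_real (2 * pi * r ^ n) * ((deriv ^^ n) h 0 / fact n)" by (simp add: field_simps)
  ultimately show ?thesis by simp
qed

lemma circle_mean_value_le:
  assumes h: "h holomorphic_on UNIV" and r: "0 \<le> r"
  shows "ennreal (2 * pi * cmod (h 0)) \<le> (\<integral>\<^sup>+\<theta>\<in>{0..2 * pi}. ennreal (cmod (h (of_real r * cis \<theta>))) \<partial>lborel)"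
proof (cases "r = 0")
  case True
  then have "(\<integral>\<^sup>+\<theta>\<in>{0..2 * pi}. ennreal (cmod (h (of_real r * cis \<theta>))) \<partial>lborel) = ennreal (cmod (h 0)) * ennreal (2 * pi)"
    by (simp add: nn_integral_cmult)
  then show ?thesis by (simp add: ennreal_mult[symmetric] mult_ac)
next
  case False
  have cont: "continuous_on UNIV h" using h by (rule holomorphic_on_imp_continuous_on)
  have cont': "continuous_on {0..2 * pi} (\<lambda>\<theta>. h (of_real r * cis \<theta>))"
    by (intro continuous_on_compose2[OF cont] continuous_intros) auto
  have "((\<lambda>\<theta>. h (of_real r * cis \<theta>)) has_integral of_real (2 * pi) * h 0) {0..2 * pi}"
    using cauchy_circle_coefficient[OF h, of r 0] r False by simp
  moreover have int: "(\<lambda>\<theta>. cmod (h (of_real r * cis \<theta>))) integrable_on {0..2 * pi}"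
    by (intro integrable_continuous_real continuous_intros cont')
  ultimately have "cmod (of_real (2 * pi) * h 0) \<le> integral {0..2 * pi} (\<lambda>\<theta>. cmod (h (of_real r * cis \<theta>)))"
    using integral_norm_bound_integral[of "\<lambda>\<theta>. h (of_real r * cis \<theta>)" "{0..2 * pi}" "\<lambda>\<theta>. cmod (h (of_real r * cis \<theta>))"]
    by (metis has_integral_integrable integral_unique order_refl)
  also have "ennreal (integral {0..2 * pi} (\<lambda>\<theta>. cmod (h (of_real r * cis \<theta>))))
      = (\<integral>\<^sup>+\<theta>. ennreal (cmod (h (of_real r * cis \<theta>)) * indicator {0..2 * pi} \<theta>) \<partial>lborel)"
  proof (rule nn_integral_has_integral_lborel[symmetric])
    have [measurable]: "h \<in> borel_measurable borel" by (intro borel_measurable_continuous_onI cont)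
    show "(\<lambda>\<theta>. cmod (h (of_real r * cis \<theta>)) * indicator {0..2*pi} \<theta>) \<in> borel_measurable borel" by measurable
    show "((\<lambda>\<theta>. cmod (h (of_real r * cis \<theta>)) * indicator {0..2*pi} \<theta>) has_integral
        integral {0..2 * pi} (\<lambda>\<theta>. cmod (h (of_real r * cis \<theta>)))) UNIV"
    proof -
      have "(\<lambda>\<theta>. cmod (h (of_real r * cis \<theta>)) * indicator {0..2*pi} \<theta>)
          = (\<lambda>\<theta>. if \<theta> \<in> {0..2 * pi} then cmod (h (of_real r * cis \<theta>)) else 0)"
        by (auto simp: indicator_def fun_eq_iff)
      then show ?thesis using integrable_integral[OF int] by (simp only: has_integral_restrict_UNIV)
    qed
  qed simp
  finally show ?thesis by (simp add: norm_mult ennreal_leI ennreal_mult ennreal_indicator)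
qed

lemma nn_integral_cball_0_ge:
  assumes h: "h holomorphic_on UNIV" and \<rho>: "0 < \<rho>"
  shows "ennreal (pi * \<rho>\<^sup>2 * cmod (h 0)) \<le> (\<integral>\<^sup>+w\<in>cball 0 \<rho>. ennreal (cmod (h w)) \<partial>lborel)"
proof -
  have cont: "continuous_on UNIV h" using h by (rule holomorphic_on_imp_continuous_on)
  have [measurable]: "h \<in> borel_measurable borel" by (intro borel_measurable_continuous_onI cont)
  have [measurable]: "cball (0 :: complex) \<rho> \<in> sets borel" by simp
  have "(\<integral>\<^sup>+r\<in>{0..\<rho>}. ennreal (2 * r) \<partial>lborel) = ennreal (\<rho>\<^sup>2 - 0\<^sup>2)"
    by (rule nn_integral_FTC_Icc) (use \<rho> in \<open>auto intro!: derivative_eq_intros\<close>)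
  then have "ennreal (pi * \<rho>\<^sup>2 * cmod (h 0)) = ennreal (pi * cmod (h 0)) * (\<integral>\<^sup>+r\<in>{0..\<rho>}. ennreal (2 * r) \<partial>lborel)"
    by (simp add: ennreal_mult[symmetric] mult_ac)
  also have "\<dots> = (\<integral>\<^sup>+r. ennreal (pi * cmod (h 0)) * (ennreal (2 * r) * indicator {0..\<rho>} r) \<partial>lborel)"
    by (rule nn_integral_cmult[symmetric]) measurable
  also have "\<dots> \<le> (\<integral>\<^sup>+r\<in>{0..}. (\<integral>\<^sup>+\<theta>\<in>{0..2 * pi}. ennreal (cmod (h (of_real r * cis \<theta>))) * indicator (cball 0 \<rho>) (of_real r * cis \<theta>) \<partial>lborel) * ennreal r \<partial>lborel)"
  proof (intro nn_integral_mono)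
    fix r :: real
    show "ennreal (pi * cmod (h 0)) * (ennreal (2 * r) * indicator {0..\<rho>} r)
      \<le> (\<integral>\<^sup>+\<theta>\<in>{0..2 * pi}. ennreal (cmod (h (of_real r * cis \<theta>))) * indicator (cball 0 \<rho>) (of_real r * cis \<theta>) \<partial>lborel) * ennreal r * indicator {0..} r"
    proof (cases "r \<in> {0..\<rho>}")
      case True
      have "ennreal (pi * cmod (h 0)) * (ennreal (2 * r)) = ennreal (2 * pi * cmod (h 0)) * ennreal r"
        using True by (simp add: ennreal_mult[symmetric] mult_ac)
      also have "\<dots> \<le> (\<integral>\<^sup>+\<theta>\<in>{0..2 * pi}. ennreal (cmod (h (of_real r * cis \<theta>))) \<partial>lborel) * ennreal r"
        by (intro mult_right_mono circle_mean_value_le h) (use True in auto)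
      also have "(\<integral>\<^sup>+\<theta>\<in>{0..2 * pi}. ennreal (cmod (h (of_real r * cis \<theta>))) \<partial>lborel)
          = (\<integral>\<^sup>+\<theta>\<in>{0..2 * pi}. ennreal (cmod (h (of_real r * cis \<theta>))) * indicator (cball 0 \<rho>) (of_real r * cis \<theta>) \<partial>lborel)"
        using True by (intro nn_integral_cong) (auto simp: norm_mult indicator_def)
      finally show ?thesis using True by simp
    qed auto
  qed
  also have "\<dots> = (\<integral>\<^sup>+w\<in>cball 0 \<rho>. ennreal (cmod (h w)) \<partial>lborel)"
    by (rule nn_integral_polar[symmetric]) measurable
  finally show ?thesis .
qed

definition weighted_modulus :: "real \<Rightarrow> (complex \<Rightarrow> complex) \<Rightarrow> complex \<Rightarrow> real" where
  "weighted_modulus \<alpha> f z = cmod (f z) * exp (- (\<alpha> / 2) * (cmod z)\<^sup>2)"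

lemma weighted_modulus_nonneg [simp]: "0 \<le> weighted_modulus \<alpha> f z"
  by (simp add: weighted_modulus_def)

lemma continuous_weighted_modulus:
  assumes "continuous_on UNIV f"
  shows "continuous_on UNIV (weighted_modulus \<alpha> f)"
  unfolding weighted_modulus_def by (intro continuous_intros assms)

text \<open>Multiplying the translate by \<open>exp (- \<alpha> * cnj z * w)\<close> absorbs the variation of the Gaussian weight.\<close>

lemma weighted_modulus_submean:
  assumes f: "f holomorphic_on UNIV" and \<alpha>: "0 < \<alpha>" and \<rho>: "0 < \<rho>" "\<rho> \<le> 1"
  shows "ennreal (weighted_modulus \<alpha> f z)
    \<le> ennreal (exp (\<alpha> / 2) / (pi * \<rho>\<^sup>2)) * (\<integral>\<^sup>+w\<in>cball z \<rho>. ennreal (weighted_modulus \<alpha> f w) \<partial>lborel)"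
proof -
  define h where "h w = f (z + w) * exp (- of_real \<alpha> * cnj z * w)" for w
  have cont: "continuous_on UNIV f" using f by (rule holomorphic_on_imp_continuous_on)
  have [measurable]: "cball z \<rho> \<in> sets borel" by simp
  have meas: "(\<lambda>w. ennreal (weighted_modulus \<alpha> f w) * indicator (cball z \<rho>) w) \<in> borel_measurable borel"
    using borel_measurable_continuous_onI[OF continuous_weighted_modulus[OF cont]] by measurable
  have h: "h holomorphic_on UNIV"
  proof -
    have "(f \<circ> (\<lambda>w. z + w)) holomorphic_on UNIV"
      by (intro holomorphic_on_compose holomorphic_intros holomorphic_on_subset[OF f]) auto
    then show ?thesis unfolding h_def o_def by (intro holomorphic_intros)
  qed
  define E where "E = exp (\<alpha> / 2 * (cmod z)\<^sup>2)"
  have bound: "cmod (h w) \<le> E * exp (\<alpha> / 2) * weighted_modulus \<alpha> f (z + w)" if "w \<in> cball 0 \<rho>" for w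
  proof -
    have "cmod w \<le> 1" using that \<rho> by (simp add: norm_minus_commute)
    then have w: "(cmod w)\<^sup>2 \<le> 1" by (simp add: power_le_one)
    \<comment> \<open>Completing the square: the exponential factor of h has modulus exp(-\<alpha>
      Re(cnj z w)), which is the Gaussian at z + w times E, which depends on z only, times
      exp(\<alpha>/2 |w|^2), which is at most exp(\<alpha>/2).\<close>
    have "(cmod (z + w))\<^sup>2 = (cmod z)\<^sup>2 + (cmod w)\<^sup>2 + 2 * Re (cnj z * w)"
      unfolding cmod_power2 by (simp add: power2_eq_square algebra_simps)
    then have "- \<alpha> * Re (cnj z * w) = \<alpha> / 2 * (cmod z)\<^sup>2 + \<alpha> / 2 * (cmod w)\<^sup>2 - \<alpha> / 2 * (cmod (z + w))\<^sup>2"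
      by (simp add: algebra_simps)
    also have "\<dots> \<le> \<alpha> / 2 * (cmod z)\<^sup>2 + \<alpha> / 2 - \<alpha> / 2 * (cmod (z + w))\<^sup>2"
      using w \<alpha> by simp
    finally have "exp (- \<alpha> * Re (cnj z * w)) \<le> E * exp (\<alpha> / 2) * exp (- (\<alpha> / 2) * (cmod (z + w))\<^sup>2)"
      by (simp add: E_def exp_add[symmetric])
    then have "cmod (f (z + w)) * exp (- \<alpha> * Re (cnj z * w))
        \<le> cmod (f (z + w)) * (E * exp (\<alpha> / 2) * exp (- (\<alpha> / 2) * (cmod (z + w))\<^sup>2))"
      by (intro mult_left_mono) auto
    then show ?thesis by (simp add: h_def norm_mult weighted_modulus_def mult_ac algebra_simps)
  qed
  have "ennreal (pi * \<rho>\<^sup>2 * cmod (h 0)) \<le> (\<integral>\<^sup>+w\<in>cball 0 \<rho>. ennreal (cmod (h w)) \<partial>lborel)"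
    by (rule nn_integral_cball_0_ge[OF h \<rho>(1)])
  also have "\<dots> \<le> (\<integral>\<^sup>+w. ennreal (E * exp (\<alpha> / 2)) * (ennreal (weighted_modulus \<alpha> f (z + w)) * indicator (cball z \<rho>) (z + w)) \<partial>lborel)"
    using bound by (intro nn_integral_mono)
      (auto simp: indicator_def dist_norm E_def ennreal_mult[symmetric] intro!: ennreal_leI)
  also have "\<dots> = ennreal (E * exp (\<alpha> / 2)) * (\<integral>\<^sup>+w. ennreal (weighted_modulus \<alpha> f (z + w)) * indicator (cball z \<rho>) (z + w) \<partial>lborel)"
    by (rule nn_integral_cmult) (use measurable_compose[OF _ meas, of "\<lambda>w. z + w"] in simp)
  also have "(\<integral>\<^sup>+w. ennreal (weighted_modulus \<alpha> f (z + w)) * indicator (cball z \<rho>) (z + w) \<partial>lborel)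
      = (\<integral>\<^sup>+w\<in>cball z \<rho>. ennreal (weighted_modulus \<alpha> f w) \<partial>distr lborel borel ((+) z))"
    by (subst nn_integral_distr) (use meas in auto)
  also have "\<dots> = (\<integral>\<^sup>+w\<in>cball z \<rho>. ennreal (weighted_modulus \<alpha> f w) \<partial>lborel)"
    by (simp add: lborel_distr_plus)
  finally have main: "ennreal (pi * \<rho>\<^sup>2 * cmod (h 0)) \<le> ennreal (E * exp (\<alpha> / 2)) * (\<integral>\<^sup>+w\<in>cball z \<rho>. ennreal (weighted_modulus \<alpha> f w) \<partial>lborel)" .
  have "ennreal (weighted_modulus \<alpha> f z) = ennreal (1 / (E * pi * \<rho>\<^sup>2)) * ennreal (pi * \<rho>\<^sup>2 * cmod (h 0))"
    using \<rho> by (simp add: ennreal_mult[symmetric] h_def weighted_modulus_def E_def exp_minus field_simps)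
  also have "\<dots> \<le> ennreal (1 / (E * pi * \<rho>\<^sup>2)) * (ennreal (E * exp (\<alpha> / 2)) * (\<integral>\<^sup>+w\<in>cball z \<rho>. ennreal (weighted_modulus \<alpha> f w) \<partial>lborel))"
    by (intro mult_left_mono main) auto
  also have "\<dots> = ennreal (exp (\<alpha> / 2) / (pi * \<rho>\<^sup>2)) * (\<integral>\<^sup>+w\<in>cball z \<rho>. ennreal (weighted_modulus \<alpha> f w) \<partial>lborel)"
    by (simp add: mult.assoc[symmetric] ennreal_mult[symmetric] E_def)
  finally show ?thesis .
qed

text \<open>
  Hardy and Littlewood's argument: at a maximum point of \<open>(1 - |w - z|) powr (2 / t) * u w\<close> the factor
  \<open>u powr (1 - t)\<close> in \<open>u = u powr t * u powr (1 - t)\<close> can be absorbed.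
\<close>

lemma submean_powr:
  fixes u :: "complex \<Rightarrow> real"
  assumes u: "continuous_on UNIV u" "\<And>z. 0 \<le> u z" and t: "0 < t" "t \<le> 1" and C: "0 < C"
    and sub: "\<And>z \<rho>. 0 < \<rho> \<Longrightarrow> \<rho> \<le> 1 \<Longrightarrow> ennreal (u z) \<le> ennreal (C / \<rho>\<^sup>2) * (\<integral>\<^sup>+w\<in>cball z \<rho>. ennreal (u w) \<partial>lborel)"
  shows "ennreal (u z powr t) \<le> ennreal (C * 2 powr (2 / t)) * (\<integral>\<^sup>+w\<in>cball z 1. ennreal (u w powr t) \<partial>lborel)"
proof -
  have [measurable]: "u \<in> borel_measurable borel" by (intro borel_measurable_continuous_onI u)
  have [measurable]: "cball z 1 \<in> sets borel" by simp
  \<comment> \<open>The weight vanishes on the boundary of the disc, so a positive maximum is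
    attained at some distance d > 0 from it. The disc of radius d/2 about the maximum point stays in
    the unit disc, and there the weight is at least (d/2)^(2/t).\<close>
  define v where "v w = (1 - dist w z) powr (2 / t) * u w" for w
  have "continuous_on (cball z 1) v"
    unfolding v_def using t
    by (intro continuous_on_mult continuous_on_powr' continuous_intros continuous_on_subset[OF u(1)])
      (auto simp: dist_commute)
  then obtain w0 where w0: "w0 \<in> cball z 1" "\<And>w. w \<in> cball z 1 \<Longrightarrow> v w \<le> v w0"
    using continuous_attains_sup[of "cball z 1" v] by (auto simp: compact_cball)
  define B where "B = v w0"
  have uB: "u z \<le> B" using w0(2)[of z] by (simp add: v_def B_def)
  show ?thesis
  proof (cases "B = 0")
    case True
    then have "u z = 0" using uB u(2)[of z] by simp
    then show ?thesis by simp
  next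
    case False
    have B0: "B > 0" using False uB u(2)[of z] by linarith
    define d where "d = 1 - dist w0 z"
    have "d \<noteq> 0" using B0 by (auto simp: B_def v_def d_def)
    moreover have "d \<ge> 0" using w0(1) by (simp add: d_def dist_commute)
    ultimately have d: "0 < d" "d \<le> 1" by (auto simp: d_def)
    have uw0: "u w0 = B / d powr (2 / t)" using d by (simp add: B_def v_def d_def)
    \<comment> \<open>Bounds u^(1 - t) on that smaller disc, because v is nowhere larger than
      B.\<close>
    define M where "M = (B * (2 / d) powr (2 / t)) powr (1 - t)"
    have M0: "M \<ge> 0" by (simp add: M_def)
    have pt: "u w \<le> M * u w powr t" and in1: "w \<in> cball z 1" if "w \<in> cball w0 (d / 2)" for w
    proof -
      have "dist w z \<le> dist w w0 + dist w0 z" by (rule dist_triangle)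
      then have dw: "d / 2 \<le> 1 - dist w z" using that by (simp add: d_def dist_commute field_simps)
      then show in1: "w \<in> cball z 1" using d by (simp add: dist_commute)
      have "(d / 2) powr (2 / t) * u w \<le> v w"
        unfolding v_def using dw d t u by (intro mult_right_mono powr_mono2) auto
      also have "\<dots> \<le> B" unfolding B_def by (rule w0(2)[OF in1])
      finally have "u w \<le> B * (2 / d) powr (2 / t)"
        using d by (simp add: powr_divide field_simps)
      then have "u w powr (1 - t) \<le> M" unfolding M_def using t u by (intro powr_mono2) auto
      then have "u w powr (1 - t) * u w powr t \<le> M * u w powr t" by (intro mult_right_mono) auto
      then show "u w \<le> M * u w powr t" using u(2)[of w] by (simp add: powr_add[symmetric])
    qed
    define I where "I = (\<integral>\<^sup>+w\<in>cball z 1. ennreal (u w powr t) \<partial>lborel)"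
    have "ennreal (u w0) \<le> ennreal (C / (d / 2)\<^sup>2) * (\<integral>\<^sup>+w\<in>cball w0 (d / 2). ennreal (u w) \<partial>lborel)"
      by (rule sub) (use d in auto)
    also have "\<dots> \<le> ennreal (C / (d / 2)\<^sup>2) * (\<integral>\<^sup>+w. ennreal M * (ennreal (u w powr t) * indicator (cball z 1) w) \<partial>lborel)"
      using pt in1 M0 by (intro mult_left_mono nn_integral_mono) (auto simp: indicator_def ennreal_mult[symmetric] intro!: ennreal_leI)
    also have "\<dots> = ennreal (C / (d / 2)\<^sup>2) * (ennreal M * I)"
      unfolding I_def by (subst nn_integral_cmult) auto
    finally have key: "ennreal (u w0) \<le> ennreal (C / (d / 2)\<^sup>2) * (ennreal M * I)" .
    show ?thesis
    proof (cases "I = top")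
      case True
      then show ?thesis using C t by (simp add: I_def[symmetric] ennreal_mult_top)
    next
      case False
      then obtain J where J: "I = ennreal J" "0 \<le> J" by (cases I) auto
      have "ennreal (u w0) \<le> ennreal (C / (d / 2)\<^sup>2 * (M * J))"
        using key C J M0 d by (simp add: ennreal_mult[symmetric])
      then have "u w0 \<le> C / (d / 2)\<^sup>2 * (M * J)" using C J M0 by (subst (asm) ennreal_le_iff) auto
      \<comment> \<open>The exponent 2/t is the one for which all powers of d cancel: 2/t - 2 -
        (2/t)(1 - t) = 0. What remains bounds B by B^(1 - t) times a constant and the integral, and
        division leaves B^t.\<close>
      then have "B \<le> d powr (2 / t) * (C / (d / 2)\<^sup>2 * (M * J))"
        using d by (simp add: uw0 field_simps)
      also have "\<dots> = B powr (1 - t) * (C * 2 powr (2 / t) * J)"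
      proof -
        have "((2 / d) powr (2 / t)) powr (1 - t) = (2 / d) powr (2 / t - 2)"
        proof -
          have "2 / t * (1 - t) = 2 / t - 2" using t by (simp add: field_simps)
          then show ?thesis by (simp only: powr_powr)
        qed
        also have "\<dots> = (2 / d) powr (2 / t) / (2 / d)\<^sup>2"
          using d by (subst powr_diff) (simp add: powr_numeral)
        finally have "M = B powr (1 - t) * ((2 / d) powr (2 / t) / (2 / d)\<^sup>2)"
          using B0 d by (simp add: M_def powr_mult)
        then show ?thesis using d by (simp add: powr_divide power_divide field_simps)
      qed
      finally have "B powr t \<le> C * 2 powr (2 / t) * J"
        using B0 by (simp add: powr_diff field_simps)
      moreover have "u z powr t \<le> B powr t" using uB u t by (intro powr_mono2) auto
      ultimately have "u z powr t \<le> C * 2 powr (2 / t) * J" by simp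
      then show ?thesis unfolding I_def[symmetric] J(1) using C J
        by (subst ennreal_mult[symmetric]) (auto intro!: ennreal_leI)
    qed
  qed
qed

section \<open>Exponential weights integrated over circles\<close>

lemma abs_sin_ge_dist:
  fixes y :: real assumes "\<bar>y\<bar> \<le> pi / 2"
  shows "\<bar>y\<bar> / 3 \<le> \<bar>sin y\<bar>"
proof -
  have pos: "y / 3 \<le> sin y" if y: "0 \<le> y" "y \<le> pi / 2" for y :: real
  \<comment> \<open>Up to pi/3 the derivative of the sine is at least 1/2. Beyond, sin y \<ge> sqrt
    3 / 2 \<ge> 0.8, while y/3 \<le> pi/6 < 0.7.\<close>
  proof (cases "y \<le> pi / 3")
    case True
    have "cos (pi / 3) \<le> cos x" if "0 \<le> x" "x \<le> y" for x
      using that True by (intro cos_monotone_0_pi_le) auto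
    then have c: "1 / 2 \<le> cos x" if "0 \<le> x" "x \<le> y" for x using that by (simp add: cos_60)
    have "0 - sin 0 / 1 \<le> sin y - y / 2"
      using DERIV_nonneg_imp_nondecreasing[of 0 y "\<lambda>x. sin x - x / 2"] y c
      by (force intro!: derivative_eq_intros)
    then show ?thesis using y by simp
  next
    case False
    have "sin (pi / 3) \<le> sin y" using False y by (intro sin_monotone_2pi_le) auto
    moreover have "1 \<le> sqrt 3" by simp
    ultimately have "sqrt 3 / 2 \<le> sin y" by (simp add: sin_60)
    moreover have "1.6 \<le> sqrt 3" by (rule real_le_rsqrt) (simp add: power2_eq_square)
    ultimately show ?thesis using y pi_less_4 by linarith
  qed
  show ?thesis using pos[of y] pos[of "-y"] assms by (cases "0 \<le> y") auto
qed

lemma nn_integral_exp_abs_le: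
  assumes c: "(0::real) < c"
  shows "(\<integral>\<^sup>+x. ennreal (exp (- c * \<bar>x - b\<bar>)) \<partial>lborel) \<le> ennreal (2 / c)"
proof -
  have half: "(\<integral>\<^sup>+x\<in>{0..}. ennreal (exp (- c * x)) \<partial>lborel) = ennreal (0 - - exp (- c * 0) / c)"
  proof (rule nn_integral_FTC_atLeast)
    have "((\<lambda>x. - exp (- c * x) / c) \<longlongrightarrow> - 0 / c) at_top"
      using c by (intro tendsto_intros filterlim_compose[OF exp_at_bot]
          filterlim_tendsto_neg_mult_at_bot[OF tendsto_const] filterlim_ident) auto
    then show "((\<lambda>x. - exp (- c * x) / c) \<longlongrightarrow> 0) at_top" by simp
  qed (use c in \<open>auto intro!: derivative_eq_intros\<close>)
  have "(\<integral>\<^sup>+x. ennreal (exp (- c * \<bar>x - b\<bar>)) \<partial>lborel) = (\<integral>\<^sup>+x. ennreal (exp (- c * \<bar>x\<bar>)) \<partial>lborel)"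
    using nn_integral_lborel_shift[of "\<lambda>x. ennreal (exp (- c * \<bar>x\<bar>))" "- b"] by simp
  also have "\<dots> \<le> (\<integral>\<^sup>+x. ennreal (exp (- c * x)) * indicator {0..} x + ennreal (exp (- c * (- x))) * indicator {0..} (- x) \<partial>lborel)"
    by (intro nn_integral_mono) (auto simp: indicator_def abs_real_def)
  also have "\<dots> = (\<integral>\<^sup>+x. ennreal (exp (- c * x)) * indicator {0..} x \<partial>lborel) + (\<integral>\<^sup>+x. ennreal (exp (- c * (- x))) * indicator {0..} (- x) \<partial>lborel)"
    by (rule nn_integral_add) measurable
  also have "(\<integral>\<^sup>+x. ennreal (exp (- c * (- x))) * indicator {0..} (- x) \<partial>lborel) = (\<integral>\<^sup>+x. ennreal (exp (- c * x)) * indicator {0..} x \<partial>lborel)"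
    using nn_integral_real_affine[of "\<lambda>x. ennreal (exp (- c * x)) * indicator {0..} x" "-1" 0] by simp
  also have "(\<integral>\<^sup>+x. ennreal (exp (- c * x)) * indicator {0..} x \<partial>lborel) + \<dots> = ennreal (2 / c)"
    unfolding half using c by (simp add: ennreal_plus[symmetric] del: ennreal_plus)
  finally show ?thesis .
qed

text \<open>
  The distance from \<open>r * cis \<theta>\<close> to \<open>w\<close> is at least its distance to the line through the origin and \<open>w\<close>.
\<close>

lemma circle_exp_bound:
  assumes e: "(0::real) < e"
  obtains K where "0 < K" "\<And>r w. 0 \<le> r \<Longrightarrow>
    (\<integral>\<^sup>+\<theta>\<in>{0..2 * pi}. ennreal (exp (- e * cmod (of_real r * cis \<theta> - w))) \<partial>lborel)
      \<le> ennreal (K * exp (- (e / 2) * \<bar>r - cmod w\<bar>) / (1 + r))"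
proof -
  \<comment> \<open>2 pi is the trivial bound from the length of the interval of angles; 60/e is r
    times the bound 30/a below, with a = e r / 2. Adding the two gives the factor 1/(1 + r), which
    stays bounded near r = 0.\<close>
  define K where "K = 2 * pi + 60 / e"
  have K: "0 < K" using e by (auto simp: K_def intro!: add_pos_pos)
  have "(\<integral>\<^sup>+\<theta>\<in>{0..2 * pi}. ennreal (exp (- e * cmod (of_real r * cis \<theta> - w))) \<partial>lborel)
      \<le> ennreal (K * exp (- (e / 2) * \<bar>r - cmod w\<bar>) / (1 + r))" if r: "0 \<le> r" for r w
  proof -
    define \<phi> where "\<phi> = Arg w"
    have \<phi>: "w = of_real (cmod w) * cis \<phi>" "- pi < \<phi>" "\<phi> \<le> pi"
      using Arg_bounded[of w] rcis_cmod_Arg[of w] by (auto simp: \<phi>_def rcis_def)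
    define a where "a = e / 2 * r"
    have a: "a \<ge> 0" using e r by (simp add: a_def)
    define X where "X = exp (- (e / 2) * \<bar>r - cmod w\<bar>)"
    \<comment> \<open>Half of the rate e is spent on the difference of the moduli, half on the
      distance to the line through w. Rotation by -\<phi> makes w real, so that the latter distance
      is an imaginary part.\<close>
    have split: "exp (- e * cmod (of_real r * cis \<theta> - w)) \<le> X * exp (- a * \<bar>sin (\<theta> - \<phi>)\<bar>)" for \<theta>
    proof -
      let ?D = "cmod (of_real r * cis \<theta> - w)"
      have 1: "\<bar>r - cmod w\<bar> \<le> ?D"
        using norm_triangle_ineq3[of "of_real r * cis \<theta>" w] r by (simp add: norm_mult)
      have "?D = cmod ((of_real r * cis \<theta> - w) * cis (- \<phi>))" by (simp add: norm_mult)
      also have "(of_real r * cis \<theta> - w) * cis (- \<phi>) = of_real r * cis (\<theta> - \<phi>) - of_real (cmod w)"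
      proof -
        have "(of_real r * cis \<theta> - w) * cis (- \<phi>) = (of_real r * cis \<theta> - of_real (cmod w) * cis \<phi>) * cis (- \<phi>)"
          using \<phi>(1) by simp
        also have "\<dots> = of_real r * (cis \<theta> * cis (- \<phi>)) - of_real (cmod w) * (cis \<phi> * cis (- \<phi>))"
          by (simp only: algebra_simps)
        finally show ?thesis by (simp only: cis_mult) simp
      qed
      finally have 2: "r * \<bar>sin (\<theta> - \<phi>)\<bar> \<le> ?D"
        using abs_Im_le_cmod[of "of_real r * cis (\<theta> - \<phi>) - of_real (cmod w)"] r by (simp add: abs_mult)
      have "e / 2 * \<bar>r - cmod w\<bar> + e / 2 * (r * \<bar>sin (\<theta> - \<phi>)\<bar>) \<le> e / 2 * ?D + e / 2 * ?D"
        using e by (intro add_mono mult_left_mono 1 2) auto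
      then show ?thesis by (simp add: X_def a_def exp_add[symmetric])
    qed
    define Y where "Y = (\<integral>\<^sup>+\<theta>\<in>{0..2 * pi}. ennreal (exp (- e * cmod (of_real r * cis \<theta> - w))) \<partial>lborel)"
    have Y1: "Y \<le> ennreal (X * (2 * pi))"
    proof -
      have "Y \<le> (\<integral>\<^sup>+\<theta>. ennreal X * indicator {0..2 * pi} \<theta> \<partial>lborel)"
        unfolding Y_def
      proof (intro nn_integral_mono mult_right_mono ennreal_leI)
        fix \<theta>
        have "X * exp (- a * \<bar>sin (\<theta> - \<phi>)\<bar>) \<le> X * 1" using a by (intro mult_left_mono) (auto simp: X_def)
        then show "exp (- e * cmod (of_real r * cis \<theta> - w)) \<le> X" using split[of \<theta>] by simp
      qed auto
      also have "\<dots> = ennreal (X * (2 * pi))"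
        by (simp add: nn_integral_cmult ennreal_mult[symmetric] X_def)
      finally show ?thesis .
    qed
    have Y2: "Y \<le> ennreal (X * (30 / a))" if a0: "a > 0"
    proof -
      \<comment> \<open>The sine vanishes at \<phi> + l pi. With \<theta> in [0, 2 pi] and \<phi> in
        (-pi, pi] the nearest such point has l between -1 and 3, so five exponentials suffice, each
        of integral at most 6/a.\<close>
      have pt: "exp (- a * \<bar>sin (\<theta> - \<phi>)\<bar>) \<le> (\<Sum>l\<in>{-1..3::int}. exp (- (a / 3) * \<bar>\<theta> - (\<phi> + of_int l * pi)\<bar>))"
        if "\<theta> \<in> {0..2 * pi}" for \<theta>
      proof -
        define l where "l = round ((\<theta> - \<phi>) / pi)"
        have "\<bar>of_int l - (\<theta> - \<phi>) / pi\<bar> \<le> 1 / 2" unfolding l_def by (rule of_int_round_abs_le)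
        then have "pi * \<bar>of_int l - (\<theta> - \<phi>) / pi\<bar> \<le> pi * (1 / 2)" by (intro mult_left_mono) auto
        moreover have "pi * \<bar>of_int l - (\<theta> - \<phi>) / pi\<bar> = \<bar>of_int l * pi - (\<theta> - \<phi>)\<bar>"
        proof -
          have "pi * (of_int l - (\<theta> - \<phi>) / pi) = of_int l * pi - (\<theta> - \<phi>)"
            by (subst right_diff_distrib) (simp add: mult.commute)
          then show ?thesis by (metis abs_mult abs_of_pos pi_gt_zero)
        qed
        ultimately have dist: "\<bar>\<theta> - (\<phi> + of_int l * pi)\<bar> \<le> pi / 2" by linarith
        have "- pi \<le> \<theta> - \<phi>" "\<theta> - \<phi> < 3 * pi" using that \<phi> by auto
        with dist have "- 3 / 2 * pi \<le> of_int l * pi" "of_int l * pi < 7 / 2 * pi" by linarith+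
        then have "- 3 / 2 \<le> real_of_int l" "real_of_int l < 7 / 2"
          using pi_gt_zero mult_le_cancel_right_pos[of pi "- 3 / 2"] mult_less_cancel_right_pos[of pi] by metis+
        then have "- 1 \<le> l" "l \<le> 3" by linarith+
        then have l: "l \<in> {-1..3}" by simp
        have "\<bar>sin (\<theta> - \<phi>)\<bar> = \<bar>sin (\<theta> - (\<phi> + of_int l * pi))\<bar>"
        proof -
          have s: "sin (of_int l * pi) = 0" by (auto simp: sin_zero_iff_int2)
          have "sin (\<theta> - (\<phi> + of_int l * pi)) = sin (\<theta> - \<phi>) * cos (of_int l * pi)"
            using s unfolding diff_diff_eq[symmetric] by (simp add: sin_diff[of "\<theta> - \<phi>"])
          moreover have "\<bar>cos (of_int l * pi)\<bar> = 1"
            using sin_cos_squared_add[of "of_int l * pi"] unfolding s by (auto simp: power2_eq_1_iff)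
          ultimately show ?thesis by (simp add: abs_mult)
        qed
        then have "\<bar>\<theta> - (\<phi> + of_int l * pi)\<bar> / 3 \<le> \<bar>sin (\<theta> - \<phi>)\<bar>" using abs_sin_ge_dist[OF dist] by simp
        then have "a * (\<bar>\<theta> - (\<phi> + of_int l * pi)\<bar> / 3) \<le> a * \<bar>sin (\<theta> - \<phi>)\<bar>" using a by (intro mult_left_mono)
        then have "exp (- a * \<bar>sin (\<theta> - \<phi>)\<bar>) \<le> exp (- (a / 3) * \<bar>\<theta> - (\<phi> + of_int l * pi)\<bar>)" by simp
        also have "\<dots> \<le> (\<Sum>l\<in>{-1..3::int}. exp (- (a / 3) * \<bar>\<theta> - (\<phi> + of_int l * pi)\<bar>))"
          by (rule member_le_sum[OF l]) auto
        finally show ?thesis .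
      qed
      have "Y \<le> (\<integral>\<^sup>+\<theta>. ennreal X * (\<Sum>l\<in>{-1..3::int}. ennreal (exp (- (a / 3) * \<bar>\<theta> - (\<phi> + of_int l * pi)\<bar>))) \<partial>lborel)"
        unfolding Y_def
      proof (intro nn_integral_mono)
        fix \<theta>
        have "ennreal (exp (- e * cmod (of_real r * cis \<theta> - w)))
          \<le> ennreal (X * (\<Sum>l\<in>{-1..3::int}. exp (- (a / 3) * \<bar>\<theta> - (\<phi> + of_int l * pi)\<bar>)))" if "\<theta> \<in> {0..2 * pi}"
          by (intro ennreal_leI order_trans[OF split] mult_left_mono pt that) (auto simp: X_def)
        then show "ennreal (exp (- e * cmod (of_real r * cis \<theta> - w))) * indicator {0..2 * pi} \<theta>
          \<le> ennreal X * (\<Sum>l\<in>{-1..3::int}. ennreal (exp (- (a / 3) * \<bar>\<theta> - (\<phi> + of_int l * pi)\<bar>)))"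
          by (auto simp: indicator_def ennreal_mult X_def sum_nonneg sum_ennreal)
      qed
      also have "\<dots> = ennreal X * (\<Sum>l\<in>{-1..3::int}. \<integral>\<^sup>+\<theta>. ennreal (exp (- (a / 3) * \<bar>\<theta> - (\<phi> + of_int l * pi)\<bar>)) \<partial>lborel)"
        by (subst nn_integral_cmult, measurable, subst nn_integral_sum) auto
      also have "\<dots> \<le> ennreal X * (\<Sum>l\<in>{-1..3::int}. ennreal (2 / (a / 3)))"
        using a0 by (intro mult_left_mono sum_mono nn_integral_exp_abs_le) auto
      also have "\<dots> = ennreal (X * (30 / a))"
        using a0 by (subst sum_ennreal) (auto simp: ennreal_mult[symmetric] X_def)
      finally show ?thesis .
    qed
    have "Y \<le> ennreal (X * K / (1 + r))"
    proof (cases "r = 0")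
      case True
      then show ?thesis using e by (intro order_trans[OF Y1] ennreal_leI) (auto simp: K_def X_def)
    next
      case False
      then have r0: "r > 0" and a0: "a > 0" using r e by (auto simp: a_def)
      obtain y where y: "Y = ennreal y" "0 \<le> y"
        using Y1 by (cases Y) (auto simp: top_unique)
      have "y \<le> X * (2 * pi)" using Y1 y by (subst (asm) y(1)) (auto simp: X_def ennreal_le_iff)
      moreover have "y \<le> X * (30 / a)" using Y2[OF a0] y a0 by (subst (asm) y(1)) (auto simp: X_def ennreal_le_iff)
      then have "r * y \<le> r * (X * (30 / a))" using r by (intro mult_left_mono)
      then have "r * y \<le> X * (60 / e)" using r0 e by (simp add: a_def field_simps)
      ultimately have "(1 + r) * y \<le> X * K" by (simp add: K_def algebra_simps)
      then show ?thesis unfolding y(1) using r by (intro ennreal_leI) (simp add: field_simps)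
    qed
    then show ?thesis by (simp add: Y_def X_def mult_ac)
  qed
  then show ?thesis using K that by blast
qed

section \<open>Discretisation of the mixed norm\<close>

lemma ennreal_powr_ennreal: "0 \<le> x \<Longrightarrow> ennreal_powr (ennreal x) a = ennreal (x powr a)"
  by (simp add: ennreal_powr_def)

lemma ennreal_powr_le_ennreal_iff:
  assumes "0 < a" "0 \<le> B"
  shows "ennreal_powr x (1 / a) \<le> ennreal B \<longleftrightarrow> x \<le> ennreal (B powr a)"
proof (cases x)
  case (real y)
  have "y powr (1 / a) \<le> B \<longleftrightarrow> y \<le> B powr a"
  proof
    assume "y powr (1 / a) \<le> B"
    then have "(y powr (1 / a)) powr a \<le> B powr a" using assms by (intro powr_mono2) auto
    then show "y \<le> B powr a" using real assms by (simp add: powr_powr)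
  next
    assume "y \<le> B powr a"
    then have "y powr (1 / a) \<le> (B powr a) powr (1 / a)" using real assms by (intro powr_mono2) auto
    then show "y powr (1 / a) \<le> B" using assms by (simp add: powr_powr)
  qed
  then show ?thesis using real assms by (simp add: ennreal_powr_ennreal ennreal_le_iff)
qed (simp add: ennreal_powr_def top_unique)

lemma ennreal_powr_cmult:
  assumes "0 < c" "0 < a"
  shows "ennreal_powr (ennreal c * x) a = ennreal (c powr a) * ennreal_powr x a"
  using assms by (cases x) (auto simp: ennreal_mult[symmetric] ennreal_powr_ennreal powr_mult ennreal_mult_top ennreal_powr_def)

definition weighted_mean :: "ennreal \<Rightarrow> real \<Rightarrow> (complex \<Rightarrow> complex) \<Rightarrow> real \<Rightarrow> real" where
  "weighted_mean P \<alpha> f r = integral_mean P f r * exp (- (\<alpha> / 2) * r\<^sup>2)"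

text \<open>The Gaussian weight is left to \<open>V\<close>, which will be a weighted mean. The
  range \<open>T\<close> permits estimates on bounded radii, where finitely many lattice points
  suffice.\<close>

definition radial_norm :: "real \<Rightarrow> ennreal \<Rightarrow> real set \<Rightarrow> (real \<Rightarrow> real) \<Rightarrow> ennreal" where
  "radial_norm \<sigma> Q T V = (if Q = top then (SUP r\<in>T. ennreal (V r * (1 + r) powr \<sigma>))
     else ennreal_powr (\<integral>\<^sup>+r\<in>T. ennreal ((V r * (1 + r) powr \<sigma>) powr enn2real Q * r) \<partial>lborel) (1 / enn2real Q))"

lemma radial_norm_top: "radial_norm \<sigma> top T V = (SUP r\<in>T. ennreal (V r * (1 + r) powr \<sigma>))"
  by (simp add: radial_norm_def)

lemma radial_norm_ennreal: "0 < q \<Longrightarrow> radial_norm \<sigma> (ennreal q) T V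
    = ennreal_powr (\<integral>\<^sup>+r\<in>T. ennreal ((V r * (1 + r) powr \<sigma>) powr q * r) \<partial>lborel) (1 / q)"
  by (simp add: radial_norm_def)

lemma continuous_circle_bdd:
  fixes f :: "complex \<Rightarrow> complex"
  assumes "continuous_on UNIV f"
  shows "bdd_above (range (\<lambda>\<theta>. cmod (f (of_real r * cis \<theta>))))"
proof -
  have "compact ((\<lambda>z. cmod (f z)) ` cball 0 \<bar>r\<bar>)"
    by (intro compact_continuous_image continuous_intros continuous_on_subset[OF assms]) auto
  then have "bdd_above ((\<lambda>z. cmod (f z)) ` cball 0 \<bar>r\<bar>)" by (intro bounded_imp_bdd_above compact_imp_bounded)
  then show ?thesis by (rule bdd_above_mono) (auto simp: norm_mult)
qed

lemma weighted_modulus_circle: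
  "weighted_modulus \<alpha> f (of_real r * cis \<theta>) = cmod (f (of_real r * cis \<theta>)) * exp (- (\<alpha> / 2) * r\<^sup>2)"
  by (simp add: weighted_modulus_def norm_mult)

lemma weighted_mean_nonneg [simp]:
  assumes "continuous_on UNIV f"
  shows "0 \<le> weighted_mean P \<alpha> f r"
proof -
  have "0 \<le> (SUP \<theta>. cmod (f (of_real r * cis \<theta>)))"
    by (rule cSUP_upper2[where x = 0]) (use continuous_circle_bdd[OF assms] in auto)
  then show ?thesis by (auto simp: weighted_mean_def integral_mean_def)
qed

lemma weighted_modulus_le_mean_top:
  assumes "continuous_on UNIV f"
  shows "weighted_modulus \<alpha> f (of_real r * cis \<theta>) \<le> weighted_mean top \<alpha> f r"
proof -
  have "cmod (f (of_real r * cis \<theta>)) \<le> (SUP \<theta>. cmod (f (of_real r * cis \<theta>)))"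
    by (rule cSUP_upper) (use continuous_circle_bdd[OF assms] in auto)
  then show ?thesis unfolding weighted_modulus_circle weighted_mean_def integral_mean_def
    by (auto intro!: mult_right_mono)
qed

lemma weighted_mean_top_le:
  assumes "\<And>\<theta>. weighted_modulus \<alpha> f (of_real r * cis \<theta>) \<le> B"
  shows "weighted_mean top \<alpha> f r \<le> B"
proof -
  have "(SUP \<theta>. cmod (f (of_real r * cis \<theta>))) \<le> B * exp (\<alpha> / 2 * r\<^sup>2)"
  proof (rule cSUP_least)
    fix \<theta> show "cmod (f (of_real r * cis \<theta>)) \<le> B * exp (\<alpha> / 2 * r\<^sup>2)"
      using assms[of \<theta>] unfolding weighted_modulus_circle by (simp add: exp_minus field_simps)
  qed simp
  then show ?thesis by (simp add: weighted_mean_def integral_mean_def exp_minus field_simps)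
qed

text \<open>Passage from the Bochner integral of the definition to a nonnegative integral;
  continuity on a compact interval supplies the integrability.\<close>

lemma weighted_mean_powr:
  assumes f: "continuous_on UNIV f" and p: "0 < p"
  shows "ennreal (weighted_mean (ennreal p) \<alpha> f r powr p)
    = ennreal (1 / (2 * pi)) * (\<integral>\<^sup>+\<theta>\<in>{0..2 * pi}. ennreal (weighted_modulus \<alpha> f (of_real r * cis \<theta>) powr p) \<partial>lborel)"
proof -
  define I where "I = (LBINT \<theta>:{0..2 * pi}. cmod (f (of_real r * cis \<theta>)) powr p)"
  have I: "0 \<le> I" unfolding I_def by (auto simp: set_lebesgue_integral_def intro!: integral_nonneg)
  have cont: "continuous_on {0..2 * pi} (\<lambda>\<theta>. cmod (f (of_real r * cis \<theta>)) powr p)"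
    by (intro continuous_on_powr' continuous_intros continuous_on_compose2[OF f]) (use p in auto)
  have int: "integrable lborel (\<lambda>\<theta>. cmod (f (of_real r * cis \<theta>)) powr p * indicator {0..2 * pi} \<theta>)"
    using borel_integrable_atLeastAtMost'[OF cont] by (simp add: set_integrable_def mult.commute)
  have I_eq: "ennreal I = (\<integral>\<^sup>+\<theta>. ennreal (cmod (f (of_real r * cis \<theta>)) powr p * indicator {0..2 * pi} \<theta>) \<partial>lborel)"
    by (subst nn_integral_eq_integral[OF int]) (auto simp: I_def set_lebesgue_integral_def mult.commute)
  have meas: "(\<lambda>\<theta>. ennreal (cmod (f (of_real r * cis \<theta>)) powr p * indicator {0..2 * pi} \<theta>)) \<in> borel_measurable lborel"
    using borel_measurable_integrable[OF int] by measurable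
  define E where "E = exp (- (\<alpha> / 2) * r\<^sup>2) powr p"
  have "weighted_mean (ennreal p) \<alpha> f r powr p = 1 / (2 * pi) * (E * I)"
    using p I by (simp add: weighted_mean_def integral_mean_def powr_mult powr_powr I_def E_def)
  also have "ennreal \<dots> = ennreal (1 / (2 * pi)) * (ennreal E * ennreal I)"
    using I by (simp only: ennreal_mult[symmetric] E_def powr_ge_zero mult_nonneg_nonneg) (simp add: ennreal_mult[symmetric])
  also have "ennreal E * ennreal I = (\<integral>\<^sup>+\<theta>. ennreal E * ennreal (cmod (f (of_real r * cis \<theta>)) powr p * indicator {0..2 * pi} \<theta>) \<partial>lborel)"
    unfolding I_eq by (rule nn_integral_cmult[symmetric]) (rule meas)
  also have "\<dots> = (\<integral>\<^sup>+\<theta>\<in>{0..2 * pi}. ennreal (weighted_modulus \<alpha> f (of_real r * cis \<theta>) powr p) \<partial>lborel)"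
    by (intro nn_integral_cong)
      (simp add: weighted_modulus_circle powr_mult E_def ennreal_mult ennreal_indicator mult_ac del: mult.commute)
  finally show ?thesis .
qed

lemma weighted_mean_measurable [measurable]:
  assumes f: "continuous_on UNIV f" and P: "0 < P"
  shows "weighted_mean P \<alpha> f \<in> borel_measurable borel"
proof -
  have [measurable]: "f \<in> borel_measurable borel" by (intro borel_measurable_continuous_onI f)
  have "integral_mean P f \<in> borel_measurable borel"
  proof (cases "P = top")
    case True
    \<comment> \<open>An uncountable supremum of continuous functions: its superlevel sets are
      unions of open sets, hence open.\<close>
    have "(\<lambda>r. SUP \<theta>. cmod (f (of_real r * cis \<theta>))) \<in> borel_measurable borel"
    proof (subst borel_measurable_iff_greater, intro allI)
      fix a
      have "{r. a < (SUP \<theta>. cmod (f (of_real r * cis \<theta>)))} = (\<Union>\<theta>. {r. a < cmod (f (of_real r * cis \<theta>))})"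
        by (subst less_cSUP_iff) (use continuous_circle_bdd[OF f] in auto)
      moreover have "open {r. a < cmod (f (of_real r * cis \<theta>))}" for \<theta>
        by (intro open_Collect_less continuous_intros continuous_on_compose2[OF f]) auto
      ultimately show "{w \<in> space borel. a < (SUP \<theta>. cmod (f (of_real w * cis \<theta>)))} \<in> sets borel"
        by (simp add: open_UN)
    qed
    then show ?thesis using True by (simp add: integral_mean_def[abs_def])
  next
    case False
    then show ?thesis unfolding integral_mean_def[abs_def] set_lebesgue_integral_def by simp
  qed
  then show ?thesis unfolding weighted_mean_def[abs_def] by measurable
qed

text \<open>The factor \<alpha> q of the radial measure, taken out of the q-th root.\<close>

definition radial_const :: "real \<Rightarrow> ennreal \<Rightarrow> real" where
  "radial_const \<alpha> Q = (if Q = top then 1 else (\<alpha> * enn2real Q) powr (1 / enn2real Q))"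

lemma radial_const_pos: "0 < \<alpha> \<Longrightarrow> 0 < Q \<Longrightarrow> 0 < radial_const \<alpha> Q"
  by (erule exponent_cases) (auto simp: radial_const_def)

lemma fock_norm_radial:
  assumes f: "continuous_on UNIV f" and \<alpha>: "0 < \<alpha>" and P: "0 < P" and Q: "0 < Q"
  shows "fock_norm \<alpha> \<sigma> P Q f = ennreal (radial_const \<alpha> Q) * radial_norm \<sigma> Q {0..} (weighted_mean P \<alpha> f)"
  using Q
proof (cases Q rule: exponent_cases)
  case 1
  then show ?thesis
    by (simp add: fock_norm_def radial_norm_top weighted_mean_def mult_ac radial_const_def)
next
  case (2 q)
  have mean: "0 \<le> integral_mean P f r" for r
    using weighted_mean_nonneg[OF f, of P 0 r] by (simp add: weighted_mean_def)
  have [measurable]: "weighted_mean P \<alpha> f \<in> borel_measurable borel" by (rule weighted_mean_measurable[OF f P])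
  have "(\<integral>\<^sup>+r\<in>{0..}. ennreal ((integral_mean P f r * (1 + r) powr \<sigma>) powr q
                   * (\<alpha> * q * exp (- (\<alpha> * q / 2) * r\<^sup>2) * r)) \<partial>lborel)
      = (\<integral>\<^sup>+r. ennreal (\<alpha> * q) * (ennreal ((weighted_mean P \<alpha> f r * (1 + r) powr \<sigma>) powr q * r) * indicator {0..} r) \<partial>lborel)"
  proof (intro nn_integral_cong)
    fix r :: real
    have "exp (- (\<alpha> / 2) * r\<^sup>2) powr q = exp (- (\<alpha> * q / 2) * r\<^sup>2)" by (simp add: exp_powr_real mult_ac)
    then have "(integral_mean P f r * (1 + r) powr \<sigma>) powr q * (\<alpha> * q * exp (- (\<alpha> * q / 2) * r\<^sup>2) * r)
      = (\<alpha> * q) * ((weighted_mean P \<alpha> f r * (1 + r) powr \<sigma>) powr q * r)" if "0 \<le> r"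
      using that mean[of r] by (simp add: weighted_mean_def powr_mult mult_ac)
    then show "ennreal ((integral_mean P f r * (1 + r) powr \<sigma>) powr q
                   * (\<alpha> * q * exp (- (\<alpha> * q / 2) * r\<^sup>2) * r)) * indicator {0..} r
      = ennreal (\<alpha> * q) * (ennreal ((weighted_mean P \<alpha> f r * (1 + r) powr \<sigma>) powr q * r) * indicator {0..} r)"
      using \<alpha> 2 by (cases "0 \<le> r") (simp_all add: ennreal_mult[symmetric])
  qed
  also have "\<dots> = ennreal (\<alpha> * q) * (\<integral>\<^sup>+r\<in>{0..}. ennreal ((weighted_mean P \<alpha> f r * (1 + r) powr \<sigma>) powr q * r) \<partial>lborel)"
    by (rule nn_integral_cmult) measurable
  finally show ?thesis
    using 2 \<alpha> by (simp add: fock_norm_def radial_norm_ennreal ennreal_powr_cmult radial_const_def)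
qed

section \<open>Rings of Gaussian integers and the discrete norm\<close>

definition lattice_ring :: "nat \<Rightarrow> (int \<times> int) set" where
  "lattice_ring j = {k. nat \<lfloor>cmod (lattice_point k)\<rfloor> = j}"

definition lattice_disc :: "nat \<Rightarrow> (int \<times> int) set" where
  "lattice_disc N = {k. cmod (lattice_point k) < real N}"

lemma finite_lattice_disc [simp]: "finite (lattice_disc N)"
proof (rule finite_subset)
  show "lattice_disc N \<subseteq> {- int N..int N} \<times> {- int N..int N}"
  proof
    fix k assume "k \<in> lattice_disc N"
    then have "\<bar>real_of_int (fst k)\<bar> < real N" "\<bar>real_of_int (snd k)\<bar> < real N"
      using abs_Re_le_cmod[of "lattice_point k"] abs_Im_le_cmod[of "lattice_point k"]
      by (auto simp: lattice_disc_def lattice_point_def)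
    then have "\<bar>fst k\<bar> < int N" "\<bar>snd k\<bar> < int N" by linarith+
    then show "k \<in> {- int N..int N} \<times> {- int N..int N}" by (cases k) auto
  qed
qed auto

lemma lattice_ring_dist:
  assumes "k \<in> lattice_ring j"
  shows "real j \<le> cmod (lattice_point k)" "cmod (lattice_point k) < real j + 1"
  using assms norm_ge_zero[of "lattice_point k"] unfolding lattice_ring_def mem_Collect_eq by linarith+

lemma lattice_disc_rings: "lattice_disc N = (\<Union>j<N. lattice_ring j)"
proof -
  have "cmod (lattice_point k) < real N \<longleftrightarrow> nat \<lfloor>cmod (lattice_point k)\<rfloor> < N" for k
    using norm_ge_zero[of "lattice_point k"] by linarith
  then show ?thesis by (auto simp: lattice_disc_def lattice_ring_def)
qed

lemma finite_lattice_ring [simp]: "finite (lattice_ring j)"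
  by (rule finite_subset[OF _ finite_lattice_disc[of "Suc j"]]) (auto simp: lattice_disc_rings)

lemma sum_lattice_disc: "(\<Sum>k\<in>lattice_disc N. f k) = (\<Sum>j<N. \<Sum>k\<in>lattice_ring j. f k)"
  unfolding lattice_disc_rings
  by (rule sum.UNION_disjoint) (simp, simp, auto simp: lattice_ring_def)

text \<open>
  The relevant weight is \<open>w = \<sigma> - 1 / P + 1 / Q\<close>: the ring of index \<open>j\<close> contains about \<open>1 + j\<close> lattice points, so that
  the mean over a circle costs \<open>(1 + j) powr (- 1 / P)\<close>, and \<open>r dr\<close> contributes \<open>(1 + j) powr (1 / Q)\<close>.
\<close>

definition discrete_norm :: "ennreal \<Rightarrow> ennreal \<Rightarrow> real \<Rightarrow> nat \<Rightarrow> (int \<times> int \<Rightarrow> real) \<Rightarrow> real" where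
  "discrete_norm P Q w N a = lnorm Q {..<N} (\<lambda>j. (1 + real j) powr w * lnorm P (lattice_ring j) a)"

lemma discrete_norm_nonneg [simp]: "0 \<le> discrete_norm P Q w N a"
  by (simp add: discrete_norm_def lnorm_nonneg)

lemma discrete_norm_cmult:
  assumes "0 < P" "0 < Q" "0 \<le> c" "\<And>k. 0 \<le> a k"
  shows "discrete_norm P Q w N (\<lambda>k. c * a k) = c * discrete_norm P Q w N a"
proof -
  have "discrete_norm P Q w N (\<lambda>k. c * a k) = lnorm Q {..<N} (\<lambda>j. c * ((1 + real j) powr w * lnorm P (lattice_ring j) a))"
    unfolding discrete_norm_def using assms by (subst lnorm_cmult) (auto simp: mult_ac)
  also have "\<dots> = c * discrete_norm P Q w N a"
    unfolding discrete_norm_def using assms by (intro lnorm_cmult) (auto simp: lnorm_nonneg)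
  finally show ?thesis .
qed

section \<open>Synthesis: the function norm bounded by the sequence norm\<close>

lemma ring_exp_le:
  assumes "k \<in> lattice_ring j" "0 \<le> e"
  shows "exp (- e * \<bar>r - cmod (lattice_point k)\<bar>) \<le> exp e * exp (- e * \<bar>r - real j\<bar>)"
proof -
  have "\<bar>r - real j\<bar> \<le> 1 + \<bar>r - cmod (lattice_point k)\<bar>" using lattice_ring_dist[OF assms(1)] by linarith
  then have "e * \<bar>r - real j\<bar> \<le> e * (1 + \<bar>r - cmod (lattice_point k)\<bar>)" using assms by (intro mult_left_mono)
  then show ?thesis by (simp add: exp_add[symmetric] algebra_simps)
qed

text \<open>Half of the decay is kept as decay in the distance from z to the ring; the other half
  bounds the sum over the lattice uniformly.\<close>

lemma ring_sum_exp_le: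
  assumes e: "(0::real) < e"
  obtains K where "1 \<le> K" "\<And>z j. (\<Sum>k\<in>lattice_ring j. exp (- e * cmod (z - lattice_point k))) \<le> K * exp (- (e / 2) * \<bar>cmod z - real j\<bar>)"
proof -
  have "0 < e / 2" using e by simp
  then obtain K where K: "1 \<le> K" "\<And>S z. finite S \<Longrightarrow> (\<Sum>k\<in>S. exp (- (e / 2) * cmod (z - lattice_point k))) \<le> K"
    using sum_exp_lattice by blast
  have "(\<Sum>k\<in>lattice_ring j. exp (- e * cmod (z - lattice_point k))) \<le> (exp (e / 2) * K) * exp (- (e / 2) * \<bar>cmod z - real j\<bar>)" for z j
  proof -
    have "(\<Sum>k\<in>lattice_ring j. exp (- e * cmod (z - lattice_point k)))
      \<le> (\<Sum>k\<in>lattice_ring j. (exp (e / 2) * exp (- (e / 2) * \<bar>cmod z - real j\<bar>)) * exp (- (e / 2) * cmod (z - lattice_point k)))"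
    proof (intro sum_mono)
      fix k assume k: "k \<in> lattice_ring j"
      have "e / 2 * \<bar>cmod z - cmod (lattice_point k)\<bar> \<le> e / 2 * cmod (z - lattice_point k)"
        using e by (intro mult_left_mono norm_triangle_ineq3) auto
      then have "exp (- e * cmod (z - lattice_point k)) \<le> exp (- (e / 2) * \<bar>cmod z - cmod (lattice_point k)\<bar>) * exp (- (e / 2) * cmod (z - lattice_point k))"
        by (simp add: exp_add[symmetric])
      also have "\<dots> \<le> (exp (e / 2) * exp (- (e / 2) * \<bar>cmod z - real j\<bar>)) * exp (- (e / 2) * cmod (z - lattice_point k))"
        using e by (intro mult_right_mono ring_exp_le k) auto
      finally show "exp (- e * cmod (z - lattice_point k))
        \<le> (exp (e / 2) * exp (- (e / 2) * \<bar>cmod z - real j\<bar>)) * exp (- (e / 2) * cmod (z - lattice_point k))" .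
    qed
    also have "\<dots> = (exp (e / 2) * exp (- (e / 2) * \<bar>cmod z - real j\<bar>)) * (\<Sum>k\<in>lattice_ring j. exp (- (e / 2) * cmod (z - lattice_point k)))"
      by (simp add: sum_distrib_left)
    also have "\<dots> \<le> (exp (e / 2) * exp (- (e / 2) * \<bar>cmod z - real j\<bar>)) * K"
      by (intro mult_left_mono K) auto
    finally show ?thesis by (simp add: mult_ac)
  qed
  moreover have "1 \<le> exp (e / 2) * K" using K(1) e mult_mono[of 1 "exp (e / 2)" 1 K] by simp
  ultimately show ?thesis using that by blast
qed

text \<open>Synthesis on one circle. For finite p the power enters the lattice sum by
  \<open>sum_powr_le\<close>, and each exponential integrates over the circle to order 1/(1 + r),
  whose p-th root is the factor (1 + r)^(-1/P). A second use of \<open>sum_powr_le\<close>, with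
  exponent 1/p, separates the rings again. The constants depend on neither N nor \<alpha> nor
  f.\<close>

lemma weighted_mean_le_lattice_sum:
  assumes P: "0 < P" and e: "(0::real) < e"
  obtains C e' where "0 < C" "0 < e'"
    "\<And>\<alpha> f r N a. continuous_on UNIV f \<Longrightarrow> 0 \<le> r \<Longrightarrow> (\<And>k. 0 \<le> a k) \<Longrightarrow>
      (\<And>\<theta>. weighted_modulus \<alpha> f (of_real r * cis \<theta>)
         \<le> (\<Sum>k\<in>lattice_disc N. exp (- e * cmod (of_real r * cis \<theta> - lattice_point k)) * a k)) \<Longrightarrow>
      weighted_mean P \<alpha> f r \<le> C * (1 + r) powr (- recip P) * (\<Sum>j<N. exp (- e' * \<bar>r - real j\<bar>) * lnorm P (lattice_ring j) a)"
  using P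
proof (cases P rule: exponent_cases)
  case 1
  obtain K where K: "1 \<le> K" "\<And>z j. (\<Sum>k\<in>lattice_ring j. exp (- e * cmod (z - lattice_point k))) \<le> K * exp (- (e / 2) * \<bar>cmod z - real j\<bar>)"
    using ring_sum_exp_le[OF e] by blast
  show ?thesis
  proof (rule that[of K "e / 2"])
    fix \<alpha> f r N and a :: "int \<times> int \<Rightarrow> real"
    assume r: "0 \<le> r" and a: "\<And>k. 0 \<le> a k" and le: "\<And>\<theta>. weighted_modulus \<alpha> f (of_real r * cis \<theta>)
         \<le> (\<Sum>k\<in>lattice_disc N. exp (- e * cmod (of_real r * cis \<theta> - lattice_point k)) * a k)"
    have "weighted_mean top \<alpha> f r \<le> K * (\<Sum>j<N. exp (- (e / 2) * \<bar>r - real j\<bar>) * lnorm top (lattice_ring j) a)"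
    proof (rule weighted_mean_top_le)
      fix \<theta>
      have "weighted_modulus \<alpha> f (of_real r * cis \<theta>) \<le> (\<Sum>j<N. \<Sum>k\<in>lattice_ring j. exp (- e * cmod (of_real r * cis \<theta> - lattice_point k)) * a k)"
        using le[of \<theta>] by (simp add: sum_lattice_disc)
      also have "\<dots> \<le> (\<Sum>j<N. \<Sum>k\<in>lattice_ring j. exp (- e * cmod (of_real r * cis \<theta> - lattice_point k)) * lnorm top (lattice_ring j) a)"
        by (intro sum_mono mult_left_mono le_lnorm_top) auto
      also have "\<dots> \<le> (\<Sum>j<N. K * exp (- (e / 2) * \<bar>r - real j\<bar>) * lnorm top (lattice_ring j) a)"
        unfolding sum_distrib_right[symmetric]
        using K(2)[of "of_real r * cis \<theta>"] r by (intro sum_mono mult_right_mono lnorm_nonneg) (auto simp: norm_mult)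
      finally show "weighted_modulus \<alpha> f (of_real r * cis \<theta>) \<le> K * (\<Sum>j<N. exp (- (e / 2) * \<bar>r - real j\<bar>) * lnorm top (lattice_ring j) a)"
        by (simp add: sum_distrib_left mult_ac)
    qed
    then show "weighted_mean P \<alpha> f r \<le> K * (1 + r) powr (- recip P) * (\<Sum>j<N. exp (- (e / 2) * \<bar>r - real j\<bar>) * lnorm P (lattice_ring j) a)"
      using 1 r by simp
  qed (use K e in auto)
next
  case (2 p)
  define e1 where "e1 = min 1 p * e"
  have e1: "0 < e1" using e 2 by (simp add: e1_def)
  obtain K where K: "1 \<le> K" "\<And>S z. finite S \<Longrightarrow> (\<Sum>k\<in>S. exp (- e * cmod (z - lattice_point k))) \<le> K"
    using sum_exp_lattice[OF e] by blast
  obtain K2 where K2: "0 < K2" "\<And>r w. 0 \<le> r \<Longrightarrow>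
    (\<integral>\<^sup>+\<theta>\<in>{0..2 * pi}. ennreal (exp (- e1 * cmod (of_real r * cis \<theta> - w))) \<partial>lborel)
      \<le> ennreal (K2 * exp (- (e1 / 2) * \<bar>r - cmod w\<bar>) / (1 + r))"
    using circle_exp_bound[OF e1] by blast
  define e2 where "e2 = e1 / 2"
  have e2: "0 < e2" using e1 by (simp add: e2_def)
  obtain K3 where K3: "1 \<le> K3" "\<And>S x. finite S \<Longrightarrow> (\<Sum>m\<in>S. exp (- e2 * \<bar>x - real m\<bar>)) \<le> K3"
    using sum_exp_nat[OF e2] by blast
  define C1 where "C1 = 1 / (2 * pi) * (K powr p * (K2 * exp e2))"
  have C1: "0 < C1" using K K2 by (simp add: C1_def)
  show ?thesis
  proof (rule that[of "C1 powr (1 / p) * K3 powr (1 / p)" "min 1 (1 / p) * e2"])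
    fix \<alpha> f r N and a :: "int \<times> int \<Rightarrow> real"
    assume f: "continuous_on UNIV f" and r: "0 \<le> r" and a: "\<And>k. 0 \<le> a k" and le: "\<And>\<theta>. weighted_modulus \<alpha> f (of_real r * cis \<theta>)
         \<le> (\<Sum>k\<in>lattice_disc N. exp (- e * cmod (of_real r * cis \<theta> - lattice_point k)) * a k)"
    define S where "S j = (\<Sum>k\<in>lattice_ring j. a k powr p)" for j
    have S0: "0 \<le> S j" for j by (auto simp: S_def intro: sum_nonneg)
    have pw: "weighted_modulus \<alpha> f (of_real r * cis \<theta>) powr p
        \<le> K powr p * (\<Sum>k\<in>lattice_disc N. exp (- e1 * cmod (of_real r * cis \<theta> - lattice_point k)) * a k powr p)" for \<theta>
    proof -
      have "weighted_modulus \<alpha> f (of_real r * cis \<theta>) powr p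
        \<le> (\<Sum>k\<in>lattice_disc N. exp (- e * cmod (of_real r * cis \<theta> - lattice_point k)) * a k) powr p"
        using 2 by (intro powr_mono2 le) auto
      also have "\<dots> \<le> K powr p * (\<Sum>k\<in>lattice_disc N. exp (- (min 1 p * e) * cmod (of_real r * cis \<theta> - lattice_point k)) * a k powr p)"
        by (rule sum_powr_le) (use a K 2 e in auto)
      finally show ?thesis by (simp add: e1_def)
    qed
    have "ennreal (weighted_mean P \<alpha> f r powr p)
        = ennreal (1 / (2 * pi)) * (\<integral>\<^sup>+\<theta>\<in>{0..2 * pi}. ennreal (weighted_modulus \<alpha> f (of_real r * cis \<theta>) powr p) \<partial>lborel)"
      using weighted_mean_powr[OF f] 2 by simp
    also have "\<dots> \<le> ennreal (1 / (2 * pi)) * (\<integral>\<^sup>+\<theta>. ennreal (K powr p) * (\<Sum>k\<in>lattice_disc N. ennreal (a k powr p) * (ennreal (exp (- e1 * cmod (of_real r * cis \<theta> - lattice_point k))) * indicator {0..2 * pi} \<theta>)) \<partial>lborel)"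
    proof (intro mult_left_mono nn_integral_mono)
      fix \<theta>
      have "ennreal (weighted_modulus \<alpha> f (of_real r * cis \<theta>) powr p) \<le> ennreal (K powr p * (\<Sum>k\<in>lattice_disc N. exp (- e1 * cmod (of_real r * cis \<theta> - lattice_point k)) * a k powr p))"
        by (intro ennreal_leI pw)
      also have "\<dots> = ennreal (K powr p) * (\<Sum>k\<in>lattice_disc N. ennreal (a k powr p) * ennreal (exp (- e1 * cmod (of_real r * cis \<theta> - lattice_point k))))"
        by (subst ennreal_mult) (auto intro!: sum_nonneg simp: sum_ennreal[symmetric] ennreal_mult mult.commute)
      finally show "ennreal (weighted_modulus \<alpha> f (of_real r * cis \<theta>) powr p) * indicator {0..2 * pi} \<theta>
          \<le> ennreal (K powr p) * (\<Sum>k\<in>lattice_disc N. ennreal (a k powr p) * (ennreal (exp (- e1 * cmod (of_real r * cis \<theta> - lattice_point k))) * indicator {0..2 * pi} \<theta>))"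
        by (auto simp: indicator_def)
    qed auto
    also have "\<dots> = ennreal (1 / (2 * pi)) * (ennreal (K powr p) * (\<Sum>k\<in>lattice_disc N. ennreal (a k powr p) *
        (\<integral>\<^sup>+\<theta>\<in>{0..2 * pi}. ennreal (exp (- e1 * cmod (of_real r * cis \<theta> - lattice_point k))) \<partial>lborel)))"
      by (simp add: nn_integral_cmult nn_integral_sum)
    also have "\<dots> \<le> ennreal (1 / (2 * pi)) * (ennreal (K powr p) * (\<Sum>k\<in>lattice_disc N. ennreal (a k powr p) *
        ennreal (K2 * exp (- (e1 / 2) * \<bar>r - cmod (lattice_point k)\<bar>) / (1 + r))))"
      using r by (intro mult_left_mono sum_mono K2) auto
    also have "\<dots> = ennreal (1 / (2 * pi) * (K powr p * (\<Sum>k\<in>lattice_disc N. a k powr p * (K2 * exp (- (e1 / 2) * \<bar>r - cmod (lattice_point k)\<bar>) / (1 + r)))))"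
    proof -
      define b where "b k = K2 * exp (- (e1 / 2) * \<bar>r - cmod (lattice_point k)\<bar>) / (1 + r)" for k
      have b: "0 \<le> b k" for k using K2 r by (simp add: b_def)
      have "(\<Sum>k\<in>lattice_disc N. ennreal (a k powr p) * ennreal (b k)) = ennreal (\<Sum>k\<in>lattice_disc N. a k powr p * b k)"
        using b by (simp add: ennreal_mult[symmetric] sum_ennreal)
      moreover have "0 \<le> (\<Sum>k\<in>lattice_disc N. a k powr p * b k)" using b by (intro sum_nonneg) auto
      ultimately have "ennreal (1 / (2 * pi)) * (ennreal (K powr p) * (\<Sum>k\<in>lattice_disc N. ennreal (a k powr p) * ennreal (b k)))
          = ennreal (1 / (2 * pi) * (K powr p * (\<Sum>k\<in>lattice_disc N. a k powr p * b k)))"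
        by (subst ennreal_mult, simp, simp, subst ennreal_mult) simp_all
      then show ?thesis by (simp only: b_def)
    qed
    finally have "weighted_mean P \<alpha> f r powr p \<le> 1 / (2 * pi) * (K powr p * (\<Sum>k\<in>lattice_disc N. a k powr p * (K2 * exp (- (e1 / 2) * \<bar>r - cmod (lattice_point k)\<bar>) / (1 + r))))"
      using K2 r by (subst (asm) ennreal_le_iff) (auto intro!: sum_nonneg mult_nonneg_nonneg divide_nonneg_nonneg)
    also have "(\<Sum>k\<in>lattice_disc N. a k powr p * (K2 * exp (- (e1 / 2) * \<bar>r - cmod (lattice_point k)\<bar>) / (1 + r)))
        \<le> (\<Sum>j<N. \<Sum>k\<in>lattice_ring j. a k powr p * (K2 * (exp e2 * exp (- e2 * \<bar>r - real j\<bar>)) / (1 + r)))"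
      unfolding sum_lattice_disc e2_def[symmetric]
      using K2 r e2 by (intro sum_mono mult_left_mono divide_right_mono ring_exp_le) auto
    also have "\<dots> = (K2 * exp e2) / (1 + r) * (\<Sum>j<N. exp (- e2 * \<bar>r - real j\<bar>) * S j)"
    proof -
      have "(\<Sum>k\<in>lattice_ring j. a k powr p * (K2 * (exp e2 * exp (- e2 * \<bar>r - real j\<bar>)) / (1 + r)))
          = (K2 * exp e2) / (1 + r) * (exp (- e2 * \<bar>r - real j\<bar>) * S j)" for j
        unfolding sum_distrib_right[symmetric] S_def by (simp only: times_divide_eq_left times_divide_eq_right mult_ac)
      then show ?thesis by (simp only: sum_distrib_left)
    qed
    finally have "weighted_mean P \<alpha> f r powr p \<le> C1 / (1 + r) * (\<Sum>j<N. exp (- e2 * \<bar>r - real j\<bar>) * S j)"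
      using K by (simp add: C1_def field_simps)
    then have "(weighted_mean P \<alpha> f r powr p) powr (1 / p) \<le> (C1 / (1 + r) * (\<Sum>j<N. exp (- e2 * \<bar>r - real j\<bar>) * S j)) powr (1 / p)"
      using 2 by (intro powr_mono2) auto
    then have "weighted_mean P \<alpha> f r \<le> (C1 / (1 + r) * (\<Sum>j<N. exp (- e2 * \<bar>r - real j\<bar>) * S j)) powr (1 / p)"
      using 2 f by (simp add: powr_powr)
    also have "\<dots> = C1 powr (1 / p) * (1 + r) powr (- recip P) * (\<Sum>j<N. exp (- e2 * \<bar>r - real j\<bar>) * S j) powr (1 / p)"
      using C1 r S0 2 by (subst powr_mult) (auto simp: powr_divide powr_minus field_simps)
    also have "\<dots> \<le> C1 powr (1 / p) * (1 + r) powr (- recip P) *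
        (K3 powr (1 / p) * (\<Sum>j<N. exp (- (min 1 (1 / p) * e2) * \<bar>r - real j\<bar>) * S j powr (1 / p)))"
      by (intro mult_left_mono sum_powr_le) (use S0 K3 2 e2 in auto)
    also have "\<dots> = C1 powr (1 / p) * K3 powr (1 / p) * (1 + r) powr (- recip P) *
        (\<Sum>j<N. exp (- (min 1 (1 / p) * e2) * \<bar>r - real j\<bar>) * lnorm P (lattice_ring j) a)"
      using 2 by (simp add: lnorm_ennreal S_def mult_ac)
    finally show "weighted_mean P \<alpha> f r \<le> C1 powr (1 / p) * K3 powr (1 / p) * (1 + r) powr (- recip P) *
        (\<Sum>j<N. exp (- (min 1 (1 / p) * e2) * \<bar>r - real j\<bar>) * lnorm P (lattice_ring j) a)" .
  qed (use C1 K3 e2 2 in auto)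
qed

lemma mult_regroup: "x * y = z \<Longrightarrow> (c * a * x) * (y * s) = (c * z) * (a * s)" for x y z c a s :: real
  by (hypsubst, simp only: mult_ac)

lemma mult_regroup': "x * y = z \<Longrightarrow> c * (b * (a * (x * (y * s)))) = c * (b * ((a * s) * z))" for x y z a b c s :: real
  by (hypsubst, simp only: mult_ac)

text \<open>The kernel exp(-e |r - j|) couples radii and ring indices. Part of its decay pays for
  replacing the weight at r by the weight at j, the rest is summed or integrated. The factor r of
  the measure is at most one more power of 1 + r, whose q-th root is the \<open>recip Q\<close> in
  the weight.\<close>

lemma radial_norm_le_lnorm:
  assumes Q: "0 < Q" and e: "(0::real) < e"
  obtains C where "0 < C"
    "\<And>V T N S. T \<in> sets borel \<Longrightarrow> T \<subseteq> {0..} \<Longrightarrow> (\<And>j. 0 \<le> S j) \<Longrightarrow> (\<And>r. r \<in> T \<Longrightarrow> 0 \<le> V r) \<Longrightarrow>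
      (\<And>r. r \<in> T \<Longrightarrow> V r \<le> (1 + r) powr (- \<rho>) * (\<Sum>j<N. exp (- e * \<bar>r - real j\<bar>) * S j)) \<Longrightarrow>
      radial_norm \<sigma> Q T V \<le> ennreal (C * lnorm Q {..<N} (\<lambda>j. (1 + real j) powr (\<sigma> - \<rho> + recip Q) * S j))"
  using Q
proof (cases Q rule: exponent_cases)
  case 1
  define w where "w = \<sigma> - \<rho>"
  have e2: "0 < e / 2" using e by simp
  obtain K where K: "1 \<le> K" "\<And>S x. finite S \<Longrightarrow> (\<Sum>m\<in>S. exp (- (e / 2) * \<bar>x - real m\<bar>)) \<le> K"
    using sum_exp_nat[OF e2] by blast
  obtain W where W: "1 \<le> W" "\<And>a b. 0 \<le> a \<Longrightarrow> 0 \<le> b \<Longrightarrow> (1 + a) powr w \<le> W * (1 + b) powr w * exp (e / 2 * \<bar>a - b\<bar>)"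
    using weight_exp_le[OF e2] by blast
  show ?thesis
  proof (rule that[of "W * K"])
    fix V :: "real \<Rightarrow> real" and T N and S :: "nat \<Rightarrow> real"
    assume T: "T \<subseteq> {0..}" and S: "\<And>j. 0 \<le> S j"
      and le: "\<And>r. r \<in> T \<Longrightarrow> V r \<le> (1 + r) powr (- \<rho>) * (\<Sum>j<N. exp (- e * \<bar>r - real j\<bar>) * S j)"
    define L where "L = lnorm top {..<N} (\<lambda>j. (1 + real j) powr w * S j)"
    have L: "0 \<le> L" by (simp add: L_def lnorm_nonneg)
    have "V r * (1 + r) powr \<sigma> \<le> W * K * L" if "r \<in> T" for r
    proof -
      have r: "0 \<le> r" using T that by auto
      have "V r * (1 + r) powr \<sigma> \<le> ((1 + r) powr (- \<rho>) * (\<Sum>j<N. exp (- e * \<bar>r - real j\<bar>) * S j)) * (1 + r) powr \<sigma>"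
        by (intro mult_right_mono le that) auto
      also have "\<dots> = (\<Sum>j<N. (1 + r) powr w * (exp (- e * \<bar>r - real j\<bar>) * S j))"
        using r by (simp add: w_def powr_diff powr_minus sum_distrib_left sum_distrib_right field_simps)
      also have "\<dots> \<le> (\<Sum>j<N. (W * (1 + real j) powr w * exp (e / 2 * \<bar>r - real j\<bar>)) * (exp (- e * \<bar>r - real j\<bar>) * S j))"
        using r S by (intro sum_mono mult_right_mono W) auto
      also have "\<dots> = (\<Sum>j<N. (W * exp (- (e / 2) * \<bar>r - real j\<bar>)) * ((1 + real j) powr w * S j))"
      proof (intro sum.cong refl)
        fix j
        have h: "exp (e / 2 * \<bar>r - real j\<bar>) * exp (- e * \<bar>r - real j\<bar>) = exp (- (e / 2) * \<bar>r - real j\<bar>)"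
          by (simp add: exp_add[symmetric])
        show "(W * (1 + real j) powr w * exp (e / 2 * \<bar>r - real j\<bar>)) * (exp (- e * \<bar>r - real j\<bar>) * S j)
          = (W * exp (- (e / 2) * \<bar>r - real j\<bar>)) * ((1 + real j) powr w * S j)"
          using h by (rule mult_regroup)
      qed
      also have "\<dots> \<le> (\<Sum>j<N. (W * exp (- (e / 2) * \<bar>r - real j\<bar>)) * L)"
        unfolding L_def using W by (intro sum_mono mult_left_mono le_lnorm_top) auto
      also have "\<dots> = W * (\<Sum>j<N. exp (- (e / 2) * \<bar>r - real j\<bar>)) * L"
        by (simp add: sum_distrib_left sum_distrib_right)
      also have "\<dots> \<le> W * K * L" using W L by (intro mult_right_mono mult_left_mono K) auto
      finally show ?thesis .
    qed
    then show "radial_norm \<sigma> Q T V \<le> ennreal (W * K * lnorm Q {..<N} (\<lambda>j. (1 + real j) powr (\<sigma> - \<rho> + recip Q) * S j))"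
      using 1 unfolding 1 radial_norm_top
      by (intro SUP_least ennreal_leI) (simp add: L_def w_def)
  qed (use W K in auto)
next
  case (2 q)
  define w where "w = \<sigma> - \<rho> + 1 / q"
  define e1 where "e1 = min 1 q * e"
  have e1: "0 < e1" "0 < e1 / 2" using e 2 by (auto simp: e1_def)
  obtain K where K: "1 \<le> K" "\<And>S x. finite S \<Longrightarrow> (\<Sum>m\<in>S. exp (- e * \<bar>x - real m\<bar>)) \<le> K"
    using sum_exp_nat[OF e] by blast
  obtain W where W: "1 \<le> W" "\<And>a b. 0 \<le> a \<Longrightarrow> 0 \<le> b \<Longrightarrow> (1 + a) powr (w * q) \<le> W * (1 + b) powr (w * q) * exp (e1 / 2 * \<bar>a - b\<bar>)"
    using weight_exp_le[OF e1(2)] by blast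
  define C1 where "C1 = K powr q * W * (4 / e1)"
  have C1: "0 < C1" using K W e1 by (simp add: C1_def)
  show ?thesis
  proof (rule that[of "C1 powr (1 / q)"])
    fix V :: "real \<Rightarrow> real" and T N and S :: "nat \<Rightarrow> real"
    assume Tm: "T \<in> sets borel" and T: "T \<subseteq> {0..}" and S: "\<And>j. 0 \<le> S j" and V: "\<And>r. r \<in> T \<Longrightarrow> 0 \<le> V r"
      and le: "\<And>r. r \<in> T \<Longrightarrow> V r \<le> (1 + r) powr (- \<rho>) * (\<Sum>j<N. exp (- e * \<bar>r - real j\<bar>) * S j)"
    define L where "L = lnorm Q {..<N} (\<lambda>j. (1 + real j) powr w * S j)"
    have L: "0 \<le> L" by (simp add: L_def lnorm_nonneg)
    have Lq: "L powr q = (\<Sum>j<N. ((1 + real j) powr w * S j) powr q)"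
      using 2 by (simp add: L_def lnorm_ennreal powr_powr sum_nonneg)
    have pt: "(V r * (1 + r) powr \<sigma>) powr q * r
        \<le> K powr q * W * (\<Sum>j<N. ((1 + real j) powr w * S j) powr q * exp (- (e1 / 2) * \<bar>r - real j\<bar>))" if "r \<in> T" for r
    proof -
      have r: "0 \<le> r" using T that by auto
      have "(V r * (1 + r) powr \<sigma>) powr q \<le> ((1 + r) powr (\<sigma> - \<rho>) * (\<Sum>j<N. exp (- e * \<bar>r - real j\<bar>) * S j)) powr q"
      proof (intro powr_mono2)
        have "V r * (1 + r) powr \<sigma> \<le> ((1 + r) powr (- \<rho>) * (\<Sum>j<N. exp (- e * \<bar>r - real j\<bar>) * S j)) * (1 + r) powr \<sigma>"
          by (intro mult_right_mono le that) auto
        then show "V r * (1 + r) powr \<sigma> \<le> (1 + r) powr (\<sigma> - \<rho>) * (\<Sum>j<N. exp (- e * \<bar>r - real j\<bar>) * S j)"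
          using r by (simp add: powr_diff powr_minus field_simps)
      qed (use V[OF that] 2 in auto)
      also have "\<dots> = (1 + r) powr ((\<sigma> - \<rho>) * q) * (\<Sum>j<N. exp (- e * \<bar>r - real j\<bar>) * S j) powr q"
        using S by (simp add: powr_mult powr_powr sum_nonneg)
      also have "\<dots> \<le> (1 + r) powr ((\<sigma> - \<rho>) * q) * (K powr q * (\<Sum>j<N. exp (- (min 1 q * e) * \<bar>r - real j\<bar>) * S j powr q))"
        by (intro mult_left_mono sum_powr_le) (use S K 2 e in auto)
      finally have "(V r * (1 + r) powr \<sigma>) powr q * r \<le> (1 + r) powr ((\<sigma> - \<rho>) * q) * (K powr q * (\<Sum>j<N. exp (- e1 * \<bar>r - real j\<bar>) * S j powr q)) * (1 + r)"
        using r by (intro mult_mono) (auto simp: e1_def intro!: mult_nonneg_nonneg sum_nonneg)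
      also have "\<dots> = K powr q * (\<Sum>j<N. (1 + r) powr (w * q) * (exp (- e1 * \<bar>r - real j\<bar>) * S j powr q))"
      proof -
        have "(1 + r) powr (w * q) = (1 + r) powr ((\<sigma> - \<rho>) * q) * (1 + r)"
          using r 2 by (simp add: w_def distrib_right powr_add)
        then show ?thesis unfolding sum_distrib_left[symmetric] by (simp only: mult_ac)
      qed
      also have "\<dots> \<le> K powr q * (\<Sum>j<N. (W * (1 + real j) powr (w * q) * exp (e1 / 2 * \<bar>r - real j\<bar>)) * (exp (- e1 * \<bar>r - real j\<bar>) * S j powr q))"
        using r by (intro mult_left_mono sum_mono mult_right_mono W) auto
      also have "\<dots> = K powr q * W * (\<Sum>j<N. ((1 + real j) powr w * S j) powr q * exp (- (e1 / 2) * \<bar>r - real j\<bar>))"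
        unfolding mult.assoc sum_distrib_left
      proof (intro sum.cong refl)
        fix j
        have h: "exp (e1 / 2 * \<bar>r - real j\<bar>) * exp (- e1 * \<bar>r - real j\<bar>) = exp (- (e1 / 2) * \<bar>r - real j\<bar>)"
          by (simp add: exp_add[symmetric])
        have h2: "((1 + real j) powr w * S j) powr q = (1 + real j) powr (w * q) * S j powr q"
          using S by (simp add: powr_mult powr_powr)
        show "K powr q * (W * ((1 + real j) powr (w * q) * (exp (e1 / 2 * \<bar>r - real j\<bar>) * (exp (- e1 * \<bar>r - real j\<bar>) * S j powr q))))
          = K powr q * (W * (((1 + real j) powr w * S j) powr q * exp (- (e1 / 2) * \<bar>r - real j\<bar>)))"
          unfolding h2 using h by (rule mult_regroup')
      qed
      finally show ?thesis .
    qed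
    have "(\<integral>\<^sup>+r\<in>T. ennreal ((V r * (1 + r) powr \<sigma>) powr q * r) \<partial>lborel)
      \<le> (\<integral>\<^sup>+r. ennreal (K powr q * W) * (\<Sum>j<N. ennreal (((1 + real j) powr w * S j) powr q) * ennreal (exp (- (e1 / 2) * \<bar>r - real j\<bar>))) \<partial>lborel)"
    proof (intro nn_integral_mono)
      fix r
      have "ennreal ((V r * (1 + r) powr \<sigma>) powr q * r) \<le> ennreal (K powr q * W * (\<Sum>j<N. ((1 + real j) powr w * S j) powr q * exp (- (e1 / 2) * \<bar>r - real j\<bar>)))" if "r \<in> T"
        by (intro ennreal_leI pt that)
      then show "ennreal ((V r * (1 + r) powr \<sigma>) powr q * r) * indicator T r
        \<le> ennreal (K powr q * W) * (\<Sum>j<N. ennreal (((1 + real j) powr w * S j) powr q) * ennreal (exp (- (e1 / 2) * \<bar>r - real j\<bar>)))"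
        using W by (auto simp: indicator_def ennreal_mult sum_nonneg sum_ennreal[symmetric])
    qed
    also have "\<dots> = ennreal (K powr q * W) * (\<Sum>j<N. ennreal (((1 + real j) powr w * S j) powr q) * (\<integral>\<^sup>+r. ennreal (exp (- (e1 / 2) * \<bar>r - real j\<bar>)) \<partial>lborel))"
      by (simp add: nn_integral_cmult nn_integral_sum)
    also have "\<dots> \<le> ennreal (K powr q * W) * (\<Sum>j<N. ennreal (((1 + real j) powr w * S j) powr q) * ennreal (2 / (e1 / 2)))"
      by (intro mult_left_mono sum_mono nn_integral_exp_abs_le e1) auto
    also have "\<dots> = ennreal (C1 * L powr q)"
      using W e1 unfolding Lq C1_def
      by (simp add: ennreal_mult[symmetric] sum_ennreal sum_nonneg sum_distrib_left sum_divide_distrib mult_ac)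
    also have "C1 * L powr q = (C1 powr (1 / q) * L) powr q"
      using C1 L 2 by (simp add: powr_mult powr_powr)
    finally show "radial_norm \<sigma> Q T V \<le> ennreal (C1 powr (1 / q) * lnorm Q {..<N} (\<lambda>j. (1 + real j) powr (\<sigma> - \<rho> + recip Q) * S j))"
      using 2 L by (simp add: radial_norm_ennreal ennreal_powr_le_ennreal_iff L_def w_def)
  qed (use C1 in auto)
qed

lemma radial_norm_le_discrete_norm:
  assumes P: "0 < P" and Q: "0 < Q" and e: "(0::real) < e"
  obtains C where "0 < C"
    "\<And>\<alpha> f N a T. continuous_on UNIV f \<Longrightarrow> (\<And>k. 0 \<le> a k) \<Longrightarrow> T \<in> sets borel \<Longrightarrow> T \<subseteq> {0..} \<Longrightarrow>
      (\<And>z. cmod z \<in> T \<Longrightarrow> weighted_modulus \<alpha> f z \<le> (\<Sum>k\<in>lattice_disc N. exp (- e * cmod (z - lattice_point k)) * a k)) \<Longrightarrow>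
      radial_norm \<sigma> Q T (weighted_mean P \<alpha> f) \<le> ennreal (C * discrete_norm P Q (\<sigma> - recip P + recip Q) N a)"
proof -
  obtain C1 e1 where C1: "0 < C1" "0 < e1"
    "\<And>\<alpha> f r N a. continuous_on UNIV f \<Longrightarrow> 0 \<le> r \<Longrightarrow> (\<And>k. 0 \<le> a k) \<Longrightarrow>
      (\<And>\<theta>. weighted_modulus \<alpha> f (of_real r * cis \<theta>)
         \<le> (\<Sum>k\<in>lattice_disc N. exp (- e * cmod (of_real r * cis \<theta> - lattice_point k)) * a k)) \<Longrightarrow>
      weighted_mean P \<alpha> f r \<le> C1 * (1 + r) powr (- recip P) * (\<Sum>j<N. exp (- e1 * \<bar>r - real j\<bar>) * lnorm P (lattice_ring j) a)"
    using weighted_mean_le_lattice_sum[OF P e] by blast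
  obtain C2 where C2: "0 < C2"
    "\<And>V T N S. T \<in> sets borel \<Longrightarrow> T \<subseteq> {0..} \<Longrightarrow> (\<And>j. 0 \<le> S j) \<Longrightarrow> (\<And>r. r \<in> T \<Longrightarrow> 0 \<le> V r) \<Longrightarrow>
      (\<And>r. r \<in> T \<Longrightarrow> V r \<le> (1 + r) powr (- recip P) * (\<Sum>j<N. exp (- e1 * \<bar>r - real j\<bar>) * S j)) \<Longrightarrow>
      radial_norm \<sigma> Q T V \<le> ennreal (C2 * lnorm Q {..<N} (\<lambda>j. (1 + real j) powr (\<sigma> - recip P + recip Q) * S j))"
    using radial_norm_le_lnorm[OF Q C1(2)] by blast
  show ?thesis
  proof (rule that[of "C2 * C1"])
    fix \<alpha> f N T and a :: "int \<times> int \<Rightarrow> real"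
    assume f: "continuous_on UNIV f" and a: "\<And>k. 0 \<le> a k" and T: "T \<in> sets borel" "T \<subseteq> {0..}"
      and le: "\<And>z. cmod z \<in> T \<Longrightarrow> weighted_modulus \<alpha> f z \<le> (\<Sum>k\<in>lattice_disc N. exp (- e * cmod (z - lattice_point k)) * a k)"
    have "radial_norm \<sigma> Q T (weighted_mean P \<alpha> f)
      \<le> ennreal (C2 * lnorm Q {..<N} (\<lambda>j. (1 + real j) powr (\<sigma> - recip P + recip Q) * (C1 * lnorm P (lattice_ring j) a)))"
    proof (rule C2(2)[OF T])
      fix r assume r: "r \<in> T"
      then have r0: "0 \<le> r" using T by auto
      have "weighted_mean P \<alpha> f r \<le> C1 * (1 + r) powr (- recip P) * (\<Sum>j<N. exp (- e1 * \<bar>r - real j\<bar>) * lnorm P (lattice_ring j) a)"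
        by (rule C1(3)[OF f r0 a le]) (use r r0 in \<open>auto simp: norm_mult\<close>)
      then show "weighted_mean P \<alpha> f r \<le> (1 + r) powr (- recip P) * (\<Sum>j<N. exp (- e1 * \<bar>r - real j\<bar>) * (C1 * lnorm P (lattice_ring j) a))"
        by (simp add: sum_distrib_left mult_ac)
    qed (use C1 f in \<open>auto simp: lnorm_nonneg\<close>)
    also have "(\<lambda>j. (1 + real j) powr (\<sigma> - recip P + recip Q) * (C1 * lnorm P (lattice_ring j) a))
        = (\<lambda>j. C1 * ((1 + real j) powr (\<sigma> - recip P + recip Q) * lnorm P (lattice_ring j) a))"
      by (simp add: mult_ac)
    also have "lnorm Q {..<N} \<dots> = C1 * discrete_norm P Q (\<sigma> - recip P + recip Q) N a"
      unfolding discrete_norm_def using C1 Q by (intro lnorm_cmult) (auto simp: lnorm_nonneg)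
    finally show "radial_norm \<sigma> Q T (weighted_mean P \<alpha> f) \<le> ennreal (C2 * C1 * discrete_norm P Q (\<sigma> - recip P + recip Q) N a)"
      by (simp add: mult_ac)
  qed (use C1 C2 in auto)
qed

text \<open>Lattice sums over a fixed finite set dominate a general f only on bounded sets; monotone
  convergence removes the bound on the radius.\<close>

lemma radial_norm_exhaust:
  assumes V: "V \<in> borel_measurable borel" and Q: "0 < Q" and B: "0 \<le> B"
    and le: "\<And>n. radial_norm \<sigma> Q {0..real n} V \<le> ennreal B"
  shows "radial_norm \<sigma> Q {0..} V \<le> ennreal B"
  using Q
proof (cases Q rule: exponent_cases)
  case 1
  show ?thesis unfolding 1 radial_norm_top
  proof (rule SUP_least)
    fix r :: real assume "r \<in> {0..}"
    moreover obtain n where "r \<le> real n" using real_arch_simple by blast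
    ultimately show "ennreal (V r * (1 + r) powr \<sigma>) \<le> ennreal B"
      using le[of n] unfolding 1 radial_norm_top SUP_le_iff by auto
  qed
next
  case (2 q)
  note [measurable] = V
  define F where "F r = ennreal ((V r * (1 + r) powr \<sigma>) powr q * r)" for r
  have [measurable]: "F \<in> borel_measurable borel" unfolding F_def by measurable
  have "F r * indicator {0..} r = (SUP n. F r * indicator {0..real n} r)" for r
  proof (rule antisym)
    obtain n where "r \<le> real n" using real_arch_simple by blast
    then show "F r * indicator {0..} r \<le> (SUP n. F r * indicator {0..real n} r)"
      by (intro SUP_upper2[of n]) (auto simp: indicator_def)
  qed (auto intro!: SUP_least simp: indicator_def)
  then have "(\<integral>\<^sup>+r\<in>{0..}. F r \<partial>lborel) = (\<integral>\<^sup>+r. (SUP n. F r * indicator {0..real n} r) \<partial>lborel)" by simp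
  also have "\<dots> = (SUP n. \<integral>\<^sup>+r\<in>{0..real n}. F r \<partial>lborel)"
    by (rule nn_integral_monotone_convergence_SUP) (auto simp: incseq_def le_fun_def indicator_def)
  also have "\<dots> \<le> ennreal (B powr q)"
    using le 2 B by (intro SUP_least) (simp add: radial_norm_ennreal ennreal_powr_le_ennreal_iff F_def)
  finally show ?thesis using 2 B by (simp add: radial_norm_ennreal ennreal_powr_le_ennreal_iff F_def)
qed

text \<open>For finite sums of kernels, which are dominated on the whole plane by one finite lattice
  sum, so that no exhaustion is involved.\<close>

lemma fock_norm_synthesis:
  assumes \<alpha>: "0 < \<alpha>" and P: "0 < P" and Q: "0 < Q" and e: "(0::real) < e"
  obtains C where "0 < C"
    "\<And>f N a. continuous_on UNIV f \<Longrightarrow> (\<And>k. 0 \<le> a k) \<Longrightarrow>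
      (\<And>z. weighted_modulus \<alpha> f z \<le> (\<Sum>k\<in>lattice_disc N. exp (- e * cmod (z - lattice_point k)) * a k)) \<Longrightarrow>
      fock_norm \<alpha> \<sigma> P Q f \<le> ennreal (C * discrete_norm P Q (\<sigma> - recip P + recip Q) N a)"
proof -
  obtain C where C: "0 < C"
    "\<And>\<alpha> f N a T. continuous_on UNIV f \<Longrightarrow> (\<And>k. 0 \<le> a k) \<Longrightarrow> T \<in> sets borel \<Longrightarrow> T \<subseteq> {0..} \<Longrightarrow>
      (\<And>z. cmod z \<in> T \<Longrightarrow> weighted_modulus \<alpha> f z \<le> (\<Sum>k\<in>lattice_disc N. exp (- e * cmod (z - lattice_point k)) * a k)) \<Longrightarrow>
      radial_norm \<sigma> Q T (weighted_mean P \<alpha> f) \<le> ennreal (C * discrete_norm P Q (\<sigma> - recip P + recip Q) N a)"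
    using radial_norm_le_discrete_norm[OF P Q e] by blast
  show ?thesis
  proof (rule that[of "radial_const \<alpha> Q * C"])
    fix f N and a :: "int \<times> int \<Rightarrow> real"
    assume f: "continuous_on UNIV f" and a: "\<And>k. 0 \<le> a k" 
      and le: "\<And>z. weighted_modulus \<alpha> f z \<le> (\<Sum>k\<in>lattice_disc N. exp (- e * cmod (z - lattice_point k)) * a k)"
    have "fock_norm \<alpha> \<sigma> P Q f \<le> ennreal (radial_const \<alpha> Q) * ennreal (C * discrete_norm P Q (\<sigma> - recip P + recip Q) N a)"
      unfolding fock_norm_radial[OF f \<alpha> P Q] by (intro mult_left_mono C f a le) auto
    then show "fock_norm \<alpha> \<sigma> P Q f \<le> ennreal (radial_const \<alpha> Q * C * discrete_norm P Q (\<sigma> - recip P + recip Q) N a)"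
      using C radial_const_pos[OF \<alpha> Q] by (simp add: ennreal_mult[symmetric] mult.assoc)
  qed (use C radial_const_pos[OF \<alpha> Q] in auto)
qed

lemma lattice_near:
  obtains k where "cmod (z - lattice_point k) \<le> 1"
proof -
  let ?k = "(round (Re z), round (Im z))"
  have "\<bar>Re z - of_int (round (Re z))\<bar> \<le> 1 / 2" "\<bar>Im z - of_int (round (Im z))\<bar> \<le> 1 / 2"
    using of_int_round_abs_le by (simp_all add: abs_minus_commute)
  then have "cmod (z - lattice_point ?k) \<le> 1 / 2 + 1 / 2"
    using cmod_le[of "z - lattice_point ?k"] by (simp add: lattice_point_def)
  then show ?thesis using that by simp
qed

text \<open>For an arbitrary continuous function: if |z| \<le> n, a lattice point at distance at
  most 1 has modulus at most n + 1 and lies in \<open>lattice_disc (n + 2)\<close>, and the term of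
  that point alone dominates f at z. The factor exp 1 compensates the exponential at distance at
  most 1. Since N grows with the radius, B has to be uniform in N.\<close>

lemma fock_norm_le_discrete_norm:
  assumes \<alpha>: "0 < \<alpha>" and P: "0 < P" and Q: "0 < Q"
  obtains C where "0 < C"
    "\<And>f a B. continuous_on UNIV f \<Longrightarrow> (\<And>k z. cmod (z - lattice_point k) \<le> 1 \<Longrightarrow> weighted_modulus \<alpha> f z \<le> a k) \<Longrightarrow>
      (\<And>N. discrete_norm P Q (\<sigma> - recip P + recip Q) N a \<le> B) \<Longrightarrow>
      fock_norm \<alpha> \<sigma> P Q f \<le> ennreal (C * B)"
proof -
  obtain C where C: "0 < C"
    "\<And>\<alpha> f N a T. continuous_on UNIV f \<Longrightarrow> (\<And>k. 0 \<le> a k) \<Longrightarrow> T \<in> sets borel \<Longrightarrow> T \<subseteq> {0..} \<Longrightarrow>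
      (\<And>z. cmod z \<in> T \<Longrightarrow> weighted_modulus \<alpha> f z \<le> (\<Sum>k\<in>lattice_disc N. exp (- 1 * cmod (z - lattice_point k)) * a k)) \<Longrightarrow>
      radial_norm \<sigma> Q T (weighted_mean P \<alpha> f) \<le> ennreal (C * discrete_norm P Q (\<sigma> - recip P + recip Q) N a)"
    using radial_norm_le_discrete_norm[OF P Q zero_less_one] by blast
  show ?thesis
  proof (rule that[of "radial_const \<alpha> Q * (C * exp 1)"])
    fix f B and a :: "int \<times> int \<Rightarrow> real"
    assume f: "continuous_on UNIV f" 
      and le: "\<And>k z. cmod (z - lattice_point k) \<le> 1 \<Longrightarrow> weighted_modulus \<alpha> f z \<le> a k"
      and B: "\<And>N. discrete_norm P Q (\<sigma> - recip P + recip Q) N a \<le> B"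
    have a: "0 \<le> a k" for k
      using le[of "lattice_point k" k] order_trans[OF weighted_modulus_nonneg] by auto
    have B0: "0 \<le> B" using B[of 0] order_trans[OF discrete_norm_nonneg] by blast
    have scaled: "discrete_norm P Q (\<sigma> - recip P + recip Q) N (\<lambda>k. exp 1 * a k) = exp 1 * discrete_norm P Q (\<sigma> - recip P + recip Q) N a" for N
      by (rule discrete_norm_cmult) (use P Q a in auto)
    have "radial_norm \<sigma> Q {0..} (weighted_mean P \<alpha> f) \<le> ennreal (C * exp 1 * B)"
    proof (rule radial_norm_exhaust[OF weighted_mean_measurable[OF f P] Q])
      fix n
      have "radial_norm \<sigma> Q {0..real n} (weighted_mean P \<alpha> f) \<le> ennreal (C * discrete_norm P Q (\<sigma> - recip P + recip Q) (n + 2) (\<lambda>k. exp 1 * a k))"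
      proof (rule C(2)[OF f])
        fix z assume z: "cmod z \<in> {0..real n}"
        obtain k where k: "cmod (z - lattice_point k) \<le> 1" by (rule lattice_near)
        have "cmod (lattice_point k) \<le> cmod z + cmod (z - lattice_point k)"
          using norm_triangle_ineq4[of z "z - lattice_point k"] by simp
        then have kN: "k \<in> lattice_disc (n + 2)" using k z by (simp add: lattice_disc_def)
        have "weighted_modulus \<alpha> f z \<le> a k" by (rule le[OF k])
        also have "\<dots> \<le> exp (1 - cmod (z - lattice_point k)) * a k" using k a[of k] mult_right_mono[of 1 "exp (1 - cmod (z - lattice_point k))" "a k"] by simp
        also have "\<dots> = exp (- 1 * cmod (z - lattice_point k)) * (exp 1 * a k)" by (simp add: exp_diff exp_minus field_simps)
        also have "\<dots> \<le> (\<Sum>k\<in>lattice_disc (n + 2). exp (- 1 * cmod (z - lattice_point k)) * (exp 1 * a k))"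
          by (rule member_le_sum[OF kN]) (use a in auto)
        finally show "weighted_modulus \<alpha> f z \<le> \<dots>" .
      qed (use a in auto)
      also have "\<dots> \<le> ennreal (C * exp 1 * B)"
        unfolding scaled using C B[of "n + 2"] by (intro ennreal_leI) (simp add: mult.assoc)
      finally show "radial_norm \<sigma> Q {0..real n} (weighted_mean P \<alpha> f) \<le> ennreal (C * exp 1 * B)" .
    qed (use C B0 in auto)
    then have "fock_norm \<alpha> \<sigma> P Q f \<le> ennreal (radial_const \<alpha> Q) * ennreal (C * exp 1 * B)"
      unfolding fock_norm_radial[OF f \<alpha> P Q] by (intro mult_left_mono) auto
    then show "fock_norm \<alpha> \<sigma> P Q f \<le> ennreal (radial_const \<alpha> Q * (C * exp 1) * B)"
      using C B0 radial_const_pos[OF \<alpha> Q] by (simp add: ennreal_mult[symmetric] mult.assoc)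
  qed (use C radial_const_pos[OF \<alpha> Q] in auto)
qed

section \<open>Sampling: the sequence norm bounded by the function norm\<close>

lemma conj_conj_exponent:
  assumes "1 \<le> T" shows "conj_exponent (conj_exponent T) = T"
proof -
  have "0 < T" using assms by (rule less_le_trans[rotated]) simp
  then show ?thesis
  proof (cases T rule: exponent_cases)
    case (2 r)
    then have r: "1 \<le> r" using assms by simp
    show ?thesis
    proof (cases "r = 1")
      case True
      then show ?thesis using 2 by (simp add: conj_exponent_def top_unique)
    next
      case False
      then have r: "1 < r" using r by simp
      then have "1 < r / (r - 1)" by (simp add: field_simps)
      moreover have "(r / (r - 1)) / (r / (r - 1) - 1) = r" using r by (simp add: field_simps)
      ultimately show ?thesis using r 2 by (simp add: conj_exponent_ennreal)
    qed
  qed (simp add: conj_exponent_def)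
qed

text \<open>The sub-mean inequality for t-th powers, with the indicator of the unit disc about z
  replaced by an exponential centred at w: on that disc |v - w| \<le> 2, whence exp 2. The
  exponential can be integrated over whole circles by \<open>circle_exp_bound\<close>.\<close>

lemma exp_local_estimate:
  assumes \<alpha>: "0 < \<alpha>" and t: "0 < t" "t \<le> 1"
  obtains C where "0 < C"
    "\<And>f z w. f holomorphic_on UNIV \<Longrightarrow> cmod (z - w) \<le> 1 \<Longrightarrow>
      ennreal (weighted_modulus \<alpha> f z powr t)
        \<le> ennreal C * (\<integral>\<^sup>+v. ennreal (weighted_modulus \<alpha> f v powr t * exp (- cmod (v - w))) \<partial>lborel)"
proof -
  define C0 where "C0 = exp (\<alpha> / 2) / pi"
  have C0: "0 < C0" by (simp add: C0_def)
  define C where "C = C0 * 2 powr (2 / t)"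
  have C: "0 < C" using C0 by (simp add: C_def)
  show ?thesis
  proof (rule that[of "C * exp 2"])
    fix f z w assume f: "f holomorphic_on UNIV" and zw: "cmod (z - w) \<le> 1"
    have cont: "continuous_on UNIV f" using f by (rule holomorphic_on_imp_continuous_on)
    have [measurable]: "weighted_modulus \<alpha> f \<in> borel_measurable borel"
      by (intro borel_measurable_continuous_onI continuous_weighted_modulus cont)
    have "ennreal (weighted_modulus \<alpha> f z powr t) \<le> ennreal C * (\<integral>\<^sup>+v\<in>cball z 1. ennreal (weighted_modulus \<alpha> f v powr t) \<partial>lborel)"
      unfolding C_def
    proof (rule submean_powr[OF continuous_weighted_modulus[OF cont] _ t C0])
      fix z \<rho> assume "0 < (\<rho>::real)" "\<rho> \<le> 1"
      then show "ennreal (weighted_modulus \<alpha> f z) \<le> ennreal (C0 / \<rho>\<^sup>2) * (\<integral>\<^sup>+w\<in>cball z \<rho>. ennreal (weighted_modulus \<alpha> f w) \<partial>lborel)"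
        using weighted_modulus_submean[OF f \<alpha>, of \<rho> z] by (simp add: C0_def)
    qed simp
    also have "\<dots> \<le> ennreal C * (\<integral>\<^sup>+v. ennreal (exp 2) * ennreal (weighted_modulus \<alpha> f v powr t * exp (- cmod (v - w))) \<partial>lborel)"
    proof (intro mult_left_mono nn_integral_mono)
      fix v
      have "weighted_modulus \<alpha> f v powr t \<le> exp 2 * (weighted_modulus \<alpha> f v powr t * exp (- cmod (v - w)))" if "v \<in> cball z 1"
      proof -
        have "cmod (v - w) \<le> cmod (v - z) + cmod (z - w)" using norm_triangle_ineq[of "v - z" "z - w"] by simp
        also have "\<dots> \<le> 2" using that zw by (simp add: dist_norm norm_minus_commute)
        finally have "1 \<le> exp (2 - cmod (v - w))" by simp
        then have "weighted_modulus \<alpha> f v powr t * 1 \<le> weighted_modulus \<alpha> f v powr t * exp (2 - cmod (v - w))"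
          by (intro mult_left_mono) auto
        then show ?thesis by (simp add: exp_diff exp_minus field_simps)
      qed
      then show "ennreal (weighted_modulus \<alpha> f v powr t) * indicator (cball z 1) v
          \<le> ennreal (exp 2) * ennreal (weighted_modulus \<alpha> f v powr t * exp (- cmod (v - w)))"
        by (cases "v \<in> cball z 1") (auto simp: ennreal_mult[symmetric] intro!: ennreal_leI)
    qed auto
    also have "\<dots> = ennreal (C * exp 2) * (\<integral>\<^sup>+v. ennreal (weighted_modulus \<alpha> f v powr t * exp (- cmod (v - w))) \<partial>lborel)"
      using C by (subst nn_integral_cmult, measurable) (simp add: ennreal_mult mult.assoc)
    finally show "ennreal (weighted_modulus \<alpha> f z powr t) \<le> \<dots>" .
  qed (use C in simp)
qed

text \<open>The angular part, in polar coordinates, of the integral in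
  \<open>exp_local_estimate\<close>.\<close>

definition circle_mass :: "real \<Rightarrow> real \<Rightarrow> (complex \<Rightarrow> complex) \<Rightarrow> complex \<Rightarrow> real \<Rightarrow> ennreal" where
  "circle_mass t \<alpha> f w s = (\<integral>\<^sup>+\<theta>\<in>{0..2 * pi}.
     ennreal (weighted_modulus \<alpha> f (of_real s * cis \<theta>) powr t * exp (- cmod (of_real s * cis \<theta> - w))) \<partial>lborel)"

lemma circle_mass_measurable [measurable]:
  assumes "continuous_on UNIV f"
  shows "circle_mass t \<alpha> f w \<in> borel_measurable borel"
proof -
  have [measurable]: "weighted_modulus \<alpha> f \<in> borel_measurable borel"
    by (intro borel_measurable_continuous_onI continuous_weighted_modulus assms)
  show ?thesis unfolding circle_mass_def[abs_def] by measurable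
qed

lemma circle_mass_le_top:
  assumes f: "continuous_on UNIV f" and t: "0 < t"
  shows "circle_mass t \<alpha> f w s \<le> ennreal (weighted_mean top \<alpha> f s powr t)
    * (\<integral>\<^sup>+\<theta>\<in>{0..2 * pi}. ennreal (exp (- 1 * cmod (of_real s * cis \<theta> - w))) \<partial>lborel)"
proof -
  have "circle_mass t \<alpha> f w s \<le> (\<integral>\<^sup>+\<theta>. ennreal (weighted_mean top \<alpha> f s powr t)
    * (ennreal (exp (- 1 * cmod (of_real s * cis \<theta> - w))) * indicator {0..2 * pi} \<theta>) \<partial>lborel)"
    unfolding circle_mass_def
  proof (intro nn_integral_mono)
    fix \<theta>
    have "weighted_modulus \<alpha> f (of_real s * cis \<theta>) powr t \<le> weighted_mean top \<alpha> f s powr t"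
      using t by (intro powr_mono2 weighted_modulus_le_mean_top f) auto
    then have "ennreal (weighted_modulus \<alpha> f (of_real s * cis \<theta>) powr t * exp (- cmod (of_real s * cis \<theta> - w)))
      \<le> ennreal (weighted_mean top \<alpha> f s powr t * exp (- 1 * cmod (of_real s * cis \<theta> - w)))"
      by (intro ennreal_leI) (simp add: mult_right_mono)
    then show "ennreal (weighted_modulus \<alpha> f (of_real s * cis \<theta>) powr t * exp (- cmod (of_real s * cis \<theta> - w))) * indicator {0..2 * pi} \<theta>
      \<le> ennreal (weighted_mean top \<alpha> f s powr t) * (ennreal (exp (- 1 * cmod (of_real s * cis \<theta> - w))) * indicator {0..2 * pi} \<theta>)"
      by (auto simp: indicator_def ennreal_mult)
  qed
  also have "\<dots> = ennreal (weighted_mean top \<alpha> f s powr t)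
    * (\<integral>\<^sup>+\<theta>\<in>{0..2 * pi}. ennreal (exp (- 1 * cmod (of_real s * cis \<theta> - w))) \<partial>lborel)"
    by (rule nn_integral_cmult) measurable
  finally show ?thesis .
qed

lemma circle_mass_finite:
  assumes f: "continuous_on UNIV f" and t: "0 < t" and s: "0 \<le> s"
  shows "circle_mass t \<alpha> f w s < top"
proof -
  obtain K where K: "0 < K" "\<And>r w. 0 \<le> r \<Longrightarrow>
    (\<integral>\<^sup>+\<theta>\<in>{0..2 * pi}. ennreal (exp (- 1 * cmod (of_real r * cis \<theta> - w))) \<partial>lborel)
      \<le> ennreal (K * exp (- (1 / 2) * \<bar>r - cmod w\<bar>) / (1 + r))"
    using circle_exp_bound[of 1] by auto
  have "circle_mass t \<alpha> f w s \<le> ennreal (weighted_mean top \<alpha> f s powr t) * ennreal (K * exp (- (1 / 2) * \<bar>s - cmod w\<bar>) / (1 + s))"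
    by (rule order_trans[OF circle_mass_le_top[OF f t]]) (intro mult_left_mono K s, simp)
  then show ?thesis by (rule le_less_trans) (simp add: ennreal_mult_less_top)
qed

definition quotient_exponent :: "ennreal \<Rightarrow> real \<Rightarrow> ennreal" where
  "quotient_exponent P t = (if P = top then top else ennreal (enn2real P / t))"

lemma quotient_exponent_ge_1:
  assumes "0 < t" "ennreal t \<le> P"
  shows "1 \<le> quotient_exponent P t"
proof (cases P)
  case (real p)
  then have "t \<le> p" using assms by simp
  then show ?thesis using real assms by (simp add: quotient_exponent_def)
qed (simp add: quotient_exponent_def)

text \<open>For finite P it is Jensen's inequality with exponent \<tau> = P/t \<ge> 1 for the
  measure exp(-|s cis \<theta> - k|) d\<theta>, whose mass is of order E/(1 + s) by
  \<open>circle_exp_bound\<close>; the sum over the ring is handled by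
  \<open>ring_sum_exp_le\<close>. The factors E^(1 - 1/\<tau>) and E^(1/\<tau>) recombine to the
  full radial decay, and 1/\<tau> - 1 is the exponent of 1 + s.\<close>

lemma lnorm_circle_mass_le:
  assumes t: "0 < t" "ennreal t \<le> P"
  obtains C where "0 < C"
    "\<And>\<alpha> f s j. continuous_on UNIV f \<Longrightarrow> 0 \<le> s \<Longrightarrow>
      lnorm (quotient_exponent P t) (lattice_ring j) (\<lambda>k. enn2real (circle_mass t \<alpha> f (lattice_point k) s))
        \<le> C * (exp (- (1 / 2) * \<bar>s - real j\<bar>) * (1 + s) powr (t * recip P - 1) * weighted_mean P \<alpha> f s powr t)"
proof -
  obtain K0 where K0: "0 < K0" "\<And>r w. 0 \<le> r \<Longrightarrow>
    (\<integral>\<^sup>+\<theta>\<in>{0..2 * pi}. ennreal (exp (- 1 * cmod (of_real r * cis \<theta> - w))) \<partial>lborel)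
      \<le> ennreal (K0 * exp (- (1 / 2) * \<bar>r - cmod w\<bar>) / (1 + r))"
    using circle_exp_bound[of 1] by auto
  define K where "K = K0 * exp (1 / 2)"
  have K_pos: "0 < K" using K0 by (simp add: K_def)
  have K: "(\<integral>\<^sup>+\<theta>\<in>{0..2 * pi}. ennreal (exp (- 1 * cmod (of_real s * cis \<theta> - lattice_point k))) \<partial>lborel)
      \<le> ennreal (K * exp (- (1 / 2) * \<bar>s - real j\<bar>) / (1 + s))" if "0 \<le> s" "k \<in> lattice_ring j" for s k j
  proof (rule order_trans[OF K0(2)[OF that(1)]], intro ennreal_leI divide_right_mono)
    show "K0 * exp (- (1 / 2) * \<bar>s - cmod (lattice_point k)\<bar>) \<le> K * exp (- (1 / 2) * \<bar>s - real j\<bar>)"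
      using ring_exp_le[OF that(2), of "1 / 2" s] K0 by (simp add: K_def)
  qed (use that in auto)
  obtain L where L: "1 \<le> L" "\<And>z j. (\<Sum>k\<in>lattice_ring j. exp (- 1 * cmod (z - lattice_point k))) \<le> L * exp (- (1 / 2) * \<bar>cmod z - real j\<bar>)"
    using ring_sum_exp_le[of 1] by auto
  have P: "0 < P" using t by (auto intro: less_le_trans[of 0 "ennreal t"])
  then show ?thesis
  proof (cases P rule: exponent_cases)
    case 1
    show ?thesis
    proof (rule that[OF K_pos])
      fix \<alpha> s j and f :: "complex \<Rightarrow> complex" assume f: "continuous_on UNIV f" and s: "0 \<le> (s::real)"
      have "lnorm top (lattice_ring j) (\<lambda>k. enn2real (circle_mass t \<alpha> f (lattice_point k) s))
        \<le> weighted_mean top \<alpha> f s powr t * (K * exp (- (1 / 2) * \<bar>s - real j\<bar>) / (1 + s))"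
      proof (rule lnorm_top_le)
        fix k assume k: "k \<in> lattice_ring j"
        have "circle_mass t \<alpha> f (lattice_point k) s \<le> ennreal (weighted_mean top \<alpha> f s powr t) * ennreal (K * exp (- (1 / 2) * \<bar>s - real j\<bar>) / (1 + s))"
          by (rule order_trans[OF circle_mass_le_top[OF f t(1)]]) (intro mult_left_mono K s k, simp)
        also have "\<dots> = ennreal (weighted_mean top \<alpha> f s powr t * (K * exp (- (1 / 2) * \<bar>s - real j\<bar>) / (1 + s)))"
          using K_pos s by (intro ennreal_mult[symmetric]) auto
        finally show "enn2real (circle_mass t \<alpha> f (lattice_point k) s) \<le> weighted_mean top \<alpha> f s powr t * (K * exp (- (1 / 2) * \<bar>s - real j\<bar>) / (1 + s))"
          using K_pos s by (intro enn2real_leI) auto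
      qed (use K_pos s in auto)
      then show "lnorm (quotient_exponent P t) (lattice_ring j) (\<lambda>k. enn2real (circle_mass t \<alpha> f (lattice_point k) s))
        \<le> K * (exp (- (1 / 2) * \<bar>s - real j\<bar>) * (1 + s) powr (t * recip P - 1) * weighted_mean P \<alpha> f s powr t)"
        using s 1 by (simp add: quotient_exponent_def powr_minus field_simps)
    qed
  next
    case (2 p)
    define \<tau> where "\<tau> = p / t"
    have tp: "t \<le> p" using t 2 by simp
    have \<tau>: "1 \<le> \<tau>" "t * \<tau> = p" "1 / \<tau> = t / p" using t tp by (auto simp: \<tau>_def)
    have Q: "quotient_exponent P t = ennreal \<tau>" using 2 by (simp add: quotient_exponent_def \<tau>_def)
    define C where "C = K powr (1 - 1 / \<tau>) * (L * (2 * pi)) powr (1 / \<tau>)"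
    have C: "0 < C" using K_pos L by (simp add: C_def)
    show ?thesis
    proof (rule that[OF C])
      fix \<alpha> s j and f :: "complex \<Rightarrow> complex" assume f: "continuous_on UNIV f" and s: "0 \<le> (s::real)"
      have [measurable]: "weighted_modulus \<alpha> f \<in> borel_measurable borel"
        by (intro borel_measurable_continuous_onI continuous_weighted_modulus f)
      define E where "E = exp (- (1 / 2) * \<bar>s - real j\<bar>)"
      have E: "0 < E" by (simp add: E_def)
      define X where "X = K * E / (1 + s)"
      have X: "0 < X" using K_pos s E by (simp add: X_def)
      define U where "U = weighted_mean P \<alpha> f s"
      have U: "0 \<le> U" using f by (simp add: U_def)
      define M where "M k = circle_mass p \<alpha> f (lattice_point k) s" for k
      have M_fin: "M k < top" for k unfolding M_def using f s 2 by (intro circle_mass_finite) auto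
      then have M_real: "ennreal (enn2real (M k)) = M k" for k by simp
      have mass: "enn2real (circle_mass t \<alpha> f (lattice_point k) s) \<le> (X powr (\<tau> - 1) * enn2real (M k)) powr (1 / \<tau>)"
        if k: "k \<in> lattice_ring j" for k
      proof -
        have "(\<integral>\<^sup>+\<theta>. ennreal (weighted_modulus \<alpha> f (of_real s * cis \<theta>) powr t *
             (exp (- 1 * cmod (of_real s * cis \<theta> - lattice_point k)) * indicator {0..2 * pi} \<theta>)) \<partial>lborel)
          \<le> ennreal ((X powr (\<tau> - 1) * enn2real (M k)) powr (1 / \<tau>))"
        proof (rule nn_integral_jensen[OF _ _ _ _ _ X \<tau>(1)])
          show "(\<integral>\<^sup>+\<theta>. ennreal (exp (- 1 * cmod (of_real s * cis \<theta> - lattice_point k)) * indicator {0..2 * pi} \<theta>) \<partial>lborel) \<le> ennreal X"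
            using K[OF s k] by (simp add: X_def E_def ennreal_mult ennreal_indicator)
          show "(\<integral>\<^sup>+\<theta>. ennreal ((weighted_modulus \<alpha> f (of_real s * cis \<theta>) powr t) powr \<tau> *
             (exp (- 1 * cmod (of_real s * cis \<theta> - lattice_point k)) * indicator {0..2 * pi} \<theta>)) \<partial>lborel) \<le> ennreal (enn2real (M k))"
            unfolding M_real powr_powr \<tau>(2) by (simp add: M_def circle_mass_def ennreal_mult ennreal_indicator mult.assoc)
        qed (auto simp: measurable_lborel1)
        moreover have "circle_mass t \<alpha> f (lattice_point k) s = (\<integral>\<^sup>+\<theta>. ennreal (weighted_modulus \<alpha> f (of_real s * cis \<theta>) powr t *
             (exp (- 1 * cmod (of_real s * cis \<theta> - lattice_point k)) * indicator {0..2 * pi} \<theta>)) \<partial>lborel)"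
          by (simp add: circle_mass_def ennreal_mult ennreal_indicator mult.assoc)
        ultimately show ?thesis by (intro enn2real_leI) auto
      qed
      have "ennreal (\<Sum>k\<in>lattice_ring j. enn2real (M k)) = (\<Sum>k\<in>lattice_ring j. M k)"
        by (simp add: sum_ennreal[symmetric] M_real)
      also have "\<dots> = (\<integral>\<^sup>+\<theta>. (\<Sum>k\<in>lattice_ring j. ennreal (weighted_modulus \<alpha> f (of_real s * cis \<theta>) powr p * exp (- cmod (of_real s * cis \<theta> - lattice_point k))) * indicator {0..2 * pi} \<theta>) \<partial>lborel)"
        unfolding M_def circle_mass_def by (rule nn_integral_sum[symmetric]) measurable
      also have "\<dots> \<le> (\<integral>\<^sup>+\<theta>. ennreal (L * E) * (ennreal (weighted_modulus \<alpha> f (of_real s * cis \<theta>) powr p) * indicator {0..2 * pi} \<theta>) \<partial>lborel)"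
      proof (intro nn_integral_mono)
        fix \<theta>
        have "(\<Sum>k\<in>lattice_ring j. weighted_modulus \<alpha> f (of_real s * cis \<theta>) powr p * exp (- cmod (of_real s * cis \<theta> - lattice_point k)))
          \<le> weighted_modulus \<alpha> f (of_real s * cis \<theta>) powr p * (L * E)"
          unfolding sum_distrib_left[symmetric] using L(2)[where z = "of_real s * cis \<theta>" and j = j] s
          by (intro mult_left_mono) (auto simp: E_def norm_mult)
        then have "ennreal (\<Sum>k\<in>lattice_ring j. weighted_modulus \<alpha> f (of_real s * cis \<theta>) powr p * exp (- cmod (of_real s * cis \<theta> - lattice_point k)))
          \<le> ennreal (L * E) * ennreal (weighted_modulus \<alpha> f (of_real s * cis \<theta>) powr p)"
          using L E by (subst ennreal_mult[symmetric]) (auto intro!: ennreal_leI simp: mult.commute)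
        then show "(\<Sum>k\<in>lattice_ring j. ennreal (weighted_modulus \<alpha> f (of_real s * cis \<theta>) powr p * exp (- cmod (of_real s * cis \<theta> - lattice_point k))) * indicator {0..2 * pi} \<theta>)
          \<le> ennreal (L * E) * (ennreal (weighted_modulus \<alpha> f (of_real s * cis \<theta>) powr p) * indicator {0..2 * pi} \<theta>)"
          by (auto simp: indicator_def sum_ennreal)
      qed
      also have "\<dots> = ennreal (L * E) * (\<integral>\<^sup>+\<theta>\<in>{0..2 * pi}. ennreal (weighted_modulus \<alpha> f (of_real s * cis \<theta>) powr p) \<partial>lborel)"
        by (rule nn_integral_cmult) measurable
      also have "\<dots> = ennreal (L * E) * (ennreal (2 * pi) * ennreal (U powr p))"
        unfolding U_def 2(2) weighted_mean_powr[OF f 2(1)]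
        by (simp add: mult.assoc[symmetric] ennreal_mult[symmetric])
      also have "\<dots> = ennreal (L * (2 * pi) * E * U powr p)"
        using L E by (simp add: ennreal_mult[symmetric] mult_ac)
      finally have M_sum: "(\<Sum>k\<in>lattice_ring j. enn2real (M k)) \<le> L * (2 * pi) * E * U powr p"
        using L E by (subst (asm) ennreal_le_iff) auto
      have "lnorm (ennreal \<tau>) (lattice_ring j) (\<lambda>k. enn2real (circle_mass t \<alpha> f (lattice_point k) s))
        \<le> lnorm (ennreal \<tau>) (lattice_ring j) (\<lambda>k. (X powr (\<tau> - 1) * enn2real (M k)) powr (1 / \<tau>))"
        using \<tau> by (intro lnorm_mono mass) auto
      also have "\<dots> = (X powr (\<tau> - 1) * (\<Sum>k\<in>lattice_ring j. enn2real (M k))) powr (1 / \<tau>)"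
        using \<tau>(1) X by (simp add: lnorm_ennreal powr_powr sum_distrib_left)
      also have "\<dots> \<le> (X powr (\<tau> - 1) * (L * (2 * pi) * E * U powr p)) powr (1 / \<tau>)"
        using \<tau>(1) by (intro powr_mono2 mult_left_mono M_sum mult_nonneg_nonneg sum_nonneg) auto
      also have "\<dots> = X powr (1 - 1 / \<tau>) * ((L * (2 * pi)) powr (1 / \<tau>) * E powr (1 / \<tau>) * U powr t)"
      proof -
        have "(\<tau> - 1) * (1 / \<tau>) = 1 - 1 / \<tau>" "p * (1 / \<tau>) = t" using \<tau> 2(1) by (auto simp: field_simps)
        then show ?thesis using L E by (simp add: powr_mult powr_powr)
      qed
      also have "X powr (1 - 1 / \<tau>) = K powr (1 - 1 / \<tau>) * E powr (1 - 1 / \<tau>) * (1 + s) powr (1 / \<tau> - 1)"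
        using K_pos E s by (simp add: X_def powr_mult powr_divide powr_diff)
      also have "K powr (1 - 1 / \<tau>) * E powr (1 - 1 / \<tau>) * (1 + s) powr (1 / \<tau> - 1) * ((L * (2 * pi)) powr (1 / \<tau>) * E powr (1 / \<tau>) * U powr t)
          = C * ((E powr (1 - 1 / \<tau>) * E powr (1 / \<tau>)) * (1 + s) powr (1 / \<tau> - 1) * U powr t)"
        by (simp only: C_def mult_ac)
      also have "E powr (1 - 1 / \<tau>) * E powr (1 / \<tau>) = E"
        using E by (subst powr_add[symmetric]) simp
      finally show "lnorm (quotient_exponent P t) (lattice_ring j) (\<lambda>k. enn2real (circle_mass t \<alpha> f (lattice_point k) s))
        \<le> C * (exp (- (1 / 2) * \<bar>s - real j\<bar>) * (1 + s) powr (t * recip P - 1) * weighted_mean P \<alpha> f s powr t)"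
        unfolding Q E_def[symmetric] U_def[symmetric] using 2 \<tau>(3) by simp
    qed
  qed
qed

lemma lnorm_powr_le:
  assumes "finite S" "0 < t" "ennreal t \<le> P" "\<And>i. i \<in> S \<Longrightarrow> 0 \<le> a i"
  shows "lnorm P S a powr t \<le> lnorm (quotient_exponent P t) S (\<lambda>i. a i powr t)"
proof -
  have "0 < P" using assms by (auto intro: less_le_trans[of 0 "ennreal t"])
  then show ?thesis
  proof (cases P rule: exponent_cases)
    case 1
    have "Max (insert 0 (a ` S)) \<in> insert 0 (a ` S)" using assms(1) by (intro Max_in) auto
    then show ?thesis
    proof
      assume "Max (insert 0 (a ` S)) = 0"
      then have "lnorm P S a = 0" using 1 by (simp add: lnorm_def)
      then show ?thesis using assms by (simp add: lnorm_nonneg)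
    next
      assume "Max (insert 0 (a ` S)) \<in> a ` S"
      then obtain i where i: "i \<in> S" "lnorm P S a = a i" using 1 by (auto simp: lnorm_def)
      have "a i powr t \<le> lnorm top S (\<lambda>i. a i powr t)" by (rule le_lnorm_top) (use assms i in auto)
      then show ?thesis using i 1 by (simp add: quotient_exponent_def)
    qed
  next
    case (2 p)
    then show ?thesis using assms by (simp add: quotient_exponent_def lnorm_ennreal powr_powr)
  qed
qed

text \<open>
  Since \<open>P / t \<ge> 1\<close>, testing against an extremal sequence replaces Minkowski's inequality for the
  \<open>P / t\<close> norm of the integral over \<open>s\<close>.
\<close>

lemma ring_lnorm_le:
  assumes \<alpha>: "0 < \<alpha>" and t: "0 < t" "t \<le> 1" "ennreal t \<le> P"
  obtains C where "0 < C"
    "\<And>f j A. f holomorphic_on UNIV \<Longrightarrow> (\<And>k. 0 \<le> A k) \<Longrightarrow>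
      (\<And>k. \<exists>z. cmod (z - lattice_point k) \<le> 1 \<and> A k \<le> weighted_modulus \<alpha> f z) \<Longrightarrow>
      ennreal (lnorm P (lattice_ring j) A powr t) \<le> ennreal C *
        (\<integral>\<^sup>+s\<in>{0..}. ennreal (exp (- (1 / 2) * \<bar>s - real j\<bar>) * (1 + s) powr (t * recip P - 1) * weighted_mean P \<alpha> f s powr t * s) \<partial>lborel)"
proof -
  obtain C1 where C1: "0 < C1"
    "\<And>f z w. f holomorphic_on UNIV \<Longrightarrow> cmod (z - w) \<le> 1 \<Longrightarrow>
      ennreal (weighted_modulus \<alpha> f z powr t)
        \<le> ennreal C1 * (\<integral>\<^sup>+v. ennreal (weighted_modulus \<alpha> f v powr t * exp (- cmod (v - w))) \<partial>lborel)"
    using exp_local_estimate[OF \<alpha> t(1,2)] by blast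
  obtain C2 where C2: "0 < C2"
    "\<And>\<alpha> f s j. continuous_on UNIV f \<Longrightarrow> 0 \<le> s \<Longrightarrow>
      lnorm (quotient_exponent P t) (lattice_ring j) (\<lambda>k. enn2real (circle_mass t \<alpha> f (lattice_point k) s))
        \<le> C2 * (exp (- (1 / 2) * \<bar>s - real j\<bar>) * (1 + s) powr (t * recip P - 1) * weighted_mean P \<alpha> f s powr t)"
    using lnorm_circle_mass_le[OF t(1,3)] by blast
  define T where "T = quotient_exponent P t"
  have T1: "1 \<le> T" unfolding T_def by (rule quotient_exponent_ge_1[OF t(1,3)])
  then have T0: "0 < T" by (rule less_le_trans[rotated]) simp
  have P: "0 < P" using t by (auto intro: less_le_trans[of 0 "ennreal t"])
  show ?thesis
  proof (rule that[of "C1 * C2"])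
    fix f j and A :: "int \<times> int \<Rightarrow> real"
    assume f: "f holomorphic_on UNIV" and A: "\<And>k. 0 \<le> A k"
      and wit: "\<And>k. \<exists>z. cmod (z - lattice_point k) \<le> 1 \<and> A k \<le> weighted_modulus \<alpha> f z"
    have cont: "continuous_on UNIV f" using f by (rule holomorphic_on_imp_continuous_on)
    have [measurable]: "weighted_modulus \<alpha> f \<in> borel_measurable borel"
      by (intro borel_measurable_continuous_onI continuous_weighted_modulus cont)
    have [measurable]: "weighted_mean P \<alpha> f \<in> borel_measurable borel"
      by (rule weighted_mean_measurable[OF cont P])
    have [measurable]: "circle_mass t \<alpha> f w \<in> borel_measurable borel" for w by (rule circle_mass_measurable[OF cont])
    \<comment> \<open>\<open>exp_local_estimate\<close> at the witness for k, in polar coordinates,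
      so that the angular part is a circle mass.\<close>
    have At: "ennreal (A k powr t) \<le> ennreal C1 * (\<integral>\<^sup>+s\<in>{0..}. circle_mass t \<alpha> f (lattice_point k) s * ennreal s \<partial>lborel)" for k
    proof -
      obtain z where z: "cmod (z - lattice_point k) \<le> 1" "A k \<le> weighted_modulus \<alpha> f z" using wit by blast
      have "ennreal (A k powr t) \<le> ennreal (weighted_modulus \<alpha> f z powr t)"
        using t A z by (intro ennreal_leI powr_mono2) auto
      also have "\<dots> \<le> ennreal C1 * (\<integral>\<^sup>+v. ennreal (weighted_modulus \<alpha> f v powr t * exp (- cmod (v - lattice_point k))) \<partial>lborel)"
        by (rule C1(2)[OF f z(1)])
      also have "(\<integral>\<^sup>+v. ennreal (weighted_modulus \<alpha> f v powr t * exp (- cmod (v - lattice_point k))) \<partial>lborel)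
          = (\<integral>\<^sup>+s\<in>{0..}. circle_mass t \<alpha> f (lattice_point k) s * ennreal s \<partial>lborel)"
        unfolding circle_mass_def by (rule nn_integral_polar) measurable
      finally show ?thesis .
    qed
    \<comment> \<open>As T \<ge> 1, conjugation of exponents is an involution, so an extremal for
      the conjugate exponent measures the T-norm.\<close>
    obtain c where c: "\<And>k. 0 \<le> c k" "lnorm (conj_exponent T) (lattice_ring j) c \<le> 1"
        "(\<Sum>k\<in>lattice_ring j. c k * A k powr t) = lnorm T (lattice_ring j) (\<lambda>k. A k powr t)"
      using lnorm_extremal[of "lattice_ring j" "conj_exponent T" "\<lambda>k. A k powr t"] conj_exponent_pos[OF T0]
      by (auto simp: conj_conj_exponent[OF T1])
    have sum_le: "(\<Sum>k\<in>lattice_ring j. c k * enn2real (circle_mass t \<alpha> f (lattice_point k) s))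
        \<le> C2 * (exp (- (1 / 2) * \<bar>s - real j\<bar>) * (1 + s) powr (t * recip P - 1) * weighted_mean P \<alpha> f s powr t)" if s: "0 \<le> s" for s
    proof -
      define b where "b k = enn2real (circle_mass t \<alpha> f (lattice_point k) s)" for k
      have "(\<Sum>k\<in>lattice_ring j. c k * b k) \<le> lnorm (conj_exponent T) (lattice_ring j) c * lnorm T (lattice_ring j) b"
        using lnorm_holder[of "lattice_ring j" "conj_exponent T" c b] c conj_exponent_pos[OF T0]
        by (simp add: conj_conj_exponent[OF T1] b_def)
      also have "\<dots> \<le> 1 * lnorm T (lattice_ring j) b"
        using c by (intro mult_right_mono lnorm_nonneg) auto
      also have "\<dots> \<le> C2 * (exp (- (1 / 2) * \<bar>s - real j\<bar>) * (1 + s) powr (t * recip P - 1) * weighted_mean P \<alpha> f s powr t)"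
        using C2(2)[OF cont s] by (simp add: b_def[abs_def] T_def)
      finally show ?thesis by (simp add: b_def)
    qed
    have "ennreal (lnorm P (lattice_ring j) A powr t) \<le> ennreal (\<Sum>k\<in>lattice_ring j. c k * A k powr t)"
      unfolding c(3) T_def using A t by (intro ennreal_leI lnorm_powr_le) auto
    also have "\<dots> = (\<Sum>k\<in>lattice_ring j. ennreal (c k) * ennreal (A k powr t))"
      using c(1) by (subst sum_ennreal[symmetric]) (auto simp: ennreal_mult)
    also have "\<dots> \<le> (\<Sum>k\<in>lattice_ring j. ennreal (c k) * (ennreal C1 * (\<integral>\<^sup>+s\<in>{0..}. circle_mass t \<alpha> f (lattice_point k) s * ennreal s \<partial>lborel)))"
      by (intro sum_mono mult_left_mono At) auto
    also have "\<dots> = ennreal C1 * (\<integral>\<^sup>+s. (\<Sum>k\<in>lattice_ring j. ennreal (c k) * (circle_mass t \<alpha> f (lattice_point k) s * ennreal s * indicator {0..} s)) \<partial>lborel)"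
    proof -
      have "(\<integral>\<^sup>+s. (\<Sum>k\<in>lattice_ring j. ennreal (c k) * (circle_mass t \<alpha> f (lattice_point k) s * ennreal s * indicator {0..} s)) \<partial>lborel)
          = (\<Sum>k\<in>lattice_ring j. ennreal (c k) * (\<integral>\<^sup>+s\<in>{0..}. circle_mass t \<alpha> f (lattice_point k) s * ennreal s \<partial>lborel))"
        by (subst nn_integral_sum, measurable, subst nn_integral_cmult) auto
      moreover have "ennreal (c k) * (ennreal C1 * x) = ennreal C1 * (ennreal (c k) * x)" for k x
        by (rule mult.left_commute)
      ultimately show ?thesis by (simp only: sum_distrib_left)
    qed
    also have "\<dots> \<le> ennreal C1 * (\<integral>\<^sup>+s. ennreal C2 * (ennreal (exp (- (1 / 2) * \<bar>s - real j\<bar>) * (1 + s) powr (t * recip P - 1) * weighted_mean P \<alpha> f s powr t * s) * indicator {0..} s) \<partial>lborel)"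
    proof (intro mult_left_mono nn_integral_mono)
      fix s :: real
      show "(\<Sum>k\<in>lattice_ring j. ennreal (c k) * (circle_mass t \<alpha> f (lattice_point k) s * ennreal s * indicator {0..} s))
        \<le> ennreal C2 * (ennreal (exp (- (1 / 2) * \<bar>s - real j\<bar>) * (1 + s) powr (t * recip P - 1) * weighted_mean P \<alpha> f s powr t * s) * indicator {0..} s)"
      proof (cases "0 \<le> s")
        case True
        have "circle_mass t \<alpha> f w s = ennreal (enn2real (circle_mass t \<alpha> f w s))" for w
          using circle_mass_finite[OF cont t(1) True] by simp
        then have "(\<Sum>k\<in>lattice_ring j. ennreal (c k) * (circle_mass t \<alpha> f (lattice_point k) s * ennreal s * indicator {0..} s))
            = (\<Sum>k\<in>lattice_ring j. ennreal (c k) * (ennreal (enn2real (circle_mass t \<alpha> f (lattice_point k) s)) * ennreal s))"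
          using True by simp
        also have "\<dots> = ennreal ((\<Sum>k\<in>lattice_ring j. c k * enn2real (circle_mass t \<alpha> f (lattice_point k) s)) * s)"
          using True c by (simp add: ennreal_mult[symmetric] sum_ennreal sum_distrib_right mult.assoc)
        also have "\<dots> \<le> ennreal (C2 * (exp (- (1 / 2) * \<bar>s - real j\<bar>) * (1 + s) powr (t * recip P - 1) * weighted_mean P \<alpha> f s powr t) * s)"
          using True by (intro ennreal_leI mult_right_mono sum_le)
        also have "\<dots> = ennreal C2 * (ennreal (exp (- (1 / 2) * \<bar>s - real j\<bar>) * (1 + s) powr (t * recip P - 1) * weighted_mean P \<alpha> f s powr t * s) * indicator {0..} s)"
          using True C2 by (simp add: ennreal_mult[symmetric] mult.assoc)
        finally show ?thesis .
      qed simp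
    qed auto
    also have "\<dots> = ennreal (C1 * C2) * (\<integral>\<^sup>+s\<in>{0..}. ennreal (exp (- (1 / 2) * \<bar>s - real j\<bar>) * (1 + s) powr (t * recip P - 1) * weighted_mean P \<alpha> f s powr t * s) \<partial>lborel)"
      using C1 C2 by (subst nn_integral_cmult) (auto simp: ennreal_mult mult.assoc)
    finally show "ennreal (lnorm P (lattice_ring j) A powr t) \<le> \<dots>" .
  qed (use C1 C2 in simp)
qed

text \<open>The values A may be dominated at any points of the unit discs; in applications these are
  the cell maxima. By \<open>ring_lnorm_le\<close> the t-th power of each ring norm is bounded by a
  radial average. For finite q Jensen's inequality with exponent q/t turns this into an average of
  q-th powers, and the averages of different rings have bounded overlap.\<close>

lemma discrete_norm_le_fock_norm:
  assumes \<alpha>: "0 < \<alpha>" and P: "0 < P" and Q: "0 < Q"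
  obtains C where "0 < C"
    "\<And>f N A. f holomorphic_on UNIV \<Longrightarrow> (\<And>k. 0 \<le> A k) \<Longrightarrow>
      (\<And>k. \<exists>z. cmod (z - lattice_point k) \<le> 1 \<and> A k \<le> weighted_modulus \<alpha> f z) \<Longrightarrow>
      ennreal (discrete_norm P Q (\<sigma> - recip P + recip Q) N A) \<le> ennreal C * fock_norm \<alpha> \<sigma> P Q f"
proof -
  \<comment> \<open>This t is positive and finite even if P or Q is infinite. It meets three
    demands: t \<le> 1 for the sub-mean inequality, t \<le> P for the ring norm, and t \<le> Q for
    Jensen's inequality in the radius.\<close>
  have "0 < min 1 (min P Q)" "min 1 (min P Q) < top" using P Q by (auto simp: min_less_iff_disj)
  then obtain t where t0: "0 < t" "ennreal t = min 1 (min P Q)"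
    by (cases "min 1 (min P Q)") auto
  have t: "0 < t" "t \<le> 1" "ennreal t \<le> P" "ennreal t \<le> Q"
    using t0 by (auto simp: min_le_iff_disj) (metis ennreal_le_1 min.cobounded1)
  define \<rho> where "\<rho> = recip P"
  obtain C1 where C1: "0 < C1"
    "\<And>f j A. f holomorphic_on UNIV \<Longrightarrow> (\<And>k. 0 \<le> A k) \<Longrightarrow>
      (\<And>k. \<exists>z. cmod (z - lattice_point k) \<le> 1 \<and> A k \<le> weighted_modulus \<alpha> f z) \<Longrightarrow>
      ennreal (lnorm P (lattice_ring j) A powr t) \<le> ennreal C1 *
        (\<integral>\<^sup>+s\<in>{0..}. ennreal (exp (- (1 / 2) * \<bar>s - real j\<bar>) * (1 + s) powr (t * recip P - 1) * weighted_mean P \<alpha> f s powr t * s) \<partial>lborel)"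
    using ring_lnorm_le[OF \<alpha> t(1-3)] by blast
  have R: "0 < radial_const \<alpha> Q" by (rule radial_const_pos[OF \<alpha> Q])
  have reduce: "ennreal x \<le> ennreal (C / radial_const \<alpha> Q) * fock_norm \<alpha> \<sigma> P Q f"
    if "0 \<le> C" "continuous_on UNIV f" "ennreal x \<le> ennreal C * radial_norm \<sigma> Q {0..} (weighted_mean P \<alpha> f)" for x C f
  proof -
    have "ennreal (C / radial_const \<alpha> Q) * fock_norm \<alpha> \<sigma> P Q f = ennreal C * radial_norm \<sigma> Q {0..} (weighted_mean P \<alpha> f)"
      unfolding fock_norm_radial[OF that(2) \<alpha> P Q] mult.assoc[symmetric]
      using R that(1) by (subst ennreal_mult[symmetric]) auto
    then show ?thesis using that by simp
  qed
  have e4: "(0::real) < 1 / 4" by simp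
  from Q show ?thesis
  proof (cases Q rule: exponent_cases)
    case 1
    \<comment> \<open>The power of 1 + s that remains after U \<le> B (1 + s)^(-\<sigma>) and s
      \<le> 1 + s; it is -t times the weight \<sigma> - \<rho> of the sequence norm.\<close>
    define m where "m = t * \<rho> - t * \<sigma>"
    obtain W where W: "1 \<le> W" "\<And>a b. 0 \<le> a \<Longrightarrow> 0 \<le> b \<Longrightarrow> (1 + a) powr m \<le> W * (1 + b) powr m * exp (1 / 4 * \<bar>a - b\<bar>)"
      using weight_exp_le[OF e4] by blast
    \<comment> \<open>8 = 2/(1/4) bounds the integral of exp(-|s - j|/4), the decay left over after
      moving the weight from s to j.\<close>
    define C where "C = (C1 * (W * 8)) powr (1 / t)"
    have C: "0 < C" using C1 W by (simp add: C_def)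
    show ?thesis
    proof (rule that[of "C / radial_const \<alpha> Q"])
      fix f N and A :: "int \<times> int \<Rightarrow> real"
      assume f: "f holomorphic_on UNIV" and A: "\<And>k. 0 \<le> A k"
        and wit: "\<And>k. \<exists>z. cmod (z - lattice_point k) \<le> 1 \<and> A k \<le> weighted_modulus \<alpha> f z"
      have cont: "continuous_on UNIV f" using f by (rule holomorphic_on_imp_continuous_on)
      have [measurable]: "weighted_mean P \<alpha> f \<in> borel_measurable borel"
        by (rule weighted_mean_measurable[OF cont P])
      have "ennreal (discrete_norm P Q (\<sigma> - \<rho> + recip Q) N A) \<le> ennreal C * radial_norm \<sigma> Q {0..} (weighted_mean P \<alpha> f)"
      proof (cases "radial_norm \<sigma> Q {0..} (weighted_mean P \<alpha> f)")
        case (real B)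
        have U: "weighted_mean P \<alpha> f s * (1 + s) powr \<sigma> \<le> B" if "0 \<le> s" for s
        proof -
          have "ennreal (weighted_mean P \<alpha> f s * (1 + s) powr \<sigma>) \<le> ennreal B"
            unfolding real(2)[symmetric] 1 radial_norm_top using that by (intro SUP_upper) auto
          then show ?thesis using real by (simp add: ennreal_le_iff)
        qed
        have ring: "(1 + real j) powr (\<sigma> - \<rho>) * lnorm P (lattice_ring j) A \<le> C * B" for j
        proof -
          have "ennreal (lnorm P (lattice_ring j) A powr t) \<le> ennreal C1 *
            (\<integral>\<^sup>+s\<in>{0..}. ennreal (exp (- (1 / 2) * \<bar>s - real j\<bar>) * (1 + s) powr (t * recip P - 1) * weighted_mean P \<alpha> f s powr t * s) \<partial>lborel)"
            by (rule C1(2)[OF f A wit])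
          also have "\<dots> \<le> ennreal C1 * (\<integral>\<^sup>+s. ennreal (B powr t * W * (1 + real j) powr m) * ennreal (exp (- (1 / 4) * \<bar>s - real j\<bar>)) \<partial>lborel)"
          proof (intro mult_left_mono nn_integral_mono)
            fix s :: real
            have "exp (- (1 / 2) * \<bar>s - real j\<bar>) * (1 + s) powr (t * recip P - 1) * weighted_mean P \<alpha> f s powr t * s
                \<le> (B powr t * W * (1 + real j) powr m) * exp (- (1 / 4) * \<bar>s - real j\<bar>)" if s: "0 \<le> s"
            proof -
              have "weighted_mean P \<alpha> f s \<le> B * (1 + s) powr (- \<sigma>)" using U[OF s] s by (simp add: powr_minus field_simps)
              then have "weighted_mean P \<alpha> f s powr t \<le> (B * (1 + s) powr (- \<sigma>)) powr t"
                using t cont by (intro powr_mono2) auto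
              also have "\<dots> = B powr t * (1 + s) powr (- (t * \<sigma>))" by (simp add: powr_mult powr_powr mult.commute)
              finally have "(1 + s) powr (t * \<rho> - 1) * weighted_mean P \<alpha> f s powr t * s
                  \<le> (1 + s) powr (t * \<rho> - 1) * (B powr t * (1 + s) powr (- (t * \<sigma>))) * (1 + s)"
                using s by (intro mult_mono) auto
              also have "\<dots> = B powr t * (1 + s) powr m"
              proof -
                have "(1 + s) powr (t * \<rho> - 1) * (1 + s) powr (- (t * \<sigma>)) * (1 + s) powr 1 = (1 + s) powr m"
                  unfolding powr_add[symmetric] m_def by (intro arg_cong2[where f = "(powr)"]) auto
                then show ?thesis using s by (simp add: mult_ac)
              qed
              also have "\<dots> \<le> B powr t * (W * (1 + real j) powr m * exp (1 / 4 * \<bar>s - real j\<bar>))"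
                using s by (intro mult_left_mono W) auto
              finally have "exp (- (1 / 2) * \<bar>s - real j\<bar>) * ((1 + s) powr (t * \<rho> - 1) * weighted_mean P \<alpha> f s powr t * s)
                  \<le> exp (- (1 / 2) * \<bar>s - real j\<bar>) * (B powr t * (W * (1 + real j) powr m * exp (1 / 4 * \<bar>s - real j\<bar>)))"
                by (intro mult_left_mono) auto
              also have "\<dots> = (B powr t * W * (1 + real j) powr m) * (exp (- (1 / 2) * \<bar>s - real j\<bar>) * exp (1 / 4 * \<bar>s - real j\<bar>))"
                by (simp only: mult_ac)
              also have "exp (- (1 / 2) * \<bar>s - real j\<bar>) * exp (1 / 4 * \<bar>s - real j\<bar>) = exp (- (1 / 4) * \<bar>s - real j\<bar>)"
                by (simp add: exp_add[symmetric])
              finally show ?thesis by (simp add: \<rho>_def mult.assoc)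
            qed
            then show "ennreal (exp (- (1 / 2) * \<bar>s - real j\<bar>) * (1 + s) powr (t * recip P - 1) * weighted_mean P \<alpha> f s powr t * s) * indicator {0..} s
              \<le> ennreal (B powr t * W * (1 + real j) powr m) * ennreal (exp (- (1 / 4) * \<bar>s - real j\<bar>))"
              using W by (cases "0 \<le> s") (auto simp: ennreal_mult[symmetric] intro!: ennreal_leI)
          qed auto
          also have "\<dots> \<le> ennreal C1 * (ennreal (B powr t * W * (1 + real j) powr m) * ennreal (2 / (1 / 4)))"
            by (subst nn_integral_cmult, measurable, intro mult_left_mono nn_integral_exp_abs_le) auto
          also have "\<dots> = ennreal (C1 * (W * 8) * B powr t * (1 + real j) powr m)"
          proof -
            have nn: "0 \<le> B powr t * W * (1 + real j) powr m" using W by simp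
            have "ennreal C1 * (ennreal (B powr t * W * (1 + real j) powr m) * ennreal (2 / (1 / 4)))
                = ennreal (C1 * ((B powr t * W * (1 + real j) powr m) * (2 / (1 / 4))))"
              by (subst ennreal_mult[OF nn, symmetric], simp, subst ennreal_mult[symmetric]) (use C1 nn in simp_all)
            then show ?thesis by (simp add: mult_ac)
          qed
          finally have "lnorm P (lattice_ring j) A powr t \<le> C1 * (W * 8) * B powr t * (1 + real j) powr m"
            using C1 W by (subst (asm) ennreal_le_iff) auto
          then have "(lnorm P (lattice_ring j) A powr t) powr (1 / t) \<le> (C1 * (W * 8) * B powr t * (1 + real j) powr m) powr (1 / t)"
            using t by (intro powr_mono2) auto
          also have "\<dots> = C * B * (1 + real j) powr (\<rho> - \<sigma>)"
          proof -
            have "m * (1 / t) = \<rho> - \<sigma>" using t by (simp add: m_def field_simps)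
            then show ?thesis using C1 W t real by (simp add: C_def powr_mult powr_powr)
          qed
          finally have "lnorm P (lattice_ring j) A \<le> C * B * (1 + real j) powr (\<rho> - \<sigma>)"
            using t by (simp add: powr_powr lnorm_nonneg)
          then have "(1 + real j) powr (\<sigma> - \<rho>) * lnorm P (lattice_ring j) A \<le> (1 + real j) powr (\<sigma> - \<rho>) * (C * B * (1 + real j) powr (\<rho> - \<sigma>))"
            by (intro mult_left_mono) auto
          also have "\<dots> = C * B * ((1 + real j) powr (\<sigma> - \<rho>) * (1 + real j) powr (\<rho> - \<sigma>))" by (simp only: mult_ac)
          also have "(1 + real j) powr (\<sigma> - \<rho>) * (1 + real j) powr (\<rho> - \<sigma>) = 1" by (simp add: powr_add[symmetric])
          finally show ?thesis by simp
        qed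
        have "discrete_norm P Q (\<sigma> - \<rho> + recip Q) N A \<le> C * B"
          unfolding discrete_norm_def 1 using ring C real by (intro lnorm_top_le) auto
        then show ?thesis using C real by (simp add: ennreal_mult[symmetric] ennreal_leI)
      qed (use C in \<open>simp add: ennreal_mult_top\<close>)
      then show "ennreal (discrete_norm P Q (\<sigma> - recip P + recip Q) N A) \<le> ennreal (C / radial_const \<alpha> Q) * fock_norm \<alpha> \<sigma> P Q f"
        using C cont unfolding \<rho>_def by (intro reduce) auto
    qed (use C R in simp)
  next
    case (2 q)
    have tq: "t \<le> q" using t 2 by simp
    \<comment> \<open>q times the weight \<sigma> - 1/P + 1/q of the sequence norm.\<close>
    define m where "m = (\<sigma> - \<rho>) * q + 1"
    obtain W where W: "1 \<le> W" "\<And>a b. 0 \<le> a \<Longrightarrow> 0 \<le> b \<Longrightarrow> (1 + a) powr (- m) \<le> W * (1 + b) powr (- m) * exp (1 / 4 * \<bar>a - b\<bar>)"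
      using weight_exp_le[OF e4] by blast
    obtain K where K: "1 \<le> K" "\<And>S x. finite S \<Longrightarrow> (\<Sum>m\<in>S. exp (- (1 / 4) * \<bar>x - real m\<bar>)) \<le> K"
      using sum_exp_nat[OF e4] by blast
    \<comment> \<open>C1^(q/t) comes from raising to the power q/t, 4^(q/t - 1) from Jensen's
      inequality for a measure of mass at most 4, and W from moving the weight from s to j.\<close>
    define C2 where "C2 = C1 powr (q / t) * 4 powr (q / t - 1) * W"
    have C2: "0 < C2" using C1 W by (simp add: C2_def)
    define C where "C = (C2 * K) powr (1 / q)"
    have C: "0 < C" using C2 K by (simp add: C_def)
    show ?thesis
    proof (rule that[of "C / radial_const \<alpha> Q"])
      fix f N and A :: "int \<times> int \<Rightarrow> real"
      assume f: "f holomorphic_on UNIV" and A: "\<And>k. 0 \<le> A k"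
        and wit: "\<And>k. \<exists>z. cmod (z - lattice_point k) \<le> 1 \<and> A k \<le> weighted_modulus \<alpha> f z"
      have cont: "continuous_on UNIV f" using f by (rule holomorphic_on_imp_continuous_on)
      define U where "U = weighted_mean P \<alpha> f"
      have U0: "0 \<le> U s" for s using cont by (simp add: U_def)
      have [measurable]: "U \<in> borel_measurable borel"
        unfolding U_def by (rule weighted_mean_measurable[OF cont P])
      define F where "F s = (U s * (1 + s) powr \<sigma>) powr q * s" for s
      have [measurable]: "F \<in> borel_measurable borel" unfolding F_def by measurable
      define X where "X j = (\<integral>\<^sup>+s\<in>{0..}. ennreal (exp (- (1 / 4) * \<bar>s - real j\<bar>) * F s) \<partial>lborel)" for j
      have "ennreal (discrete_norm P Q (\<sigma> - \<rho> + recip Q) N A) \<le> ennreal C * radial_norm \<sigma> Q {0..} U"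
      proof (cases "radial_norm \<sigma> Q {0..} U")
        case (real B)
        have FB: "(\<integral>\<^sup>+s\<in>{0..}. ennreal (F s) \<partial>lborel) \<le> ennreal (B powr q)"
          unfolding F_def ennreal_powr_le_ennreal_iff[OF 2(1) real(1), symmetric]
          using real 2 by (simp add: radial_norm_ennreal)
        have X_le: "X j \<le> ennreal (B powr q)" for j
        proof (rule order_trans[OF _ FB], unfold X_def, intro nn_integral_mono)
          fix s :: real
          have "exp (- (1 / 4) * \<bar>s - real j\<bar>) * F s \<le> 1 * F s" if "0 \<le> s"
            using that by (intro mult_right_mono) (auto simp: F_def)
          then show "ennreal (exp (- (1 / 4) * \<bar>s - real j\<bar>) * F s) * indicator {0..} s \<le> ennreal (F s) * indicator {0..} s"
            by (cases "0 \<le> s") (auto intro!: ennreal_leI)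
        qed
        then have X_real: "ennreal (enn2real (X j)) = X j" for j
          by (metis ennreal_enn2real ennreal_less_top le_less_trans)
        have ring: "(1 + real j) powr m * lnorm P (lattice_ring j) A powr q \<le> C2 * enn2real (X j)" for j
        proof -
          define S where "S = lnorm P (lattice_ring j) A"
          have S: "0 \<le> S" by (simp add: S_def lnorm_nonneg)
          define J where "J = W * (1 + real j) powr (- m) * enn2real (X j)"
          have J: "0 \<le> J" using W by (simp add: J_def)
          have tau: "1 \<le> q / t" using tq t by simp
          define G where "G s = (1 + s) powr (t * \<rho>) * U s powr t" for s
          \<comment> \<open>(1 + s)^(t/P - 1) s is split into (1 + s)^(t/P), which goes to G, and
            s/(1 + s) \<le> 1; thus h is a density of mass at most 4.\<close>
          define h where "h s = exp (- (1 / 2) * \<bar>s - real j\<bar>) * (s / (1 + s)) * indicator {0..} s" for s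
          have Gh: "(\<integral>\<^sup>+s. ennreal (G s * h s) \<partial>lborel) \<le> ennreal ((4 powr (q / t - 1) * J) powr (1 / (q / t)))"
          proof (rule nn_integral_jensen[OF _ _ _ _ _ _ tau _ J])
            show "G \<in> borel_measurable lborel" "h \<in> borel_measurable lborel" unfolding G_def h_def by measurable
            show "(\<integral>\<^sup>+s. ennreal (h s) \<partial>lborel) \<le> ennreal 4"
            proof -
              have "(\<integral>\<^sup>+s. ennreal (h s) \<partial>lborel) \<le> (\<integral>\<^sup>+s. ennreal (exp (- (1 / 2) * \<bar>s - real j\<bar>)) \<partial>lborel)"
              proof (intro nn_integral_mono ennreal_leI)
                fix s
                have "exp (- (1 / 2) * \<bar>s - real j\<bar>) * (s / (1 + s)) \<le> exp (- (1 / 2) * \<bar>s - real j\<bar>) * 1" if "0 \<le> s"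
                  using that by (intro mult_left_mono) auto
                then show "h s \<le> exp (- (1 / 2) * \<bar>s - real j\<bar>)" by (auto simp: h_def indicator_def)
              qed
              also have "\<dots> \<le> ennreal (2 / (1 / 2))" by (rule nn_integral_exp_abs_le) simp
              finally show ?thesis by simp
            qed
            have "(\<integral>\<^sup>+s. ennreal (G s powr (q / t) * h s) \<partial>lborel)
                \<le> (\<integral>\<^sup>+s. ennreal (W * (1 + real j) powr (- m)) * (ennreal (exp (- (1 / 4) * \<bar>s - real j\<bar>) * F s) * indicator {0..} s) \<partial>lborel)"
            proof (intro nn_integral_mono)
              fix s :: real
              have "G s powr (q / t) * h s \<le> W * (1 + real j) powr (- m) * (exp (- (1 / 4) * \<bar>s - real j\<bar>) * F s)" if s: "0 \<le> s"
              proof -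
                have "G s powr (q / t) = (1 + s) powr (q * \<rho>) * U s powr q"
                  using t by (simp add: G_def powr_mult powr_powr mult.commute)
                then have "G s powr (q / t) * h s = exp (- (1 / 2) * \<bar>s - real j\<bar>) * ((1 + s) powr (q * \<rho>) / (1 + s)) * (U s powr q * s)"
                  using s by (simp add: h_def)
                also have "(1 + s) powr (q * \<rho>) / (1 + s) = (1 + s) powr (- m) * (1 + s) powr (\<sigma> * q)"
                proof -
                  have "(1 + s) powr (- m) * (1 + s) powr (\<sigma> * q) = (1 + s) powr (q * \<rho> - 1)"
                    unfolding powr_add[symmetric] m_def by (intro arg_cong2[where f = "(powr)"]) (auto simp: algebra_simps)
                  then show ?thesis using s by (simp add: powr_diff)
                qed
                also have "exp (- (1 / 2) * \<bar>s - real j\<bar>) * ((1 + s) powr (- m) * (1 + s) powr (\<sigma> * q)) * (U s powr q * s)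
                    = exp (- (1 / 2) * \<bar>s - real j\<bar>) * (1 + s) powr (- m) * F s"
                  using U0 by (simp add: F_def powr_mult powr_powr mult_ac)
                also have "\<dots> \<le> exp (- (1 / 2) * \<bar>s - real j\<bar>) * (W * (1 + real j) powr (- m) * exp (1 / 4 * \<bar>s - real j\<bar>)) * F s"
                  using s by (intro mult_right_mono mult_left_mono W) (auto simp: F_def)
                also have "\<dots> = W * (1 + real j) powr (- m) * ((exp (- (1 / 2) * \<bar>s - real j\<bar>) * exp (1 / 4 * \<bar>s - real j\<bar>)) * F s)"
                  by (simp only: mult_ac)
                also have "exp (- (1 / 2) * \<bar>s - real j\<bar>) * exp (1 / 4 * \<bar>s - real j\<bar>) = exp (- (1 / 4) * \<bar>s - real j\<bar>)"
                  by (simp add: exp_add[symmetric])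
                finally show ?thesis .
              qed
              then show "ennreal (G s powr (q / t) * h s)
                  \<le> ennreal (W * (1 + real j) powr (- m)) * (ennreal (exp (- (1 / 4) * \<bar>s - real j\<bar>) * F s) * indicator {0..} s)"
                using W by (cases "0 \<le> s") (auto simp: ennreal_mult[symmetric] h_def F_def intro!: ennreal_leI)
            qed
            also have "\<dots> = ennreal (W * (1 + real j) powr (- m)) * X j"
              unfolding X_def by (rule nn_integral_cmult) measurable
            also have "\<dots> = ennreal J"
              using W unfolding J_def by (subst X_real[symmetric]) (simp add: ennreal_mult)
            finally show "(\<integral>\<^sup>+s. ennreal (G s powr (q / t) * h s) \<partial>lborel) \<le> ennreal J" .
          qed (auto simp: G_def h_def indicator_def)
          have Gh_eq: "(\<integral>\<^sup>+s\<in>{0..}. ennreal (exp (- (1 / 2) * \<bar>s - real j\<bar>) * (1 + s) powr (t * recip P - 1) * weighted_mean P \<alpha> f s powr t * s) \<partial>lborel)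
              = (\<integral>\<^sup>+s. ennreal (G s * h s) \<partial>lborel)"
          proof (intro nn_integral_cong)
            fix s :: real
            show "ennreal (exp (- (1 / 2) * \<bar>s - real j\<bar>) * (1 + s) powr (t * recip P - 1) * weighted_mean P \<alpha> f s powr t * s) * indicator {0..} s = ennreal (G s * h s)"
            proof (cases "0 \<le> s")
              case True
              then have "(1 + s) powr (t * recip P - 1) = (1 + s) powr (t * \<rho>) / (1 + s)" by (simp add: \<rho>_def powr_diff)
              then show ?thesis using True by (simp add: G_def h_def U_def mult_ac)
            qed (simp add: h_def)
          qed
          have "ennreal (S powr t) \<le> ennreal C1 *
            (\<integral>\<^sup>+s\<in>{0..}. ennreal (exp (- (1 / 2) * \<bar>s - real j\<bar>) * (1 + s) powr (t * recip P - 1) * weighted_mean P \<alpha> f s powr t * s) \<partial>lborel)"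
            unfolding S_def by (rule C1(2)[OF f A wit])
          also have "\<dots> \<le> ennreal C1 * ennreal ((4 powr (q / t - 1) * J) powr (1 / (q / t)))"
            unfolding Gh_eq by (rule mult_left_mono[OF Gh]) simp
          finally have "S powr t \<le> C1 * (4 powr (q / t - 1) * J) powr (1 / (q / t))"
            using C1 by (subst (asm) ennreal_mult[symmetric]) (auto simp: ennreal_le_iff)
          then have "(S powr t) powr (q / t) \<le> (C1 * (4 powr (q / t - 1) * J) powr (1 / (q / t))) powr (q / t)"
            using t 2 by (intro powr_mono2) auto
          also have "\<dots> = C1 powr (q / t) * (4 powr (q / t - 1) * J)"
            using C1 J t 2 by (simp add: powr_mult powr_powr)
          finally have "S powr q \<le> C2 * (1 + real j) powr (- m) * enn2real (X j)"
            using t by (simp add: powr_powr C2_def J_def mult_ac)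
          then have "(1 + real j) powr m * S powr q \<le> (1 + real j) powr m * (C2 * (1 + real j) powr (- m) * enn2real (X j))"
            by (intro mult_left_mono) auto
          also have "\<dots> = C2 * enn2real (X j)" by (simp add: powr_minus field_simps)
          finally show ?thesis by (simp add: S_def)
        qed
        \<comment> \<open>Bounded overlap: at each s the weights exp(-|s - j|/4) of all rings add up
          to at most K.\<close>
        have X_sum: "(\<Sum>j<N. enn2real (X j)) \<le> K * B powr q"
        proof -
          have "ennreal (\<Sum>j<N. enn2real (X j)) = (\<Sum>j<N. X j)" by (simp add: sum_ennreal[symmetric] X_real)
          also have "\<dots> = (\<integral>\<^sup>+s. (\<Sum>j<N. ennreal (exp (- (1 / 4) * \<bar>s - real j\<bar>) * F s) * indicator {0..} s) \<partial>lborel)"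
            unfolding X_def by (rule nn_integral_sum[symmetric]) measurable
          also have "\<dots> \<le> (\<integral>\<^sup>+s. ennreal K * (ennreal (F s) * indicator {0..} s) \<partial>lborel)"
          proof (intro nn_integral_mono)
            fix s :: real
            have "(\<Sum>j<N. exp (- (1 / 4) * \<bar>s - real j\<bar>) * F s) \<le> K * F s" if "0 \<le> s"
              unfolding sum_distrib_right[symmetric] using that by (intro mult_right_mono K) (auto simp: F_def)
            then show "(\<Sum>j<N. ennreal (exp (- (1 / 4) * \<bar>s - real j\<bar>) * F s) * indicator {0..} s) \<le> ennreal K * (ennreal (F s) * indicator {0..} s)"
              using K by (cases "0 \<le> s") (auto simp: sum_ennreal F_def ennreal_mult[symmetric] intro!: ennreal_leI)
          qed
          also have "\<dots> = ennreal K * (\<integral>\<^sup>+s\<in>{0..}. ennreal (F s) \<partial>lborel)"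
            by (rule nn_integral_cmult) measurable
          also have "\<dots> \<le> ennreal K * ennreal (B powr q)" by (intro mult_left_mono FB) auto
          also have "\<dots> = ennreal (K * B powr q)" using K by (simp add: ennreal_mult)
          finally show ?thesis using K by (subst (asm) ennreal_le_iff) auto
        qed
        have "discrete_norm P Q (\<sigma> - \<rho> + recip Q) N A
            = (\<Sum>j<N. (1 + real j) powr m * lnorm P (lattice_ring j) A powr q) powr (1 / q)"
        proof -
          have "(\<sigma> - \<rho> + recip Q) * q = m" using 2 by (simp add: m_def field_simps)
          then show ?thesis using 2 unfolding discrete_norm_def 2(2)
            by (simp add: lnorm_ennreal powr_mult powr_powr lnorm_nonneg)
        qed
        also have "\<dots> \<le> (C2 * (K * B powr q)) powr (1 / q)"
        proof (intro powr_mono2)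
          have "(\<Sum>j<N. (1 + real j) powr m * lnorm P (lattice_ring j) A powr q) \<le> (\<Sum>j<N. C2 * enn2real (X j))"
            by (intro sum_mono ring)
          also have "\<dots> \<le> C2 * (K * B powr q)"
            unfolding sum_distrib_left[symmetric] using C2 by (intro mult_left_mono X_sum) auto
          finally show "(\<Sum>j<N. (1 + real j) powr m * lnorm P (lattice_ring j) A powr q) \<le> C2 * (K * B powr q)" .
        qed (use 2 in \<open>auto intro: sum_nonneg\<close>)
        also have "\<dots> = C * B" using C2 K real 2 by (simp add: C_def powr_mult powr_powr)
        finally show ?thesis using C real by (simp add: ennreal_mult[symmetric] ennreal_leI)
      qed (use C in \<open>simp add: ennreal_mult_top\<close>)
      then show "ennreal (discrete_norm P Q (\<sigma> - recip P + recip Q) N A) \<le> ennreal (C / radial_const \<alpha> Q) * fock_norm \<alpha> \<sigma> P Q f"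
        using C cont unfolding \<rho>_def U_def by (intro reduce) auto
    qed (use C R in simp)
  qed
qed

section \<open>Elementary properties of the norms\<close>

lemma weighted_mean_le:
  assumes f: "continuous_on UNIV f" and P: "0 < P"
    and le: "\<And>\<theta>. weighted_modulus \<alpha> f (of_real r * cis \<theta>) \<le> B"
  shows "weighted_mean P \<alpha> f r \<le> B"
  using P
proof (cases P rule: exponent_cases)
  case 1
  then show ?thesis using weighted_mean_top_le[OF le] by simp
next
  case (2 p)
  have B: "0 \<le> B" using le[of 0] order_trans[OF weighted_modulus_nonneg] by blast
  have "ennreal (weighted_mean P \<alpha> f r powr p) = ennreal (1 / (2 * pi)) * (\<integral>\<^sup>+\<theta>\<in>{0..2 * pi}. ennreal (weighted_modulus \<alpha> f (of_real r * cis \<theta>) powr p) \<partial>lborel)"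
    unfolding 2(2) by (rule weighted_mean_powr[OF f 2(1)])
  also have "\<dots> \<le> ennreal (1 / (2 * pi)) * (\<integral>\<^sup>+\<theta>. ennreal (B powr p) * indicator {0..2 * pi} \<theta> \<partial>lborel)"
    using 2 by (intro mult_left_mono nn_integral_mono mult_right_mono ennreal_leI powr_mono2 le) auto
  also have "\<dots> = ennreal (B powr p)"
    by (simp add: nn_integral_cmult ennreal_mult[symmetric])
  finally have "weighted_mean P \<alpha> f r powr p \<le> B powr p" by (simp add: ennreal_le_iff)
  then have "(weighted_mean P \<alpha> f r powr p) powr (1 / p) \<le> (B powr p) powr (1 / p)"
    by (rule powr_mono2[rotated 2]) (use 2 in auto)
  then show ?thesis using 2 B f by (simp add: powr_powr)
qed

lemma weighted_modulus_cmult: "weighted_modulus \<alpha> (\<lambda>z. c * f z) z = cmod c * weighted_modulus \<alpha> f z"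
  by (simp add: weighted_modulus_def norm_mult)

lemma weighted_mean_cmult_le:
  assumes f: "continuous_on UNIV f" and P: "0 < P"
  shows "weighted_mean P \<alpha> (\<lambda>z. c * f z) r \<le> cmod c * weighted_mean P \<alpha> f r"
  using P
proof (cases P rule: exponent_cases)
  case 1
  show ?thesis unfolding 1
    by (rule weighted_mean_top_le) (auto simp: weighted_modulus_cmult intro!: mult_left_mono weighted_modulus_le_mean_top f)
next
  case (2 p)
  have cf: "continuous_on UNIV (\<lambda>z. c * f z)" by (intro continuous_intros f)
  have [measurable]: "weighted_modulus \<alpha> f \<in> borel_measurable borel"
    by (intro borel_measurable_continuous_onI continuous_weighted_modulus f)
  have "ennreal (weighted_mean P \<alpha> (\<lambda>z. c * f z) r powr p)
      = ennreal (1 / (2 * pi)) * (\<integral>\<^sup>+\<theta>. ennreal (cmod c powr p) * (ennreal (weighted_modulus \<alpha> f (of_real r * cis \<theta>) powr p) * indicator {0..2 * pi} \<theta>) \<partial>lborel)"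
    unfolding 2(2) weighted_mean_powr[OF cf 2(1)]
    by (simp add: weighted_modulus_cmult powr_mult ennreal_mult mult.assoc)
  also have "\<dots> = ennreal (cmod c powr p) * ennreal (weighted_mean P \<alpha> f r powr p)"
    unfolding 2(2) weighted_mean_powr[OF f 2(1)] by (subst nn_integral_cmult) (auto simp: mult_ac)
  also have "\<dots> = ennreal ((cmod c * weighted_mean P \<alpha> f r) powr p)"
    using f by (simp add: ennreal_mult[symmetric] powr_mult)
  finally have "weighted_mean P \<alpha> (\<lambda>z. c * f z) r powr p = (cmod c * weighted_mean P \<alpha> f r) powr p"
    by simp
  then have "(weighted_mean P \<alpha> (\<lambda>z. c * f z) r powr p) powr (1 / p) = ((cmod c * weighted_mean P \<alpha> f r) powr p) powr (1 / p)"
    by simp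
  then show ?thesis using 2 f cf by (simp add: powr_powr)
qed

text \<open>For finite p, (x + y)^p \<le> 2^p (x^p + y^p) holds for every p > 0, so p < 1 is
  included. The constant is uniform in r, as the radial integral requires.\<close>

lemma weighted_mean_diff_le:
  assumes P: "0 < P"
  obtains K where "0 < K"
    "\<And>\<alpha> f g r. continuous_on UNIV f \<Longrightarrow> continuous_on UNIV g \<Longrightarrow>
      weighted_mean P \<alpha> (\<lambda>z. f z - g z) r \<le> K * (weighted_mean P \<alpha> f r + weighted_mean P \<alpha> g r)"
proof -
  have tri: "weighted_modulus \<alpha> (\<lambda>z. f z - g z) z \<le> weighted_modulus \<alpha> f z + weighted_modulus \<alpha> g z" for \<alpha> f g z
    unfolding weighted_modulus_def distrib_right[symmetric] by (intro mult_right_mono norm_triangle_ineq4) auto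
  from P show ?thesis
  proof (cases P rule: exponent_cases)
    case 1
    show ?thesis
    proof (rule that[of 1])
      fix \<alpha> r and f g :: "complex \<Rightarrow> complex" assume "continuous_on UNIV f" "continuous_on UNIV g"
      then show "weighted_mean P \<alpha> (\<lambda>z. f z - g z) r \<le> 1 * (weighted_mean P \<alpha> f r + weighted_mean P \<alpha> g r)"
        unfolding 1 by (auto intro!: weighted_mean_top_le order_trans[OF tri] add_mono weighted_modulus_le_mean_top)
    qed simp
  next
    case (2 p)
    show ?thesis
    proof (rule that[of "(2 powr (p + 1)) powr (1 / p)"])
      fix \<alpha> r and f g :: "complex \<Rightarrow> complex" assume f: "continuous_on UNIV f" and g: "continuous_on UNIV g"
      have fg: "continuous_on UNIV (\<lambda>z. f z - g z)" by (intro continuous_intros f g)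
      have [measurable]: "weighted_modulus \<alpha> f \<in> borel_measurable borel" "weighted_modulus \<alpha> g \<in> borel_measurable borel"
        by (intro borel_measurable_continuous_onI continuous_weighted_modulus f g)+
      define a where "a = weighted_mean P \<alpha> f r"
      define b where "b = weighted_mean P \<alpha> g r"
      have ab: "0 \<le> a" "0 \<le> b" using f g by (auto simp: a_def b_def)
      have pw: "(x + y) powr p \<le> 2 powr p * (x powr p + y powr p)" if "0 \<le> x" "0 \<le> y" for x y :: real
      proof -
        have "(x + y) powr p \<le> (2 * max x y) powr p" using that 2 by (intro powr_mono2) auto
        also have "\<dots> = 2 powr p * max x y powr p" using that by (simp add: powr_mult)
        also have "\<dots> \<le> 2 powr p * (x powr p + y powr p)" by (intro mult_left_mono) (auto simp: max_def)
        finally show ?thesis .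
      qed
      have "ennreal (weighted_mean P \<alpha> (\<lambda>z. f z - g z) r powr p)
        = ennreal (1 / (2 * pi)) * (\<integral>\<^sup>+\<theta>\<in>{0..2 * pi}. ennreal (weighted_modulus \<alpha> (\<lambda>z. f z - g z) (of_real r * cis \<theta>) powr p) \<partial>lborel)"
        unfolding 2(2) by (rule weighted_mean_powr[OF fg 2(1)])
      also have "\<dots> \<le> ennreal (1 / (2 * pi)) * (\<integral>\<^sup>+\<theta>. ennreal (2 powr p) * (ennreal (weighted_modulus \<alpha> f (of_real r * cis \<theta>) powr p) * indicator {0..2 * pi} \<theta>
            + ennreal (weighted_modulus \<alpha> g (of_real r * cis \<theta>) powr p) * indicator {0..2 * pi} \<theta>) \<partial>lborel)"
      proof (intro mult_left_mono nn_integral_mono)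
        fix \<theta>
        have "weighted_modulus \<alpha> (\<lambda>z. f z - g z) (of_real r * cis \<theta>) powr p
            \<le> (weighted_modulus \<alpha> f (of_real r * cis \<theta>) + weighted_modulus \<alpha> g (of_real r * cis \<theta>)) powr p"
          using 2 by (intro powr_mono2 tri) auto
        also have "\<dots> \<le> 2 powr p * (weighted_modulus \<alpha> f (of_real r * cis \<theta>) powr p + weighted_modulus \<alpha> g (of_real r * cis \<theta>) powr p)"
          by (intro pw) auto
        finally have "ennreal (weighted_modulus \<alpha> (\<lambda>z. f z - g z) (of_real r * cis \<theta>) powr p)
            \<le> ennreal (2 powr p) * (ennreal (weighted_modulus \<alpha> f (of_real r * cis \<theta>) powr p) + ennreal (weighted_modulus \<alpha> g (of_real r * cis \<theta>) powr p))"
          by (subst ennreal_plus[symmetric], simp, simp, subst ennreal_mult[symmetric]) (auto intro!: ennreal_leI)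
        then show "ennreal (weighted_modulus \<alpha> (\<lambda>z. f z - g z) (of_real r * cis \<theta>) powr p) * indicator {0..2 * pi} \<theta>
            \<le> ennreal (2 powr p) * (ennreal (weighted_modulus \<alpha> f (of_real r * cis \<theta>) powr p) * indicator {0..2 * pi} \<theta>
            + ennreal (weighted_modulus \<alpha> g (of_real r * cis \<theta>) powr p) * indicator {0..2 * pi} \<theta>)"
          by (auto simp: indicator_def)
      qed auto
      also have "\<dots> = ennreal (2 powr p) * (ennreal (a powr p) + ennreal (b powr p))"
        unfolding a_def b_def 2(2) weighted_mean_powr[OF f 2(1)] weighted_mean_powr[OF g 2(1)]
        by (subst nn_integral_cmult, measurable, subst nn_integral_add, measurable) (simp add: distrib_left mult_ac)
      also have "\<dots> = ennreal (2 powr p * (a powr p + b powr p))"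
        by (subst ennreal_plus[symmetric], simp, simp, subst ennreal_mult[symmetric]) auto
      finally have "weighted_mean P \<alpha> (\<lambda>z. f z - g z) r powr p \<le> 2 powr p * (a powr p + b powr p)"
        by (simp add: ennreal_le_iff)
      also have "\<dots> \<le> 2 powr p * ((a + b) powr p + (a + b) powr p)"
        using ab 2 by (intro mult_left_mono add_mono powr_mono2) auto
      also have "\<dots> = 2 powr (p + 1) * (a + b) powr p" by (simp add: powr_add)
      finally have "(weighted_mean P \<alpha> (\<lambda>z. f z - g z) r powr p) powr (1 / p) \<le> (2 powr (p + 1) * (a + b) powr p) powr (1 / p)"
        using 2 by (intro powr_mono2) auto
      also have "\<dots> = (2 powr (p + 1)) powr (1 / p) * ((a + b) powr p) powr (1 / p)" by (simp add: powr_mult)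
      also have "((a + b) powr p) powr (1 / p) = a + b" using ab 2 by (simp add: powr_powr)
      finally show "weighted_mean P \<alpha> (\<lambda>z. f z - g z) r \<le> (2 powr (p + 1)) powr (1 / p) * (weighted_mean P \<alpha> f r + weighted_mean P \<alpha> g r)"
        using 2 fg by (simp add: powr_powr a_def b_def)
    qed simp
  qed
qed

lemma ennreal_powr_mono: "0 \<le> a \<Longrightarrow> x \<le> y \<Longrightarrow> ennreal_powr x a \<le> ennreal_powr y a"
  by (cases x; cases y) (auto simp: ennreal_powr_def top_unique ennreal_le_iff intro!: ennreal_leI powr_mono2)

lemma radial_norm_le_cmult:
  assumes Q: "0 < Q" and c: "0 < c" and V: "V \<in> borel_measurable borel"
    and nn: "\<And>r. 0 \<le> V' r" "\<And>r. 0 \<le> V r" and le: "\<And>r. 0 \<le> r \<Longrightarrow> V' r \<le> c * V r"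
  shows "radial_norm \<sigma> Q {0..} V' \<le> ennreal c * radial_norm \<sigma> Q {0..} V"
  using Q
proof (cases Q rule: exponent_cases)
  case 1
  show ?thesis unfolding 1 radial_norm_top
  proof (rule SUP_least)
    fix r :: real assume r: "r \<in> {0..}"
    have "V' r * (1 + r) powr \<sigma> \<le> c * V r * (1 + r) powr \<sigma>" using r by (intro mult_right_mono le) auto
    then have "ennreal (V' r * (1 + r) powr \<sigma>) \<le> ennreal c * ennreal (V r * (1 + r) powr \<sigma>)"
      using c nn by (subst ennreal_mult[symmetric]) (auto intro!: ennreal_leI simp: mult_ac)
    also have "\<dots> \<le> ennreal c * (SUP r\<in>{0..}. ennreal (V r * (1 + r) powr \<sigma>))"
      using r by (intro mult_left_mono SUP_upper) auto
    finally show "ennreal (V' r * (1 + r) powr \<sigma>) \<le> \<dots>" .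
  qed
next
  case (2 q)
  note [measurable] = V
  have "(\<integral>\<^sup>+r\<in>{0..}. ennreal ((V' r * (1 + r) powr \<sigma>) powr q * r) \<partial>lborel)
    \<le> (\<integral>\<^sup>+r. ennreal (c powr q) * (ennreal ((V r * (1 + r) powr \<sigma>) powr q * r) * indicator {0..} r) \<partial>lborel)"
  proof (intro nn_integral_mono)
    fix r :: real
    have "(V' r * (1 + r) powr \<sigma>) powr q * r \<le> c powr q * ((V r * (1 + r) powr \<sigma>) powr q * r)" if r: "0 \<le> r"
    proof -
      have "V' r * (1 + r) powr \<sigma> \<le> c * V r * (1 + r) powr \<sigma>" using r by (intro mult_right_mono le) auto
      then have "(V' r * (1 + r) powr \<sigma>) powr q \<le> (c * V r * (1 + r) powr \<sigma>) powr q"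
        using 2 nn by (intro powr_mono2) auto
      also have "\<dots> = c powr q * (V r * (1 + r) powr \<sigma>) powr q" using c nn by (simp add: powr_mult mult.assoc)
      finally show ?thesis using r by (simp add: mult.assoc[symmetric] mult_right_mono)
    qed
    then show "ennreal ((V' r * (1 + r) powr \<sigma>) powr q * r) * indicator {0..} r
      \<le> ennreal (c powr q) * (ennreal ((V r * (1 + r) powr \<sigma>) powr q * r) * indicator {0..} r)"
      by (cases "0 \<le> r") (auto simp: ennreal_mult[symmetric] intro!: ennreal_leI)
  qed
  also have "\<dots> = ennreal (c powr q) * (\<integral>\<^sup>+r\<in>{0..}. ennreal ((V r * (1 + r) powr \<sigma>) powr q * r) \<partial>lborel)"
    by (rule nn_integral_cmult) measurable
  finally have "radial_norm \<sigma> Q {0..} V' \<le> ennreal_powr \<dots> (1 / q)"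
    using 2 by (simp add: radial_norm_ennreal ennreal_powr_mono)
  also have "\<dots> = ennreal c * radial_norm \<sigma> Q {0..} V"
    using 2 c by (subst ennreal_powr_cmult) (auto simp: radial_norm_ennreal powr_powr)
  finally show ?thesis .
qed

text \<open>Completing the square. A Gaussian of any width thus meets the exponential decay that the
  lattice estimates ask for.\<close>

lemma gaussian_le_exp:
  fixes c x :: real
  assumes "0 < c"
  shows "exp (- c * x\<^sup>2) \<le> exp (1 / (4 * c)) * exp (- x)"
proof -
  have "0 \<le> c * (x - 1 / (2 * c))\<^sup>2" using assms by simp
  also have "c * (x - 1 / (2 * c))\<^sup>2 = c * x\<^sup>2 - x + 1 / (4 * c)"
    using assms by (simp add: power2_eq_square field_simps)
  finally show ?thesis by (simp add: exp_add[symmetric])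
qed

text \<open>A Gaussian bound of smaller exponent is dominated by a lattice sum with a single term:
  \<open>lattice_disc 1\<close> contains only the origin, its defining inequality being strict. The
  1 added to D makes the constant positive.\<close>

lemma fock_norm_le_gaussian:
  assumes \<alpha>': "\<alpha>' < \<alpha>" and \<alpha>: "0 < \<alpha>" and P: "0 < P" and Q: "0 < Q"
  obtains C where "0 < C"
    "\<And>f B. continuous_on UNIV f \<Longrightarrow> 0 \<le> B \<Longrightarrow> (\<And>z. cmod (f z) \<le> B * exp (\<alpha>' / 2 * (cmod z)\<^sup>2)) \<Longrightarrow>
      fock_norm \<alpha> \<sigma> P Q f \<le> ennreal (C * B)"
proof -
  obtain C where C: "0 < C"
    "\<And>f N a. continuous_on UNIV f \<Longrightarrow> (\<And>k. 0 \<le> a k) \<Longrightarrow>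
      (\<And>z. weighted_modulus \<alpha> f z \<le> (\<Sum>k\<in>lattice_disc N. exp (- 1 * cmod (z - lattice_point k)) * a k)) \<Longrightarrow>
      fock_norm \<alpha> \<sigma> P Q f \<le> ennreal (C * discrete_norm P Q (\<sigma> - recip P + recip Q) N a)"
    using fock_norm_synthesis[OF \<alpha> P Q zero_less_one] by blast
  define c where "c = (\<alpha> - \<alpha>') / 2"
  have c: "0 < c" using \<alpha>' by (simp add: c_def)
  define E where "E = exp (1 / (4 * c))"
  define D where "D = discrete_norm P Q (\<sigma> - recip P + recip Q) 1 (\<lambda>_. 1)"
  have "0 \<le> D" by (simp add: D_def)
  have origin: "lattice_point (0, 0) = 0" by (simp add: lattice_point_def complex_eq_iff)
  show ?thesis
  proof (rule that[of "C * E * (D + 1)"])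
    fix f B assume f: "continuous_on UNIV f" and B: "0 \<le> (B::real)" and le: "\<And>z. cmod (f z) \<le> B * exp (\<alpha>' / 2 * (cmod z)\<^sup>2)"
    have "fock_norm \<alpha> \<sigma> P Q f \<le> ennreal (C * discrete_norm P Q (\<sigma> - recip P + recip Q) 1 (\<lambda>k. (E * B) * 1))"
    proof (rule C(2)[OF f])
      fix z
      have "weighted_modulus \<alpha> f z \<le> B * exp (\<alpha>' / 2 * (cmod z)\<^sup>2) * exp (- (\<alpha> / 2) * (cmod z)\<^sup>2)"
        unfolding weighted_modulus_def by (intro mult_right_mono le) auto
      also have "\<dots> = B * exp (- c * (cmod z)\<^sup>2)"
        by (simp add: c_def mult.assoc exp_add[symmetric] field_simps)
      also have "\<dots> \<le> B * (E * exp (- cmod z))"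
        unfolding E_def by (intro mult_left_mono gaussian_le_exp c B)
      also have "\<dots> = exp (- 1 * cmod (z - lattice_point (0, 0))) * (E * B * 1)"
        by (simp add: origin mult_ac)
      also have "\<dots> \<le> (\<Sum>k\<in>lattice_disc 1. exp (- 1 * cmod (z - lattice_point k)) * (E * B * 1))"
        by (rule member_le_sum[where f = "\<lambda>k. exp (- 1 * cmod (z - lattice_point k)) * (E * B * 1)"])
          (use B origin in \<open>auto simp: E_def\<close>, simp add: lattice_disc_def)
      finally show "weighted_modulus \<alpha> f z \<le> \<dots>" .
    qed (use B in \<open>auto simp: E_def\<close>)
    also have "discrete_norm P Q (\<sigma> - recip P + recip Q) 1 (\<lambda>k. (E * B) * 1) = E * B * D"
      unfolding D_def by (rule discrete_norm_cmult) (use P Q B in \<open>auto simp: E_def\<close>)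
    also have "ennreal (C * (E * B * D)) \<le> ennreal (C * E * (D + 1) * B)"
      using C B by (intro ennreal_leI) (simp add: algebra_simps E_def)
    finally show "fock_norm \<alpha> \<sigma> P Q f \<le> ennreal (C * E * (D + 1) * B)" .
  qed (use C \<open>0 \<le> D\<close> in \<open>auto simp: E_def\<close>)
qed

lemma fock_norm_zero:
  assumes "0 < \<alpha>" "0 < P" "0 < Q" shows "fock_norm \<alpha> \<sigma> P Q (\<lambda>z. 0) = 0"
proof -
  have "0 < \<alpha>" by fact
  then obtain C where "0 < C"
    "\<And>f B. continuous_on UNIV f \<Longrightarrow> 0 \<le> B \<Longrightarrow> (\<And>z. cmod (f z) \<le> B * exp (0 / 2 * (cmod z)\<^sup>2)) \<Longrightarrow>
      fock_norm \<alpha> \<sigma> P Q f \<le> ennreal (C * B)"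
    using fock_norm_le_gaussian[of 0 \<alpha> P Q \<sigma>] assms by blast
  from this(2)[of "\<lambda>z. 0" 0] show ?thesis by simp
qed

lemma fock_norm_cmult_le:
  assumes \<alpha>: "0 < \<alpha>" and P: "0 < P" and Q: "0 < Q" and f: "continuous_on UNIV f"
  shows "fock_norm \<alpha> \<sigma> P Q (\<lambda>z. c * f z) \<le> ennreal (cmod c) * fock_norm \<alpha> \<sigma> P Q f"
proof (cases "c = 0")
  case True
  then show ?thesis using fock_norm_zero[OF \<alpha> P Q] by simp
next
  case False
  have cf: "continuous_on UNIV (\<lambda>z. c * f z)" by (intro continuous_intros f)
  have "radial_norm \<sigma> Q {0..} (weighted_mean P \<alpha> (\<lambda>z. c * f z)) \<le> ennreal (cmod c) * radial_norm \<sigma> Q {0..} (weighted_mean P \<alpha> f)"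
    by (rule radial_norm_le_cmult[OF Q])
      (use False f cf in \<open>auto intro: weighted_mean_cmult_le[OF f P] weighted_mean_measurable[OF f P]\<close>)
  then have "ennreal (radial_const \<alpha> Q) * radial_norm \<sigma> Q {0..} (weighted_mean P \<alpha> (\<lambda>z. c * f z))
      \<le> ennreal (radial_const \<alpha> Q) * (ennreal (cmod c) * radial_norm \<sigma> Q {0..} (weighted_mean P \<alpha> f))"
    by (rule mult_left_mono) simp
  then show ?thesis unfolding fock_norm_radial[OF cf \<alpha> P Q] fock_norm_radial[OF f \<alpha> P Q] by (simp only: mult.left_commute)
qed

text \<open>As \<alpha> = \<beta> \<tau>^2, the Gaussian weights agree after s = \<tau> r. Only the
  polynomial weight changes, and (1 + \<tau> r)^\<sigma> is at most a constant times (1 +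
  r)^\<sigma>. Applied with 1/\<tau> the same bound gives the reverse comparison.\<close>

lemma fock_norm_dilation_le:
  assumes \<alpha>: "0 < \<alpha>" and \<beta>: "0 < \<beta>" and \<tau>: "0 < \<tau>" "\<alpha> = \<beta> * \<tau>\<^sup>2" and P: "0 < P" and Q: "0 < Q"
  obtains C where "0 < C"
    "\<And>g. continuous_on UNIV g \<Longrightarrow> fock_norm \<beta> \<sigma> P Q g \<le> ennreal C * fock_norm \<alpha> \<sigma> P Q (dilation \<tau> g)"
proof -
  \<comment> \<open>The first factor serves \<sigma> \<ge> 0, the second \<sigma> < 0; both are at
    least 1, so the product dominates each.\<close>
  define M where "M = max 1 \<tau> powr \<bar>\<sigma>\<bar> * (1 / min 1 \<tau>) powr \<bar>\<sigma>\<bar>"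
  have "1 \<le> max 1 \<tau> powr \<bar>\<sigma>\<bar>" "1 \<le> (1 / min 1 \<tau>) powr \<bar>\<sigma>\<bar>"
    using \<tau> by (auto intro!: ge_one_powr_ge_zero)
  then have M: "max 1 \<tau> powr \<bar>\<sigma>\<bar> \<le> M" "(1 / min 1 \<tau>) powr \<bar>\<sigma>\<bar> \<le> M" "0 < M"
    unfolding M_def using mult_left_mono[of 1 _ "max 1 \<tau> powr \<bar>\<sigma>\<bar>"] mult_right_mono[of 1 _ "(1 / min 1 \<tau>) powr \<bar>\<sigma>\<bar>"] \<tau> by auto
  have weight: "(1 + \<tau> * r) powr \<sigma> \<le> M * (1 + r) powr \<sigma>" if r: "0 \<le> r" for r
  proof (cases "0 \<le> \<sigma>")
    case True
    have "1 * r \<le> max 1 \<tau> * r" "\<tau> * r \<le> max 1 \<tau> * r" using r by (intro mult_right_mono; simp)+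
    then have "1 + \<tau> * r \<le> max 1 \<tau> * (1 + r)" unfolding distrib_left by (intro add_mono) auto
    then have "(1 + \<tau> * r) powr \<sigma> \<le> (max 1 \<tau> * (1 + r)) powr \<sigma>"
      using True r \<tau> by (intro powr_mono2) auto
    also have "\<dots> = max 1 \<tau> powr \<bar>\<sigma>\<bar> * (1 + r) powr \<sigma>" using True r by (simp add: powr_mult)
    finally show ?thesis using M by (meson mult_right_mono order_trans powr_ge_zero)
  next
    case False
    have "min 1 \<tau> * r \<le> \<tau> * r" using r by (intro mult_right_mono) auto
    then have "min 1 \<tau> * (1 + r) \<le> 1 + \<tau> * r" unfolding distrib_left by (intro add_mono) auto
    then have "(1 + \<tau> * r) powr \<sigma> \<le> (min 1 \<tau> * (1 + r)) powr \<sigma>"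
      using False r \<tau> by (intro powr_mono2') auto
    also have "\<dots> = (1 / min 1 \<tau>) powr \<bar>\<sigma>\<bar> * (1 + r) powr \<sigma>"
      using False r \<tau> by (simp add: powr_mult powr_divide powr_minus_divide[symmetric])
    finally show ?thesis using M by (meson mult_right_mono order_trans powr_ge_zero)
  qed
  \<comment> \<open>The power of \<tau> comes from the q-th root of s ds = \<tau>^2 r dr; for
    infinite Q it equals 1, so that C = 2 M.\<close>
  define C where "C = M * (1 + \<tau> powr (2 * recip Q))"
  have C: "0 < C" unfolding C_def using M by (intro mult_pos_pos add_pos_nonneg) auto
  show ?thesis
  proof (rule that[of "radial_const \<beta> Q * C / radial_const \<alpha> Q"])
    fix g :: "complex \<Rightarrow> complex" assume g: "continuous_on UNIV g"
    have Dg: "continuous_on UNIV (dilation \<tau> g)"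
      unfolding dilation_def by (intro continuous_on_compose2[OF g] continuous_intros) auto
    define V where "V = weighted_mean P \<beta> g"
    have [measurable]: "V \<in> borel_measurable borel" unfolding V_def by (rule weighted_mean_measurable[OF g P])
    have V0: "0 \<le> V r" for r using g by (simp add: V_def)
    have mean: "weighted_mean P \<alpha> (dilation \<tau> g) = (\<lambda>r. V (\<tau> * r))"
      by (simp add: fun_eq_iff V_def weighted_mean_def integral_mean_def dilation_def \<tau>(2) power_mult_distrib mult.assoc)
    have main: "radial_norm \<sigma> Q {0..} V \<le> ennreal C * radial_norm \<sigma> Q {0..} (\<lambda>r. V (\<tau> * r))"
      using Q
    proof (cases Q rule: exponent_cases)
      case 1
      have CM: "C = M * 2" using \<tau>(1) by (simp add: C_def 1)
      show ?thesis unfolding 1 radial_norm_top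
      proof (rule SUP_least)
        fix s :: real assume s: "s \<in> {0..}"
        define r where "r = s / \<tau>"
        have r: "0 \<le> r" "s = \<tau> * r" using s \<tau> by (auto simp: r_def)
        have "V s * (1 + s) powr \<sigma> \<le> V (\<tau> * r) * (M * (1 + r) powr \<sigma>)"
          unfolding r(2) by (intro mult_left_mono weight r V0)
        also have "\<dots> \<le> V (\<tau> * r) * (C * (1 + r) powr \<sigma>)"
          unfolding CM using M V0 by (intro mult_left_mono mult_right_mono) auto
        finally have "ennreal (V s * (1 + s) powr \<sigma>) \<le> ennreal C * ennreal (V (\<tau> * r) * (1 + r) powr \<sigma>)"
          using C V0 by (subst ennreal_mult[symmetric]) (auto intro!: ennreal_leI simp: mult_ac)
        also have "\<dots> \<le> ennreal C * (SUP r\<in>{0..}. ennreal (V (\<tau> * r) * (1 + r) powr \<sigma>))"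
          using r by (intro mult_left_mono SUP_upper) auto
        finally show "ennreal (V s * (1 + s) powr \<sigma>) \<le> \<dots>" .
      qed
    next
      case (2 q)
      have "(\<integral>\<^sup>+s\<in>{0..}. ennreal ((V s * (1 + s) powr \<sigma>) powr q * s) \<partial>lborel)
        = ennreal \<tau> * (\<integral>\<^sup>+r. ennreal ((V (\<tau> * r) * (1 + \<tau> * r) powr \<sigma>) powr q * (\<tau> * r)) * indicator {0..} (\<tau> * r) \<partial>lborel)"
        using \<tau> by (subst nn_integral_real_affine[where c = \<tau> and t = 0]) auto
      also have "\<dots> \<le> ennreal \<tau> * (\<integral>\<^sup>+r. ennreal (\<tau> * M powr q) * (ennreal ((V (\<tau> * r) * (1 + r) powr \<sigma>) powr q * r) * indicator {0..} r) \<partial>lborel)"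
      proof (intro mult_left_mono nn_integral_mono)
        fix r :: real
        have "(V (\<tau> * r) * (1 + \<tau> * r) powr \<sigma>) powr q * (\<tau> * r) \<le> \<tau> * M powr q * ((V (\<tau> * r) * (1 + r) powr \<sigma>) powr q * r)" if r: "0 \<le> r"
        proof -
          have "V (\<tau> * r) * (1 + \<tau> * r) powr \<sigma> \<le> V (\<tau> * r) * (M * (1 + r) powr \<sigma>)"
            by (intro mult_left_mono weight r V0)
          then have "(V (\<tau> * r) * (1 + \<tau> * r) powr \<sigma>) powr q \<le> (V (\<tau> * r) * (M * (1 + r) powr \<sigma>)) powr q"
            using V0 2 by (intro powr_mono2) auto
          also have "\<dots> = M powr q * (V (\<tau> * r) * (1 + r) powr \<sigma>) powr q"
            using M V0 by (simp add: powr_mult mult_ac)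
          finally have "(V (\<tau> * r) * (1 + \<tau> * r) powr \<sigma>) powr q * (\<tau> * r) \<le> M powr q * (V (\<tau> * r) * (1 + r) powr \<sigma>) powr q * (\<tau> * r)"
            using r \<tau> by (intro mult_right_mono) auto
          then show ?thesis by (simp only: mult_ac)
        qed
        then show "ennreal ((V (\<tau> * r) * (1 + \<tau> * r) powr \<sigma>) powr q * (\<tau> * r)) * indicator {0..} (\<tau> * r)
          \<le> ennreal (\<tau> * M powr q) * (ennreal ((V (\<tau> * r) * (1 + r) powr \<sigma>) powr q * r) * indicator {0..} r)"
          using \<tau> by (cases "0 \<le> r") (auto simp: ennreal_mult[symmetric] indicator_def zero_le_mult_iff intro!: ennreal_leI)
      qed auto
      also have "\<dots> = ennreal ((M * \<tau> powr (2 / q)) powr q) * (\<integral>\<^sup>+r\<in>{0..}. ennreal ((V (\<tau> * r) * (1 + r) powr \<sigma>) powr q * r) \<partial>lborel)"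
      proof -
        have "ennreal \<tau> * (ennreal (\<tau> * M powr q) * x) = ennreal ((M * \<tau> powr (2 / q)) powr q) * x" for x
        proof -
          have "(M * \<tau> powr (2 / q)) powr q = \<tau> * (\<tau> * M powr q)"
            using M \<tau> 2 by (simp add: powr_mult powr_powr powr_numeral power2_eq_square mult_ac)
          then show ?thesis using \<tau> by (simp add: ennreal_mult mult.assoc)
        qed
        then show ?thesis by (subst nn_integral_cmult) auto
      qed
      finally have "radial_norm \<sigma> Q {0..} V \<le> ennreal_powr \<dots> (1 / q)"
        using 2 by (simp add: radial_norm_ennreal ennreal_powr_mono)
      also have "\<dots> = ennreal (M * \<tau> powr (2 / q)) * radial_norm \<sigma> Q {0..} (\<lambda>r. V (\<tau> * r))"
        using 2 M \<tau> by (subst ennreal_powr_cmult) (auto simp: radial_norm_ennreal powr_powr)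
      also have "\<dots> \<le> ennreal C * radial_norm \<sigma> Q {0..} (\<lambda>r. V (\<tau> * r))"
        using M 2 by (intro mult_right_mono ennreal_leI) (auto simp: C_def)
      finally show ?thesis .
    qed
    have R: "0 < radial_const \<alpha> Q" "0 < radial_const \<beta> Q" using radial_const_pos \<alpha> \<beta> Q by auto
    have "fock_norm \<beta> \<sigma> P Q g \<le> ennreal (radial_const \<beta> Q) * (ennreal C * radial_norm \<sigma> Q {0..} (\<lambda>r. V (\<tau> * r)))"
      unfolding fock_norm_radial[OF g \<beta> P Q] V_def[symmetric] by (intro mult_left_mono main) auto
    also have "\<dots> = ennreal (radial_const \<beta> Q * C / radial_const \<alpha> Q) * fock_norm \<alpha> \<sigma> P Q (dilation \<tau> g)"
      unfolding fock_norm_radial[OF Dg \<alpha> P Q] mean mult.assoc[symmetric]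
      using R C by (simp add: ennreal_mult[symmetric])
    finally show "fock_norm \<beta> \<sigma> P Q g \<le> \<dots>" .
  qed (use C radial_const_pos \<alpha> \<beta> Q in auto)
qed

section \<open>The Gaussian pairing\<close>

text \<open>The positive part of 1/P - 1 minus the reciprocal of the conjugate exponent is 1/P - 1
  in each of the cases P infinite, P \<le> 1, P > 1; the claim is the difference of this identity
  for P and for Q. The right side is the negative of the weight of the sequence norm for \<sigma> =
  0.\<close>

lemma sigma_exponent_duality:
  assumes "0 < P" "0 < Q"
  shows "sigma_exponent P Q - recip (conj_exponent P) + recip (conj_exponent Q) = recip P - recip Q"
proof -
  have "pos_part (recip P - 1) - recip (conj_exponent P) = recip P - 1" if "0 < P" for P
    using that
  proof (cases P rule: exponent_cases)
    case 1
    have "recip 1 = 1" using recip_ennreal[of 1] by simp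
    then show ?thesis using 1 by (simp add: pos_part_def)
  next
    case (2 p)
    show ?thesis
    proof (cases "p \<le> 1")
      case True
      then show ?thesis using 2 by (simp add: conj_exponent_def ennreal_le_1 pos_part_def)
    next
      case False
      then have "1 / p < 1" using 2 by simp
      then show ?thesis using False 2 by (simp add: conj_exponent_ennreal pos_part_def field_simps)
    qed
  qed
  from this[OF assms(1)] this[OF assms(2)] show ?thesis by (simp add: sigma_exponent_def)
qed

text \<open>Compactness of the discs. By \<open>lattice_near\<close> the discs cover the plane, so
  these maxima control the function everywhere.\<close>

lemma cell_maximum:
  assumes f: "continuous_on UNIV f"
  obtains v where "\<And>k. cmod (v k - lattice_point k) \<le> 1"
    "\<And>k z. cmod (z - lattice_point k) \<le> 1 \<Longrightarrow> weighted_modulus \<alpha> f z \<le> weighted_modulus \<alpha> f (v k)"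
proof -
  have "\<exists>v. cmod (v - lattice_point k) \<le> 1 \<and> (\<forall>z. cmod (z - lattice_point k) \<le> 1 \<longrightarrow> weighted_modulus \<alpha> f z \<le> weighted_modulus \<alpha> f v)" for k
  proof -
    have "continuous_on (cball (lattice_point k) 1) (weighted_modulus \<alpha> f)"
      by (rule continuous_on_subset[OF continuous_weighted_modulus[OF f]]) simp
    then obtain v where "v \<in> cball (lattice_point k) 1" "\<forall>z\<in>cball (lattice_point k) 1. weighted_modulus \<alpha> f z \<le> weighted_modulus \<alpha> f v"
      using continuous_attains_sup[of "cball (lattice_point k) 1" "weighted_modulus \<alpha> f"] by (auto simp: compact_cball)
    then show ?thesis by (intro exI[of _ v]) (auto simp: dist_norm norm_minus_commute)
  qed
  then show ?thesis using that by metis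
qed

text \<open>Hoelder's inequality inside each ring, then over the ring index, where the opposite
  weights cancel.\<close>

lemma discrete_holder:
  assumes P: "0 < P" and Q: "0 < Q" and nn: "\<And>k. 0 \<le> a k" "\<And>k. 0 \<le> b k"
  shows "(\<Sum>k\<in>lattice_disc N. a k * b k) \<le> discrete_norm P Q w N a * discrete_norm (conj_exponent P) (conj_exponent Q) (- w) N b"
proof -
  have "(\<Sum>k\<in>lattice_disc N. a k * b k) \<le> (\<Sum>j<N. lnorm P (lattice_ring j) a * lnorm (conj_exponent P) (lattice_ring j) b)"
    unfolding sum_lattice_disc by (intro sum_mono lnorm_holder P nn) simp
  also have "\<dots> = (\<Sum>j<N. ((1 + real j) powr w * lnorm P (lattice_ring j) a) * ((1 + real j) powr (- w) * lnorm (conj_exponent P) (lattice_ring j) b))"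
  proof (intro sum.cong refl)
    fix j
    have "(1 + real j) powr w * (1 + real j) powr (- w) = 1" by (simp add: powr_add[symmetric])
    then show "lnorm P (lattice_ring j) a * lnorm (conj_exponent P) (lattice_ring j) b
      = ((1 + real j) powr w * lnorm P (lattice_ring j) a) * ((1 + real j) powr (- w) * lnorm (conj_exponent P) (lattice_ring j) b)"
      by (metis (no_types, lifting) mult.assoc mult.commute mult_1)
  qed
  also have "\<dots> \<le> discrete_norm P Q w N a * discrete_norm (conj_exponent P) (conj_exponent Q) (- w) N b"
    unfolding discrete_norm_def by (rule lnorm_holder) (use Q in \<open>auto simp: lnorm_nonneg\<close>)
  finally show ?thesis .
qed

text \<open>Extremals are taken in two stages, inside each ring and over the ring index, and
  multiplied. The factor (1 + j)^(-w) in s cancels the weight of the norm, and the same factor is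
  part of the sequence against which d is extremal.\<close>

lemma discrete_extremal:
  assumes P: "0 < P" and Q: "0 < Q" and nn: "\<And>k. 0 \<le> b k"
  obtains c where "\<And>k. 0 \<le> c k" "discrete_norm P Q w N c \<le> 1"
    "(\<Sum>k\<in>lattice_disc N. c k * b k) = discrete_norm (conj_exponent P) (conj_exponent Q) (- w) N b"
proof -
  define S where "S j = lnorm (conj_exponent P) (lattice_ring j) b" for j
  have "\<exists>c. (\<forall>k. 0 \<le> c k) \<and> lnorm P (lattice_ring j) c \<le> 1 \<and> (\<Sum>k\<in>lattice_ring j. c k * b k) = S j" for j
    unfolding S_def by (rule lnorm_extremal[of "lattice_ring j" P b]) (use P nn in auto)
  then obtain c where c: "\<And>j k. 0 \<le> c j k" "\<And>j. lnorm P (lattice_ring j) (c j) \<le> 1" "\<And>j. (\<Sum>k\<in>lattice_ring j. c j k * b k) = S j"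
    by metis
  obtain d where d: "\<And>j. 0 \<le> d j" "lnorm Q {..<N} d \<le> 1"
    "(\<Sum>j<N. d j * ((1 + real j) powr (- w) * S j)) = lnorm (conj_exponent Q) {..<N} (\<lambda>j. (1 + real j) powr (- w) * S j)"
    by (rule lnorm_extremal[of "{..<N}" Q "\<lambda>j. (1 + real j) powr (- w) * S j"]) (use Q in \<open>auto simp: S_def lnorm_nonneg\<close>)
  define s where "s j = d j * (1 + real j) powr (- w)" for j
  have s0: "0 \<le> s j" for j using d by (simp add: s_def)
  \<comment> \<open>The index of the ring of k. Each lattice point lies in exactly one ring, so the
    local extremals glue to a single function.\<close>
  define J where "J k = nat \<lfloor>cmod (lattice_point k)\<rfloor>" for k
  have J: "J k = j" if "k \<in> lattice_ring j" for k j using that by (simp add: lattice_ring_def J_def)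
  define a where "a k = s (J k) * c (J k) k" for k
  show ?thesis
  proof (rule that[of a])
    show "0 \<le> a k" for k using s0 c by (simp add: a_def)
    have ring: "lnorm P (lattice_ring j) a = s j * lnorm P (lattice_ring j) (c j)" for j
    proof -
      have "lnorm P (lattice_ring j) a = lnorm P (lattice_ring j) (\<lambda>k. s j * c j k)"
        using P s0 c by (intro antisym lnorm_mono) (auto simp: a_def J)
      then show ?thesis using P s0 c by (simp add: lnorm_cmult)
    qed
    have "discrete_norm P Q w N a \<le> lnorm Q {..<N} d"
      unfolding discrete_norm_def
    proof (rule lnorm_mono)
      fix j
      have "(1 + real j) powr w * lnorm P (lattice_ring j) a = d j * ((1 + real j) powr w * (1 + real j) powr (- w)) * lnorm P (lattice_ring j) (c j)"
        by (simp add: ring s_def)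
      also have "(1 + real j) powr w * (1 + real j) powr (- w) = 1" by (simp add: powr_add[symmetric])
      also have "d j * 1 * lnorm P (lattice_ring j) (c j) \<le> d j"
        using mult_left_mono[OF c(2)[of j] d(1)[of j]] by simp
      finally show "(1 + real j) powr w * lnorm P (lattice_ring j) a \<le> d j" .
    qed (use Q in \<open>auto simp: lnorm_nonneg\<close>)
    then show "discrete_norm P Q w N a \<le> 1" using d by simp
    have "(\<Sum>k\<in>lattice_disc N. a k * b k) = (\<Sum>j<N. s j * S j)"
      unfolding sum_lattice_disc c(3)[symmetric] sum_distrib_left
      by (intro sum.cong refl) (simp add: a_def J mult.assoc)
    then show "(\<Sum>k\<in>lattice_disc N. a k * b k) = discrete_norm (conj_exponent P) (conj_exponent Q) (- w) N b"
      using d(3) by (simp add: discrete_norm_def s_def S_def mult.assoc)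
  qed
qed

text \<open>The modulus of the integrand is the product of the two weighted moduli. On each unit
  disc it is at most the product of the cell maxima, and pi is the area of the disc; overlaps of the
  covering discs only enlarge the upper bound. The sum of the products is then left to
  \<open>discrete_holder\<close>.\<close>

lemma pairing_bound:
  assumes \<alpha>: "0 < \<alpha>" and P: "0 < P" and Q: "0 < Q"
  obtains C where "0 < C"
    "\<And>f g. f holomorphic_on UNIV \<Longrightarrow> g holomorphic_on UNIV \<Longrightarrow>
      (\<integral>\<^sup>+z. ennreal (cmod (gauss_integrand \<alpha> f g z)) \<partial>lborel)
        \<le> ennreal C * fock_norm \<alpha> 0 P Q f * fock_norm \<alpha> (sigma_exponent P Q) (conj_exponent P) (conj_exponent Q) g"
proof -
  obtain C1 where C1: "0 < C1"
    "\<And>f N A. f holomorphic_on UNIV \<Longrightarrow> (\<And>k. 0 \<le> A k) \<Longrightarrow>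
      (\<And>k. \<exists>z. cmod (z - lattice_point k) \<le> 1 \<and> A k \<le> weighted_modulus \<alpha> f z) \<Longrightarrow>
      ennreal (discrete_norm P Q (0 - recip P + recip Q) N A) \<le> ennreal C1 * fock_norm \<alpha> 0 P Q f"
    using discrete_norm_le_fock_norm[OF \<alpha> P Q] by blast
  obtain C2 where C2: "0 < C2"
    "\<And>f N A. f holomorphic_on UNIV \<Longrightarrow> (\<And>k. 0 \<le> A k) \<Longrightarrow>
      (\<And>k. \<exists>z. cmod (z - lattice_point k) \<le> 1 \<and> A k \<le> weighted_modulus \<alpha> f z) \<Longrightarrow>
      ennreal (discrete_norm (conj_exponent P) (conj_exponent Q) (sigma_exponent P Q - recip (conj_exponent P) + recip (conj_exponent Q)) N A)
        \<le> ennreal C2 * fock_norm \<alpha> (sigma_exponent P Q) (conj_exponent P) (conj_exponent Q) f"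
    using discrete_norm_le_fock_norm[OF \<alpha> conj_exponent_pos[OF P] conj_exponent_pos[OF Q]] by blast
  define w where "w = 0 - recip P + recip Q"
  have w: "sigma_exponent P Q - recip (conj_exponent P) + recip (conj_exponent Q) = - w"
    using sigma_exponent_duality[OF P Q] by (simp add: w_def)
  show ?thesis
  proof (rule that[of "pi * (C1 * C2)"])
    fix f g assume f: "f holomorphic_on UNIV" and g: "g holomorphic_on UNIV"
    have contf: "continuous_on UNIV f" and contg: "continuous_on UNIV g"
      using f g by (auto intro: holomorphic_on_imp_continuous_on)
    define u where "u z = weighted_modulus \<alpha> f z * weighted_modulus \<alpha> g z" for z
    have u: "cmod (gauss_integrand \<alpha> f g z) = u z" for z
    proof -
      have "exp (- \<alpha> * (cmod z)\<^sup>2) = exp (- (\<alpha> / 2) * (cmod z)\<^sup>2) * exp (- (\<alpha> / 2) * (cmod z)\<^sup>2)"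
        by (simp add: exp_add[symmetric])
      then show ?thesis by (simp add: gauss_integrand_def u_def weighted_modulus_def norm_mult)
    qed
    have u0: "0 \<le> u z" for z by (simp add: u_def)
    have "continuous_on UNIV u"
      unfolding u_def by (intro continuous_intros continuous_weighted_modulus contf contg)
    then have [measurable]: "u \<in> borel_measurable borel" by (rule borel_measurable_continuous_onI)
    have [measurable]: "cball (z::complex) r \<in> sets borel" for z r by simp
    obtain v where v: "\<And>k. cmod (v k - lattice_point k) \<le> 1"
      "\<And>k z. cmod (z - lattice_point k) \<le> 1 \<Longrightarrow> weighted_modulus \<alpha> f z \<le> weighted_modulus \<alpha> f (v k)"
      using cell_maximum[OF contf] by blast
    obtain y where y: "\<And>k. cmod (y k - lattice_point k) \<le> 1"
      "\<And>k z. cmod (z - lattice_point k) \<le> 1 \<Longrightarrow> weighted_modulus \<alpha> g z \<le> weighted_modulus \<alpha> g (y k)"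
      using cell_maximum[OF contg] by blast
    define A where "A k = weighted_modulus \<alpha> f (v k)" for k
    define B where "B k = weighted_modulus \<alpha> g (y k)" for k
    have AB: "0 \<le> A k" "0 \<le> B k" for k by (auto simp: A_def B_def)
    define Nf where "Nf = fock_norm \<alpha> 0 P Q f"
    define Ng where "Ng = fock_norm \<alpha> (sigma_exponent P Q) (conj_exponent P) (conj_exponent Q) g"
    have disc: "ennreal (\<Sum>k\<in>lattice_disc N. A k * B k) \<le> (ennreal C1 * Nf) * (ennreal C2 * Ng)" for N
    proof -
      have "ennreal (\<Sum>k\<in>lattice_disc N. A k * B k)
        \<le> ennreal (discrete_norm P Q w N A * discrete_norm (conj_exponent P) (conj_exponent Q) (- w) N B)"
        by (intro ennreal_leI discrete_holder P Q AB)
      also have "\<dots> = ennreal (discrete_norm P Q w N A) * ennreal (discrete_norm (conj_exponent P) (conj_exponent Q) (- w) N B)"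
        by (simp add: ennreal_mult)
      also have "\<dots> \<le> (ennreal C1 * Nf) * (ennreal C2 * Ng)"
      proof (rule mult_mono)
        show "ennreal (discrete_norm P Q w N A) \<le> ennreal C1 * Nf"
          unfolding w_def Nf_def by (rule C1(2)[OF f]) (use v in \<open>auto simp: A_def\<close>)
        show "ennreal (discrete_norm (conj_exponent P) (conj_exponent Q) (- w) N B) \<le> ennreal C2 * Ng"
          unfolding w[symmetric] Ng_def by (rule C2(2)[OF g]) (use y in \<open>auto simp: B_def\<close>)
      qed auto
      finally show ?thesis .
    qed
    have part: "(\<integral>\<^sup>+z\<in>cball 0 (real n). ennreal (u z) \<partial>lborel) \<le> ennreal pi * ((ennreal C1 * Nf) * (ennreal C2 * Ng))" for n
    proof -
      have "(\<integral>\<^sup>+z\<in>cball 0 (real n). ennreal (u z) \<partial>lborel)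
        \<le> (\<integral>\<^sup>+z. (\<Sum>k\<in>lattice_disc (n + 2). ennreal (A k * B k) * indicator (cball (lattice_point k) 1) z) \<partial>lborel)"
      proof (intro nn_integral_mono)
        fix z :: complex
        show "ennreal (u z) * indicator (cball 0 (real n)) z \<le> (\<Sum>k\<in>lattice_disc (n + 2). ennreal (A k * B k) * indicator (cball (lattice_point k) 1) z)"
        proof (cases "z \<in> cball 0 (real n)")
          case True
          obtain k where k: "cmod (z - lattice_point k) \<le> 1" by (rule lattice_near)
          have "cmod (lattice_point k) \<le> cmod z + cmod (z - lattice_point k)"
            using norm_triangle_ineq4[of z "z - lattice_point k"] by simp
          then have kN: "k \<in> lattice_disc (n + 2)" using k True by (simp add: lattice_disc_def)
          have "u z \<le> A k * B k" unfolding u_def A_def B_def by (intro mult_mono v y k) auto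
          then have "ennreal (u z) * indicator (cball 0 (real n)) z \<le> ennreal (A k * B k) * indicator (cball (lattice_point k) 1) z"
            using k True by (auto simp: dist_norm norm_minus_commute intro!: ennreal_leI)
          also have "\<dots> \<le> (\<Sum>k\<in>lattice_disc (n + 2). ennreal (A k * B k) * indicator (cball (lattice_point k) 1) z)"
            by (rule member_le_sum[OF kN]) auto
          finally show ?thesis .
        qed simp
      qed
      also have "\<dots> = (\<Sum>k\<in>lattice_disc (n + 2). ennreal (A k * B k) * emeasure lborel (cball (lattice_point k) 1))"
        by (subst nn_integral_sum, measurable, subst nn_integral_cmult_indicator) auto
      also have "\<dots> = (\<Sum>k\<in>lattice_disc (n + 2). ennreal (A k * B k) * ennreal pi)"
        by (simp add: emeasure_cball unit_ball_vol_2)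
      also have "\<dots> = ennreal pi * ennreal (\<Sum>k\<in>lattice_disc (n + 2). A k * B k)"
        unfolding sum_distrib_right[symmetric] using AB by (subst sum_ennreal) (auto simp: mult.commute)
      also have "\<dots> \<le> ennreal pi * ((ennreal C1 * Nf) * (ennreal C2 * Ng))" by (intro mult_left_mono disc) auto
      finally show ?thesis .
    qed
    have "ennreal (u z) = (SUP n. ennreal (u z) * indicator (cball 0 (real n)) z)" for z
    proof (rule antisym)
      obtain n where "cmod z \<le> real n" using real_arch_simple by blast
      then show "ennreal (u z) \<le> (SUP n. ennreal (u z) * indicator (cball 0 (real n)) z)"
        by (intro SUP_upper2[of n]) (auto simp: indicator_def)
    qed (auto intro!: SUP_least simp: indicator_def)
    then have "(\<integral>\<^sup>+z. ennreal (u z) \<partial>lborel) = (\<integral>\<^sup>+z. (SUP n. ennreal (u z) * indicator (cball 0 (real n)) z) \<partial>lborel)" by simp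
    also have "\<dots> = (SUP n. \<integral>\<^sup>+z\<in>cball 0 (real n). ennreal (u z) \<partial>lborel)"
      by (rule nn_integral_monotone_convergence_SUP) (auto simp: incseq_def le_fun_def indicator_def)
    also have "\<dots> \<le> ennreal pi * ((ennreal C1 * Nf) * (ennreal C2 * Ng))" by (rule SUP_least) (rule part)
    also have "\<dots> = ennreal (pi * (C1 * C2)) * Nf * Ng"
      using C1 C2 by (simp add: ennreal_mult mult_ac)
    finally show "(\<integral>\<^sup>+z. ennreal (cmod (gauss_integrand \<alpha> f g z)) \<partial>lborel)
        \<le> ennreal (pi * (C1 * C2)) * fock_norm \<alpha> 0 P Q f * fock_norm \<alpha> (sigma_exponent P Q) (conj_exponent P) (conj_exponent Q) g"
      by (simp add: u Nf_def Ng_def)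
  qed (use C1 C2 in simp)
qed

section \<open>Gaussian moments and Taylor expansions\<close>

lemma gaussian_moment:
  assumes \<alpha>: "(0::real) < \<alpha>"
  shows "has_bochner_integral lborel (\<lambda>r. indicator {0..} r * (r ^ (2 * n + 1) * exp (- \<alpha> * r\<^sup>2))) (fact n / (2 * \<alpha> ^ (n + 1)))"
proof -
  \<comment> \<open>An antiderivative of e^(-x) x^n / n!, since the terms telescope under
    differentiation. With x = \<alpha> r^2 it yields the odd moments.\<close>
  define G :: "real \<Rightarrow> real" where "G x = - exp (- x) * (\<Sum>i\<le>n. x ^ i / fact i)" for x
  have DG: "((\<lambda>x. - exp (- x) * (\<Sum>i\<le>m. x ^ i / fact i)) has_real_derivative exp (- x) * x ^ m / fact m) (at x)" for m x
  proof (induction m)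
    case 0
    then show ?case by (auto intro!: derivative_eq_intros)
  next
    case (Suc m)
    have "((\<lambda>x. x ^ Suc m / fact (Suc m)) has_real_derivative x ^ m / fact m) (at x)"
      by (rule DERIV_cong[OF DERIV_cdivide[OF DERIV_pow]]) (simp add: fact_Suc del: of_nat_Suc)
    moreover have "((\<lambda>x. - exp (- x)) has_real_derivative exp (- x)) (at x)"
      by (auto intro!: derivative_eq_intros)
    ultimately have "((\<lambda>x. - exp (- x) * (x ^ Suc m / fact (Suc m))) has_real_derivative
        exp (- x) * (x ^ Suc m / fact (Suc m)) + (x ^ m / fact m) * (- exp (- x))) (at x)"
      by (intro DERIV_mult)
    from DERIV_add[OF Suc this] show ?case by (simp only: sum.atMost_Suc distrib_left) (simp add: mult.commute)
  qed
  have lim: "(G \<longlongrightarrow> 0) at_top"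
  proof -
    have "((\<lambda>x::real. - (\<Sum>i\<le>n. (x ^ i / exp x) / fact i)) \<longlongrightarrow> - (\<Sum>i\<le>n. 0 / fact i)) at_top"
      by (intro tendsto_minus tendsto_sum tendsto_divide[OF tendsto_power_div_exp_0 tendsto_const]) simp
    then show ?thesis by (simp add: G_def[abs_def] exp_minus sum_distrib_left divide_simps sum_negf)
  qed
  define F where "F r = G (\<alpha> * r\<^sup>2) * (fact n / (2 * \<alpha> ^ (n + 1)))" for r
  have "(\<integral>\<^sup>+r. ennreal (r ^ (2 * n + 1) * exp (- \<alpha> * r\<^sup>2)) * indicator {0..} r \<partial>lborel) = ennreal (0 - F 0)"
  proof (rule nn_integral_FTC_atLeast)
    fix r :: real assume r: "0 \<le> r"
    have "((\<lambda>r. G (\<alpha> * r\<^sup>2)) has_real_derivative exp (- (\<alpha> * r\<^sup>2)) * (\<alpha> * r\<^sup>2) ^ n / fact n * (\<alpha> * (2 * r))) (at r)"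
      unfolding G_def by (rule DERIV_chain2[OF DG]) (auto intro!: derivative_eq_intros)
    then have "(F has_real_derivative exp (- (\<alpha> * r\<^sup>2)) * (\<alpha> * r\<^sup>2) ^ n / fact n * (\<alpha> * (2 * r)) * (fact n / (2 * \<alpha> ^ (n + 1)))) (at r)"
      unfolding F_def by (rule DERIV_cmult_right)
    moreover have "exp (- (\<alpha> * r\<^sup>2)) * (\<alpha> * r\<^sup>2) ^ n / fact n * (\<alpha> * (2 * r)) * (fact n / (2 * \<alpha> ^ (n + 1))) = r ^ (2 * n + 1) * exp (- \<alpha> * r\<^sup>2)"
      using \<alpha> by (simp add: power_mult_distrib power_mult[symmetric] field_simps)
    ultimately show "(F has_real_derivative r ^ (2 * n + 1) * exp (- \<alpha> * r\<^sup>2)) (at r)" by simp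
  next
    have "filterlim (\<lambda>r::real. \<alpha> * r\<^sup>2) at_top at_top"
      using \<alpha> by (intro filterlim_tendsto_pos_mult_at_top[OF tendsto_const] filterlim_pow_at_top filterlim_ident) auto
    then have "((\<lambda>r. G (\<alpha> * r\<^sup>2)) \<longlongrightarrow> 0) at_top" by (rule filterlim_compose[OF lim])
    then show "(F \<longlongrightarrow> 0) at_top" unfolding F_def by (rule tendsto_mult_left_zero)
  qed auto
  moreover have "G 0 = - 1"
  proof -
    have "(\<Sum>i\<le>n. (0::real) ^ i / fact i) = (\<Sum>i\<le>n. if i = 0 then 1 else 0)" by (intro sum.cong) auto
    then show ?thesis by (simp add: G_def)
  qed
  ultimately have moment: "(\<integral>\<^sup>+r. ennreal (indicator {0..} r * (r ^ (2 * n + 1) * exp (- \<alpha> * r\<^sup>2))) \<partial>lborel) = ennreal (fact n / (2 * \<alpha> ^ (n + 1)))"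
  proof -
    have "ennreal (indicator {0..} r * (r ^ (2 * n + 1) * exp (- \<alpha> * r\<^sup>2))) = ennreal (r ^ (2 * n + 1) * exp (- \<alpha> * r\<^sup>2)) * indicator {0..} r" for r
      by (simp add: indicator_def)
    then show ?thesis
      using \<open>(\<integral>\<^sup>+r. ennreal (r ^ (2 * n + 1) * exp (- \<alpha> * r\<^sup>2)) * indicator {0..} r \<partial>lborel) = ennreal (0 - F 0)\<close> \<open>G 0 = - 1\<close>
      by (simp only: F_def) simp
  qed
  show ?thesis
    by (rule has_bochner_integral_nn_integral[OF _ _ _ moment]) (use \<alpha> in \<open>auto simp: indicator_def\<close>)
qed

text \<open>On each circle the angular integral extracts the conjugate of the n-th Taylor
  coefficient of g; the radial integral is the moment n!/(2 \<alpha>^(n+1)), and the factors 2 pi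
  and \<alpha>/pi leave n!/\<alpha>^n. Absolute convergence justifies the iterated
  integration.\<close>

lemma gauss_pairing_monomial:
  assumes \<alpha>: "0 < \<alpha>" and g: "g holomorphic_on UNIV" and conv: "gauss_convergent \<alpha> (\<lambda>z. z ^ n) g"
  shows "gauss_pairing \<alpha> (\<lambda>z. z ^ n) g = cnj ((deriv ^^ n) g 0 / fact n) * of_real (fact n / \<alpha> ^ n)"
proof -
  have cont: "continuous_on UNIV g" using g by (rule holomorphic_on_imp_continuous_on)
  define \<phi> where "\<phi> = gauss_integrand \<alpha> (\<lambda>z. z ^ n) g"
  have [measurable]: "\<phi> \<in> borel_measurable borel"
    using borel_measurable_integrable[OF conv[unfolded gauss_convergent_def]] by (simp add: \<phi>_def)
  define D where "D = (\<lambda>(r::real, \<theta>::real). r * indicator {0..} r * indicator {0..2 * pi} \<theta>)"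
  have [measurable]: "D \<in> borel_measurable (lborel \<Otimes>\<^sub>M lborel)" unfolding D_def by measurable
  have D0: "0 \<le> D x" for x by (auto simp: D_def indicator_def split: prod.split)
  define M where "M = distr (density (lborel \<Otimes>\<^sub>M lborel) (\<lambda>x. ennreal (D x))) borel (\<lambda>(r, \<theta>). complex_of_real r * cis \<theta>)"
  have polar: "lborel = M" unfolding M_def D_def using lborel_polar by (simp add: case_prod_beta')
  define a where "a = (deriv ^^ n) g 0 / fact n"
  have int: "integrable (lborel \<Otimes>\<^sub>M lborel) (\<lambda>x. D x *\<^sub>R \<phi> (complex_of_real (fst x) * cis (snd x)))"
  proof -
    have "integrable M \<phi>" using conv unfolding gauss_convergent_def \<phi>_def[symmetric] polar .
    then show ?thesis unfolding M_def
      by (subst (asm) integrable_distr_eq) (auto simp: integrable_density D0 case_prod_beta')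
  qed
  have inner: "(LINT \<theta>|lborel. D (r, \<theta>) *\<^sub>R \<phi> (complex_of_real r * cis \<theta>))
      = of_real (indicator {0..} r * (r ^ (2 * n + 1) * exp (- \<alpha> * r\<^sup>2))) * (of_real (2 * pi) * cnj a)" for r
  proof (cases "0 < r")
    case True
    have "(LINT \<theta>|lborel. indicator {0..2 * pi} \<theta> *\<^sub>R (g (of_real r * cis \<theta>) * cis (- real n * \<theta>))) = of_real (2 * pi * r ^ n) * a"
    proof -
      have "continuous_on {0..2 * pi} (\<lambda>\<theta>. g (of_real r * cis \<theta>) * cis (- real n * \<theta>))"
        by (intro continuous_intros continuous_on_compose2[OF cont]) auto
      then have "set_integrable lborel {0..2 * pi} (\<lambda>\<theta>. g (of_real r * cis \<theta>) * cis (- real n * \<theta>))"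
        by (rule borel_integrable_atLeastAtMost')
      then have "(LINT \<theta>:{0..2 * pi}|lborel. g (of_real r * cis \<theta>) * cis (- real n * \<theta>)) = integral {0..2 * pi} (\<lambda>\<theta>. g (of_real r * cis \<theta>) * cis (- real n * \<theta>))"
        by (rule set_borel_integral_eq_integral)
      also have "\<dots> = of_real (2 * pi * r ^ n) * a"
        unfolding a_def by (rule integral_unique[OF cauchy_circle_coefficient[OF g True]])
      finally show ?thesis by (simp add: set_lebesgue_integral_def)
    qed
    from arg_cong[OF this, of cnj]
    have c: "(LINT \<theta>|lborel. cnj (indicator {0..2 * pi} \<theta> *\<^sub>R (g (of_real r * cis \<theta>) * cis (- real n * \<theta>)))) = of_real (2 * pi * r ^ n) * cnj a"
      by (subst Bochner_Integration.integral_cnj) simp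
    have "D (r, \<theta>) *\<^sub>R \<phi> (complex_of_real r * cis \<theta>)
        = of_real (r ^ (n + 1) * exp (- \<alpha> * r\<^sup>2)) * cnj (indicator {0..2 * pi} \<theta> *\<^sub>R (g (of_real r * cis \<theta>) * cis (- real n * \<theta>)))" for \<theta>
      using True by (simp add: D_def \<phi>_def gauss_integrand_def norm_mult power_mult_distrib Complex.DeMoivre cis_cnj scaleR_conv_of_real mult_ac)
    then have "(LINT \<theta>|lborel. D (r, \<theta>) *\<^sub>R \<phi> (complex_of_real r * cis \<theta>))
        = of_real (r ^ (n + 1) * exp (- \<alpha> * r\<^sup>2)) * (of_real (2 * pi * r ^ n) * cnj a)"
      by (simp only: c integral_mult_right_zero)
    also have "\<dots> = of_real (indicator {0..} r * (r ^ (2 * n + 1) * exp (- \<alpha> * r\<^sup>2))) * (of_real (2 * pi) * cnj a)"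
    proof -
      have "r ^ (2 * n + 1) = r ^ (n + 1) * r ^ n" by (simp add: power_add[symmetric] mult_2)
      then show ?thesis using True by simp
    qed
    finally show ?thesis .
  next
    case False
    then have "D (r, \<theta>) = 0" for \<theta> by (auto simp: D_def indicator_def)
    then show ?thesis using False by (auto simp: indicator_def)
  qed
  have "(LINT z|lborel. \<phi> z) = (LINT x|(lborel \<Otimes>\<^sub>M lborel). D x *\<^sub>R \<phi> (complex_of_real (fst x) * cis (snd x)))"
    unfolding polar M_def by (subst integral_distr) (auto simp: integral_density D0 case_prod_beta')
  also have "\<dots> = (LINT r|lborel. LINT \<theta>|lborel. D (r, \<theta>) *\<^sub>R \<phi> (complex_of_real r * cis \<theta>))"
    using lborel_pair.integral_fst'[OF int] by simp
  also have "\<dots> = (LINT r|lborel. of_real (indicator {0..} r * (r ^ (2 * n + 1) * exp (- \<alpha> * r\<^sup>2)))) * (of_real (2 * pi) * cnj a)"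
    unfolding inner by (rule integral_mult_left_zero)
  also have "(LINT r|lborel. complex_of_real (indicator {0..} r * (r ^ (2 * n + 1) * exp (- \<alpha> * r\<^sup>2)))) = of_real (fact n / (2 * \<alpha> ^ (n + 1)))"
    unfolding integral_complex_of_real using has_bochner_integral_integral_eq[OF gaussian_moment[OF \<alpha>, of n]] by simp
  finally show ?thesis
    using \<alpha> by (simp add: gauss_pairing_def \<phi>_def[symmetric] a_def field_simps)
qed

text \<open>Cauchy's estimate on the circle of radius l |z| bounds the n-th term by l^(-n) times the
  growth bound at that radius. The price of geometric convergence is the larger Gaussian exponent a
  l^2.\<close>

lemma taylor_remainder:
  assumes h: "h holomorphic_on UNIV" and B: "\<And>z. cmod (h z) \<le> B * exp (a / 2 * (cmod z)\<^sup>2)" and l: "1 < l"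
  shows "cmod (h z - (\<Sum>n<N. (deriv ^^ n) h 0 / fact n * z ^ n)) \<le> B / (1 - 1 / l) * (1 / l) ^ N * exp (a * l\<^sup>2 / 2 * (cmod z)\<^sup>2)"
proof -
  define c where "c n = (deriv ^^ n) h 0 / fact n" for n
  define E where "E = B * exp (a * l\<^sup>2 / 2 * (cmod z)\<^sup>2)"
  have sums: "(\<lambda>n. c n * z ^ n) sums h z"
    using holomorphic_power_series[of h 0 "cmod z + 1" z] holomorphic_on_subset[OF h] by (simp add: c_def)
  have E0: "0 \<le> E"
    using order_trans[OF norm_ge_zero B[of 0]] by (simp add: E_def)
  have term_le: "cmod (c n * z ^ n) \<le> E * (1 / l) ^ n" for n
  proof (cases "z = 0")
    case True
    then show ?thesis using B[of 0] E0 l by (cases n) (auto simp: c_def E_def)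
  next
    case False
    define R where "R = l * cmod z"
    have R: "0 < R" using False l by (simp add: R_def)
    have "cmod ((deriv ^^ n) h 0) \<le> fact n * E / R ^ n"
    proof (rule Cauchy_inequality)
      fix x assume "cmod (0 - x) = R"
      then show "cmod (h x) \<le> E" using B[of x] by (simp add: E_def R_def power_mult_distrib mult_ac)
    qed (use R h in \<open>auto intro: holomorphic_on_subset holomorphic_on_imp_continuous_on\<close>)
    then have "cmod (c n) \<le> E / R ^ n" by (simp add: c_def norm_divide field_simps)
    then have "cmod (c n) * cmod z ^ n \<le> E / R ^ n * cmod z ^ n" by (intro mult_right_mono) auto
    also have "\<dots> = E * (1 / l) ^ n" using False l by (simp add: R_def power_mult_distrib field_simps)
    finally show ?thesis by (simp add: norm_mult norm_power)
  qed
  have geo: "(\<lambda>n. (1 / l) ^ n) sums (1 / (1 - 1 / l))" using l by (intro geometric_sums) auto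
  have "(\<lambda>n. c (n + N) * z ^ (n + N)) sums (h z - (\<Sum>n<N. c n * z ^ n))"
    using sums_split_initial_segment[OF sums] .
  moreover have geo': "(\<lambda>n. E * (1 / l) ^ N * (1 / l) ^ n) sums (E * (1 / l) ^ N * (1 / (1 - 1 / l)))"
    by (rule sums_mult[OF geo])
  moreover have "cmod (\<Sum>n. c (n + N) * z ^ (n + N)) \<le> (\<Sum>n. E * (1 / l) ^ N * (1 / l) ^ n)"
  proof (rule norm_suminf_le)
    show "cmod (c (n + N) * z ^ (n + N)) \<le> E * (1 / l) ^ N * (1 / l) ^ n" for n
      using term_le[of "n + N"] by (simp add: power_add mult_ac)
  qed (rule sums_summable[OF geo'])
  ultimately have "cmod (h z - (\<Sum>n<N. c n * z ^ n)) \<le> E * (1 / l) ^ N * (1 / (1 - 1 / l))"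
    by (simp only: sums_unique[symmetric])
  then show ?thesis by (simp add: c_def E_def field_simps)
qed

section \<open>The space and the density of dilates\<close>

text \<open>Stands in for the triangle inequality at the level of q-th powers, for every q > 0: a
  sum is at most twice its larger term.\<close>

lemma nn_integral_powr_add_le:
  assumes q: "0 < q" and K: "0 < K"
    and nn: "\<And>r. 0 \<le> V r" "\<And>r. 0 \<le> U1 r" "\<And>r. 0 \<le> U2 r"
    and [measurable]: "U1 \<in> borel_measurable borel" "U2 \<in> borel_measurable borel" "T \<in> sets borel" and T: "T \<subseteq> {0..}"
    and le: "\<And>r. r \<in> T \<Longrightarrow> V r \<le> K * (U1 r + U2 r)"
  shows "(\<integral>\<^sup>+r\<in>T. ennreal (V r powr q * r) \<partial>lborel)
    \<le> ennreal ((2 * K) powr q) * ((\<integral>\<^sup>+r\<in>T. ennreal (U1 r powr q * r) \<partial>lborel) + (\<integral>\<^sup>+r\<in>T. ennreal (U2 r powr q * r) \<partial>lborel))"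
proof -
  have "(\<integral>\<^sup>+r\<in>T. ennreal (V r powr q * r) \<partial>lborel)
    \<le> (\<integral>\<^sup>+r. ennreal ((2 * K) powr q) * (ennreal (U1 r powr q * r) * indicator T r + ennreal (U2 r powr q * r) * indicator T r) \<partial>lborel)"
  proof (intro nn_integral_mono)
    fix r
    have "ennreal (V r powr q * r) \<le> ennreal ((2 * K) powr q) * (ennreal (U1 r powr q * r) + ennreal (U2 r powr q * r))" if r: "r \<in> T"
    proof -
      have r0: "0 \<le> r" using r T by auto
      have "V r \<le> 2 * K * max (U1 r) (U2 r)"
      proof -
        have "U1 r + U2 r \<le> 2 * max (U1 r) (U2 r)" by linarith
        then have "K * (U1 r + U2 r) \<le> K * (2 * max (U1 r) (U2 r))" using K by (intro mult_left_mono) auto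
        then show ?thesis using le[OF r] by (simp only: mult_ac)
      qed
      then have "V r powr q \<le> (2 * K * max (U1 r) (U2 r)) powr q" using q nn by (intro powr_mono2) auto
      also have "\<dots> = (2 * K) powr q * max (U1 r) (U2 r) powr q" using nn K by (simp add: powr_mult le_max_iff_disj)
      also have "\<dots> \<le> (2 * K) powr q * (U1 r powr q + U2 r powr q)" by (intro mult_left_mono) (auto simp: max_def)
      finally have "V r powr q * r \<le> (2 * K) powr q * (U1 r powr q + U2 r powr q) * r" using r0 by (intro mult_right_mono)
      then have "ennreal (V r powr q * r) \<le> ennreal ((2 * K) powr q * (U1 r powr q * r + U2 r powr q * r))"
        by (intro ennreal_leI) (simp add: algebra_simps)
      also have "\<dots> = ennreal ((2 * K) powr q) * (ennreal (U1 r powr q * r) + ennreal (U2 r powr q * r))"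
        using r0 by (subst ennreal_mult) auto
      finally show ?thesis .
    qed
    then show "ennreal (V r powr q * r) * indicator T r \<le> ennreal ((2 * K) powr q) * (ennreal (U1 r powr q * r) * indicator T r + ennreal (U2 r powr q * r) * indicator T r)"
      by (cases "r \<in> T") auto
  qed
  also have "\<dots> = ennreal ((2 * K) powr q) * ((\<integral>\<^sup>+r\<in>T. ennreal (U1 r powr q * r) \<partial>lborel) + (\<integral>\<^sup>+r\<in>T. ennreal (U2 r powr q * r) \<partial>lborel))"
    by (subst nn_integral_cmult) (auto simp: nn_integral_add)
  finally show ?thesis .
qed

lemma fock_norm_unweighted:
  assumes f: "continuous_on UNIV f" and \<alpha>: "0 < \<alpha>" and P: "0 < P" and q: "0 < q"
  shows "fock_norm \<alpha> 0 P (ennreal q) f = ennreal (radial_const \<alpha> (ennreal q)) *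
    ennreal_powr (\<integral>\<^sup>+r\<in>{0..}. ennreal (weighted_mean P \<alpha> f r powr q * r) \<partial>lborel) (1 / q)"
proof -
  have "(\<integral>\<^sup>+r\<in>{0..}. ennreal ((weighted_mean P \<alpha> f r * (1 + r) powr 0) powr q * r) \<partial>lborel)
      = (\<integral>\<^sup>+r\<in>{0..}. ennreal (weighted_mean P \<alpha> f r powr q * r) \<partial>lborel)"
    by (intro nn_integral_cong) (auto simp: indicator_def)
  then show ?thesis using q by (simp add: fock_norm_radial[OF f \<alpha> P] radial_norm_ennreal)
qed

lemma fock_norm_finite_iff:
  assumes f: "continuous_on UNIV f" and \<alpha>: "0 < \<alpha>" and P: "0 < P" and q: "0 < q"
  shows "fock_norm \<alpha> 0 P (ennreal q) f < top \<longleftrightarrow> (\<integral>\<^sup>+r\<in>{0..}. ennreal (weighted_mean P \<alpha> f r powr q * r) \<partial>lborel) < top"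
proof -
  have "0 < radial_const \<alpha> (ennreal q)" using radial_const_pos[OF \<alpha>] q by simp
  then show ?thesis unfolding fock_norm_unweighted[OF assms]
    by (cases "\<integral>\<^sup>+r\<in>{0..}. ennreal (weighted_mean P \<alpha> f r powr q * r) \<partial>lborel")
      (auto simp: ennreal_powr_def ennreal_mult_top ennreal_mult_less_top)
qed

lemma fock_space_iff: "f \<in> fock_space \<alpha> \<sigma> P Q \<longleftrightarrow> f holomorphic_on UNIV \<and> fock_norm \<alpha> \<sigma> P Q f < top"
  by (simp add: fock_space_def)

lemma fock_space_diff:
  assumes \<alpha>: "0 < \<alpha>" and P: "0 < P" and q: "0 < q"
    and f: "f \<in> fock_space \<alpha> 0 P (ennreal q)" and g: "g \<in> fock_space \<alpha> 0 P (ennreal q)"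
  shows "(\<lambda>z. f z - g z) \<in> fock_space \<alpha> 0 P (ennreal q)"
proof -
  obtain K where K: "0 < K"
    "\<And>\<alpha> f g r. continuous_on UNIV f \<Longrightarrow> continuous_on UNIV g \<Longrightarrow>
      weighted_mean P \<alpha> (\<lambda>z. f z - g z) r \<le> K * (weighted_mean P \<alpha> f r + weighted_mean P \<alpha> g r)"
    using weighted_mean_diff_le[OF P] by blast
  have h: "f holomorphic_on UNIV" "g holomorphic_on UNIV" using f g by (auto simp: fock_space_iff)
  then have c: "continuous_on UNIV f" "continuous_on UNIV g" by (auto intro: holomorphic_on_imp_continuous_on)
  have cfg: "continuous_on UNIV (\<lambda>z. f z - g z)" by (intro continuous_intros c)
  have "(\<integral>\<^sup>+r\<in>{0..}. ennreal (weighted_mean P \<alpha> (\<lambda>z. f z - g z) r powr q * r) \<partial>lborel)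
    \<le> ennreal ((2 * K) powr q) * ((\<integral>\<^sup>+r\<in>{0..}. ennreal (weighted_mean P \<alpha> f r powr q * r) \<partial>lborel)
        + (\<integral>\<^sup>+r\<in>{0..}. ennreal (weighted_mean P \<alpha> g r powr q * r) \<partial>lborel))"
    by (rule nn_integral_powr_add_le[OF q K(1)])
      (use c cfg K in \<open>auto intro: weighted_mean_measurable[OF _ P]\<close>)
  also have "\<dots> < top"
    using f g fock_norm_finite_iff[OF c(1) \<alpha> P q] fock_norm_finite_iff[OF c(2) \<alpha> P q]
    by (auto simp: fock_space_iff ennreal_mult_less_top)
  finally show ?thesis using h fock_norm_finite_iff[OF cfg \<alpha> P q]
    by (auto simp: fock_space_iff intro!: holomorphic_intros)
qed

lemma fock_space_cmult:
  assumes \<alpha>: "0 < \<alpha>" and P: "0 < P" and Q: "0 < Q" and f: "f \<in> fock_space \<alpha> \<sigma> P Q"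
  shows "(\<lambda>z. c * f z) \<in> fock_space \<alpha> \<sigma> P Q"
proof -
  have h: "f holomorphic_on UNIV" and N: "fock_norm \<alpha> \<sigma> P Q f < top" using f by (auto simp: fock_space_iff)
  have "fock_norm \<alpha> \<sigma> P Q (\<lambda>z. c * f z) \<le> ennreal (cmod c) * fock_norm \<alpha> \<sigma> P Q f"
    by (rule fock_norm_cmult_le[OF \<alpha> P Q holomorphic_on_imp_continuous_on[OF h]])
  also have "\<dots> < top" using N by (simp add: ennreal_mult_less_top)
  finally show ?thesis using h by (auto simp: fock_space_iff intro!: holomorphic_intros)
qed

lemma fock_space_add:
  assumes \<alpha>: "0 < \<alpha>" and P: "0 < P" and q: "0 < q"
    and f: "f \<in> fock_space \<alpha> 0 P (ennreal q)" and g: "g \<in> fock_space \<alpha> 0 P (ennreal q)"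
  shows "(\<lambda>z. f z + g z) \<in> fock_space \<alpha> 0 P (ennreal q)"
  using fock_space_diff[OF \<alpha> P q f fock_space_cmult[OF \<alpha> P _ g, of "- 1"]] q by simp

lemma fock_space_zero:
  assumes "0 < \<alpha>" "0 < P" "0 < Q" shows "(\<lambda>z. 0) \<in> fock_space \<alpha> \<sigma> P Q"
  using fock_norm_zero[OF assms] by (simp add: fock_space_iff)

lemma fock_space_sum:
  assumes \<alpha>: "0 < \<alpha>" and P: "0 < P" and q: "0 < q" and S: "finite S"
    and f: "\<And>i. i \<in> S \<Longrightarrow> f i \<in> fock_space \<alpha> 0 P (ennreal q)"
  shows "(\<lambda>z. \<Sum>i\<in>S. c i * f i z) \<in> fock_space \<alpha> 0 P (ennreal q)"
  using S f
proof (induction S rule: finite_induct)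
  case empty
  then show ?case using fock_space_zero[OF \<alpha> P] q by simp
next
  case (insert i S)
  then show ?case using q by (auto intro!: fock_space_add[OF \<alpha> P q] fock_space_cmult[OF \<alpha> P])
qed

lemma linear_functional_sum:
  assumes \<alpha>: "0 < \<alpha>" and P: "0 < P" and q: "0 < q" and S: "finite S"
    and F: "linear_functional_on (fock_space \<alpha> 0 P (ennreal q)) F"
    and f: "\<And>i. i \<in> S \<Longrightarrow> f i \<in> fock_space \<alpha> 0 P (ennreal q)"
  shows "F (\<lambda>z. \<Sum>i\<in>S. c i * f i z) = (\<Sum>i\<in>S. c i * F (f i))"
  using S f
proof (induction S rule: finite_induct)
  case empty
  have "(\<lambda>z. 0) \<in> fock_space \<alpha> 0 P (ennreal q)" using fock_space_zero[OF \<alpha> P] q by simp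
  moreover have "\<forall>f\<in>fock_space \<alpha> 0 P (ennreal q). F (\<lambda>z. 0 * f z) = 0 * F f"
    using F unfolding linear_functional_on_def by blast
  ultimately show ?case by auto
next
  case (insert i S)
  have part: "(\<lambda>z. c i * f i z) \<in> fock_space \<alpha> 0 P (ennreal q)"
    using insert q by (intro fock_space_cmult[OF \<alpha> P]) auto
  have rest: "(\<lambda>z. \<Sum>i\<in>S. c i * f i z) \<in> fock_space \<alpha> 0 P (ennreal q)"
    using insert by (intro fock_space_sum[OF \<alpha> P q]) auto
  have add: "F (\<lambda>z. g z + h z) = F g + F h" if "g \<in> fock_space \<alpha> 0 P (ennreal q)" "h \<in> fock_space \<alpha> 0 P (ennreal q)" for g h
    using F that unfolding linear_functional_on_def by blast
  have "F (\<lambda>z. c i * f i z + (\<Sum>i\<in>S. c i * f i z)) = F (\<lambda>z. c i * f i z) + F (\<lambda>z. \<Sum>i\<in>S. c i * f i z)"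
    by (rule add[OF part rest])
  moreover have "F (\<lambda>z. c i * f i z) = c i * F (f i)"
    using F insert unfolding linear_functional_on_def by blast
  ultimately show ?case using insert by simp
qed

text \<open>Comparison with the weight at 0 in \<open>weight_exp_le\<close>, and then of an
  exponential with a Gaussian.\<close>

lemma power_le_gaussian:
  assumes c: "(0::real) < c"
  obtains B where "0 < B" "\<And>x. 0 \<le> x \<Longrightarrow> (1 + x) powr m \<le> B * exp (c * x\<^sup>2)"
proof -
  obtain W where W: "1 \<le> W" "\<And>a b. 0 \<le> a \<Longrightarrow> 0 \<le> b \<Longrightarrow> (1 + a) powr m \<le> W * (1 + b) powr m * exp (1 * \<bar>a - b\<bar>)"
    using weight_exp_le[OF zero_less_one] by blast
  have "(1 + x) powr m \<le> W * exp (1 / (4 * c)) * exp (c * x\<^sup>2)" if "0 \<le> x" for x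
  proof -
    have "exp x \<le> exp (1 / (4 * c)) * exp (c * x\<^sup>2)"
      using gaussian_le_exp[OF c, of x] by (simp add: exp_minus field_simps)
    then have "W * exp x \<le> W * (exp (1 / (4 * c)) * exp (c * x\<^sup>2))" using W by (intro mult_left_mono) auto
    then show ?thesis using W(2)[OF that order_refl] that by (simp add: mult.assoc)
  qed
  then show ?thesis using W(1) by (intro that[of "W * exp (1 / (4 * c))"]) auto
qed

lemma le_lnorm:
  assumes "finite S" "0 < P" "i \<in> S" "\<And>i. i \<in> S \<Longrightarrow> 0 \<le> a i"
  shows "a i \<le> lnorm P S a"
  using assms(2)
proof (cases P rule: exponent_cases)
  case 1
  then show ?thesis using assms by (simp add: le_lnorm_top)
next
  case (2 p)
  have "a i powr p \<le> (\<Sum>i\<in>S. a i powr p)" by (rule member_le_sum) (use assms in auto)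
  then have "(a i powr p) powr (1 / p) \<le> (\<Sum>i\<in>S. a i powr p) powr (1 / p)" by (rule powr_mono2[rotated 2]) (use 2 in auto)
  then show ?thesis using 2 assms by (simp add: lnorm_ennreal powr_powr)
qed

text \<open>A single entry of the sequence norm bounds one cell, with a polynomial loss in the ring
  index, which a Gaussian of slightly larger exponent absorbs.\<close>

lemma fock_space_growth:
  assumes \<alpha>: "0 < \<alpha>" "\<alpha> < \<alpha>'" and P: "0 < P" and Q: "0 < Q" and f: "f \<in> fock_space \<alpha> \<sigma> P Q"
  obtains B where "0 \<le> B" "\<And>z. cmod (f z) \<le> B * exp (\<alpha>' / 2 * (cmod z)\<^sup>2)"
proof -
  have h: "f holomorphic_on UNIV" and N: "fock_norm \<alpha> \<sigma> P Q f < top" using f by (auto simp: fock_space_iff)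
  define w where "w = \<sigma> - recip P + recip Q"
  obtain C where C: "0 < C"
    "\<And>f N A. f holomorphic_on UNIV \<Longrightarrow> (\<And>k. 0 \<le> A k) \<Longrightarrow>
      (\<And>k. \<exists>z. cmod (z - lattice_point k) \<le> 1 \<and> A k \<le> weighted_modulus \<alpha> f z) \<Longrightarrow>
      ennreal (discrete_norm P Q w N A) \<le> ennreal C * fock_norm \<alpha> \<sigma> P Q f"
    unfolding w_def using discrete_norm_le_fock_norm[OF \<alpha>(1) P Q] by blast
  obtain v where v: "\<And>k. cmod (v k - lattice_point k) \<le> 1"
    "\<And>k z. cmod (z - lattice_point k) \<le> 1 \<Longrightarrow> weighted_modulus \<alpha> f z \<le> weighted_modulus \<alpha> f (v k)"
    using cell_maximum[OF holomorphic_on_imp_continuous_on[OF h]] by blast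
  define A where "A k = weighted_modulus \<alpha> f (v k)" for k
  have "ennreal C * fock_norm \<alpha> \<sigma> P Q f < top" using N by (simp add: ennreal_mult_less_top)
  then obtain M where M: "ennreal C * fock_norm \<alpha> \<sigma> P Q f = ennreal M" "0 \<le> M"
    by (cases "ennreal C * fock_norm \<alpha> \<sigma> P Q f") auto
  have dn: "discrete_norm P Q w N A \<le> M" for N
  proof -
    have "ennreal (discrete_norm P Q w N A) \<le> ennreal M"
      unfolding M(1)[symmetric] by (rule C(2)[OF h]) (use v in \<open>auto simp: A_def\<close>)
    then show ?thesis using M by (simp add: ennreal_le_iff)
  qed
  have \<delta>: "0 < (\<alpha>' - \<alpha>) / 2" using \<alpha> by simp
  obtain W where W: "0 < W" "\<And>x. 0 \<le> x \<Longrightarrow> (1 + x) powr \<bar>w\<bar> \<le> W * exp ((\<alpha>' - \<alpha>) / 2 * x\<^sup>2)"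
    using power_le_gaussian[OF \<delta>] by blast
  show ?thesis
  proof (rule that[of "M * (2 powr \<bar>w\<bar> * W)"])
    fix z
    obtain k where k: "cmod (z - lattice_point k) \<le> 1" by (rule lattice_near)
    define j where "j = nat \<lfloor>cmod (lattice_point k)\<rfloor>"
    have kj: "k \<in> lattice_ring j" by (simp add: j_def lattice_ring_def)
    have jz: "real j \<le> cmod z + 1"
      using lattice_ring_dist(1)[OF kj] k norm_triangle_ineq4[of z "z - lattice_point k"] by simp
    have "1 + real j \<le> 1 + (cmod z + 1)" using jz by simp
    also have "\<dots> \<le> 2 * (1 + cmod z)" by simp
    finally have jz': "1 + real j \<le> 2 * (1 + cmod z)" .
    have "(1 + real j) powr w * A k \<le> (1 + real j) powr w * lnorm P (lattice_ring j) A"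
      by (intro mult_left_mono le_lnorm P kj) (auto simp: A_def)
    also have "\<dots> \<le> discrete_norm P Q w (Suc j) A"
      unfolding discrete_norm_def by (rule le_lnorm[OF _ Q]) (auto simp: lnorm_nonneg)
    also have "\<dots> \<le> M" by (rule dn)
    finally have "A k \<le> M * (1 + real j) powr (- w)" by (simp add: powr_minus field_simps)
    also have "\<dots> \<le> M * (1 + real j) powr \<bar>w\<bar>" using M by (intro mult_left_mono powr_mono) auto
    also have "\<dots> \<le> M * (2 * (1 + cmod z)) powr \<bar>w\<bar>" using M jz' by (intro mult_left_mono powr_mono2) auto
    also have "\<dots> = M * (2 powr \<bar>w\<bar> * (1 + cmod z) powr \<bar>w\<bar>)" by (subst powr_mult) simp_all
    also have "\<dots> \<le> M * (2 powr \<bar>w\<bar> * (W * exp ((\<alpha>' - \<alpha>) / 2 * (cmod z)\<^sup>2)))"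
      using M by (intro mult_left_mono W) auto
    finally have "weighted_modulus \<alpha> f z \<le> M * (2 powr \<bar>w\<bar> * (W * exp ((\<alpha>' - \<alpha>) / 2 * (cmod z)\<^sup>2)))"
      using v(2)[OF k] by (simp add: A_def)
    then have "weighted_modulus \<alpha> f z * exp (\<alpha> / 2 * (cmod z)\<^sup>2)
        \<le> M * (2 powr \<bar>w\<bar> * (W * exp ((\<alpha>' - \<alpha>) / 2 * (cmod z)\<^sup>2))) * exp (\<alpha> / 2 * (cmod z)\<^sup>2)"
      by (intro mult_right_mono) auto
    also have "\<dots> = M * (2 powr \<bar>w\<bar> * W) * (exp ((\<alpha>' - \<alpha>) / 2 * (cmod z)\<^sup>2) * exp (\<alpha> / 2 * (cmod z)\<^sup>2))"
      by (simp only: mult_ac)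
    also have "exp ((\<alpha>' - \<alpha>) / 2 * (cmod z)\<^sup>2) * exp (\<alpha> / 2 * (cmod z)\<^sup>2) = exp (\<alpha>' / 2 * (cmod z)\<^sup>2)"
      by (simp add: exp_add[symmetric] field_simps)
    also have "weighted_modulus \<alpha> f z * exp (\<alpha> / 2 * (cmod z)\<^sup>2) = cmod (f z)"
      by (simp add: weighted_modulus_def exp_minus field_simps)
    finally show "cmod (f z) \<le> M * (2 powr \<bar>w\<bar> * W) * exp (\<alpha>' / 2 * (cmod z)\<^sup>2)" .
  qed (use M W in auto)
qed

text \<open>
  The part of the norm over \<open>r \<ge> 2 n\<close> is controlled uniformly in \<open>\<rho> \<ge> 1 / 2\<close> by the tail of the integral
  of \<open>f\<close> over \<open>r \<ge> n\<close>; on the disc of radius \<open>2 n\<close> the dilates converge uniformly.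
\<close>

lemma fock_space_dilates_dense:
  assumes \<alpha>: "0 < \<alpha>" and P: "0 < P" and q: "0 < q" and f: "f \<in> fock_space \<alpha> 0 P (ennreal q)" and \<epsilon>: "(0::real) < \<epsilon>"
  obtains \<rho> where "0 < \<rho>" "\<rho> < 1" "fock_norm \<alpha> 0 P (ennreal q) (\<lambda>z. f (of_real \<rho> * z) - f z) < ennreal \<epsilon>"
proof -
  have h: "f holomorphic_on UNIV" and N: "fock_norm \<alpha> 0 P (ennreal q) f < top" using f by (auto simp: fock_space_iff)
  have cf: "continuous_on UNIV f" using h by (rule holomorphic_on_imp_continuous_on)
  define U where "U = weighted_mean P \<alpha> f"
  have U0: "0 \<le> U r" for r using cf by (simp add: U_def)
  have [measurable]: "U \<in> borel_measurable borel" unfolding U_def by (rule weighted_mean_measurable[OF cf P])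
  have fin: "(\<integral>\<^sup>+r\<in>{0..}. ennreal (U r powr q * r) \<partial>lborel) < top"
    using N fock_norm_finite_iff[OF cf \<alpha> P q] by (simp add: U_def)
  define c where "c = radial_const \<alpha> (ennreal q)"
  have c: "0 < c" using radial_const_pos[OF \<alpha>] q by (simp add: c_def)
  \<comment> \<open>Bound for the q-th power integral that makes the norm at most
    \<epsilon>/2.\<close>
  define \<eta> where "\<eta> = (\<epsilon> / (2 * c)) powr q"
  have \<eta>: "0 < \<eta>" using \<epsilon> c by (simp add: \<eta>_def)
  obtain K where K: "0 < K"
    "\<And>\<alpha> f g r. continuous_on UNIV f \<Longrightarrow> continuous_on UNIV g \<Longrightarrow>
      weighted_mean P \<alpha> (\<lambda>z. f z - g z) r \<le> K * (weighted_mean P \<alpha> f r + weighted_mean P \<alpha> g r)"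
    using weighted_mean_diff_le[OF P] by blast
  \<comment> \<open>The far part will be at most (2 K)^q (4 \<eta>1 + \<eta>1), where 4 \<eta>1
    bounds the dilated tail; the 10 makes this \<eta>/2.\<close>
  define \<eta>1 where "\<eta>1 = \<eta> / (10 * (2 * K) powr q)"
  have \<eta>1: "0 < \<eta>1" using \<eta> K by (simp add: \<eta>1_def)
  \<comment> \<open>Tails of a convergent integral vanish, by dominated convergence; a supremum over
    r offers no such statement.\<close>
  have "(\<lambda>n. \<integral>\<^sup>+r. ennreal (U r powr q * r) * indicator {real n..} r \<partial>lborel) \<longlonglongrightarrow> (\<integral>\<^sup>+r. 0 \<partial>(lborel :: real measure))"
  proof (rule nn_integral_dominated_convergence[where w = "\<lambda>r. ennreal (U r powr q * r) * indicator {0..} r"])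
    show "AE r in lborel. (\<lambda>n. ennreal (U r powr q * r) * indicator {real n..} r) \<longlonglongrightarrow> 0"
    proof (rule AE_I2)
      fix r :: real
      obtain m :: nat where m: "r < real m" using reals_Archimedean2 by blast
      have "eventually (\<lambda>n. ennreal (U r powr q * r) * indicator {real n..} r = 0) sequentially"
        using eventually_ge_at_top[of m] by eventually_elim (use m in \<open>auto simp: indicator_def\<close>)
      then show "(\<lambda>n. ennreal (U r powr q * r) * indicator {real n..} r) \<longlonglongrightarrow> 0" by (rule tendsto_eventually)
    qed
    show "(\<integral>\<^sup>+r. ennreal (U r powr q * r) * indicator {0..} r \<partial>lborel) < \<infinity>" using fin by simp
    show "AE r in lborel. ennreal (U r powr q * r) * indicator {real j..} r \<le> ennreal (U r powr q * r) * indicator {0..} r" for j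
      by (rule AE_I2) (auto simp: indicator_def)
  qed measurable
  then have "eventually (\<lambda>n. (\<integral>\<^sup>+r. ennreal (U r powr q * r) * indicator {real n..} r \<partial>lborel) < ennreal \<eta>1) sequentially"
    using \<eta>1 by (intro order_tendstoD(2)[where y = 0]) auto
  then obtain n where tail: "(\<integral>\<^sup>+r\<in>{real n..}. ennreal (U r powr q * r) \<partial>lborel) < ennreal \<eta>1"
    by (auto simp: eventually_sequentially)
  define R where "R = 2 * real n"
  \<comment> \<open>The near part is at most \<delta>^q R^2, which is to be at most \<eta>/2; the 1
    keeps D positive when n = 0.\<close>
  define D where "D = R\<^sup>2 + 1"
  have D: "0 < D" "R\<^sup>2 \<le> D" by (simp_all add: D_def add_nonneg_pos)
  define \<delta> where "\<delta> = (\<eta> / (2 * D)) powr (1 / q)"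
  have \<delta>: "0 < \<delta>" using \<eta> D by (simp add: \<delta>_def)
  have "uniformly_continuous_on (cball 0 R) f"
    by (intro compact_uniformly_continuous continuous_on_subset[OF cf]) auto
  then obtain d where d: "0 < d" "\<And>x y. x \<in> cball 0 R \<Longrightarrow> y \<in> cball 0 R \<Longrightarrow> dist y x < d \<Longrightarrow> dist (f y) (f x) < \<delta>"
    using \<delta> unfolding uniformly_continuous_on_def by metis
  \<comment> \<open>Close enough to 1 that (1 - \<rho>) R < d, and at least 1/2 so that \<rho> r
    \<ge> n whenever r \<ge> R = 2 n.\<close>
  define \<rho> where "\<rho> = max (1 / 2) (1 - d / (2 * (R + 1)))"
  have R: "0 \<le> R" by (simp add: R_def)
  have \<rho>: "1 / 2 \<le> \<rho>" "\<rho> < 1" using d R by (auto simp: \<rho>_def)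
  define fr where "fr z = f (of_real \<rho> * z)" for z
  have cfr: "continuous_on UNIV fr" unfolding fr_def by (intro continuous_on_compose2[OF cf] continuous_intros) auto
  define V where "V = weighted_mean P \<alpha> (\<lambda>z. fr z - f z)"
  have cV: "continuous_on UNIV (\<lambda>z. fr z - f z)" by (intro continuous_intros cfr cf)
  have V0: "0 \<le> V r" for r using cV by (simp add: V_def)
  have [measurable]: "V \<in> borel_measurable borel" unfolding V_def by (rule weighted_mean_measurable[OF cV P])
  have near: "V r \<le> \<delta>" if r: "0 \<le> r" "r \<le> R" for r
    unfolding V_def
  proof (rule weighted_mean_le[OF cV P])
    fix \<theta>
    define z where "z = of_real r * cis \<theta>"
    have z: "cmod z \<le> R" using r by (simp add: z_def norm_mult)
    have "dist (of_real \<rho> * z) z = (1 - \<rho>) * cmod z"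
    proof -
      have "of_real \<rho> * z - z = - (of_real (1 - \<rho>) * z)" by (simp add: algebra_simps)
      then show ?thesis using \<rho> by (simp add: dist_norm norm_mult del: of_real_diff)
    qed
    also have "\<dots> \<le> d / (2 * (R + 1)) * R"
      using z \<rho> by (intro mult_mono) (auto simp: \<rho>_def)
    also have "\<dots> < d" using d R by (simp add: field_simps) (intro add_nonneg_pos; simp)
    finally have "dist (f (of_real \<rho> * z)) (f z) < \<delta>"
      using z \<rho> mult_mono[of \<rho> 1 "cmod z" R] by (intro d) (auto simp: norm_mult)
    then have "cmod (fr z - f z) \<le> \<delta>" by (simp add: fr_def dist_norm)
    moreover have "exp (- (\<alpha> / 2) * (cmod z)\<^sup>2) \<le> 1" using \<alpha> by simp
    ultimately have "cmod (fr z - f z) * exp (- (\<alpha> / 2) * (cmod z)\<^sup>2) \<le> \<delta> * 1" using \<delta> by (intro mult_mono) auto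
    then show "weighted_modulus \<alpha> (\<lambda>z. fr z - f z) (of_real r * cis \<theta>) \<le> \<delta>" by (simp add: weighted_modulus_def z_def)
  qed
  have far: "V r \<le> K * (U (\<rho> * r) + U r)" if r: "0 \<le> r" for r
  proof -
    \<comment> \<open>The circle mean of the dilate at r is that of f at \<rho> r, and the Gaussian
      weight is larger at the smaller radius.\<close>
    have "weighted_mean P \<alpha> fr r \<le> U (\<rho> * r)"
    proof -
      have "\<rho>\<^sup>2 \<le> 1" using \<rho> by (simp add: power_le_one)
      then have "\<alpha> / 2 * (\<rho> * r)\<^sup>2 \<le> \<alpha> / 2 * r\<^sup>2"
        using \<alpha> by (intro mult_left_mono) (auto simp: power_mult_distrib mult_left_le_one_le)
      then have "integral_mean P f (\<rho> * r) * exp (- (\<alpha> / 2) * r\<^sup>2) \<le> integral_mean P f (\<rho> * r) * exp (- (\<alpha> / 2) * (\<rho> * r)\<^sup>2)"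
        using weighted_mean_nonneg[OF cf, of P 0 "\<rho> * r"] by (intro mult_left_mono) (auto simp: weighted_mean_def)
      moreover have "integral_mean P fr r = integral_mean P f (\<rho> * r)"
        by (simp add: integral_mean_def fr_def mult.assoc)
      ultimately show ?thesis by (simp add: U_def weighted_mean_def)
    qed
    then have "K * (weighted_mean P \<alpha> fr r + weighted_mean P \<alpha> f r) \<le> K * (U (\<rho> * r) + U r)"
      using K by (intro mult_left_mono add_mono) (auto simp: U_def)
    then show ?thesis using K(2)[OF cfr cf, of \<alpha> r] by (simp add: V_def)
  qed
  have dil: "(\<integral>\<^sup>+r\<in>{R..}. ennreal (U (\<rho> * r) powr q * r) \<partial>lborel) \<le> ennreal (4 * \<eta>1)"
  proof -
    have "(\<integral>\<^sup>+r\<in>{R..}. ennreal (U (\<rho> * r) powr q * r) \<partial>lborel)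
      = ennreal (1 / \<rho>) * (\<integral>\<^sup>+s. ennreal (U s powr q * (1 / \<rho> * s)) * indicator {R..} (1 / \<rho> * s) \<partial>lborel)"
      using \<rho> by (subst nn_integral_real_affine[where c = "1 / \<rho>" and t = 0]) auto
    \<comment> \<open>One factor 1/\<rho> \<le> 2 comes from dr, the other from r =
      s/\<rho>.\<close>
    also have "\<dots> \<le> ennreal 2 * (\<integral>\<^sup>+s. ennreal 2 * (ennreal (U s powr q * s) * indicator {real n..} s) \<partial>lborel)"
    proof (rule mult_mono[OF ennreal_leI nn_integral_mono])
      show "1 / \<rho> \<le> 2" using \<rho> by (simp add: field_simps)
      fix s :: real
      show "ennreal (U s powr q * (1 / \<rho> * s)) * indicator {R..} (1 / \<rho> * s) \<le> ennreal 2 * (ennreal (U s powr q * s) * indicator {real n..} s)"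
      proof (cases "R \<le> 1 / \<rho> * s")
        case True
        then have s: "\<rho> * R \<le> s" using \<rho> by (simp add: field_simps)
        moreover have "real n \<le> \<rho> * R" using \<rho> mult_right_mono[of "1 / 2" \<rho> R] R by (simp add: R_def)
        ultimately have sn: "real n \<le> s" by simp
        then have s0: "0 \<le> s" using of_nat_0_le_iff order_trans by blast
        have "1 / \<rho> * s \<le> 2 * s" using \<rho> s0 by (intro mult_right_mono) (auto simp: field_simps)
        then have "U s powr q * (1 / \<rho> * s) \<le> 2 * (U s powr q * s)"
          using mult_left_mono[of "1 / \<rho> * s" "2 * s" "U s powr q"] by simp
        then have "ennreal (U s powr q * (1 / \<rho> * s)) \<le> ennreal 2 * ennreal (U s powr q * s)"
          using s0 by (subst ennreal_mult[symmetric]) (auto intro!: ennreal_leI)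
        then show ?thesis using True sn by simp
      qed simp
    qed auto
    also have "\<dots> = ennreal 2 * (ennreal 2 * (\<integral>\<^sup>+s\<in>{real n..}. ennreal (U s powr q * s) \<partial>lborel))"
      by (subst nn_integral_cmult) auto
    also have "\<dots> = ennreal 4 * (\<integral>\<^sup>+s\<in>{real n..}. ennreal (U s powr q * s) \<partial>lborel)"
      by (simp only: mult.assoc[symmetric] ennreal_mult'[symmetric] zero_le_numeral) simp
    also have "\<dots> \<le> ennreal 4 * ennreal \<eta>1" using tail by (intro mult_left_mono) auto
    also have "\<dots> = ennreal (4 * \<eta>1)" using \<eta>1 by (simp add: ennreal_mult)
    finally show ?thesis .
  qed
  have energy: "(\<integral>\<^sup>+r\<in>{0..}. ennreal (V r powr q * r) \<partial>lborel) \<le> ennreal \<eta>"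
  proof -
    have "(\<integral>\<^sup>+r\<in>{0..}. ennreal (V r powr q * r) \<partial>lborel)
      \<le> (\<integral>\<^sup>+r. ennreal (\<delta> powr q * R) * indicator {0..R} r + ennreal (V r powr q * r) * indicator {R..} r \<partial>lborel)"
    proof (intro nn_integral_mono)
      fix r :: real
      have "V r powr q * r \<le> \<delta> powr q * R" if "0 \<le> r" "r \<le> R"
        using that V0 near q by (intro mult_mono powr_mono2) auto
      then show "ennreal (V r powr q * r) * indicator {0..} r
          \<le> ennreal (\<delta> powr q * R) * indicator {0..R} r + ennreal (V r powr q * r) * indicator {R..} r"
        by (auto simp: indicator_def intro!: ennreal_leI add_increasing2)
    qed
    also have "\<dots> = ennreal (\<delta> powr q * R) * ennreal R + (\<integral>\<^sup>+r\<in>{R..}. ennreal (V r powr q * r) \<partial>lborel)"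
      using R by (subst nn_integral_add, measurable, subst nn_integral_cmult_indicator) auto
    also have "\<dots> \<le> ennreal (\<delta> powr q * R) * ennreal R + ennreal ((2 * K) powr q) *
        ((\<integral>\<^sup>+r\<in>{R..}. ennreal (U (\<rho> * r) powr q * r) \<partial>lborel) + (\<integral>\<^sup>+r\<in>{R..}. ennreal (U r powr q * r) \<partial>lborel))"
      by (intro add_mono order_refl nn_integral_powr_add_le[OF q K(1)]) (use V0 U0 R far in auto)
    also have "\<dots> \<le> ennreal (\<delta> powr q * R) * ennreal R + ennreal ((2 * K) powr q) * (ennreal (4 * \<eta>1) + ennreal \<eta>1)"
    proof (intro add_mono mult_left_mono dil order_refl)
      have "(\<integral>\<^sup>+r\<in>{R..}. ennreal (U r powr q * r) \<partial>lborel) \<le> (\<integral>\<^sup>+r\<in>{real n..}. ennreal (U r powr q * r) \<partial>lborel)"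
        by (intro nn_integral_mono) (auto simp: indicator_def R_def)
      then show "(\<integral>\<^sup>+r\<in>{R..}. ennreal (U r powr q * r) \<partial>lborel) \<le> ennreal \<eta>1" using tail by simp
    qed auto
    also have "\<dots> = ennreal (\<delta> powr q * R * R + (2 * K) powr q * (4 * \<eta>1 + \<eta>1))"
    proof -
      have "ennreal x * ennreal R + ennreal y * (ennreal a + ennreal b) = ennreal (x * R + y * (a + b))"
        if "0 \<le> x" "0 \<le> y" "0 \<le> a" "0 \<le> b" for x y a b
        using that R by (simp add: ennreal_mult)
      then show ?thesis using R \<eta>1 by simp
    qed
    also have "\<dots> \<le> ennreal \<eta>"
    proof (rule ennreal_leI)
      have "\<delta> powr q = \<eta> / (2 * D)"
        using q \<eta> D by (simp add: \<delta>_def powr_powr)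
      then have "\<delta> powr q * R * R = \<eta> / 2 * (R\<^sup>2 / D)" by (simp add: power2_eq_square)
      also have "\<dots> \<le> \<eta> / 2 * 1" using \<eta> D by (intro mult_left_mono) auto
      finally have "\<delta> powr q * R * R \<le> \<eta> / 2" by simp
      moreover have "(2 * K) powr q * (4 * \<eta>1 + \<eta>1) = \<eta> / 2" using K by (simp add: \<eta>1_def field_simps)
      ultimately show "\<delta> powr q * R * R + (2 * K) powr q * (4 * \<eta>1 + \<eta>1) \<le> \<eta>" by simp
    qed
    finally show ?thesis .
  qed
  have "ennreal_powr (\<integral>\<^sup>+r\<in>{0..}. ennreal (V r powr q * r) \<partial>lborel) (1 / q) \<le> ennreal (\<epsilon> / (2 * c))"
    using energy \<epsilon> c q by (simp add: ennreal_powr_le_ennreal_iff \<eta>_def)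
  then have "fock_norm \<alpha> 0 P (ennreal q) (\<lambda>z. fr z - f z) \<le> ennreal c * ennreal (\<epsilon> / (2 * c))"
    unfolding fock_norm_unweighted[OF cV \<alpha> P q] c_def[symmetric] V_def by (rule mult_left_mono) simp
  also have "\<dots> = ennreal (\<epsilon> / 2)" using c \<epsilon> by (simp add: ennreal_mult[symmetric])
  also have "\<dots> < ennreal \<epsilon>" using \<epsilon> by (simp add: ennreal_lessI)
  finally show ?thesis using \<rho> by (intro that[of \<rho>]) (auto simp: fr_def)
qed

lemma entire_series:
  fixes h :: "complex \<Rightarrow> complex"
  assumes "\<And>z. (\<lambda>n. c n * z ^ n) sums h z"
  shows "h holomorphic_on UNIV" "(deriv ^^ n) h 0 / fact n = c n"
proof -
  have "h has_fps_expansion Abs_fps c" using assms by (intro has_fps_expansionI) simp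
  then show "(deriv ^^ n) h 0 / fact n = c n" using fps_nth_fps_expansion by fastforce
  have "h holomorphic_on (\<Union>m::nat\<in>UNIV. ball 0 (real m))"
  proof (rule holomorphic_on_UN_open)
    fix m :: nat
    show "h holomorphic_on ball 0 (real m)"
      by (rule power_series_holomorphic[where a = c]) (use assms in simp)
  qed auto
  also have "(\<Union>m::nat\<in>UNIV. ball 0 (real m)) = (UNIV :: complex set)"
    using reals_Archimedean2 by auto
  finally show "h holomorphic_on UNIV" .
qed

section \<open>Continuous functionals\<close>

lemma monomial_in_fock_space:
  assumes \<alpha>: "0 < \<alpha>" and P: "0 < P" and Q: "0 < Q"
  shows "(\<lambda>z. z ^ n) \<in> fock_space \<alpha> \<sigma> P Q"
proof -
  have a4: "0 < \<alpha> / 4" and a2: "\<alpha> / 2 < \<alpha>" using \<alpha> by auto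
  obtain B where B: "0 < B" "\<And>x. 0 \<le> x \<Longrightarrow> (1 + x) powr real n \<le> B * exp (\<alpha> / 4 * x\<^sup>2)"
    using power_le_gaussian[OF a4] by blast
  obtain C where C: "0 < C"
    "\<And>f B. continuous_on UNIV f \<Longrightarrow> 0 \<le> B \<Longrightarrow> (\<And>z. cmod (f z) \<le> B * exp (\<alpha> / 2 / 2 * (cmod z)\<^sup>2)) \<Longrightarrow>
      fock_norm \<alpha> \<sigma> P Q f \<le> ennreal (C * B)"
    using fock_norm_le_gaussian[OF a2 \<alpha> P Q] by blast
  have "fock_norm \<alpha> \<sigma> P Q (\<lambda>z. z ^ n) \<le> ennreal (C * B)"
  proof (rule C(2))
    fix z :: complex
    have "cmod (z ^ n) \<le> (1 + cmod z) ^ n" by (simp add: norm_power power_mono)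
    also have "\<dots> = (1 + cmod z) powr real n"
      by (rule powr_realpow[symmetric]) (simp add: add_pos_nonneg)
    also have "\<dots> \<le> B * exp (\<alpha> / 2 / 2 * (cmod z)\<^sup>2)" using B(2)[of "cmod z"] by simp
    finally show "cmod (z ^ n) \<le> \<dots>" .
  qed (use B in \<open>auto intro: continuous_intros\<close>)
  then show ?thesis by (auto simp: fock_space_iff intro!: holomorphic_intros intro: le_less_trans)
qed

text \<open>Growth strictly below the critical Gaussian leaves room for the Taylor remainder, which
  then tends to 0 geometrically in the norm; continuity of F does the rest.\<close>

lemma dual_taylor_sums:
  assumes \<alpha>: "0 < \<alpha>'" "\<alpha>' < \<alpha>" and P: "0 < P" and q: "0 < q"
    and F: "F \<in> continuous_dual (fock_space \<alpha> 0 P (ennreal q)) (fock_norm \<alpha> 0 P (ennreal q))"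
    and h: "h holomorphic_on UNIV" and B: "\<And>z. cmod (h z) \<le> B * exp (\<alpha>' / 2 * (cmod z)\<^sup>2)"
  shows "h \<in> fock_space \<alpha> 0 P (ennreal q)"
    "(\<lambda>n. (deriv ^^ n) h 0 / fact n * F (\<lambda>z. z ^ n)) sums F h"
proof -
  let ?X = "fock_space \<alpha> 0 P (ennreal q)" and ?N = "fock_norm \<alpha> 0 P (ennreal q)"
  have \<alpha>0: "0 < \<alpha>" and Q: "0 < ennreal q" using \<alpha> q by auto
  have ch: "continuous_on UNIV h" using h by (rule holomorphic_on_imp_continuous_on)
  have B0: "0 \<le> B" using order_trans[OF norm_ge_zero B[of 0]] by simp
  \<comment> \<open>An intermediate exponent: l is chosen with \<alpha>' l^2 = \<alpha>'', the
    exponent that \<open>taylor_remainder\<close> produces and that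
    \<open>fock_norm_le_gaussian\<close> still accepts.\<close>
  define \<alpha>'' where "\<alpha>'' = (\<alpha>' + \<alpha>) / 2"
  have \<alpha>'': "\<alpha>'' < \<alpha>" "\<alpha>' < \<alpha>''" using \<alpha> by (auto simp: \<alpha>''_def)
  define l where "l = sqrt (\<alpha>'' / \<alpha>')"
  have l: "1 < l" "\<alpha>' * l\<^sup>2 = \<alpha>''" using \<alpha> \<alpha>'' by (auto simp: l_def)
  obtain C where C: "0 < C"
    "\<And>f B. continuous_on UNIV f \<Longrightarrow> 0 \<le> B \<Longrightarrow> (\<And>z. cmod (f z) \<le> B * exp (\<alpha>'' / 2 * (cmod z)\<^sup>2)) \<Longrightarrow> ?N f \<le> ennreal (C * B)"
    using fock_norm_le_gaussian[OF \<alpha>''(1) \<alpha>0 P Q] by blast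
  have "?N h \<le> ennreal (C * B)"
  proof (rule C(2)[OF ch B0])
    fix z
    have "exp (\<alpha>' / 2 * (cmod z)\<^sup>2) \<le> exp (\<alpha>'' / 2 * (cmod z)\<^sup>2)" using \<alpha>'' by (simp add: mult_right_mono)
    then show "cmod (h z) \<le> B * exp (\<alpha>'' / 2 * (cmod z)\<^sup>2)"
      using B0 by (intro order_trans[OF B] mult_left_mono)
  qed
  then show hX: "h \<in> ?X" using h by (auto simp: fock_space_iff intro: le_less_trans)
  define T where "T N z = (\<Sum>n<N. (deriv ^^ n) h 0 / fact n * z ^ n)" for N z
  have mono: "(\<lambda>z. z ^ n) \<in> ?X" for n by (rule monomial_in_fock_space[OF \<alpha>0 P Q])
  have TX: "T N \<in> ?X" for N
    unfolding T_def[abs_def] by (rule fock_space_sum[OF \<alpha>0 P q]) (auto intro: mono)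
  have FT: "F (T N) = (\<Sum>n<N. (deriv ^^ n) h 0 / fact n * F (\<lambda>z. z ^ n))" for N
    unfolding T_def[abs_def]
    by (rule linear_functional_sum[OF \<alpha>0 P q]) (use F mono in \<open>auto simp: continuous_dual_def\<close>)
  have cT: "continuous_on UNIV (T N)" for N unfolding T_def by (intro continuous_intros)
  define b where "b N = B / (1 - 1 / l) * (1 / l) ^ N" for N
  have b0: "0 \<le> b N" for N using B0 l by (simp add: b_def)
  have near: "?N (\<lambda>z. T N z - h z) \<le> ennreal (C * b N)" for N
  proof (rule C(2)[OF _ b0])
    fix z
    have "cmod (h z - T N z) \<le> b N * exp (\<alpha>' * l\<^sup>2 / 2 * (cmod z)\<^sup>2)"
      unfolding T_def b_def by (rule taylor_remainder[OF h B l(1)])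
    then show "cmod (T N z - h z) \<le> b N * exp (\<alpha>'' / 2 * (cmod z)\<^sup>2)"
      by (simp add: l(2) norm_minus_commute)
  qed (intro continuous_intros cT ch)
  have "(\<lambda>N. C * b N) \<longlonglongrightarrow> C * (B / (1 - 1 / l) * 0)"
    unfolding b_def using l by (intro tendsto_intros LIMSEQ_realpow_zero) auto
  then have lim: "(\<lambda>N. C * b N) \<longlonglongrightarrow> 0" by simp
  have "(\<lambda>N. F (T N)) \<longlonglongrightarrow> F h"
  proof (rule LIMSEQ_I)
    fix \<epsilon> :: real assume "0 < \<epsilon>"
    moreover have "continuous_functional_on ?X ?N F" using F by (simp add: continuous_dual_def)
    ultimately obtain \<delta> where \<delta>: "0 < \<delta>" "\<And>g. g \<in> ?X \<Longrightarrow> ?N (\<lambda>z. g z - h z) < ennreal \<delta> \<Longrightarrow> cmod (F g - F h) < \<epsilon>"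
      using hX unfolding continuous_functional_on_def by blast
    have "eventually (\<lambda>N. C * b N < \<delta>) sequentially" by (rule order_tendstoD(2)[OF lim \<delta>(1)])
    then obtain n0 where n0: "\<And>N. n0 \<le> N \<Longrightarrow> C * b N < \<delta>" by (auto simp: eventually_sequentially)
    have "cmod (F (T N) - F h) < \<epsilon>" if "n0 \<le> N" for N
    proof (rule \<delta>(2)[OF TX])
      show "?N (\<lambda>z. T N z - h z) < ennreal \<delta>"
        using n0[OF that] \<delta> by (intro le_less_trans[OF near]) (simp add: ennreal_lessI)
    qed
    then show "\<exists>n0. \<forall>N\<ge>n0. norm (F (T N) - F h) < \<epsilon>" by blast
  qed
  then show "(\<lambda>n. (deriv ^^ n) h 0 / fact n * F (\<lambda>z. z ^ n)) sums F h"
    unfolding sums_def FT .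
qed

section \<open>Reproducing kernels as test functions, and dual norms\<close>

definition fock_kernel :: "real \<Rightarrow> complex \<Rightarrow> complex \<Rightarrow> complex" where
  "fock_kernel \<alpha> w z = exp (of_real \<alpha> * cnj w * z)"

lemma fock_kernel_holomorphic: "fock_kernel \<alpha> w holomorphic_on UNIV"
  unfolding fock_kernel_def[abs_def] by (intro holomorphic_intros)

lemma fock_kernel_taylor: "(deriv ^^ n) (fock_kernel \<alpha> w) 0 / fact n = (of_real \<alpha> * cnj w) ^ n / fact n"
proof (rule entire_series(2))
  fix z
  have "(\<lambda>n. (of_real \<alpha> * cnj w * z) ^ n /\<^sub>R fact n) sums exp (of_real \<alpha> * cnj w * z)" by (rule exp_converges)
  then show "(\<lambda>n. (of_real \<alpha> * cnj w) ^ n / fact n * z ^ n) sums fock_kernel \<alpha> w z"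
    by (simp add: fock_kernel_def power_mult_distrib scaleR_conv_of_real divide_inverse mult_ac)
qed

text \<open>The product |w| |z| is split so that only a quarter of |z|^2 is charged. The growth
  exponent is then \<alpha>/2, strictly below \<alpha>, and \<open>dual_taylor_sums\<close> applies
  to kernels.\<close>

lemma fock_kernel_growth:
  assumes "0 < \<alpha>"
  shows "cmod (fock_kernel \<alpha> w z) \<le> exp (\<alpha> * (cmod w)\<^sup>2) * exp (\<alpha> / 2 / 2 * (cmod z)\<^sup>2)"
proof -
  have "Re (of_real \<alpha> * cnj w * z) \<le> cmod (of_real \<alpha> * cnj w * z)" by (rule complex_Re_le_cmod)
  also have "\<dots> = \<alpha> * (cmod w * cmod z)" using assms by (simp add: norm_mult)
  also have "\<dots> \<le> \<alpha> * ((cmod w)\<^sup>2 + (cmod z)\<^sup>2 / 4)"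
  proof (intro mult_left_mono)
    show "cmod w * cmod z \<le> (cmod w)\<^sup>2 + (cmod z)\<^sup>2 / 4"
      using zero_le_power2[of "cmod w - cmod z / 2"] by (simp add: power2_eq_square field_simps)
  qed (use assms in simp)
  finally show ?thesis by (simp add: fock_kernel_def exp_add[symmetric] algebra_simps)
qed

text \<open>Completing the square: after division by exp(\<alpha>/2 |w|^2) the weighted kernel is an
  exact Gaussian bump centred at w.\<close>

lemma weighted_modulus_kernel:
  "weighted_modulus \<alpha> (fock_kernel \<alpha> w) z = exp (\<alpha> / 2 * (cmod w)\<^sup>2) * exp (- (\<alpha> / 2) * (cmod (z - w))\<^sup>2)"
proof -
  have "(cmod (z - w))\<^sup>2 = (cmod z)\<^sup>2 + (cmod w)\<^sup>2 - 2 * Re (cnj w * z)"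
    unfolding cmod_power2 by (simp add: power2_eq_square algebra_simps)
  then have "\<alpha> / 2 * (cmod w)\<^sup>2 + - (\<alpha> / 2) * (cmod (z - w))\<^sup>2
      = \<alpha> / 2 * (cmod w)\<^sup>2 + - (\<alpha> / 2) * ((cmod z)\<^sup>2 + (cmod w)\<^sup>2 - 2 * Re (cnj w * z))"
    by (simp only:)
  also have "\<dots> = \<alpha> * Re (cnj w * z) + - (\<alpha> / 2) * (cmod z)\<^sup>2"
    by (simp add: right_diff_distrib distrib_left)
  finally have "\<alpha> / 2 * (cmod w)\<^sup>2 + - (\<alpha> / 2) * (cmod (z - w))\<^sup>2 = \<alpha> * Re (cnj w * z) + - (\<alpha> / 2) * (cmod z)\<^sup>2" .
  moreover have "Re (of_real \<alpha> * cnj w * z) = \<alpha> * Re (cnj w * z)" by (simp add: algebra_simps)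
  ultimately show ?thesis unfolding weighted_modulus_def fock_kernel_def norm_exp_eq_Re exp_add[symmetric] by simp
qed

lemma dual_kernel_sums:
  assumes \<alpha>: "0 < \<alpha>" and P: "0 < P" and q: "0 < q"
    and F: "F \<in> continuous_dual (fock_space \<alpha> 0 P (ennreal q)) (fock_norm \<alpha> 0 P (ennreal q))"
  shows "fock_kernel \<alpha> w \<in> fock_space \<alpha> 0 P (ennreal q)"
    "(\<lambda>n. (of_real \<alpha> * cnj w) ^ n / fact n * F (\<lambda>z. z ^ n)) sums F (fock_kernel \<alpha> w)"
proof -
  have a: "0 < \<alpha> / 2" "\<alpha> / 2 < \<alpha>" using \<alpha> by auto
  note * = dual_taylor_sums[OF a P q F fock_kernel_holomorphic fock_kernel_growth[OF \<alpha>]]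
  show "fock_kernel \<alpha> w \<in> fock_space \<alpha> 0 P (ennreal q)" by (rule *(1))
  show "(\<lambda>n. (of_real \<alpha> * cnj w) ^ n / fact n * F (\<lambda>z. z ^ n)) sums F (fock_kernel \<alpha> w)"
    using *(2)[of w] unfolding fock_kernel_taylor .
qed

text \<open>Scaling by an upper bound C > 0 instead of the norm itself avoids dividing by a norm
  that might vanish.\<close>

lemma dual_norm_bound:
  assumes \<alpha>: "0 < \<alpha>" and P: "0 < P" and Q: "0 < Q"
    and F: "F \<in> continuous_dual (fock_space \<alpha> \<sigma> P Q) (fock_norm \<alpha> \<sigma> P Q)"
    and f: "f \<in> fock_space \<alpha> \<sigma> P Q" "fock_norm \<alpha> \<sigma> P Q f \<le> ennreal C" and C: "0 < C"
  shows "ennreal (cmod (F f)) \<le> ennreal C * dual_norm (fock_space \<alpha> \<sigma> P Q) (fock_norm \<alpha> \<sigma> P Q) F"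
proof -
  define h where "h z = of_real (1 / C) * f z" for z
  have cf: "continuous_on UNIV f" using f by (auto simp: fock_space_iff intro: holomorphic_on_imp_continuous_on)
  have hX: "h \<in> fock_space \<alpha> \<sigma> P Q" unfolding h_def[abs_def] by (rule fock_space_cmult[OF \<alpha> P Q f(1)])
  have "fock_norm \<alpha> \<sigma> P Q h \<le> ennreal (cmod (of_real (1 / C))) * fock_norm \<alpha> \<sigma> P Q f"
    unfolding h_def[abs_def] by (rule fock_norm_cmult_le[OF \<alpha> P Q cf])
  also have "\<dots> \<le> ennreal (cmod (of_real (1 / C))) * ennreal C" by (intro mult_left_mono f) auto
  also have "\<dots> = 1" using C by (simp add: ennreal_mult[symmetric] del: of_real_divide)
  finally have "h \<in> {f \<in> fock_space \<alpha> \<sigma> P Q. fock_norm \<alpha> \<sigma> P Q f \<le> 1}" using hX by simp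
  then have "ennreal (cmod (F h)) \<le> dual_norm (fock_space \<alpha> \<sigma> P Q) (fock_norm \<alpha> \<sigma> P Q) F"
    unfolding dual_norm_def by (rule SUP_upper)
  moreover have "F h = of_real (1 / C) * F f"
    using F f(1) unfolding h_def[abs_def] continuous_dual_def linear_functional_on_def by blast
  then have "cmod (F f) = C * cmod (F h)" using C by (simp add: norm_mult norm_divide)
  ultimately show ?thesis using C by (simp add: ennreal_mult mult_left_mono)
qed

text \<open>Continuity at 0 with tolerance 1, and homogeneity; no triangle inequality enters, so
  quasi-norms are covered. Scaling by \<delta>/2 puts the unit ball strictly inside the
  \<delta>-neighbourhood.\<close>

lemma dual_norm_finite:
  assumes \<alpha>: "0 < \<alpha>" and P: "0 < P" and Q: "0 < Q"
    and F: "F \<in> continuous_dual (fock_space \<alpha> \<sigma> P Q) (fock_norm \<alpha> \<sigma> P Q)"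
  shows "dual_norm (fock_space \<alpha> \<sigma> P Q) (fock_norm \<alpha> \<sigma> P Q) F < top"
proof -
  let ?X = "fock_space \<alpha> \<sigma> P Q" and ?N = "fock_norm \<alpha> \<sigma> P Q"
  have zero: "(\<lambda>z. 0) \<in> ?X" by (rule fock_space_zero[OF \<alpha> P Q])
  have scale: "F (\<lambda>z. c * f z) = c * F f" if "f \<in> ?X" for c f
    using F that unfolding continuous_dual_def linear_functional_on_def by blast
  have F0: "F (\<lambda>z. 0) = 0" using scale[OF zero, of 0] by simp
  have "continuous_functional_on ?X ?N F" using F by (simp add: continuous_dual_def)
  from bspec[OF this[unfolded continuous_functional_on_def] zero]
  have "\<forall>\<epsilon>>0. \<exists>\<delta>>0. \<forall>h\<in>?X. ?N h < ennreal \<delta> \<longrightarrow> cmod (F h) < \<epsilon>" by (simp add: F0)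
  then obtain \<delta> where \<delta>: "0 < \<delta>" "\<And>h. h \<in> ?X \<Longrightarrow> ?N h < ennreal \<delta> \<Longrightarrow> cmod (F h) < 1"
    using zero_less_one by blast
  have "dual_norm ?X ?N F \<le> ennreal (2 / \<delta>)"
    unfolding dual_norm_def
  proof (rule SUP_least)
    fix f assume "f \<in> {f \<in> ?X. ?N f \<le> 1}"
    then have f: "f \<in> ?X" "?N f \<le> 1" by auto
    have cf: "continuous_on UNIV f" using f by (auto simp: fock_space_iff intro: holomorphic_on_imp_continuous_on)
    define h where "h z = of_real (\<delta> / 2) * f z" for z
    have hX: "h \<in> ?X" unfolding h_def[abs_def] by (rule fock_space_cmult[OF \<alpha> P Q f(1)])
    have "?N h \<le> ennreal (cmod (of_real (\<delta> / 2))) * ?N f"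
      unfolding h_def[abs_def] by (rule fock_norm_cmult_le[OF \<alpha> P Q cf])
    also have "\<dots> \<le> ennreal (cmod (of_real (\<delta> / 2))) * 1" by (intro mult_left_mono f) auto
    also have "\<dots> < ennreal \<delta>" using \<delta> by (simp add: ennreal_lessI del: of_real_divide)
    finally have "cmod (F h) < 1" by (rule \<delta>(2)[OF hX])
    moreover have "F h = of_real (\<delta> / 2) * F f" unfolding h_def[abs_def] by (rule scale[OF f(1)])
    ultimately have "cmod (F f) \<le> 2 / \<delta>" using \<delta> by (simp add: norm_mult norm_divide field_simps)
    then show "ennreal (cmod (F f)) \<le> ennreal (2 / \<delta>)" by (rule ennreal_leI)
  qed
  then show ?thesis by (rule le_less_trans) simp
qed

text \<open>
  The functional is tested on sums of kernels centred at points where \<open>g\<close> is largest in each lattice cell,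
  with coefficients that are extremal for the discrete duality.
\<close>

lemma representing_function_bound:
  assumes \<alpha>: "0 < \<alpha>" and P: "0 < P" and q: "0 < q"
  obtains C where "0 < C"
    "\<And>F g. F \<in> continuous_dual (fock_space \<alpha> 0 P (ennreal q)) (fock_norm \<alpha> 0 P (ennreal q)) \<Longrightarrow>
      g holomorphic_on UNIV \<Longrightarrow> (\<And>w. F (fock_kernel \<alpha> w) = cnj (g w)) \<Longrightarrow>
      fock_norm \<alpha> (sigma_exponent P (ennreal q)) (conj_exponent P) (conj_exponent (ennreal q)) g
        \<le> ennreal C * dual_norm (fock_space \<alpha> 0 P (ennreal q)) (fock_norm \<alpha> 0 P (ennreal q)) F"
proof -
  have Q: "0 < ennreal q" using q by simp
  define w where "w = 0 - recip P + recip (ennreal q)"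
  have w: "sigma_exponent P (ennreal q) - recip (conj_exponent P) + recip (conj_exponent (ennreal q)) = - w"
    using sigma_exponent_duality[OF P Q] by (simp add: w_def)
  obtain C1 where C1: "0 < C1"
    "\<And>f N a. continuous_on UNIV f \<Longrightarrow> (\<And>k. 0 \<le> a k) \<Longrightarrow>
      (\<And>z. weighted_modulus \<alpha> f z \<le> (\<Sum>k\<in>lattice_disc N. exp (- 1 * cmod (z - lattice_point k)) * a k)) \<Longrightarrow>
      fock_norm \<alpha> 0 P (ennreal q) f \<le> ennreal (C1 * discrete_norm P (ennreal q) w N a)"
    unfolding w_def using fock_norm_synthesis[OF \<alpha> P Q zero_less_one] by blast
  obtain C2 where C2: "0 < C2"
    "\<And>f a B. continuous_on UNIV f \<Longrightarrow> (\<And>k z. cmod (z - lattice_point k) \<le> 1 \<Longrightarrow> weighted_modulus \<alpha> f z \<le> a k) \<Longrightarrow>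
      (\<And>N. discrete_norm (conj_exponent P) (conj_exponent (ennreal q)) (- w) N a \<le> B) \<Longrightarrow>
      fock_norm \<alpha> (sigma_exponent P (ennreal q)) (conj_exponent P) (conj_exponent (ennreal q)) f \<le> ennreal (C2 * B)"
    unfolding w[symmetric] using fock_norm_le_discrete_norm[OF \<alpha> conj_exponent_pos[OF P] conj_exponent_pos[OF Q]] by blast
  \<comment> \<open>The first factor turns the Gaussian of rate \<alpha>/2 into exp(-|z - v k|); the
    second moves the centre from v k to the lattice point at distance at most 1.\<close>
  define E where "E = exp (1 / (4 * (\<alpha> / 2))) * exp 1"
  have E: "0 < E" by (simp add: E_def)
  show ?thesis
  proof (rule that[of "C2 * (C1 * E)"])
    fix F g
    let ?X = "fock_space \<alpha> 0 P (ennreal q)" and ?N = "fock_norm \<alpha> 0 P (ennreal q)"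
    assume F: "F \<in> continuous_dual ?X ?N" and g: "g holomorphic_on UNIV" and Fg: "\<And>w. F (fock_kernel \<alpha> w) = cnj (g w)"
    have cg: "continuous_on UNIV g" using g by (rule holomorphic_on_imp_continuous_on)
    obtain D where D: "dual_norm ?X ?N F = ennreal D" "0 \<le> D"
      using dual_norm_finite[OF \<alpha> P Q F] by (cases "dual_norm ?X ?N F") auto
    obtain v where v: "\<And>k. cmod (v k - lattice_point k) \<le> 1"
      "\<And>k z. cmod (z - lattice_point k) \<le> 1 \<Longrightarrow> weighted_modulus \<alpha> g z \<le> weighted_modulus \<alpha> g (v k)"
      using cell_maximum[OF cg] by blast
    define b where "b k = weighted_modulus \<alpha> g (v k)" for k
    have dual: "discrete_norm (conj_exponent P) (conj_exponent (ennreal q)) (- w) N b \<le> C1 * E * D" for N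
    proof -
      obtain c where c: "\<And>k. 0 \<le> c k" "discrete_norm P (ennreal q) w N c \<le> 1"
        "(\<Sum>k\<in>lattice_disc N. c k * b k) = discrete_norm (conj_exponent P) (conj_exponent (ennreal q)) (- w) N b"
        by (rule discrete_extremal[OF P Q, of b w N]) (auto simp: b_def)
      \<comment> \<open>The sign turns the conjugate of g(v k) into its modulus. The Gaussian factor
        serves twice: it makes the k-th value of F equal to c k * b k, and it normalises the kernel
        at v k.\<close>
      define s where "s k = of_real (c k * exp (- (\<alpha> / 2) * (cmod (v k))\<^sup>2)) * sgn (g (v k))" for k
      define f where "f z = (\<Sum>k\<in>lattice_disc N. s k * fock_kernel \<alpha> (v k) z)" for z
      have fX: "f \<in> ?X"
        unfolding f_def[abs_def] by (rule fock_space_sum[OF \<alpha> P q]) (auto intro: dual_kernel_sums(1)[OF \<alpha> P q F])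
      have "F f = (\<Sum>k\<in>lattice_disc N. s k * F (fock_kernel \<alpha> (v k)))"
        unfolding f_def[abs_def]
        by (rule linear_functional_sum[OF \<alpha> P q]) (use F in \<open>auto simp: continuous_dual_def intro: dual_kernel_sums(1)[OF \<alpha> P q F]\<close>)
      also have "\<dots> = (\<Sum>k\<in>lattice_disc N. of_real (c k * b k))"
      proof (intro sum.cong refl)
        fix k
        have "sgn (g (v k)) * cnj (g (v k)) = of_real (cmod (g (v k)))"
          by (cases "g (v k) = 0") (auto simp: sgn_eq complex_norm_square[symmetric] power2_eq_square field_simps)
        then show "s k * F (fock_kernel \<alpha> (v k)) = of_real (c k * b k)"
          by (simp add: s_def Fg b_def weighted_modulus_def mult.assoc)
      qed
      also have "\<dots> = of_real (discrete_norm (conj_exponent P) (conj_exponent (ennreal q)) (- w) N b)"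
        by (simp only: of_real_sum[symmetric] c(3))
      finally have Ff: "cmod (F f) = discrete_norm (conj_exponent P) (conj_exponent (ennreal q)) (- w) N b"
        by simp
      have cf: "continuous_on UNIV f" using fX by (auto simp: fock_space_iff intro: holomorphic_on_imp_continuous_on)
      have "?N f \<le> ennreal (C1 * discrete_norm P (ennreal q) w N (\<lambda>k. E * c k))"
      proof (rule C1(2)[OF cf])
        fix z
        have "weighted_modulus \<alpha> f z \<le> (\<Sum>k\<in>lattice_disc N. cmod (s k) * weighted_modulus \<alpha> (fock_kernel \<alpha> (v k)) z)"
        proof -
          have "cmod (f z) \<le> (\<Sum>k\<in>lattice_disc N. cmod (s k) * cmod (fock_kernel \<alpha> (v k) z))"
            unfolding f_def by (rule order_trans[OF norm_sum]) (simp add: norm_mult)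
          then have "weighted_modulus \<alpha> f z \<le> (\<Sum>k\<in>lattice_disc N. cmod (s k) * cmod (fock_kernel \<alpha> (v k) z)) * exp (- (\<alpha> / 2) * (cmod z)\<^sup>2)"
            unfolding weighted_modulus_def by (intro mult_right_mono) auto
          then show ?thesis by (simp add: weighted_modulus_def sum_distrib_right mult.assoc)
        qed
        also have "\<dots> \<le> (\<Sum>k\<in>lattice_disc N. exp (- 1 * cmod (z - lattice_point k)) * (E * c k))"
        proof (intro sum_mono)
          fix k
          have "cmod (s k) \<le> c k * exp (- (\<alpha> / 2) * (cmod (v k))\<^sup>2)"
            using c(1)[of k] by (simp add: s_def norm_mult norm_sgn del: of_real_mult)
          then have "cmod (s k) * weighted_modulus \<alpha> (fock_kernel \<alpha> (v k)) z
              \<le> c k * exp (- (\<alpha> / 2) * (cmod (v k))\<^sup>2) * weighted_modulus \<alpha> (fock_kernel \<alpha> (v k)) z"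
            by (intro mult_right_mono) auto
          also have "\<dots> = c k * ((exp (- (\<alpha> / 2) * (cmod (v k))\<^sup>2) * exp (\<alpha> / 2 * (cmod (v k))\<^sup>2)) * exp (- (\<alpha> / 2) * (cmod (z - v k))\<^sup>2))"
            unfolding weighted_modulus_kernel by (simp only: mult_ac)
          also have "exp (- (\<alpha> / 2) * (cmod (v k))\<^sup>2) * exp (\<alpha> / 2 * (cmod (v k))\<^sup>2) = 1"
            by (simp add: exp_add[symmetric])
          also have "c k * (1 * exp (- (\<alpha> / 2) * (cmod (z - v k))\<^sup>2)) \<le> c k * (exp (- 1 * cmod (z - lattice_point k)) * E)"
          proof (rule mult_left_mono[OF _ c(1)])
            have "exp (- (\<alpha> / 2) * (cmod (z - v k))\<^sup>2) \<le> exp (1 / (4 * (\<alpha> / 2))) * exp (- cmod (z - v k))"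
              by (rule gaussian_le_exp) (use \<alpha> in simp)
            also have "\<dots> \<le> exp (1 / (4 * (\<alpha> / 2))) * exp (1 - cmod (z - lattice_point k))"
              using v(1)[of k] norm_triangle_ineq[of "z - v k" "v k - lattice_point k"] by simp
            finally show "1 * exp (- (\<alpha> / 2) * (cmod (z - v k))\<^sup>2) \<le> exp (- 1 * cmod (z - lattice_point k)) * E"
              by (simp add: E_def exp_diff exp_minus field_simps)
          qed
          finally show "cmod (s k) * weighted_modulus \<alpha> (fock_kernel \<alpha> (v k)) z \<le> exp (- 1 * cmod (z - lattice_point k)) * (E * c k)"
            by (simp only: mult_ac)
        qed
        finally show "weighted_modulus \<alpha> f z \<le> \<dots>" .
      qed (use E c in auto)
      also have "discrete_norm P (ennreal q) w N (\<lambda>k. E * c k) = E * discrete_norm P (ennreal q) w N c"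
        by (rule discrete_norm_cmult) (use P Q E c in auto)
      also have "ennreal (C1 * (E * discrete_norm P (ennreal q) w N c)) \<le> ennreal (C1 * E)"
        using mult_left_mono[OF c(2), of "C1 * E"] C1 E by (intro ennreal_leI) (simp add: mult.assoc)
      finally have "ennreal (cmod (F f)) \<le> ennreal (C1 * E) * dual_norm ?X ?N F"
        by (intro dual_norm_bound[OF \<alpha> P Q F fX]) (use C1 E in auto)
      also have "\<dots> = ennreal (C1 * E * D)" using C1 E D by (simp add: ennreal_mult)
      finally show ?thesis unfolding Ff using C1 E D by (subst (asm) ennreal_le_iff) auto
    qed
    have "fock_norm \<alpha> (sigma_exponent P (ennreal q)) (conj_exponent P) (conj_exponent (ennreal q)) g \<le> ennreal (C2 * (C1 * E * D))"
      by (rule C2(2)[OF cg _ dual]) (use v in \<open>auto simp: b_def\<close>)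
    also have "\<dots> = ennreal (C2 * (C1 * E)) * dual_norm ?X ?N F"
      using C1 C2 E D by (simp add: ennreal_mult mult.assoc)
    finally show "fock_norm \<alpha> (sigma_exponent P (ennreal q)) (conj_exponent P) (conj_exponent (ennreal q)) g \<le> \<dots>" .
  qed (use C1 C2 E in simp)
qed

section \<open>The pairing as a functional, and representation of functionals\<close>

lemma gauss_functional_bound:
  assumes \<alpha>: "0 < \<alpha>" and P: "0 < P" and Q: "0 < Q"
  obtains C where "0 < C"
    "\<And>f g. f \<in> fock_space \<alpha> 0 P Q \<Longrightarrow> g \<in> fock_space \<alpha> (sigma_exponent P Q) (conj_exponent P) (conj_exponent Q) \<Longrightarrow>
      gauss_convergent \<alpha> f g \<and> ennreal (cmod (gauss_pairing \<alpha> f g))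
        \<le> ennreal C * fock_norm \<alpha> 0 P Q f * fock_norm \<alpha> (sigma_exponent P Q) (conj_exponent P) (conj_exponent Q) g"
proof -
  obtain C where C: "0 < C"
    "\<And>f g. f holomorphic_on UNIV \<Longrightarrow> g holomorphic_on UNIV \<Longrightarrow>
      (\<integral>\<^sup>+z. ennreal (cmod (gauss_integrand \<alpha> f g z)) \<partial>lborel)
        \<le> ennreal C * fock_norm \<alpha> 0 P Q f * fock_norm \<alpha> (sigma_exponent P Q) (conj_exponent P) (conj_exponent Q) g"
    using pairing_bound[OF \<alpha> P Q] by blast
  show ?thesis
  proof (rule that[of "\<alpha> / pi * C"])
    fix f g assume f: "f \<in> fock_space \<alpha> 0 P Q" and g: "g \<in> fock_space \<alpha> (sigma_exponent P Q) (conj_exponent P) (conj_exponent Q)"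
    let ?B = "fock_norm \<alpha> 0 P Q f" and ?D = "fock_norm \<alpha> (sigma_exponent P Q) (conj_exponent P) (conj_exponent Q) g"
    have h: "f holomorphic_on UNIV" "g holomorphic_on UNIV" and fin: "?B < top" "?D < top"
      using f g by (auto simp: fock_space_iff)
    have c: "continuous_on UNIV f" "continuous_on UNIV g" using h by (auto intro: holomorphic_on_imp_continuous_on)
    have le: "(\<integral>\<^sup>+z. ennreal (cmod (gauss_integrand \<alpha> f g z)) \<partial>lborel) \<le> ennreal C * ?B * ?D" by (rule C(2)[OF h])
    also have "\<dots> < \<infinity>" using fin by (simp add: ennreal_mult_less_top)
    finally have "(\<integral>\<^sup>+z. ennreal (cmod (gauss_integrand \<alpha> f g z)) \<partial>lborel) < \<infinity>" .
    moreover have "continuous_on UNIV (gauss_integrand \<alpha> f g)"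
      unfolding gauss_integrand_def[abs_def] by (intro continuous_intros c)
    then have "gauss_integrand \<alpha> f g \<in> borel_measurable lborel"
      using borel_measurable_continuous_onI by simp
    ultimately have int: "integrable lborel (gauss_integrand \<alpha> f g)" by (intro integrableI_bounded)
    have "ennreal (cmod (LINT z|lborel. gauss_integrand \<alpha> f g z)) \<le> (\<integral>\<^sup>+z. ennreal (cmod (gauss_integrand \<alpha> f g z)) \<partial>lborel)"
      by (rule integral_norm_bound_ennreal[OF int])
    also note le
    finally have "ennreal (\<alpha> / pi) * ennreal (cmod (LINT z|lborel. gauss_integrand \<alpha> f g z)) \<le> ennreal (\<alpha> / pi) * (ennreal C * ?B * ?D)"
      by (rule mult_left_mono) simp
    then have "ennreal (cmod (gauss_pairing \<alpha> f g)) \<le> ennreal (\<alpha> / pi * C) * ?B * ?D"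
      using \<alpha> C(1) by (simp add: gauss_pairing_def norm_mult norm_divide ennreal_mult mult.assoc del: times_divide_eq_left)
    then show "gauss_convergent \<alpha> f g \<and> ennreal (cmod (gauss_pairing \<alpha> f g)) \<le> ennreal (\<alpha> / pi * C) * ?B * ?D"
      using int by (simp add: gauss_convergent_def)
  qed (use C \<alpha> in simp)
qed

lemma gauss_pairing_in_dual:
  assumes \<alpha>: "0 < \<alpha>" and P: "0 < P" and q: "0 < q"
    and g: "g \<in> fock_space \<alpha> (sigma_exponent P (ennreal q)) (conj_exponent P) (conj_exponent (ennreal q))"
  shows "restrict (\<lambda>f. gauss_pairing \<alpha> f g) (fock_space \<alpha> 0 P (ennreal q))
    \<in> continuous_dual (fock_space \<alpha> 0 P (ennreal q)) (fock_norm \<alpha> 0 P (ennreal q))"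
proof -
  let ?X = "fock_space \<alpha> 0 P (ennreal q)" and ?N = "fock_norm \<alpha> 0 P (ennreal q)"
  let ?D = "fock_norm \<alpha> (sigma_exponent P (ennreal q)) (conj_exponent P) (conj_exponent (ennreal q)) g"
  have Q: "0 < ennreal q" using q by simp
  obtain C where C: "0 < C"
    "\<And>f g. f \<in> ?X \<Longrightarrow> g \<in> fock_space \<alpha> (sigma_exponent P (ennreal q)) (conj_exponent P) (conj_exponent (ennreal q)) \<Longrightarrow>
      gauss_convergent \<alpha> f g \<and> ennreal (cmod (gauss_pairing \<alpha> f g))
        \<le> ennreal C * ?N f * fock_norm \<alpha> (sigma_exponent P (ennreal q)) (conj_exponent P) (conj_exponent (ennreal q)) g"
    using gauss_functional_bound[OF \<alpha> P Q] by blast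
  have int: "integrable lborel (gauss_integrand \<alpha> f g)" if "f \<in> ?X" for f
    using C(2)[OF that g] by (simp add: gauss_convergent_def)
  have add: "gauss_pairing \<alpha> (\<lambda>z. f z + h z) g = gauss_pairing \<alpha> f g + gauss_pairing \<alpha> h g" if "f \<in> ?X" "h \<in> ?X" for f h
  proof -
    have "gauss_integrand \<alpha> (\<lambda>z. f z + h z) g = (\<lambda>z. gauss_integrand \<alpha> f g z + gauss_integrand \<alpha> h g z)"
      by (simp add: gauss_integrand_def fun_eq_iff algebra_simps)
    then show ?thesis using int that by (simp add: gauss_pairing_def distrib_left)
  qed
  have diff: "gauss_pairing \<alpha> (\<lambda>z. f z - h z) g = gauss_pairing \<alpha> f g - gauss_pairing \<alpha> h g" if "f \<in> ?X" "h \<in> ?X" for f h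
  proof -
    have "gauss_integrand \<alpha> (\<lambda>z. f z - h z) g = (\<lambda>z. gauss_integrand \<alpha> f g z - gauss_integrand \<alpha> h g z)"
      by (simp add: gauss_integrand_def fun_eq_iff algebra_simps)
    then show ?thesis using int that by (simp add: gauss_pairing_def right_diff_distrib)
  qed
  have cmult: "gauss_pairing \<alpha> (\<lambda>z. c * f z) g = c * gauss_pairing \<alpha> f g" for c f
  proof -
    have "gauss_integrand \<alpha> (\<lambda>z. c * f z) g = (\<lambda>z. c * gauss_integrand \<alpha> f g z)"
      by (simp add: gauss_integrand_def fun_eq_iff mult.assoc)
    then show ?thesis by (simp add: gauss_pairing_def)
  qed
  have "?D < top" using g by (simp add: fock_space_iff)
  then obtain d where d: "?D = ennreal d" "0 \<le> d" by (cases ?D) auto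
  define M where "M = C * d"
  have M: "0 \<le> M" using C d by (simp add: M_def)
  have "continuous_functional_on ?X ?N (restrict (\<lambda>f. gauss_pairing \<alpha> f g) ?X)"
    unfolding continuous_functional_on_def
  proof (intro ballI allI impI)
    fix f \<epsilon> assume f: "f \<in> ?X" and \<epsilon>: "(0::real) < \<epsilon>"
    show "\<exists>\<delta>>0. \<forall>h\<in>?X. ?N (\<lambda>z. h z - f z) < ennreal \<delta> \<longrightarrow>
        cmod (restrict (\<lambda>f. gauss_pairing \<alpha> f g) ?X h - restrict (\<lambda>f. gauss_pairing \<alpha> f g) ?X f) < \<epsilon>"
    \<comment> \<open>The 1 covers M = 0 and makes M \<epsilon>/(M + 1) strictly smaller than
      \<epsilon>.\<close>
    proof (intro exI[of _ "\<epsilon> / (M + 1)"] conjI ballI impI)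
      show "0 < \<epsilon> / (M + 1)" using \<epsilon> M by simp
      fix h assume h: "h \<in> ?X" and near: "?N (\<lambda>z. h z - f z) < ennreal (\<epsilon> / (M + 1))"
      have hf: "(\<lambda>z. h z - f z) \<in> ?X" by (rule fock_space_diff[OF \<alpha> P q h f])
      have "ennreal (cmod (gauss_pairing \<alpha> (\<lambda>z. h z - f z) g)) \<le> ennreal C * ?N (\<lambda>z. h z - f z) * ?D"
        using C(2)[OF hf g] by blast
      also have "\<dots> \<le> ennreal C * ennreal (\<epsilon> / (M + 1)) * ennreal d"
        unfolding d(1) using near by (intro mult_right_mono mult_left_mono) auto
      also have "\<dots> = ennreal (M * (\<epsilon> / (M + 1)))"
        using C d \<epsilon> M by (simp add: ennreal_mult[symmetric] M_def mult_ac)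
      finally have "cmod (gauss_pairing \<alpha> (\<lambda>z. h z - f z) g) \<le> M * (\<epsilon> / (M + 1))"
        using \<epsilon> M by (subst (asm) ennreal_le_iff) auto
      also have "\<dots> < \<epsilon>" using \<epsilon> M by (simp add: field_simps)
      finally show "cmod (restrict (\<lambda>f. gauss_pairing \<alpha> f g) ?X h - restrict (\<lambda>f. gauss_pairing \<alpha> f g) ?X f) < \<epsilon>"
        using h f diff by simp
    qed
  qed
  moreover have "linear_functional_on ?X (restrict (\<lambda>f. gauss_pairing \<alpha> f g) ?X)"
    unfolding linear_functional_on_def
    using add cmult fock_space_add[OF \<alpha> P q] fock_space_cmult[OF \<alpha> P Q] by simp
  ultimately show ?thesis by (simp add: continuous_dual_def)
qed

text \<open>The pairing with g is a continuous functional, so its value at a kernel is the sum of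
  its values on the Taylor terms, each known from \<open>gauss_pairing_monomial\<close>; they add up
  to the conjugate of the power series of g at w. Thus g can be recovered from its
  functional.\<close>

lemma gauss_pairing_reproducing:
  assumes \<alpha>: "0 < \<alpha>" and P: "0 < P" and q: "0 < q"
    and g: "g \<in> fock_space \<alpha> (sigma_exponent P (ennreal q)) (conj_exponent P) (conj_exponent (ennreal q))"
  shows "gauss_pairing \<alpha> (fock_kernel \<alpha> w) g = cnj (g w)"
proof -
  let ?X = "fock_space \<alpha> 0 P (ennreal q)"
  define F where "F = restrict (\<lambda>f. gauss_pairing \<alpha> f g) ?X"
  have Q: "0 < ennreal q" using q by simp
  have F: "F \<in> continuous_dual ?X (fock_norm \<alpha> 0 P (ennreal q))"
    unfolding F_def by (rule gauss_pairing_in_dual[OF \<alpha> P q g])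
  have h: "g holomorphic_on UNIV" using g by (simp add: fock_space_iff)
  have mono: "(\<lambda>z. z ^ n) \<in> ?X" for n by (rule monomial_in_fock_space[OF \<alpha> P Q])
  have conv: "gauss_convergent \<alpha> (\<lambda>z. z ^ n) g" for n
    by (rule gauss_functional_bound[OF \<alpha> P Q]) (use mono g in blast)
  have "(of_real \<alpha> * cnj w) ^ n / fact n * F (\<lambda>z. z ^ n) = cnj ((deriv ^^ n) g 0 / fact n * w ^ n)" for n
    using mono \<alpha> by (simp add: F_def gauss_pairing_monomial[OF \<alpha> h conv] power_mult_distrib field_simps)
  then have "(\<lambda>n. cnj ((deriv ^^ n) g 0 / fact n * w ^ n)) sums F (fock_kernel \<alpha> w)"
    using dual_kernel_sums(2)[OF \<alpha> P q F, of w] by simp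
  moreover have "(\<lambda>n. (deriv ^^ n) g 0 / fact n * w ^ n) sums g w"
    using holomorphic_power_series[of g 0 "cmod w + 1" w] holomorphic_on_subset[OF h] by simp
  then have "(\<lambda>n. cnj ((deriv ^^ n) g 0 / fact n * w ^ n)) sums cnj (g w)" by (simp only: sums_cnj)
  ultimately have "F (fock_kernel \<alpha> w) = cnj (g w)" by (rule sums_unique2)
  then show ?thesis using dual_kernel_sums(1)[OF \<alpha> P q F] by (simp add: F_def)
qed

text \<open>\<open>dual_taylor_sums\<close> does not reach f itself, whose growth may be critical. A
  dilate of f has strictly smaller Gaussian growth, so F and G agree on it, and both are continuous
  at f.\<close>

lemma dual_eqI:
  assumes \<alpha>: "0 < \<alpha>" and P: "0 < P" and q: "0 < q"
    and F: "F \<in> continuous_dual (fock_space \<alpha> 0 P (ennreal q)) (fock_norm \<alpha> 0 P (ennreal q))"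
    and G: "G \<in> continuous_dual (fock_space \<alpha> 0 P (ennreal q)) (fock_norm \<alpha> 0 P (ennreal q))"
    and eq: "\<And>n. F (\<lambda>z. z ^ n) = G (\<lambda>z. z ^ n)"
  shows "F = G"
proof (rule extensionalityI)
  let ?X = "fock_space \<alpha> 0 P (ennreal q)" and ?N = "fock_norm \<alpha> 0 P (ennreal q)"
  have Q: "0 < ennreal q" using q by simp
  show "F \<in> extensional ?X" "G \<in> extensional ?X" using F G by (auto simp: continuous_dual_def)
  fix f assume f: "f \<in> ?X"
  then have hf: "f holomorphic_on UNIV" by (simp add: fock_space_iff)
  have "cmod (F f - G f) \<le> 0"
  proof (rule field_le_epsilon)
    fix \<epsilon> :: real assume \<epsilon>: "0 < \<epsilon>"
    have near: "\<exists>\<delta>>0. \<forall>h\<in>?X. ?N (\<lambda>z. h z - f z) < ennreal \<delta> \<longrightarrow> cmod (H h - H f) < \<epsilon> / 2"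
      if "H \<in> continuous_dual ?X ?N" for H
      using that f half_gt_zero[OF \<epsilon>] unfolding continuous_dual_def continuous_functional_on_def by blast
    obtain \<delta>1 where \<delta>1: "0 < \<delta>1" "\<And>h. h \<in> ?X \<Longrightarrow> ?N (\<lambda>z. h z - f z) < ennreal \<delta>1 \<Longrightarrow> cmod (F h - F f) < \<epsilon> / 2"
      using near[OF F] by blast
    obtain \<delta>2 where \<delta>2: "0 < \<delta>2" "\<And>h. h \<in> ?X \<Longrightarrow> ?N (\<lambda>z. h z - f z) < ennreal \<delta>2 \<Longrightarrow> cmod (G h - G f) < \<epsilon> / 2"
      using near[OF G] by blast
    have "0 < min \<delta>1 \<delta>2" using \<delta>1 \<delta>2 by simp
    then obtain \<rho> where \<rho>: "0 < \<rho>" "\<rho> < 1" "?N (\<lambda>z. f (of_real \<rho> * z) - f z) < ennreal (min \<delta>1 \<delta>2)"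
      using fock_space_dilates_dense[OF \<alpha> P q f] by blast
    define h where "h z = f (of_real \<rho> * z)" for z
    have hh: "h holomorphic_on UNIV"
    proof -
      have "(f \<circ> (\<lambda>z. of_real \<rho> * z)) holomorphic_on UNIV"
        by (intro holomorphic_on_compose holomorphic_intros holomorphic_on_subset[OF hf]) auto
      then show ?thesis by (simp add: h_def[abs_def] o_def)
    qed
    have \<rho>2: "0 < \<rho>\<^sup>2" "\<rho>\<^sup>2 < 1" using \<rho> by (auto simp: power_less_one_iff)
    \<comment> \<open>Strictly between \<alpha> and \<alpha>/\<rho>^2: f grows at most with exponent
      \<alpha>1, and its dilate with \<alpha>1 \<rho>^2 < \<alpha>.\<close>
    define \<alpha>1 where "\<alpha>1 = (\<alpha> + \<alpha> / \<rho>\<^sup>2) / 2"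
    have \<alpha>1: "\<alpha> < \<alpha>1" using \<alpha> \<rho>2 by (simp add: \<alpha>1_def field_simps)
    obtain B where B: "0 \<le> B" "\<And>z. cmod (f z) \<le> B * exp (\<alpha>1 / 2 * (cmod z)\<^sup>2)"
      using fock_space_growth[OF \<alpha> \<alpha>1 P Q f] by blast
    define \<alpha>2 where "\<alpha>2 = \<alpha>1 * \<rho>\<^sup>2"
    have "\<alpha>2 = (\<alpha> * \<rho>\<^sup>2 + \<alpha>) / 2" using \<rho>2 by (simp add: \<alpha>2_def \<alpha>1_def field_simps)
    moreover have "0 < \<alpha> * \<rho>\<^sup>2" "\<alpha> * \<rho>\<^sup>2 < \<alpha> * 1" using \<alpha> \<rho>2 by (intro mult_pos_pos mult_strict_left_mono; simp)+
    ultimately have \<alpha>2: "0 < \<alpha>2" "\<alpha>2 < \<alpha>" by simp_all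
    have hB: "cmod (h z) \<le> B * exp (\<alpha>2 / 2 * (cmod z)\<^sup>2)" for z
      using B(2)[of "of_real \<rho> * z"] \<rho> by (simp add: h_def norm_mult power_mult_distrib \<alpha>2_def mult.assoc)
    have hX: "h \<in> ?X" by (rule dual_taylor_sums(1)[OF \<alpha>2 P q F hh hB])
    have FG: "F h = G h"
      using dual_taylor_sums(2)[OF \<alpha>2 P q F hh hB] dual_taylor_sums(2)[OF \<alpha>2 P q G hh hB] unfolding eq by (rule sums_unique2)
    have "ennreal (min \<delta>1 \<delta>2) \<le> ennreal \<delta>1" "ennreal (min \<delta>1 \<delta>2) \<le> ennreal \<delta>2" by (auto intro!: ennreal_leI)
    then have "?N (\<lambda>z. h z - f z) < ennreal \<delta>1" "?N (\<lambda>z. h z - f z) < ennreal \<delta>2"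
      using \<rho>(3) unfolding h_def by (auto intro: less_le_trans)
    then have "cmod (F h - F f) < \<epsilon> / 2" "cmod (F h - G f) < \<epsilon> / 2"
      using \<delta>1(2)[OF hX] \<delta>2(2)[OF hX] FG by auto
    moreover have "cmod (F f - G f) \<le> cmod (F h - G f) + cmod (F h - F f)"
      using norm_triangle_ineq4[of "F h - G f" "F h - F f"] by simp
    ultimately have "cmod (F f - G f) < \<epsilon> / 2 + \<epsilon> / 2" by linarith
    then show "cmod (F f - G f) \<le> 0 + \<epsilon>" by simp
  qed
  then show "F f = G f" by simp
qed

text \<open>The Taylor coefficients c n of g carry the factor \<alpha>^n / n! of the kernel, which
  cancels the n!/\<alpha>^n of the pairing, so pairing z^n with g returns F at z^n. Membership of g
  in the dual space comes from \<open>representing_function_bound\<close>; equality of the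
  functionals is then a matter of monomials.\<close>

lemma dual_representation:
  assumes \<alpha>: "0 < \<alpha>" and P: "0 < P" and q: "0 < q"
    and F: "F \<in> continuous_dual (fock_space \<alpha> 0 P (ennreal q)) (fock_norm \<alpha> 0 P (ennreal q))"
  obtains g where "g \<in> fock_space \<alpha> (sigma_exponent P (ennreal q)) (conj_exponent P) (conj_exponent (ennreal q))"
    "F = restrict (\<lambda>f. gauss_pairing \<alpha> f g) (fock_space \<alpha> 0 P (ennreal q))"
proof -
  let ?X = "fock_space \<alpha> 0 P (ennreal q)" and ?N = "fock_norm \<alpha> 0 P (ennreal q)"
  let ?Y = "fock_space \<alpha> (sigma_exponent P (ennreal q)) (conj_exponent P) (conj_exponent (ennreal q))"
  have Q: "0 < ennreal q" using q by simp
  define g where "g w = cnj (F (fock_kernel \<alpha> w))" for w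
  define c where "c n = of_real \<alpha> ^ n / fact n * cnj (F (\<lambda>z. z ^ n))" for n
  have sums: "(\<lambda>n. c n * w ^ n) sums g w" for w
  proof -
    have "(\<lambda>n. cnj ((of_real \<alpha> * cnj w) ^ n / fact n * F (\<lambda>z. z ^ n))) sums cnj (F (fock_kernel \<alpha> w))"
      unfolding sums_cnj by (rule dual_kernel_sums(2)[OF \<alpha> P q F])
    moreover have "cnj ((of_real \<alpha> * cnj w) ^ n / fact n * F (\<lambda>z. z ^ n)) = c n * w ^ n" for n
      by (simp add: c_def power_mult_distrib)
    ultimately show ?thesis by (simp add: g_def)
  qed
  have hg: "g holomorphic_on UNIV" by (rule entire_series(1)[OF sums])
  obtain C where C: "0 < C"
    "\<And>F g. F \<in> continuous_dual ?X ?N \<Longrightarrow> g holomorphic_on UNIV \<Longrightarrow> (\<And>w. F (fock_kernel \<alpha> w) = cnj (g w)) \<Longrightarrow>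
      fock_norm \<alpha> (sigma_exponent P (ennreal q)) (conj_exponent P) (conj_exponent (ennreal q)) g
        \<le> ennreal C * dual_norm ?X ?N F"
    using representing_function_bound[OF \<alpha> P q] by blast
  have "fock_norm \<alpha> (sigma_exponent P (ennreal q)) (conj_exponent P) (conj_exponent (ennreal q)) g \<le> ennreal C * dual_norm ?X ?N F"
    by (rule C(2)[OF F hg]) (simp add: g_def)
  also have "\<dots> < top" using dual_norm_finite[OF \<alpha> P Q F] by (simp add: ennreal_mult_less_top)
  finally have gY: "g \<in> ?Y" using hg by (simp add: fock_space_iff)
  have mono: "(\<lambda>z. z ^ n) \<in> ?X" for n by (rule monomial_in_fock_space[OF \<alpha> P Q])
  have conv: "gauss_convergent \<alpha> (\<lambda>z. z ^ n) g" for n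
    by (rule gauss_functional_bound[OF \<alpha> P Q]) (use mono gY in blast)
  have "F = restrict (\<lambda>f. gauss_pairing \<alpha> f g) ?X"
  proof (rule dual_eqI[OF \<alpha> P q F gauss_pairing_in_dual[OF \<alpha> P q gY]])
    fix n
    have "gauss_pairing \<alpha> (\<lambda>z. z ^ n) g = cnj (c n) * of_real (fact n / \<alpha> ^ n)"
      unfolding gauss_pairing_monomial[OF \<alpha> hg conv] entire_series(2)[OF sums] ..
    also have "\<dots> = F (\<lambda>z. z ^ n)" using \<alpha> by (simp add: c_def)
    finally show "F (\<lambda>z. z ^ n) = restrict (\<lambda>f. gauss_pairing \<alpha> f g) ?X (\<lambda>z. z ^ n)" using mono by simp
  qed
  then show ?thesis using that gY by blast
qed

section \<open>Passage between the weights \<alpha> and \<beta> by dilation\<close>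

lemma dilation_holomorphic:
  assumes "g holomorphic_on UNIV" shows "dilation \<tau> g holomorphic_on UNIV"
proof -
  have "(g \<circ> (\<lambda>z. of_real \<tau> * z)) holomorphic_on UNIV"
    by (intro holomorphic_on_compose holomorphic_intros holomorphic_on_subset[OF assms]) auto
  then show ?thesis by (simp add: dilation_def[abs_def] o_def)
qed

lemma dilation_inverse: "\<tau> \<noteq> 0 \<Longrightarrow> dilation (1 / \<tau>) (dilation \<tau> g) = g"
  by (simp add: fun_eq_iff dilation_def)

theorem theorem1p6:
  fixes \<alpha> \<beta> \<gamma> :: real and p q :: ennreal
    and X Y :: "(complex \<Rightarrow> complex) set"
    and NX NY :: "(complex \<Rightarrow> complex) \<Rightarrow> ennreal"
  assumes "\<alpha> > 0" and "\<beta> > 0" and "0 < p" and "0 < q" and "q < top"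
    and "\<gamma> = sqrt (\<alpha> * \<beta>)"
  defines "X \<equiv> fock_space \<alpha> 0 p q"
    and "NX \<equiv> fock_norm \<alpha> 0 p q"
    and "Y \<equiv> fock_space \<beta> (sigma_exponent p q) (conj_exponent p) (conj_exponent q)"
    and "NY \<equiv> fock_norm \<beta> (sigma_exponent p q) (conj_exponent p) (conj_exponent q)"
  shows "(\<forall>g\<in>Y. (\<forall>f\<in>X. tr_convergent \<alpha> \<gamma> f g) \<and>
                 tr_functional X \<alpha> \<gamma> g \<in> continuous_dual X NX) \<and>
         (\<forall>F\<in>continuous_dual X NX. \<exists>!g. g \<in> Y \<and> F = tr_functional X \<alpha> \<gamma> g) \<and>
         (\<exists>C>0. \<forall>F\<in>continuous_dual X NX. \<forall>g\<in>Y. F = tr_functional X \<alpha> \<gamma> g \<longrightarrow>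
            ennreal (inverse C) * NY g \<le> dual_norm X NX F \<and>
            dual_norm X NX F \<le> ennreal C * NY g)"
proof -
  have \<alpha>: "0 < \<alpha>" and \<beta>: "0 < \<beta>" and p: "0 < p" and q: "0 < q" by fact+
  obtain r where r: "0 < r" "q = ennreal r" using q assms(5) by (cases q rule: exponent_cases) auto
  define s where "s = sigma_exponent p q"
  have P': "0 < conj_exponent p" and Q': "0 < conj_exponent q" using conj_exponent_pos p q by auto
  define Z where "Z = fock_space \<alpha> s (conj_exponent p) (conj_exponent q)"
  define NZ where "NZ = fock_norm \<alpha> s (conj_exponent p) (conj_exponent q)"
  \<comment> \<open>From \<gamma>^2 = \<alpha> \<beta> follows \<tau>^2 = \<alpha>/\<beta>. Dilation
    by \<tau> is therefore a bijection from \<open>Y\<close> onto \<open>Z\<close>, the same space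
    with \<alpha> in place of \<beta>, with norms comparable in both directions.\<close>
  define \<tau> where "\<tau> = \<alpha> / \<gamma>"
  have \<gamma>: "0 < \<gamma>" "\<gamma>\<^sup>2 = \<alpha> * \<beta>" using \<alpha> \<beta> assms(6) by auto
  have \<tau>: "0 < \<tau>" "\<alpha> = \<beta> * \<tau>\<^sup>2" "0 < 1 / \<tau>" "\<beta> = \<alpha> * (1 / \<tau>)\<^sup>2"
    using \<alpha> \<beta> \<gamma> by (auto simp: \<tau>_def power_divide field_simps power2_eq_square)
  obtain C1 where C1: "0 < C1" "\<And>g. continuous_on UNIV g \<Longrightarrow> NY g \<le> ennreal C1 * NZ (dilation \<tau> g)"
    unfolding NY_def NZ_def s_def using fock_norm_dilation_le[OF \<alpha> \<beta> \<tau>(1,2) P' Q'] by blast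
  obtain C2 where C2: "0 < C2" "\<And>g. continuous_on UNIV g \<Longrightarrow> NZ g \<le> ennreal C2 * NY (dilation (1 / \<tau>) g)"
    unfolding NY_def NZ_def s_def using fock_norm_dilation_le[OF \<beta> \<alpha> \<tau>(3,4) P' Q'] by blast
  have undo: "dilation (1 / \<tau>) (dilation \<tau> g) = g" "dilation \<tau> (dilation (1 / \<tau>) g) = g" for g
    using dilation_inverse[of \<tau> g] dilation_inverse[of "1 / \<tau>" g] \<tau> by auto
  have C2': "NZ (dilation \<tau> g) \<le> ennreal C2 * NY g" if "g holomorphic_on UNIV" for g
    using C2(2)[OF holomorphic_on_imp_continuous_on[OF dilation_holomorphic[OF that]], of \<tau>] by (simp only: undo)
  have toZ: "dilation \<tau> g \<in> Z" if "g \<in> Y" for g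
  proof -
    have g: "g holomorphic_on UNIV" "NY g < top" using that by (auto simp: Y_def NY_def fock_space_iff)
    have "ennreal C2 * NY g < top" using g by (simp add: ennreal_mult_less_top)
    then show ?thesis
      using C2'[OF g(1)] dilation_holomorphic[OF g(1)] by (auto simp: Z_def NZ_def fock_space_iff intro: le_less_trans)
  qed
  have toY: "dilation (1 / \<tau>) g \<in> Y" if "g \<in> Z" for g
  proof -
    have g: "g holomorphic_on UNIV" "NZ g < top" using that by (auto simp: Z_def NZ_def fock_space_iff)
    have "NY (dilation (1 / \<tau>) g) \<le> ennreal C1 * NZ g"
      using C1(2)[OF holomorphic_on_imp_continuous_on[OF dilation_holomorphic[OF g(1)]], of "1 / \<tau>"] by (simp only: undo)
    also have "\<dots> < top" using g by (simp add: ennreal_mult_less_top)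
    finally show ?thesis using dilation_holomorphic[OF g(1)] by (simp add: Y_def NY_def fock_space_iff)
  qed
  \<comment> \<open>With the dilation moved onto g, all results for the single parameter \<alpha>
    apply to \<open>dilation \<tau> g\<close> in \<open>Z\<close>.\<close>
  have tr: "tr_functional X \<alpha> \<gamma> g = restrict (\<lambda>f. gauss_pairing \<alpha> f (dilation \<tau> g)) X" for g
    by (simp add: tr_functional_def tr_pairing_def \<tau>_def)
  obtain C3 where C3: "0 < C3" "\<And>f g. f \<in> X \<Longrightarrow> g \<in> Z \<Longrightarrow>
      gauss_convergent \<alpha> f g \<and> ennreal (cmod (gauss_pairing \<alpha> f g)) \<le> ennreal C3 * NX f * NZ g"
    unfolding X_def NX_def Z_def NZ_def s_def using gauss_functional_bound[OF \<alpha> p q] by blast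
  obtain C4 where C4: "0 < C4" "\<And>F g. F \<in> continuous_dual X NX \<Longrightarrow> g holomorphic_on UNIV \<Longrightarrow>
      (\<And>w. F (fock_kernel \<alpha> w) = cnj (g w)) \<Longrightarrow> NZ g \<le> ennreal C4 * dual_norm X NX F"
    unfolding X_def NX_def NZ_def s_def r(2) using representing_function_bound[OF \<alpha> p r(1)] by blast
  have in_dual: "tr_functional X \<alpha> \<gamma> g \<in> continuous_dual X NX" if "g \<in> Y" for g
    unfolding tr using gauss_pairing_in_dual[OF \<alpha> p r(1)] toZ[OF that] by (simp add: X_def NX_def Z_def s_def r(2))
  \<comment> \<open>The values at the kernels determine \<open>dilation \<tau> g\<close>, which
    gives uniqueness; they also supply the hypothesis under which \<open>C4\<close> bounds its
    norm.\<close>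
  have kernel: "tr_functional X \<alpha> \<gamma> g (fock_kernel \<alpha> w) = cnj (dilation \<tau> g w)" if "g \<in> Y" for g w
  proof -
    have "fock_kernel \<alpha> w \<in> X"
      using dual_kernel_sums(1)[OF \<alpha> p r(1)] in_dual[OF that] by (simp add: X_def NX_def r(2))
    moreover have "gauss_pairing \<alpha> (fock_kernel \<alpha> w) (dilation \<tau> g) = cnj (dilation \<tau> g w)"
      using gauss_pairing_reproducing[OF \<alpha> p r(1)] toZ[OF that] by (simp add: Z_def s_def r(2))
    ultimately show ?thesis by (simp add: tr)
  qed
  have part1: "tr_convergent \<alpha> \<gamma> f g" if "g \<in> Y" "f \<in> X" for f g
    using C3(2)[OF that(2) toZ[OF that(1)]] by (simp add: tr_convergent_def \<tau>_def)
  have part2: "\<exists>!g. g \<in> Y \<and> F = tr_functional X \<alpha> \<gamma> g" if F: "F \<in> continuous_dual X NX" for F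
  proof -
    obtain G where G: "G \<in> Z" "F = restrict (\<lambda>f. gauss_pairing \<alpha> f G) X"
      using dual_representation[OF \<alpha> p r(1)] F unfolding X_def NX_def Z_def s_def r(2) by blast
    show ?thesis
    proof (rule ex1I[of _ "dilation (1 / \<tau>) G"])
      show "dilation (1 / \<tau>) G \<in> Y \<and> F = tr_functional X \<alpha> \<gamma> (dilation (1 / \<tau>) G)"
        using toY[OF G(1)] G(2) by (simp add: tr undo)
      then have *: "dilation (1 / \<tau>) G \<in> Y" "F = tr_functional X \<alpha> \<gamma> (dilation (1 / \<tau>) G)" by auto
      fix g assume g: "g \<in> Y \<and> F = tr_functional X \<alpha> \<gamma> g"
      have "cnj (dilation \<tau> g w) = cnj (dilation \<tau> (dilation (1 / \<tau>) G) w)" for w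
        using kernel[of g w] kernel[OF *(1), of w] *(2) g by simp
      then have "dilation \<tau> g = G" by (simp add: fun_eq_iff undo)
      then show "g = dilation (1 / \<tau>) G" using undo(1)[of g] by simp
    qed
  qed
  \<comment> \<open>Dominates both products at once: C1 * C4 for the lower estimate and C3 * C2 for
    the upper one.\<close>
  define C where "C = C1 * C4 + C3 * C2"
  have C: "0 < C" using C1 C2 C3 C4 by (simp add: C_def add_pos_pos)
  have part3: "ennreal (inverse C) * NY g \<le> dual_norm X NX F \<and> dual_norm X NX F \<le> ennreal C * NY g"
    if F: "F \<in> continuous_dual X NX" and g: "g \<in> Y" and Fg: "F = tr_functional X \<alpha> \<gamma> g" for F g
  proof
    have hg: "g holomorphic_on UNIV" using g by (simp add: Y_def fock_space_iff)
    have "NY g \<le> ennreal C1 * NZ (dilation \<tau> g)" by (rule C1(2)[OF holomorphic_on_imp_continuous_on[OF hg]])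
    also have "\<dots> \<le> ennreal C1 * (ennreal C4 * dual_norm X NX F)"
      by (intro mult_left_mono C4(2)[OF F dilation_holomorphic[OF hg]]) (simp_all add: Fg kernel[OF g])
    also have "\<dots> = ennreal (C1 * C4) * dual_norm X NX F" using C1 C4 by (simp add: ennreal_mult mult.assoc)
    also have "\<dots> \<le> ennreal C * dual_norm X NX F"
      using C2 C3 by (intro mult_right_mono ennreal_leI) (auto simp: C_def)
    finally have "ennreal (inverse C) * NY g \<le> ennreal (inverse C) * (ennreal C * dual_norm X NX F)"
      by (rule mult_left_mono) simp
    also have "\<dots> = dual_norm X NX F" using C by (simp add: mult.assoc[symmetric] ennreal_mult[symmetric])
    finally show "ennreal (inverse C) * NY g \<le> dual_norm X NX F" .
    show "dual_norm X NX F \<le> ennreal C * NY g"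
      unfolding dual_norm_def
    proof (rule SUP_least)
      fix f assume "f \<in> {f \<in> X. NX f \<le> 1}"
      then have f: "f \<in> X" "NX f \<le> 1" by auto
      have "ennreal (cmod (F f)) = ennreal (cmod (gauss_pairing \<alpha> f (dilation \<tau> g)))" using f by (simp add: Fg tr)
      also have "\<dots> \<le> ennreal C3 * NX f * NZ (dilation \<tau> g)" using C3(2)[OF f(1) toZ[OF g]] by blast
      also have "\<dots> \<le> ennreal C3 * 1 * (ennreal C2 * NY g)"
        by (intro mult_mono mult_left_mono f C2' hg) auto
      also have "\<dots> = ennreal (C3 * C2) * NY g" using C3 C2 by (simp add: ennreal_mult mult.assoc)
      also have "\<dots> \<le> ennreal C * NY g"
        using C1 C4 by (intro mult_right_mono ennreal_leI) (auto simp: C_def)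
      finally show "ennreal (cmod (F f)) \<le> ennreal C * NY g" .
    qed
  qed
  show ?thesis using part1 in_dual part2 part3 C by blast
qed

end
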